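(* The set $\mathcal{W}(\mathbb{R}^2)$ of all two-dimensional elastic Herglotz wave functions is a reproducing kernel Hilbert space with respect to the inner product $$\langle\mathbf{u},\mathbf{v}\rangle_{\mathcal{H}(\mathbb{R}^2)}=\int_{\mathbb{R}^2}\left(\mathbf{u}(x)\cdot\overline{\mathbf{v}(x)}+\nabla_\varphi\mathbf{u}(x):\overline{\nabla_\varphi\mathbf{v}(x)}\right)\frac{dx}{\langle x\rangle^3},\qquad\langle x\rangle=(1+|x|^2)^{1/2}.$$
   Context: Constants: $\rho>0$, $\omega>0$, and the Lamé constants $\lambda,\mu\in\mathbb{R}$ satisfy $\mu>0$ and $2\mu+\lambda>0$; $k_p,k_s>0$ are given by $k_p^2=\frac{\omega^2\rho}{2\mu+\lambda}$, $k_s^2=\frac{\omega^2\rho}{\mu}$. A two-dimensional elastic Herglotz wave function is an entire solution (defined on all of $\mathbb{R}^2$) $\mathbf{u}:\mathbb{R}^2\to\mathbb{C}^2$ of the two-dimensional spectral Navier equation $\mu\Delta\mathbf{u}+(\lambda+\mu)\nabla(\nabla\cdot\mathbf{u})+\rho\,\omega^2\mathbf{u}=0$ such that $$\mathbf{u}(x)=\int_{\mathbb{S}^1}\left(e^{ik_p x\cdot\xi}\mathbf{g}_1(\xi)+e^{ik_s x\cdot\xi}\mathbf{g}_2(\xi)\right)d\sigma(\xi),$$ where $\mathbf{g}_1,\mathbf{g}_2\in[L^2(\mathbb{S}^1)]^2$, $\mathbf{g}_1(\xi)$ is parallel to $\xi$ and $\mathbf{g}_2(\xi)$ is orthogonal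 to $\xi$ for almost every $\xi$, and $d\sigma$ is arc length on $\mathbb{S}^1$. Angular gradient: in polar coordinates $(r,\varphi)$, let $\widehat{\mathbf r}=(\cos\varphi,\sin\varphi)$, $\widehat{\boldsymbol\varphi}=(-\sin\varphi,\cos\varphi)$ and write $\mathbf{u}=u^r\widehat{\mathbf r}+u^\varphi\widehat{\boldsymbol\varphi}$. Then $$\nabla_\varphi\mathbf{u}=\left(\tfrac{\partial u^r}{\partial\varphi}-u^\varphi\right)\widehat{\boldsymbol\varphi}\otimes\widehat{\mathbf r}+\left(\tfrac{\partial u^\varphi}{\partial\varphi}+u^r\right)\widehat{\boldsymbol\varphi}\otimes\widehat{\boldsymbol\varphi}.$$ For tensors with components $A_{ij},B_{ij}$ in an orthonormal basis, $A:B=\sum_{i,j}A_{ij}B_{ij}$. The dot $\cdot$ is the bilinear dot product. The ambient Hilbert space $\mathcal{H}(\mathbb{R}^2)$ is the completion of $C_c^\infty(\mathbb{R}^2;\mathbb{C}^2)$ with respect to the norm associated with $\langle\cdot,\cdot\rangle_{\mathcal{H}(\mathbb{R}^2)}$; $\mathcal{W}(\mathbb{R}^2)$ is regarded as a subspace of it. Reproducing kernel Hilbert space: let $H$ be a Hilbert space of functions $\mathbf{u}:X\to\mathbb{C}^d$, $d\in\mathbb{N}$, with inner product $\langle\cdot,\cdot\rangle_H$. $H$ is a reproducing kernel Hilbert space if there is a complex-valued second-order tensor ($d\times d$ matrix) $\Gamma(x,y)$, $(x,y)\in X\times X$, such that (i) for all $x\in X$ and $z\in\mathbb{C}^d$,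 the function $y\mapsto\Gamma(x,y)z$ belongs to $H$; (ii) for all $\mathbf{u}\in H$, $x\in X$, $z\in\mathbb{C}^d$, $\mathbf{u}(x)\cdot\overline{z}=\langle\mathbf{u},\Gamma(x,\cdot)z\rangle_H$. *)

theory Defs
  imports "HOL-Analysis.Analysis"
begin

section \<open>Complex vectors\<close>

text \<open>The dot product on complex vectors is bilinear; conjugation is always written explicitly.
  (The library's inner product on this type is the real one, the real part of the Hermitian product.)\<close>

definition cdot :: "complex^'d \<Rightarrow> complex^'d \<Rightarrow> complex" where
  "cdot a b = (\<Sum>i\<in>UNIV. a $ i * b $ i)"

definition vcnj :: "complex^'d \<Rightarrow> complex^'d" where
  "vcnj a = (\<chi> i. cnj (a $ i))"

definition cvec :: "real^'d \<Rightarrow> complex^'d" where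
  "cvec a = (\<chi> i. complex_of_real (a $ i))"

definition tensor :: "complex^'d \<Rightarrow> complex^'d \<Rightarrow> complex^'d^'d" where
  "tensor a b = (\<chi> i j. a $ i * b $ j)"

definition ddot :: "complex^'d^'d \<Rightarrow> complex^'d^'d \<Rightarrow> complex" where
  "ddot A B = (\<Sum>i\<in>UNIV. \<Sum>j\<in>UNIV. A $ i $ j * B $ i $ j)"

definition mcnj :: "complex^'d^'d \<Rightarrow> complex^'d^'d" where
  "mcnj A = (\<chi> i j. cnj (A $ i $ j))"


section \<open>Reproducing kernel Hilbert spaces of vector-valued functions\<close>

text \<open>The distribution has no complex inner product spaces, so Hilbert spaces of functions are
  given by a set of functions (with pointwise operations) and a sesquilinear form that is linear
  in its first argument. Only the values of the form on that set matter.\<close>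

definition hilbert_function_space ::
    "('x \<Rightarrow> complex^'d) set \<Rightarrow> (('x \<Rightarrow> complex^'d) \<Rightarrow> ('x \<Rightarrow> complex^'d) \<Rightarrow> complex) \<Rightarrow> bool" where
  "hilbert_function_space H ip \<longleftrightarrow>
     (\<lambda>x. 0) \<in> H \<and>
     (\<forall>u\<in>H. \<forall>v\<in>H. (\<lambda>x. u x + v x) \<in> H) \<and>
     (\<forall>c. \<forall>u\<in>H. (\<lambda>x. c *s u x) \<in> H) \<and>
     (\<forall>u\<in>H. \<forall>v\<in>H. \<forall>w\<in>H. ip (\<lambda>x. u x + v x) w = ip u w + ip v w) \<and>
     (\<forall>c. \<forall>u\<in>H. \<forall>v\<in>H. ip (\<lambda>x. c *s u x) v = c * ip u v) \<and>
     (\<forall>u\<in>H. \<forall>v\<in>H. ip v u = cnj (ip u v)) \<and>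
     (\<forall>u\<in>H. 0 \<le> Re (ip u u)) \<and>
     (\<forall>u\<in>H. ip u u = 0 \<longrightarrow> u = (\<lambda>x. 0)) \<and>
     (\<forall>s :: nat \<Rightarrow> 'x \<Rightarrow> complex^'d.
        (\<forall>n. s n \<in> H) \<and>
        (\<forall>e>0. \<exists>N. \<forall>m\<ge>N. \<forall>n\<ge>N.
           sqrt (Re (ip (\<lambda>x. s m x - s n x) (\<lambda>x. s m x - s n x))) < e) \<longrightarrow>
        (\<exists>u\<in>H. (\<lambda>n. sqrt (Re (ip (\<lambda>x. s n x - u x) (\<lambda>x. s n x - u x)))) \<longlonglongrightarrow> 0))"

definition reproducing_kernel_hilbert_space ::
    "('x \<Rightarrow> complex^'d) set \<Rightarrow> (('x \<Rightarrow> complex^'d) \<Rightarrow> ('x \<Rightarrow> complex^'d) \<Rightarrow> complex) \<Rightarrow> bool" where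
  "reproducing_kernel_hilbert_space H ip \<longleftrightarrow>
     hilbert_function_space H ip \<and>
     (\<exists>\<Gamma> :: 'x \<Rightarrow> 'x \<Rightarrow> complex^'d^'d.
        (\<forall>x z. (\<lambda>y. \<Gamma> x y *v z) \<in> H) \<and>
        (\<forall>u\<in>H. \<forall>x z. cdot (u x) (vcnj z) = ip u (\<lambda>y. \<Gamma> x y *v z)))"


section \<open>Classical derivatives and the spectral Navier equation\<close>

definition partial :: "2 \<Rightarrow> (real^2 \<Rightarrow> 'a::real_normed_vector) \<Rightarrow> real^2 \<Rightarrow> 'a" where
  "partial j f x = frechet_derivative f (at x) (axis j 1)"

primrec Ck :: "nat \<Rightarrow> (real^2 \<Rightarrow> 'a::real_normed_vector) \<Rightarrow> bool" where
  "Ck 0 f \<longleftrightarrow> continuous_on UNIV f"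
| "Ck (Suc k) f \<longleftrightarrow> (\<forall>x. f differentiable at x) \<and> (\<forall>j. Ck k (partial j f))"

definition grad :: "(real^2 \<Rightarrow> complex) \<Rightarrow> real^2 \<Rightarrow> complex^2" where
  "grad f x = (\<chi> j. partial j f x)"

definition divergence :: "(real^2 \<Rightarrow> complex^2) \<Rightarrow> real^2 \<Rightarrow> complex" where
  "divergence u x = (\<Sum>j\<in>UNIV. partial j u x $ j)"

definition laplacian :: "(real^2 \<Rightarrow> complex^2) \<Rightarrow> real^2 \<Rightarrow> complex^2" where
  "laplacian u x = (\<Sum>j\<in>UNIV. partial j (partial j u) x)"

definition entire_navier_solution ::
    "real \<Rightarrow> real \<Rightarrow> real \<Rightarrow> real \<Rightarrow> (real^2 \<Rightarrow> complex^2) \<Rightarrow> bool" where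
  "entire_navier_solution lam \<mu> \<rho> \<omega> u \<longleftrightarrow>
     Ck 2 u \<and>
     (\<forall>x. \<mu> *\<^sub>R laplacian u x + (lam + \<mu>) *\<^sub>R grad (divergence u) x + (\<rho> * \<omega>\<^sup>2) *\<^sub>R u x = 0)"


section \<open>Elastic Herglotz wave functions\<close>

definition polar :: "real \<Rightarrow> real \<Rightarrow> real^2" where
  "polar r \<phi> = vector [r * cos \<phi>, r * sin \<phi>]"

definition arc_length :: "(real^2) measure" where
  "arc_length = distr (restrict_space lborel {0..<2 * pi})
                      (restrict_space borel (sphere 0 1)) (polar 1)"

definition L2_circle :: "(real^2 \<Rightarrow> complex^2) set" where
  "L2_circle = {g. g \<in> borel_measurable arc_length \<and>
                   integrable arc_length (\<lambda>\<xi>. (norm (g \<xi>))\<^sup>2)}"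

definition elastic_herglotz ::
    "real \<Rightarrow> real \<Rightarrow> real \<Rightarrow> real \<Rightarrow> real \<Rightarrow> real \<Rightarrow> (real^2 \<Rightarrow> complex^2) set" where
  "elastic_herglotz lam \<mu> \<rho> \<omega> kp ks =
     {u. entire_navier_solution lam \<mu> \<rho> \<omega> u \<and>
         (\<exists>g1\<in>L2_circle. \<exists>g2\<in>L2_circle.
            (AE \<xi> in arc_length. \<exists>c. g1 \<xi> = c *s cvec \<xi>) \<and>
            (AE \<xi> in arc_length. cdot (g2 \<xi>) (cvec \<xi>) = 0) \<and>
            (\<forall>x. u x = (LINT \<xi>|arc_length.
                          exp (\<i> * complex_of_real (kp * (x \<bullet> \<xi>))) *s g1 \<xi>
                        + exp (\<i> * complex_of_real (ks * (x \<bullet> \<xi>))) *s g2 \<xi>)))}"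


section \<open>Angular gradient and the ambient Hilbert space\<close>

definition r_hat :: "real \<Rightarrow> real^2" where
  "r_hat \<phi> = vector [cos \<phi>, sin \<phi>]"

definition phi_hat :: "real \<Rightarrow> real^2" where
  "phi_hat \<phi> = vector [- sin \<phi>, cos \<phi>]"

definition u_r :: "(real^2 \<Rightarrow> complex^2) \<Rightarrow> real \<Rightarrow> real \<Rightarrow> complex" where
  "u_r u r \<phi> = cdot (u (polar r \<phi>)) (cvec (r_hat \<phi>))"

definition u_phi :: "(real^2 \<Rightarrow> complex^2) \<Rightarrow> real \<Rightarrow> real \<Rightarrow> complex" where
  "u_phi u r \<phi> = cdot (u (polar r \<phi>)) (cvec (phi_hat \<phi>))"

definition angular_gradient_polar ::
    "(real^2 \<Rightarrow> complex^2) \<Rightarrow> real \<Rightarrow> real \<Rightarrow> complex^2^2" where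
  "angular_gradient_polar u r \<phi> =
     (\<chi> i j.
        (vector_derivative (u_r u r) (at \<phi>) - u_phi u r \<phi>)
          * tensor (cvec (phi_hat \<phi>)) (cvec (r_hat \<phi>)) $ i $ j
      + (vector_derivative (u_phi u r) (at \<phi>) + u_r u r \<phi>)
          * tensor (cvec (phi_hat \<phi>)) (cvec (phi_hat \<phi>)) $ i $ j)"

text \<open>Everything above is periodic in the angle, so any determination of it may be used. The origin,
  where the frame is undefined, receives the angle 0; it is a null set for all integrals below.\<close>

definition angular_gradient :: "(real^2 \<Rightarrow> complex^2) \<Rightarrow> real^2 \<Rightarrow> complex^2^2" where
  "angular_gradient u x = angular_gradient_polar u (norm x) (Arg (Complex (x $ 1) (x $ 2)))"

definition bracket :: "real^2 \<Rightarrow> real" where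
  "bracket x = sqrt (1 + (norm x)\<^sup>2)"

text \<open>The Bochner integral is 0 for non-integrable integrands; on elements of the ambient
  space below the integrand is integrable.\<close>

definition H_inner :: "(real^2 \<Rightarrow> complex^2) \<Rightarrow> (real^2 \<Rightarrow> complex^2) \<Rightarrow> complex" where
  "H_inner u v =
     (LINT x|lborel.
        (cdot (u x) (vcnj (v x)) + ddot (angular_gradient u x) (mcnj (angular_gradient v x)))
        / complex_of_real (bracket x ^ 3))"

definition test_functions :: "(real^2 \<Rightarrow> complex^2) set" where
  "test_functions = {f. (\<forall>k. Ck k f) \<and> (\<exists>K. compact K \<and> (\<forall>x. x \<notin> K \<longrightarrow> f x = 0))}"

text \<open>The map taking a test function to the pair of itself and its angular gradient is an isometry
  into the weighted \<open>L\<^sup>2\<close> space of pairs, so the completion of the test functions is the closure of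
  its image there. The norms are the Euclidean and the Frobenius norm, so the integrand
  is the squared norm associated with \<open>H_inner\<close>. Members of the set are representatives,
  not classes modulo null sets.\<close>

definition H_ambient :: "((real^2 \<Rightarrow> complex^2) \<times> (real^2 \<Rightarrow> complex^2^2)) set" where
  "H_ambient =
     {(u, U). u \<in> borel_measurable lborel \<and> U \<in> borel_measurable lborel \<and>
        integrable lborel (\<lambda>x. ((norm (u x))\<^sup>2 + (norm (U x))\<^sup>2) / bracket x ^ 3) \<and>
        (\<exists>f. (\<forall>n::nat. f n \<in> test_functions) \<and>
             (\<lambda>n. \<integral>\<^sup>+x. ennreal (((norm (u x - f n x))\<^sup>2
                                  + (norm (U x - angular_gradient (f n) x))\<^sup>2)
                                 / bracket x ^ 3) \<partial>lborel) \<longlonglongrightarrow> 0)}"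

end

theory Submission
  imports Defs "HOL-Probability.Probability" "HOL-Real_Asymp.Real_Asymp"
begin

text \<open>
  For a density \<open>f\<close> on the circle let \<open>herg k f x\<close> be the integral of
  \<open>exp(\<i>k x\<cdot>\<xi>) f(\<xi>)\<close> over the unit circle. The components of an elastic Herglotz wave
  with densities \<open>g\<^sub>1, g\<^sub>2\<close> are sums of one such wave of wave number \<open>kp\<close> and one of
  wave number \<open>ks\<close>. The whole theorem rests on one estimate: \<^emph>\<open>the norm of an elastic Herglotz
  wave in the weighted space is equivalent to the \<open>L\<^sup>2\<close> norm of its pair of densities\<close>
  (\<open>elastic_wave_energy_upper\<close>, \<open>elastic_energy_lower\<close>). Completeness is then inherited
  from \<open>L\<^sup>2\<close> of the circle, because being parallel or orthogonal to \<open>\<xi>\<close> almost everywhere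
  survives limits in \<open>L\<^sup>2\<close>. Point evaluations are bounded by the \<open>L\<^sup>1\<close> norm of the densities,
  hence by the norm of the wave, and the Riesz representation theorem turns them into a kernel.

  For the estimate, the angular gradient at \<open>x\<close> is the tensor product of a unit vector with the
  derivative \<open>ang_deriv u x\<close> of \<open>u\<close> along rotations (\<open>angular_gradient_eq\<close>), so the Cartesian
  components decouple and scalar waves suffice. Fix \<open>x\<close> and rotate it by \<open>\<eta>\<close>: the \<open>n\<close>-th Fourier
  coefficient in \<open>\<eta>\<close> of \<open>herg k f (\<eta>x)\<close> is the \<open>n\<close>-th coefficient of \<open>f\<close> times the wave
  \<open>mode k n\<close> whose density is the character \<open>\<xi>\<^sup>n\<close>, and the angular derivative contributes a
  factor \<open>\<i>n\<close>. Parseval on each circle and the rotation invariance of the weighted Lebesgue measure give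

  \<^item> \<open>4\<pi>\<^sup>2 energy (herg k f + herg l g) = \<Sum>\<^sub>n (1 + n\<^sup>2) q\<^sub>n (f\<^sub>n, g\<^sub>n)\<close>,

  where \<open>q\<^sub>n\<close> is the Gram form of \<open>mode k n\<close> and \<open>mode l n\<close> in the weighted \<open>L\<^sup>2\<close> space
  (\<open>energy_eq_qform\<close>).

  The weight \<open>(1 + |x|\<^sup>2) powr (-3/2)\<close> has Fourier transform \<open>2\<pi> exp(-|z|)\<close>
  (\<open>fourier_weight\<close>). Therefore the entries of \<open>q\<^sub>n\<close> are \<open>4\<pi>\<^sup>2\<close> times the Fourier coefficients of
  the function \<open>\<eta> \<mapsto> exp(-|k\<eta> - l e\<^sub>1|)\<close> on the circle (\<open>gram_eq_fcoeff\<close>). For \<open>k = l\<close> this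
  function has a corner at \<open>e\<^sub>1\<close>, whose jump \<open>2k\<close> of the derivative makes the coefficients
  asymptotic to \<open>2k/n\<^sup>2\<close>. For \<open>k \<noteq> l\<close> it is smooth and the coefficients are \<open>o(1/n\<^sup>2)\<close>. Hence
  \<open>(1 + n\<^sup>2) q\<^sub>n\<close> converges to a positive diagonal form. Each single \<open>q\<^sub>n\<close> is positive definite
  since the two modes are linearly independent, so the bounds are uniform in \<open>n\<close>.

  If \<open>kp = ks\<close>, which is possible for \<open>lam = -\<mu>\<close>, the wave depends only on \<open>g\<^sub>1 + g\<^sub>2\<close>. But
  \<open>g\<^sub>1\<close> and \<open>g\<^sub>2\<close> are pointwise orthogonal, so Pythagoras recovers both norms from the sum.

  Membership in the ambient space follows by multiplying with smooth radial cutoffs, which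
  commute with the angular derivative.
\<close>

section \<open>Square-integrable functions on a finite measure space\<close>

definition square_integrable :: "'a measure \<Rightarrow> ('a \<Rightarrow> 'b::{banach, second_countable_topology}) \<Rightarrow> bool"
  where "square_integrable M f \<longleftrightarrow>
    f \<in> borel_measurable M \<and> integrable M (\<lambda>x. (norm (f x))\<^sup>2)"

lemma norm_add_square_le: "(norm (a + b))\<^sup>2 \<le> 2 * (norm a)\<^sup>2 + 2 * (norm b)\<^sup>2"
  for a b :: "'a::real_normed_vector"
proof -
  have "(norm (a + b))\<^sup>2 \<le> (norm a + norm b)\<^sup>2"
    by (intro power_mono norm_triangle_ineq) auto
  also have "\<dots> \<le> 2 * (norm a)\<^sup>2 + 2 * (norm b)\<^sup>2"
    using sum_squares_bound[of "norm a" "norm b"] by (simp add: power2_sum)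
  finally show ?thesis .
qed

lemma square_integrable_bound:
  assumes "square_integrable M f" "g \<in> borel_measurable M" "\<And>x. x \<in> space M \<Longrightarrow> norm (g x) \<le> C * norm (f x)"
  shows "square_integrable M g"
proof -
  have "integrable M (\<lambda>x. C\<^sup>2 * (norm (f x))\<^sup>2)"
    using assms(1) by (simp add: square_integrable_def)
  then have "integrable M (\<lambda>x. (norm (g x))\<^sup>2)"
  proof (rule Bochner_Integration.integrable_bound)
    show "AE x in M. norm ((norm (g x))\<^sup>2) \<le> norm (C\<^sup>2 * (norm (f x))\<^sup>2)"
    proof (intro AE_I2)
      fix x assume "x \<in> space M"
      from power_mono[OF assms(3)[OF this], of 2]
      show "norm ((norm (g x))\<^sup>2) \<le> norm (C\<^sup>2 * (norm (f x))\<^sup>2)"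
        by (simp add: power_mult_distrib abs_mult)
    qed
  qed (use assms(2) in measurable)
  then show ?thesis using assms(2) by (simp add: square_integrable_def)
qed

lemma square_integrable_add:
  assumes "square_integrable M f" "square_integrable M g"
  shows "square_integrable M (\<lambda>x. f x + g x)"
proof -
  have "integrable M (\<lambda>x. 2 * (norm (f x))\<^sup>2 + 2 * (norm (g x))\<^sup>2)"
    using assms by (simp add: square_integrable_def)
  moreover have [measurable]: "f \<in> borel_measurable M" "g \<in> borel_measurable M"
    using assms by (auto simp: square_integrable_def)
  ultimately have "integrable M (\<lambda>x. (norm (f x + g x))\<^sup>2)"
    by (elim Bochner_Integration.integrable_bound) (auto intro!: order_trans[OF norm_add_square_le])
  then show ?thesis by (simp add: square_integrable_def)
qed

lemma square_integrable_uminus: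
  "square_integrable M f \<Longrightarrow> square_integrable M (\<lambda>x. - f x)"
  by (auto simp: square_integrable_def)

lemma square_integrable_diff:
  assumes "square_integrable M f" "square_integrable M g"
  shows "square_integrable M (\<lambda>x. f x - g x)"
  using square_integrable_add[OF assms(1) square_integrable_uminus[OF assms(2)]] by simp

lemma square_integrable_sum:
  "(\<And>i. i \<in> I \<Longrightarrow> square_integrable M (f i)) \<Longrightarrow> square_integrable M (\<lambda>x. \<Sum>i\<in>I. f i x)"
  by (induction I rule: infinite_finite_induct)
     (auto intro: square_integrable_add simp: square_integrable_def[where f = "\<lambda>x. 0"])

lemma square_integrable_mult_integrable:
  fixes f g :: "'a \<Rightarrow> complex"
  assumes "square_integrable M f" "square_integrable M g"
  shows "integrable M (\<lambda>x. f x * g x)"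
proof -
  have "integrable M (\<lambda>x. (norm (f x))\<^sup>2 + (norm (g x))\<^sup>2)"
    using assms by (simp add: square_integrable_def)
  moreover have [measurable]: "f \<in> borel_measurable M" "g \<in> borel_measurable M"
    using assms by (auto simp: square_integrable_def)
  ultimately show ?thesis
  proof (elim Bochner_Integration.integrable_bound)
    show "AE x in M. norm (f x * g x) \<le> norm ((norm (f x))\<^sup>2 + (norm (g x))\<^sup>2)"
    proof (intro AE_I2)
      fix x
      have "norm (f x) * norm (g x) \<le> 2 * norm (f x) * norm (g x)" by simp
      also have "\<dots> \<le> (norm (f x))\<^sup>2 + (norm (g x))\<^sup>2"
        using sum_squares_bound by blast
      finally show "norm (f x * g x) \<le> norm ((norm (f x))\<^sup>2 + (norm (g x))\<^sup>2)"
        by (simp add: norm_mult)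
    qed
  qed simp
qed

lemma (in finite_measure) square_integrable_const: "square_integrable M (\<lambda>x. c)"
  by (simp add: square_integrable_def)

lemma (in finite_measure) square_integrable_bounded:
  assumes "f \<in> borel_measurable M" "\<And>x. x \<in> space M \<Longrightarrow> norm (f x) \<le> C"
  shows "square_integrable M f"
  by (rule square_integrable_bound[where f = "\<lambda>x. 1::real" and C = C])
     (use assms in \<open>auto simp: square_integrable_const\<close>)

lemma (in finite_measure) square_integrable_integrable:
  assumes "square_integrable M f"
  shows "integrable M f"
proof (rule Bochner_Integration.integrable_bound[where f = "\<lambda>x. 1 + (norm (f x))\<^sup>2"])
  show "integrable M (\<lambda>x. 1 + (norm (f x))\<^sup>2)"
    using assms by (simp add: square_integrable_def)
  show "AE x in M. norm (f x) \<le> norm (1 + (norm (f x))\<^sup>2)"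
  proof (intro AE_I2)
    fix x
    have "2 * 1 * norm (f x) \<le> 1\<^sup>2 + (norm (f x))\<^sup>2" by (rule sum_squares_bound)
    then show "norm (f x) \<le> norm (1 + (norm (f x))\<^sup>2)"
      using norm_ge_zero[of "f x"] unfolding real_norm_def by (simp del: norm_ge_zero)
  qed
qed (use assms in \<open>simp add: square_integrable_def\<close>)

text \<open>Cauchy--Schwarz against the constant 1, from the nonnegativity of \<open>\<integral>(t - |f|)\<^sup>2\<close> for all \<open>t\<close>.\<close>

lemma (in finite_measure) square_integral_norm_le:
  assumes "square_integrable M f"
  shows "(\<integral>x. norm (f x) \<partial>M)\<^sup>2 \<le> measure M (space M) * (\<integral>x. (norm (f x))\<^sup>2 \<partial>M)"
proof -
  let ?m = "measure M (space M)" and ?I = "\<integral>x. norm (f x) \<partial>M" and ?J = "\<integral>x. (norm (f x))\<^sup>2 \<partial>M"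
  have i: "integrable M (\<lambda>x. norm (f x))" "integrable M (\<lambda>x. (norm (f x))\<^sup>2)"
    using square_integrable_integrable[OF assms] assms by (auto simp: square_integrable_def)
  have q: "0 \<le> t\<^sup>2 * ?m - 2 * t * ?I + ?J" for t
  proof -
    have "0 \<le> (\<integral>x. (t - norm (f x))\<^sup>2 \<partial>M)" by simp
    also have "\<dots> = (\<integral>x. t\<^sup>2 - 2 * t * norm (f x) + (norm (f x))\<^sup>2 \<partial>M)"
      by (simp add: power2_diff algebra_simps)
    also have "\<dots> = t\<^sup>2 * ?m - 2 * t * ?I + ?J" using i by simp
    finally show ?thesis .
  qed
  show ?thesis
  proof (cases "?m = 0")
    case True
    then have "AE x in M. False"
      by (metis AE_iff_null_sets Collect_empty_eq emeasure_eq_measure ennreal_0 null_setsI sets.top sets_eq_imp_space_eq measure_eq_0_null_sets emeasure_space AE_I' subset_refl Collect_subset)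
    then have "?I = (\<integral>x. 0 \<partial>M)" by (intro integral_cong_AE) (use i in auto)
    then show ?thesis using True by simp
  next
    case False
    then have m: "?m > 0" by (simp add: zero_less_measure_iff)
    have "0 \<le> ?m * ((?I / ?m)\<^sup>2 * ?m - 2 * (?I / ?m) * ?I + ?J)"
      using q[of "?I / ?m"] m by (intro mult_nonneg_nonneg) auto
    also have "\<dots> = ?m * ?J - ?I\<^sup>2" using m by (simp add: field_simps power2_eq_square)
    finally show ?thesis by simp
  qed
qed

text \<open>On a finite measure space an \<open>L\<^sup>2\<close>-Cauchy sequence is \<open>L\<^sup>1\<close>-Cauchy and so has an almost everywhere
  convergent subsequence; Fatou's lemma shows that its limit is the limit in \<open>L\<^sup>2\<close>. The subsequence is
  part of the conclusion because pointwise constraints are transported along it.\<close>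

theorem (in finite_measure) square_integrable_complete:
  fixes s :: "nat \<Rightarrow> 'a \<Rightarrow> 'b::{banach, second_countable_topology}"
  assumes s: "\<And>n. square_integrable M (s n)"
    and C: "\<And>e. e > 0 \<Longrightarrow> \<exists>N. \<forall>m\<ge>N. \<forall>n\<ge>N. (\<integral>x. (norm (s m x - s n x))\<^sup>2 \<partial>M) < e"
  obtains f r where "square_integrable M f" "strict_mono (r :: nat \<Rightarrow> nat)"
    "AE x in M. (\<lambda>n. s (r n) x) \<longlonglongrightarrow> f x"
    "(\<lambda>n. \<integral>x. (norm (s n x - f x))\<^sup>2 \<partial>M) \<longlonglongrightarrow> 0"
proof -
  have [measurable]: "s n \<in> borel_measurable M" for n using s[of n] by (simp add: square_integrable_def)
  have sd: "square_integrable M (\<lambda>x. s m x - s n x)" for m n by (intro square_integrable_diff s)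
  have L1: "\<exists>N. \<forall>i\<ge>N. \<forall>j\<ge>N. (\<integral>x. norm (s i x - s j x) \<partial>M) < e" if "e > 0" for e :: real
  proof -
    let ?m = "measure M (space M) + 1"
    have m: "?m > 0" by (smt (verit) measure_nonneg)
    obtain N where N: "\<forall>m\<ge>N. \<forall>n\<ge>N. (\<integral>x. (norm (s m x - s n x))\<^sup>2 \<partial>M) < e\<^sup>2 / ?m"
      using C[of "e\<^sup>2 / ?m"] \<open>e > 0\<close> m by auto
    show ?thesis
    proof (intro exI[of _ N] allI impI)
      fix i j assume ij: "i \<ge> N" "j \<ge> N"
      have "(\<integral>x. norm (s i x - s j x) \<partial>M)\<^sup>2 \<le> measure M (space M) * (\<integral>x. (norm (s i x - s j x))\<^sup>2 \<partial>M)"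
        by (rule square_integral_norm_le[OF sd])
      also have "\<dots> \<le> ?m * (\<integral>x. (norm (s i x - s j x))\<^sup>2 \<partial>M)"
        by (intro mult_right_mono) auto
      also have "\<dots> < ?m * (e\<^sup>2 / ?m)" using N ij m by (intro mult_strict_left_mono) auto
      also have "\<dots> = e\<^sup>2" using m by simp
      finally show "(\<integral>x. norm (s i x - s j x) \<partial>M) < e"
        using \<open>e > 0\<close> by (simp add: power2_less_imp_less)
    qed
  qed
  obtain r where r: "strict_mono r" "AE x in M. Cauchy (\<lambda>i. s (r i) x)"
  proof (rule cauchy_L1_AE_cauchy_subseq[of M s])
    show "integrable M (s n)" for n by (rule square_integrable_integrable[OF s])
    show "\<exists>N. \<forall>i\<ge>N. \<forall>j\<ge>N. (\<integral>x. norm (s i x - s j x) \<partial>M) < e" if "e > 0" for e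
      using L1[OF that] .
  qed auto
  define f where "f x = lim (\<lambda>i. s (r i) x)" for x
  have f[measurable]: "f \<in> borel_measurable M" unfolding f_def by measurable
  have conv: "AE x in M. (\<lambda>n. s (r n) x) \<longlonglongrightarrow> f x"
    using r(2) by eventually_elim (simp add: f_def Cauchy_convergent convergent_LIMSEQ_iff[symmetric])
  have nn: "(\<integral>\<^sup>+x. ennreal ((norm (s m x - s n x))\<^sup>2) \<partial>M) = ennreal (\<integral>x. (norm (s m x - s n x))\<^sup>2 \<partial>M)" for m n
    using sd[of m n] by (intro nn_integral_eq_integral) (auto simp: square_integrable_def)
  have fatou: "(\<integral>\<^sup>+x. ennreal ((norm (s n x - f x))\<^sup>2) \<partial>M) \<le> ennreal e"
    if N: "\<forall>m\<ge>N. \<forall>n\<ge>N. (\<integral>x. (norm (s m x - s n x))\<^sup>2 \<partial>M) < e" and "n \<ge> N" for n N e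
  proof -
    have "(\<integral>\<^sup>+x. ennreal ((norm (s n x - f x))\<^sup>2) \<partial>M)
        = (\<integral>\<^sup>+x. liminf (\<lambda>k. ennreal ((norm (s n x - s (r k) x))\<^sup>2)) \<partial>M)"
    proof (rule nn_integral_cong_AE, use conv in eventually_elim)
      fix x assume "(\<lambda>n. s (r n) x) \<longlonglongrightarrow> f x"
      then have "(\<lambda>k. ennreal ((norm (s n x - s (r k) x))\<^sup>2)) \<longlonglongrightarrow> ennreal ((norm (s n x - f x))\<^sup>2)"
        by (intro tendsto_intros)
      from lim_imp_Liminf[OF _ this]
      show "ennreal ((norm (s n x - f x))\<^sup>2) = liminf (\<lambda>k. ennreal ((norm (s n x - s (r k) x))\<^sup>2))"
        by simp
    qed
    also have "\<dots> \<le> liminf (\<lambda>k. \<integral>\<^sup>+x. ennreal ((norm (s n x - s (r k) x))\<^sup>2) \<partial>M)"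
      by (rule nn_integral_liminf) measurable
    also have "\<dots> \<le> ennreal e"
    proof (rule Liminf_le)
      show "\<forall>\<^sub>F k in sequentially. (\<integral>\<^sup>+x. ennreal ((norm (s n x - s (r k) x))\<^sup>2) \<partial>M) \<le> ennreal e"
        using eventually_ge_at_top[of N]
      proof eventually_elim
        case (elim k)
        then have "r k \<ge> N" using seq_suble[OF r(1), of k] by simp
        then show ?case unfolding nn using N \<open>n \<ge> N\<close> by (intro ennreal_leI) (simp add: less_imp_le)
      qed
    qed simp
    finally show ?thesis .
  qed
  have sf: "square_integrable M (\<lambda>x. s n x - f x)" "(\<integral>x. (norm (s n x - f x))\<^sup>2 \<partial>M) \<le> e"
    if N: "\<forall>m\<ge>N. \<forall>n\<ge>N. (\<integral>x. (norm (s m x - s n x))\<^sup>2 \<partial>M) < e" and "n \<ge> N" "e > 0" for n N e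
  proof -
    have "(\<integral>\<^sup>+x. ennreal ((norm (s n x - f x))\<^sup>2) \<partial>M) < \<infinity>"
      using fatou[OF N \<open>n \<ge> N\<close>] ennreal_less_top le_less_trans infinity_ennreal_def by metis
    then have i: "integrable M (\<lambda>x. (norm (s n x - f x))\<^sup>2)"
      by (intro integrableI_bounded) auto
    then show "square_integrable M (\<lambda>x. s n x - f x)" by (simp add: square_integrable_def)
    from i have "ennreal (\<integral>x. (norm (s n x - f x))\<^sup>2 \<partial>M) \<le> ennreal e"
      using fatou[OF N \<open>n \<ge> N\<close>] by (subst nn_integral_eq_integral[symmetric]) auto
    then show "(\<integral>x. (norm (s n x - f x))\<^sup>2 \<partial>M) \<le> e" using \<open>e > 0\<close> by simp
  qed
  obtain N1 where N1: "\<forall>m\<ge>N1. \<forall>n\<ge>N1. (\<integral>x. (norm (s m x - s n x))\<^sup>2 \<partial>M) < 1"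
    using C[of 1] by auto
  have "square_integrable M (\<lambda>x. s N1 x - (s N1 x - f x))"
    by (intro square_integrable_diff s sf(1)[OF N1]) auto
  then have fs: "square_integrable M f" by simp
  have lim: "(\<lambda>n. \<integral>x. (norm (s n x - f x))\<^sup>2 \<partial>M) \<longlonglongrightarrow> 0"
  proof (rule LIMSEQ_I)
    fix e :: real assume "0 < e"
    obtain N where N: "\<forall>m\<ge>N. \<forall>n\<ge>N. (\<integral>x. (norm (s m x - s n x))\<^sup>2 \<partial>M) < e / 2"
      using C[of "e / 2"] \<open>0 < e\<close> by auto
    show "\<exists>no. \<forall>n\<ge>no. norm ((\<integral>x. (norm (s n x - f x))\<^sup>2 \<partial>M) - 0) < e"
    proof (intro exI[of _ N] allI impI)
      fix n assume "n \<ge> N"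
      have "(\<integral>x. (norm (s n x - f x))\<^sup>2 \<partial>M) \<le> e / 2" using sf(2)[OF N \<open>n \<ge> N\<close>] \<open>0 < e\<close> by simp
      moreover have "0 \<le> (\<integral>x. (norm (s n x - f x))\<^sup>2 \<partial>M)" by simp
      ultimately show "norm ((\<integral>x. (norm (s n x - f x))\<^sup>2 \<partial>M) - 0) < e" using \<open>0 < e\<close> by simp
    qed
  qed
  show ?thesis by (rule that[OF fs r(1) conv lim])
qed

section \<open>The unit circle\<close>

lemma polar_nth [simp]: "polar r \<phi> $ 1 = r * cos \<phi>" "polar r \<phi> $ 2 = r * sin \<phi>"
  by (simp_all add: polar_def)

lemma vec2_eq_iff: "x = y \<longleftrightarrow> x $ 1 = y $ 1 \<and> x $ 2 = (y $ 2 :: 'a)" for x y :: "'a^2"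
  by (simp add: vec_eq_iff forall_2)

lemma norm_vec2: "norm x = sqrt ((norm (x $ 1))\<^sup>2 + (norm (x $ 2))\<^sup>2)" for x :: "'a::real_normed_vector^2"
  by (simp add: norm_vec_def L2_set_def sum_2)

lemma inner_vec2: "x \<bullet> y = x $ 1 * y $ 1 + x $ 2 * y $ 2" for x y :: "real^2"
  by (simp add: inner_vec_def sum_2)

lemma norm_polar [simp]: "norm (polar r \<phi>) = \<bar>r\<bar>"
proof -
  have "(r * cos \<phi>)\<^sup>2 + (r * sin \<phi>)\<^sup>2 = r\<^sup>2 * ((cos \<phi>)\<^sup>2 + (sin \<phi>)\<^sup>2)"
    by (simp only: power_mult_distrib distrib_left)
  then show ?thesis by (simp add: norm_vec2)
qed

lemma polar_1_sphere [simp]: "polar 1 \<phi> \<in> sphere 0 1"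
  by simp

lemma polar_periodic: "polar r (\<phi> + 2 * pi) = polar r \<phi>"
  by (simp add: vec2_eq_iff)

lemma continuous_on_vector2 [continuous_intros]:
  fixes f g :: "'a::topological_space \<Rightarrow> 'b::{real_normed_vector}"
  assumes "continuous_on S f" "continuous_on S g"
  shows "continuous_on S (\<lambda>x. vector [f x, g x] :: 'b^2)"
proof -
  have "(\<lambda>x. vector [f x, g x] :: 'b^2) = (\<lambda>x. \<chi> i. if i = 1 then f x else g x)"
    by (auto simp: fun_eq_iff vec2_eq_iff)
  moreover have "continuous_on S (\<lambda>x. if i = 1 then f x else g x)" for i :: 2
    using assms by (cases "i = 1") auto
  ultimately show ?thesis by (simp only:) (rule continuous_on_vec_lambda)
qed

lemma continuous_on_polar [continuous_intros]:
  fixes f g :: "'a::t2_space \<Rightarrow> real"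
  shows "continuous_on S f \<Longrightarrow> continuous_on S g \<Longrightarrow> continuous_on S (\<lambda>x. polar (f x) (g x))"
  unfolding polar_def by (intro continuous_intros)

lemma sphere_polarE:
  assumes "\<xi> \<in> sphere (0::real^2) 1"
  obtains a where "0 \<le> a" "a < 2 * pi" "\<xi> = polar 1 a"
proof -
  have "(\<xi> $ 1)\<^sup>2 + (\<xi> $ 2)\<^sup>2 = 1" using assms by (simp add: norm_vec2)
  then obtain t where t: "0 \<le> t" "t < 2 * pi" "\<xi> $ 1 = cos t" "\<xi> $ 2 = sin t"
    using sincos_total_2pi by metis
  then show ?thesis by (intro that[of t]) (simp_all add: vec2_eq_iff)
qed

lemma space_arc_length [simp]: "space arc_length = sphere 0 1"
  by (simp add: arc_length_def space_restrict_space)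

lemma sets_arc_length [measurable_cong]: "sets arc_length = sets (restrict_space borel (sphere 0 1))"
  by (simp add: arc_length_def)

lemma polar_measurable:
  "polar 1 \<in> measurable (restrict_space lborel {0..<2*pi}) (restrict_space borel (sphere 0 1))"
proof (rule measurable_restrict_space2)
  have "polar 1 \<in> borel_measurable borel"
    by (intro borel_measurable_continuous_onI continuous_intros)
  then show "polar 1 \<in> borel_measurable (restrict_space lborel {0..<2*pi})"
    by (intro measurable_restrict_space1) simp
qed auto

lemma emeasure_arc_length: "emeasure arc_length (sphere 0 1) = ennreal (2 * pi)"
proof -
  have "emeasure arc_length (sphere 0 1) = emeasure (restrict_space lborel {0..<2*pi}) (polar 1 -` sphere 0 1 \<inter> {0..<2*pi})"
    unfolding arc_length_def
    by (subst emeasure_distr[OF polar_measurable]) (simp_all add: sets_restrict_space_iff space_restrict_space)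
  also have "polar 1 -` sphere 0 1 \<inter> {0..<2*pi} = {0..<2*pi}" by auto
  also have "emeasure (restrict_space lborel {0..<2*pi}) {0..<2*pi} = ennreal (2 * pi)"
    by (subst emeasure_restrict_space) auto
  finally show ?thesis .
qed

interpretation arc_length: finite_measure arc_length
  by standard (simp add: emeasure_arc_length)

lemma measure_arc_length [simp]: "measure arc_length (sphere 0 1) = 2 * pi"
  by (simp add: measure_def emeasure_arc_length)

lemma borel_measurable_arc_length_continuous:
  "continuous_on (sphere 0 1) h \<Longrightarrow> h \<in> borel_measurable arc_length"
  by (subst measurable_cong_sets[OF sets_arc_length refl]) (rule borel_measurable_continuous_on_restrict)

lemma integrable_arc_length_bounded:
  fixes h :: "_ \<Rightarrow> 'a::{banach, second_countable_topology}"
  assumes "h \<in> borel_measurable arc_length" "\<And>\<xi>. \<xi> \<in> sphere 0 1 \<Longrightarrow> norm (h \<xi>) \<le> B"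
  shows "integrable arc_length h"
  by (rule arc_length.integrable_const_bound[of _ B]) (use assms in \<open>auto intro!: AE_I2\<close>)

lemma integrable_arc_length_continuous:
  fixes h :: "_ \<Rightarrow> 'a::{banach, second_countable_topology}"
  assumes "continuous_on (sphere 0 1) h"
  shows "integrable arc_length h"
proof -
  have "bounded (h ` sphere 0 1)"
    by (intro compact_imp_bounded compact_continuous_image assms) simp
  then obtain B where "\<forall>x\<in>h ` sphere 0 1. norm x \<le> B" by (auto simp: bounded_iff)
  then show ?thesis
    by (intro integrable_arc_length_bounded[where B = B] borel_measurable_arc_length_continuous assms) auto
qed

text \<open>This puts circle integrals within reach of the fundamental theorem of calculus.\<close>

lemma integral_arc_length_continuous:
  fixes h :: "_ \<Rightarrow> complex"
  assumes h: "continuous_on (sphere 0 1) h"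
  shows "(\<integral>\<xi>. h \<xi> \<partial>arc_length) = integral {0..2*pi} (\<lambda>\<theta>. h (polar 1 \<theta>))"
proof -
  have c: "continuous_on UNIV (\<lambda>\<theta>. h (polar 1 \<theta>))"
    by (intro continuous_on_compose2[OF h] continuous_intros) auto
  have "(\<integral>\<xi>. h \<xi> \<partial>arc_length) = (\<integral>\<theta>. h (polar 1 \<theta>) \<partial>restrict_space lborel {0..<2*pi})"
    unfolding arc_length_def
    by (intro integral_distr polar_measurable borel_measurable_continuous_on_restrict h)
  also have "\<dots> = (LINT \<theta>:{0..<2*pi}|lborel. h (polar 1 \<theta>))"
    by (subst integral_restrict_space) (auto simp: set_lebesgue_integral_def)
  also have "\<dots> = (LINT \<theta>:{0..2*pi}|lborel. h (polar 1 \<theta>))"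
  proof (rule set_integral_cong_set)
    show "set_borel_measurable lborel {0..<2 * pi} (\<lambda>\<theta>. h (polar 1 \<theta>))"
      "set_borel_measurable lborel {0..2 * pi} (\<lambda>\<theta>. h (polar 1 \<theta>))"
      using borel_measurable_continuous_onI[OF c] by (auto simp: set_borel_measurable_def)
    show "AE x in lborel. (x \<in> {0..2 * pi}) = (x \<in> {0..<2 * pi})"
      using AE_lborel_singleton[of "2 * pi"] by eventually_elim auto
  qed
  also have "\<dots> = integral {0..2*pi} (\<lambda>\<theta>. h (polar 1 \<theta>))"
    by (rule set_borel_integral_eq_integral(2))
       (auto simp: set_integrable_def intro!: borel_integrable_compact continuous_on_subset[OF c])
  finally show ?thesis .
qed

text \<open>The plane is read as the complex numbers: \<open>rot \<eta> x\<close> is the product of \<open>\<eta>\<close> and \<open>x\<close>,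
  a rotation for \<open>\<eta>\<close> on the unit circle, and \<open>conj2\<close> is conjugation.\<close>

definition rot :: "real^2 \<Rightarrow> real^2 \<Rightarrow> real^2" where
  "rot \<eta> x = vector [\<eta> $ 1 * x $ 1 - \<eta> $ 2 * x $ 2, \<eta> $ 2 * x $ 1 + \<eta> $ 1 * x $ 2]"

definition conj2 :: "real^2 \<Rightarrow> real^2" where
  "conj2 x = vector [x $ 1, - x $ 2]"

lemma rot_nth [simp]: "rot \<eta> x $ 1 = \<eta> $ 1 * x $ 1 - \<eta> $ 2 * x $ 2" "rot \<eta> x $ 2 = \<eta> $ 2 * x $ 1 + \<eta> $ 1 * x $ 2"
  and conj2_nth [simp]: "conj2 x $ 1 = x $ 1" "conj2 x $ 2 = - x $ 2"
  by (simp_all add: rot_def conj2_def)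

lemma continuous_on_rot [continuous_intros]:
  "continuous_on S f \<Longrightarrow> continuous_on S g \<Longrightarrow> continuous_on S (\<lambda>x. rot (f x) (g x))"
  "continuous_on S f \<Longrightarrow> continuous_on S (\<lambda>x. conj2 (f x))"
  unfolding rot_def conj2_def by (intro continuous_intros; assumption)+

lemma rot_polar: "rot (polar 1 a) (polar r b) = polar r (a + b)"
  by (simp add: vec2_eq_iff cos_add sin_add algebra_simps)

lemma conj2_polar: "conj2 (polar r a) = polar r (- a)"
  by (simp add: vec2_eq_iff)

lemma norm_conj2 [simp]: "norm (conj2 x) = norm x"
  by (simp add: norm_vec2)

lemma norm_rot [simp]: "norm (rot \<eta> x) = norm \<eta> * norm x"
proof -
  have "(\<eta> $ 1 * x $ 1 - \<eta> $ 2 * x $ 2)\<^sup>2 + (\<eta> $ 2 * x $ 1 + \<eta> $ 1 * x $ 2)\<^sup>2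
      = ((\<eta> $ 1)\<^sup>2 + (\<eta> $ 2)\<^sup>2) * ((x $ 1)\<^sup>2 + (x $ 2)\<^sup>2)"
    by (simp add: power2_eq_square algebra_simps)
  then show ?thesis by (simp add: norm_vec2 real_sqrt_mult)
qed

text \<open>For an antiderivative \<open>P\<close>, the integral on the left is \<open>P a - P (a - 2\<pi>)\<close>. Its derivative in \<open>a\<close>
  vanishes by periodicity, and at \<open>a = 2\<pi>\<close> it is the integral on the right.\<close>

lemma integral_periodic_reflect:
  fixes H :: "real \<Rightarrow> complex"
  assumes H: "continuous_on UNIV H" and per: "\<And>x. H (x + 2 * pi) = H x" and a: "0 \<le> a" "a \<le> 2 * pi"
  shows "integral {0..2*pi} (\<lambda>\<theta>. H (a - \<theta>)) = integral {0..2*pi} H"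
proof -
  obtain P where P: "\<And>x. x \<in> {-2*pi..2*pi} \<Longrightarrow> (P has_vector_derivative H x) (at x within {-2*pi..2*pi})"
    using antiderivative_continuous[OF continuous_on_subset[OF H]] by blast
  have 1: "integral {0..2*pi} (\<lambda>\<theta>. H (b - \<theta>)) = P b - P (b - 2 * pi)" if b: "0 \<le> b" "b \<le> 2 * pi" for b
  proof (rule integral_unique)
    have "((\<lambda>\<theta>. H (b - \<theta>)) has_integral - P (b - 2 * pi) - (- P (b - 0))) {0..2*pi}"
    proof (rule fundamental_theorem_of_calculus)
      fix \<theta> assume t: "\<theta> \<in> {0..2*pi}"
      have d: "((\<lambda>\<theta>. b - \<theta>) has_vector_derivative -1) (at \<theta> within {0..2*pi})"
        by (auto intro!: derivative_eq_intros)
      have "(P has_vector_derivative H (b - \<theta>)) (at (b - \<theta>) within (\<lambda>\<theta>. b - \<theta>) ` {0..2*pi})"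
        by (rule has_vector_derivative_within_subset[OF P]) (use b t in auto)
      from vector_diff_chain_within[OF d this]
      show "((\<lambda>\<theta>. - P (b - \<theta>)) has_vector_derivative H (b - \<theta>)) (at \<theta> within {0..2*pi})"
        by (auto simp: o_def intro!: derivative_eq_intros)
    qed simp
    then show "((\<lambda>\<theta>. H (b - \<theta>)) has_integral P b - P (b - 2 * pi)) {0..2*pi}" by simp
  qed
  have 2: "integral {0..2*pi} H = P (2 * pi) - P 0"
    by (intro integral_unique fundamental_theorem_of_calculus has_vector_derivative_within_subset[OF P]) auto
  have 3: "((\<lambda>b. P b - P (b - 2 * pi)) has_vector_derivative 0) (at b within {0..2*pi})"
    if b: "b \<in> {0..2*pi}" for b
  proof -
    have d: "((\<lambda>b. b - 2 * pi) has_vector_derivative 1) (at b within {0..2*pi})"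
      by (auto intro!: derivative_eq_intros)
    have "(P has_vector_derivative H (b - 2 * pi)) (at (b - 2 * pi) within (\<lambda>\<theta>. \<theta> - 2 * pi) ` {0..2*pi})"
      by (rule has_vector_derivative_within_subset[OF P]) (use b in auto)
    from vector_diff_chain_within[OF d this]
    have s: "((\<lambda>b. P (b - 2 * pi)) has_vector_derivative H (b - 2 * pi)) (at b within {0..2*pi})"
      by (auto simp: o_def)
    have "(P has_vector_derivative H b) (at b within {0..2*pi})"
      by (rule has_vector_derivative_within_subset[OF P]) (use b in auto)
    from has_vector_derivative_diff[OF this s] show ?thesis using per[of "b - 2 * pi"] by simp
  qed
  obtain c where "\<And>b. b \<in> {0..2*pi} \<Longrightarrow> P b - P (b - 2 * pi) = c"
    using has_vector_derivative_zero_constant[OF convex_real_interval(5) 3] by metis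
  from this[of a] this[of "2 * pi"] show ?thesis
    unfolding 1[OF a] 2 using a by simp
qed

text \<open>Invariance of arc length under the reflection \<open>\<eta> \<mapsto> \<xi>\<eta>\<^sup>-\<^sup>1\<close>. Integrals of functions of the angle between
  two points of the circle are reduced to single Fourier coefficients in this way.\<close>

lemma integral_arc_length_reflect:
  fixes h :: "_ \<Rightarrow> complex"
  assumes h: "continuous_on (sphere 0 1) h" and \<xi>: "\<xi> \<in> sphere 0 1"
  shows "(\<integral>\<eta>. h (rot \<xi> (conj2 \<eta>)) \<partial>arc_length) = (\<integral>\<eta>. h \<eta> \<partial>arc_length)"
proof -
  obtain a where a: "0 \<le> a" "a < 2 * pi" "\<xi> = polar 1 a" using sphere_polarE[OF \<xi>] .
  have c: "continuous_on UNIV (\<lambda>\<theta>. h (polar 1 \<theta>))"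
    by (intro continuous_on_compose2[OF h] continuous_intros) auto
  have "(\<integral>\<eta>. h (rot \<xi> (conj2 \<eta>)) \<partial>arc_length) = integral {0..2*pi} (\<lambda>\<theta>. h (polar 1 (a - \<theta>)))"
    by (subst integral_arc_length_continuous)
       (use \<xi> in \<open>auto intro!: continuous_intros continuous_on_compose2[OF h] simp: a(3) conj2_polar rot_polar\<close>)
  also have "\<dots> = integral {0..2*pi} (\<lambda>\<theta>. h (polar 1 \<theta>))"
    using integral_periodic_reflect[OF c] a by (simp add: polar_periodic)
  also have "\<dots> = (\<integral>\<eta>. h \<eta> \<partial>arc_length)"
    using h by (simp add: integral_arc_length_continuous)
  finally show ?thesis .
qed

section \<open>Fourier series on the circle\<close>

text \<open>The character \<open>\<xi>\<^sup>n\<close> of the circle, that is \<open>exp(\<i>n\<theta>)\<close> in the angle.\<close>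

definition chr :: "int \<Rightarrow> real^2 \<Rightarrow> complex" where
  "chr n \<xi> = Complex (\<xi> $ 1) (\<xi> $ 2) powi n"

lemma sphere_Complex: "\<xi> \<in> sphere (0::real^2) 1 \<Longrightarrow> norm (Complex (\<xi> $ 1) (\<xi> $ 2)) = 1"
  by (simp add: cmod_def norm_vec2)

lemma sphere_Complex_nz: "\<xi> \<in> sphere (0::real^2) 1 \<Longrightarrow> Complex (\<xi> $ 1) (\<xi> $ 2) \<noteq> 0"
  using sphere_Complex by fastforce

lemma norm_chr [simp]: "\<xi> \<in> sphere 0 1 \<Longrightarrow> norm (chr n \<xi>) = 1"
  by (simp add: chr_def norm_power_int sphere_Complex)

lemma chr_0 [simp]: "chr 0 \<xi> = 1"
  by (simp add: chr_def)

lemma chr_add: "\<xi> \<in> sphere 0 1 \<Longrightarrow> chr (m + n) \<xi> = chr m \<xi> * chr n \<xi>"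
  by (simp add: chr_def power_int_add sphere_Complex_nz)

lemma cnj_chr: "\<xi> \<in> sphere 0 1 \<Longrightarrow> cnj (chr n \<xi>) = chr (- n) \<xi>"
  using norm_chr[of \<xi> n] complex_norm_square[of "chr n \<xi>"] chr_add[of \<xi> n "- n"]
  by (metis add.right_inverse chr_0 mult_cancel_left1 mult_left_cancel norm_zero of_real_1 power_one zero_neq_one)

lemma chr_polar: "chr n (polar 1 \<theta>) = cis (of_int n * \<theta>)"
proof -
  have "Complex (cos \<theta>) (sin \<theta>) = cis \<theta>" by (simp add: cis.ctr)
  then show ?thesis by (simp add: chr_def cis_power_int)
qed

lemma chr_rot_conj2:
  assumes "\<xi> \<in> sphere 0 1" "\<eta> \<in> sphere 0 1"
  shows "chr n (rot \<xi> (conj2 \<eta>)) = chr n \<xi> * cnj (chr n \<eta>)"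
proof -
  obtain a where a: "\<xi> = polar 1 a" using sphere_polarE[OF assms(1)] by metis
  obtain b where b: "\<eta> = polar 1 b" using sphere_polarE[OF assms(2)] by metis
  show ?thesis by (simp add: a b conj2_polar rot_polar chr_polar cis_mult cis_cnj algebra_simps)
qed

lemma continuous_on_chr [continuous_intros]: "continuous_on (sphere 0 1) (chr n)"
proof -
  have "continuous_on (sphere 0 1) (\<lambda>\<xi>::real^2. Complex (\<xi> $ 1) (\<xi> $ 2))"
    unfolding Complex_eq by (intro continuous_intros)
  then show ?thesis unfolding chr_def
    by (intro continuous_on_power_int) (use sphere_Complex_nz in auto)
qed

lemma chr_measurable [measurable]: "chr n \<in> borel_measurable arc_length"
  by (intro borel_measurable_arc_length_continuous continuous_intros)

lemma chr_square_integrable: "square_integrable arc_length (chr n)"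
  by (rule arc_length.square_integrable_bounded[where C = 1]) auto

text \<open>The Fourier coefficients are not normalised: the coefficient of \<open>chr n\<close> in the series is
  \<open>fcoeff n f / (2\<pi>)\<close>.\<close>

definition fcoeff :: "int \<Rightarrow> (real^2 \<Rightarrow> complex) \<Rightarrow> complex" where
  "fcoeff n f = (\<integral>\<xi>. cnj (chr n \<xi>) * f \<xi> \<partial>arc_length)"

lemma borel_measurable_cnj [measurable]:
  "f \<in> borel_measurable M \<Longrightarrow> (\<lambda>x. cnj (f x)) \<in> borel_measurable M"
  by (rule measurable_compose[OF _ borel_measurable_continuous_onI]) (auto intro!: continuous_intros)

lemma integrable_chr_mult:
  assumes "integrable arc_length f"
  shows "integrable arc_length (\<lambda>\<xi>. cnj (chr n \<xi>) * f \<xi>)" "integrable arc_length (\<lambda>\<xi>. chr n \<xi> * f \<xi>)"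
proof -
  have [measurable]: "f \<in> borel_measurable arc_length" using assms by auto
  show "integrable arc_length (\<lambda>\<xi>. cnj (chr n \<xi>) * f \<xi>)"
    by (rule Bochner_Integration.integrable_bound[OF assms]) (auto intro!: AE_I2 simp: norm_mult)
  show "integrable arc_length (\<lambda>\<xi>. chr n \<xi> * f \<xi>)"
    by (rule Bochner_Integration.integrable_bound[OF assms]) (auto intro!: AE_I2 simp: norm_mult)
qed

lemma fcoeff_add: "integrable arc_length f \<Longrightarrow> integrable arc_length g \<Longrightarrow>
    fcoeff n (\<lambda>\<xi>. f \<xi> + g \<xi>) = fcoeff n f + fcoeff n g"
  by (simp add: fcoeff_def integrable_chr_mult distrib_left)

lemma fcoeff_diff: "integrable arc_length f \<Longrightarrow> integrable arc_length g \<Longrightarrow>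
    fcoeff n (\<lambda>\<xi>. f \<xi> - g \<xi>) = fcoeff n f - fcoeff n g"
  by (simp add: fcoeff_def integrable_chr_mult right_diff_distrib)

lemma fcoeff_cmult: "fcoeff n (\<lambda>\<xi>. c * f \<xi>) = c * fcoeff n f"
  by (simp add: fcoeff_def mult.left_commute)

lemma fcoeff_chr_mult: "fcoeff n (\<lambda>\<xi>. chr m \<xi> * f \<xi>) = fcoeff (n - m) f"
  unfolding fcoeff_def
proof (intro Bochner_Integration.integral_cong refl)
  fix \<xi> assume "\<xi> \<in> space arc_length"
  then show "cnj (chr n \<xi>) * (chr m \<xi> * f \<xi>) = cnj (chr (n - m) \<xi>) * f \<xi>"
    using chr_add[of \<xi> "- n" m] by (simp add: cnj_chr mult.assoc[symmetric])
qed

lemma has_vector_derivative_cis: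
  "((\<lambda>\<theta>. cis (k * \<theta>)) has_vector_derivative \<i> * k * cis (k * \<theta>)) (at \<theta> within S)"
proof -
  have "((\<lambda>z. exp (\<i> * of_real k * z)) has_field_derivative \<i> * k * exp (\<i> * of_real k * of_real \<theta>)) (at (of_real \<theta>))"
    by (auto intro!: derivative_eq_intros)
  from has_vector_derivative_real_field[OF this, of S] show ?thesis
    by (simp add: cis_conv_exp mult.assoc)
qed

lemma fcoeff_chr: "fcoeff n (chr m) = (if n = m then 2 * pi else 0)"
proof -
  have "fcoeff n (chr m) = integral {0..2*pi} (\<lambda>\<theta>. cis (of_int (m - n) * \<theta>))"
    unfolding fcoeff_def
    by (subst integral_arc_length_continuous)
       (auto intro!: continuous_intros simp: chr_polar cis_cnj cis_mult algebra_simps)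
  also have "\<dots> = (if n = m then 2 * pi else 0)"
  proof (cases "n = m")
    case False
    define k :: real where "k = of_int (m - n)"
    have k: "k \<noteq> 0" using False by (simp add: k_def)
    have "((\<lambda>\<theta>. cis (k * \<theta>)) has_integral
        cis (k * (2 * pi)) / (\<i> * k) - cis (k * 0) / (\<i> * k)) {0..2*pi}"
    proof (rule fundamental_theorem_of_calculus)
      fix \<theta>
      from has_vector_derivative_divide[OF has_vector_derivative_cis[of k \<theta> "{0..2*pi}"], of "\<i> * k"]
      show "((\<lambda>\<theta>. cis (k * \<theta>) / (\<i> * k)) has_vector_derivative cis (k * \<theta>)) (at \<theta> within {0..2*pi})"
        using k by simp
    qed simp
    then have "((\<lambda>\<theta>. cis (of_int (m - n) * \<theta>)) has_integral
        cis (of_int (m - n) * (2 * pi)) / (\<i> * of_int (m - n)) - cis (of_int (m - n) * 0) / (\<i> * of_int (m - n))) {0..2*pi}"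
      by (simp add: k_def)
    moreover have "cis (of_int (m - n) * (2 * pi)) = 1"
      using cis_multiple_2pi[of "of_int (m - n)"] by (simp only: Ints_of_int mult.commute simp_thms)
    ultimately show ?thesis using False by (simp add: integral_unique)
  qed (simp add: scaleR_conv_of_real)
  finally show ?thesis .
qed

text \<open>Multiplication by a coordinate only shifts the coefficients by one in both directions, so functions with
  vanishing coefficients are stable under multiplication by coordinates. Quantifying over all such \<open>F\<close>
  lets the induction pass through products of polynomials.\<close>

lemma real_polynomial_mult_fcoeff_zero:
  assumes "real_polynomial_function p" "integrable arc_length F" "\<And>n. fcoeff n F = 0"
  shows "integrable arc_length (\<lambda>\<xi>. of_real (p \<xi>) * F \<xi>) \<and> (\<forall>n. fcoeff n (\<lambda>\<xi>. of_real (p \<xi>) * F \<xi>) = 0)"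
  using assms
proof (induction p arbitrary: F rule: real_polynomial_function.induct)
  case (linear f)
  define A B where "A = (of_real (f (axis 1 1)) - \<i> * of_real (f (axis 2 1))) / 2"
    and "B = (of_real (f (axis 1 1)) + \<i> * of_real (f (axis 2 1))) / 2"
  interpret f: bounded_linear f by fact
  have fx: "f \<xi> = \<xi> $ 1 * f (axis 1 1) + \<xi> $ 2 * f (axis 2 1)" for \<xi>
  proof -
    have "\<xi> = \<xi> $ 1 *\<^sub>R axis 1 1 + \<xi> $ 2 *\<^sub>R axis 2 1"
      by (simp add: vec2_eq_iff axis_def)
    then have "f \<xi> = f (\<xi> $ 1 *\<^sub>R axis 1 1 + \<xi> $ 2 *\<^sub>R axis 2 1)" by simp
    also have "\<dots> = \<xi> $ 1 * f (axis 1 1) + \<xi> $ 2 * f (axis 2 1)"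
      by (simp add: f.add f.scaleR)
    finally show ?thesis .
  qed
  have eq: "of_real (f \<xi>) * F \<xi> = A * (chr 1 \<xi> * F \<xi>) + B * (chr (-1) \<xi> * F \<xi>)" if "\<xi> \<in> sphere 0 1" for \<xi>
  proof -
    have c: "chr (-1) \<xi> = cnj (chr 1 \<xi>)" using cnj_chr[OF that, of 1] by simp
    have d: "chr 1 \<xi> = of_real (\<xi> $ 1) + \<i> * of_real (\<xi> $ 2)" by (simp add: chr_def Complex_eq)
    have "of_real (f \<xi>) = A * chr 1 \<xi> + B * chr (-1) \<xi>"
      unfolding c d A_def B_def fx[of \<xi>] by (simp add: field_simps complex_eq_iff)
    then show ?thesis by (simp add: algebra_simps)
  qed
  have i: "integrable arc_length (\<lambda>\<xi>. A * (chr 1 \<xi> * F \<xi>))" "integrable arc_length (\<lambda>\<xi>. B * (chr (-1) \<xi> * F \<xi>))"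
    using integrable_chr_mult(2)[OF linear(2)] by auto
  have "integrable arc_length (\<lambda>\<xi>. of_real (f \<xi>) * F \<xi>)
      \<longleftrightarrow> integrable arc_length (\<lambda>\<xi>. A * (chr 1 \<xi> * F \<xi>) + B * (chr (-1) \<xi> * F \<xi>))"
    by (rule Bochner_Integration.integrable_cong) (auto simp: eq)
  moreover have "fcoeff n (\<lambda>\<xi>. of_real (f \<xi>) * F \<xi>) = 0" for n
  proof -
    have "fcoeff n (\<lambda>\<xi>. of_real (f \<xi>) * F \<xi>) = fcoeff n (\<lambda>\<xi>. A * (chr 1 \<xi> * F \<xi>) + B * (chr (-1) \<xi> * F \<xi>))"
      unfolding fcoeff_def by (rule Bochner_Integration.integral_cong) (auto simp: eq)
    also have "\<dots> = 0"
      by (simp only: fcoeff_add[OF i] fcoeff_cmult fcoeff_chr_mult linear) simp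
    finally show ?thesis .
  qed
  ultimately show ?case using i by simp
next
  case (const c)
  then show ?case by (simp add: fcoeff_cmult)
next
  case (add p q)
  then show ?case by (simp add: distrib_right fcoeff_add)
next
  case (mult p q)
  have "integrable arc_length (\<lambda>\<xi>. of_real (p \<xi>) * (of_real (q \<xi>) * F \<xi>)) \<and>
      (\<forall>n. fcoeff n (\<lambda>\<xi>. of_real (p \<xi>) * (of_real (q \<xi>) * F \<xi>)) = 0)"
    using mult.IH(2)[OF mult.prems] by (intro mult.IH(1)) auto
  then show ?case by (simp add: mult.assoc)
qed

text \<open>Weierstrass approximation of \<open>g\<close> by polynomials on the circle.\<close>

lemma continuous_mult_integral_zero:
  assumes F: "integrable arc_length F" "\<And>n. fcoeff n F = 0" and g: "continuous_on (sphere 0 1) g"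
  shows "(\<integral>\<xi>. of_real (g \<xi>) * F \<xi> \<partial>arc_length) = 0"
proof -
  let ?I = "\<integral>\<xi>. norm (F \<xi>) \<partial>arc_length"
  have [measurable]: "F \<in> borel_measurable arc_length" using F by auto
  have gm[measurable]: "g \<in> borel_measurable arc_length" by (rule borel_measurable_arc_length_continuous[OF g])
  have ig: "integrable arc_length (\<lambda>\<xi>. of_real (g \<xi>) * F \<xi>)"
  proof -
    have "bounded (g ` sphere 0 1)" by (intro compact_imp_bounded compact_continuous_image g) simp
    then obtain B where B: "\<And>x. x \<in> sphere 0 1 \<Longrightarrow> \<bar>g x\<bar> \<le> B"
      unfolding bounded_iff real_norm_def by blast
    have "integrable arc_length (\<lambda>\<xi>. B * norm (F \<xi>))" using F by simp
    then show ?thesis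
    proof (rule Bochner_Integration.integrable_bound)
      show "AE \<xi> in arc_length. norm (of_real (g \<xi>) * F \<xi>) \<le> norm (B * norm (F \<xi>))"
      proof (intro AE_I2)
        fix \<xi> assume "\<xi> \<in> space arc_length"
        then have "\<bar>g \<xi>\<bar> \<le> B" using B by simp
        then show "norm (of_real (g \<xi>) * F \<xi>) \<le> norm (B * norm (F \<xi>))"
          by (auto simp: norm_mult abs_mult intro!: mult_right_mono)
      qed
    qed measurable
  qed
  have "norm (\<integral>\<xi>. of_real (g \<xi>) * F \<xi> \<partial>arc_length) \<le> e * ?I" if "e > 0" for e
  proof -
    obtain p where p: "real_polynomial_function p" "\<And>x. x \<in> sphere 0 1 \<Longrightarrow> \<bar>g x - p x\<bar> < e"
      using Stone_Weierstrass_real_polynomial_function[OF _ g \<open>e > 0\<close>] by auto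
    note z = real_polynomial_mult_fcoeff_zero[OF p(1) F]
    from z have "fcoeff 0 (\<lambda>\<xi>. of_real (p \<xi>) * F \<xi>) = 0" by blast
    then have "(\<integral>\<xi>. of_real (p \<xi>) * F \<xi> \<partial>arc_length) = 0" by (simp add: fcoeff_def)
    then have "(\<integral>\<xi>. of_real (g \<xi>) * F \<xi> \<partial>arc_length) = (\<integral>\<xi>. of_real (g \<xi>) * F \<xi> - of_real (p \<xi>) * F \<xi> \<partial>arc_length)"
      using z ig by simp
    also have "norm \<dots> \<le> (\<integral>\<xi>. norm (of_real (g \<xi>) * F \<xi> - of_real (p \<xi>) * F \<xi>) \<partial>arc_length)"
      by (rule integral_norm_bound)
    also have "\<dots> \<le> (\<integral>\<xi>. e * norm (F \<xi>) \<partial>arc_length)"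
    proof (rule integral_mono)
      fix \<xi> assume "\<xi> \<in> space arc_length"
      then have "\<bar>g \<xi> - p \<xi>\<bar> \<le> e" using p(2)[of \<xi>] by simp
      moreover have "norm (of_real (g \<xi>) * F \<xi> - of_real (p \<xi>) * F \<xi>) = \<bar>g \<xi> - p \<xi>\<bar> * norm (F \<xi>)"
        by (simp add: left_diff_distrib[symmetric] norm_mult flip: of_real_diff)
      ultimately show "norm (of_real (g \<xi>) * F \<xi> - of_real (p \<xi>) * F \<xi>) \<le> e * norm (F \<xi>)"
        by (simp add: mult_right_mono)
    qed (use z ig F in auto)
    finally show ?thesis by simp
  qed
  then have "norm (\<integral>\<xi>. of_real (g \<xi>) * F \<xi> \<partial>arc_length) \<le> 0 + e" if "e > 0" for e
  proof -
    have I: "0 \<le> ?I" by simp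
    have "norm (\<integral>\<xi>. of_real (g \<xi>) * F \<xi> \<partial>arc_length) \<le> e / (?I + 1) * ?I"
      using \<open>\<And>e. e > 0 \<Longrightarrow> norm (\<integral>\<xi>. of_real (g \<xi>) * F \<xi> \<partial>arc_length) \<le> e * ?I\<close>[of "e / (?I + 1)"] I \<open>e > 0\<close> by simp
    also have "e / (i + 1) * i \<le> e" if "0 \<le> i" for i using that \<open>e > 0\<close> by (simp add: field_simps)
    from this[OF I] have "e / (?I + 1) * ?I \<le> e" .
    finally show ?thesis by simp
  qed
  then show ?thesis using field_le_epsilon[of "norm (\<integral>\<xi>. of_real (g \<xi>) * F \<xi> \<partial>arc_length)" 0] by fastforce
qed

text \<open>Continuous functions \<open>max 0 (1 - m dist(\<cdot>, C))\<close> decrease to the indicator of a closed set \<open>C\<close>, so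
  \<open>F\<close> integrates to zero over closed sets, and by Dynkin's lemma over all Borel sets.\<close>

theorem fcoeff_zero_imp_AE_zero:
  assumes F: "integrable arc_length F" "\<And>n. fcoeff n F = 0"
  shows "AE \<xi> in arc_length. F \<xi> = 0"
proof -
  have [measurable]: "F \<in> borel_measurable arc_length" using F by auto
  have ms: "A \<in> sets borel \<Longrightarrow> indicator A \<in> borel_measurable arc_length" for A :: "(real^2) set"
    by (subst measurable_cong_sets[OF sets_arc_length refl]) (auto intro!: measurable_restrict_space1)
  have ii: "integrable arc_length (\<lambda>\<xi>. indicator A \<xi> *\<^sub>R F \<xi>)" if "A \<in> sets borel" for A
    by (rule Bochner_Integration.integrable_bound[OF F(1)])
       (use ms[OF that] in \<open>auto intro!: AE_I2 borel_measurable_scaleR split: split_indicator\<close>)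
  have closed: "(\<integral>\<xi>. indicator C \<xi> *\<^sub>R F \<xi> \<partial>arc_length) = 0" if "closed C" for C
  proof (cases "C = {}")
    case False
    define g where "g m \<xi> = max 0 (1 - real m * infdist \<xi> C)" for m \<xi>
    have gc: "continuous_on (sphere 0 1) (g m)" for m
      unfolding g_def by (intro continuous_intros)
    have gm: "g m \<in> borel_measurable arc_length" for m by (rule borel_measurable_arc_length_continuous[OF gc])
    have "(\<lambda>m. \<integral>\<xi>. of_real (g m \<xi>) * F \<xi> \<partial>arc_length) \<longlonglongrightarrow> (\<integral>\<xi>. indicator C \<xi> *\<^sub>R F \<xi> \<partial>arc_length)"
    proof (rule integral_dominated_convergence[where w = "\<lambda>\<xi>. norm (F \<xi>)"])
      show "AE \<xi> in arc_length. (\<lambda>m. of_real (g m \<xi>) * F \<xi>) \<longlonglongrightarrow> indicator C \<xi> *\<^sub>R F \<xi>"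
      proof (intro AE_I2)
        fix \<xi> :: "real^2"
        have "(\<lambda>m. g m \<xi>) \<longlonglongrightarrow> indicator C \<xi>"
        proof (cases "\<xi> \<in> C")
          case False
          then have d: "infdist \<xi> C > 0"
            using that \<open>C \<noteq> {}\<close> by (simp add: infdist_pos_not_in_closed)
          obtain N where N: "1 < real N * infdist \<xi> C" using reals_Archimedean3[OF d] by blast
          have "\<forall>\<^sub>F m in sequentially. g m \<xi> = 0"
            using eventually_ge_at_top[of N]
          proof eventually_elim
            case (elim m)
            then have "real N * infdist \<xi> C \<le> real m * infdist \<xi> C" using d by (intro mult_right_mono) auto
            then show ?case using N by (simp add: g_def)
          qed
          then show ?thesis using False by (simp add: tendsto_eventually)
        qed (simp add: g_def)
        from tendsto_mult[OF tendsto_of_real[OF this] tendsto_const[of "F \<xi>"]]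
        show "(\<lambda>m. of_real (g m \<xi>) * F \<xi>) \<longlonglongrightarrow> indicator C \<xi> *\<^sub>R F \<xi>"
          by (simp add: scaleR_conv_of_real)
      qed
      show "AE \<xi> in arc_length. norm (of_real (g m \<xi>) * F \<xi>) \<le> norm (F \<xi>)" for m
      proof (intro AE_I2)
        fix \<xi> :: "real^2"
        have "\<bar>g m \<xi>\<bar> \<le> 1" using infdist_nonneg[of \<xi> C] by (simp add: g_def)
        then show "norm (of_real (g m \<xi>) * F \<xi>) \<le> norm (F \<xi>)"
          using mult_right_mono[of "\<bar>g m \<xi>\<bar>" 1 "norm (F \<xi>)"] by (simp add: norm_mult)
      qed
    qed (use F gm ii[of C] that in auto)
    moreover have "(\<integral>\<xi>. of_real (g m \<xi>) * F \<xi> \<partial>arc_length) = 0" for m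
      by (rule continuous_mult_integral_zero[OF F gc])
    ultimately show ?thesis by (simp add: LIMSEQ_const_iff)
  qed simp
  have all: "(\<integral>\<xi>. indicator A \<xi> *\<^sub>R F \<xi> \<partial>arc_length) = 0" if "A \<in> sets borel" for A
  proof -
    have "A \<in> sigma_sets UNIV {C. closed C}" using that by (simp add: borel_eq_closed)
    have st: "Int_stable {C :: (real^2) set. closed C}" "{C :: (real^2) set. closed C} \<subseteq> Pow UNIV"
      by (auto intro!: Int_stableI)
    from st \<open>A \<in> sigma_sets UNIV {C. closed C}\<close> show ?thesis
    proof (induction rule: sigma_sets_induct_disjoint)
      case (basic A) then show ?case using closed by auto
    next
      case empty show ?case by simp
    next
      case (compl A)
      have "A \<in> sets borel" using compl by (simp add: borel_eq_closed)
      have u: "(\<integral>\<xi>. F \<xi> \<partial>arc_length) = 0" using F(2)[of 0] by (simp add: fcoeff_def)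
      have "(\<integral>\<xi>. indicator (UNIV - A) \<xi> *\<^sub>R F \<xi> \<partial>arc_length) = (\<integral>\<xi>. F \<xi> - indicator A \<xi> *\<^sub>R F \<xi> \<partial>arc_length)"
        by (rule Bochner_Integration.integral_cong) (auto split: split_indicator)
      also have "\<dots> = 0" using compl F ii[OF \<open>A \<in> sets borel\<close>] u by simp
      finally show ?case .
    next
      case (union A)
      have m: "A i \<in> sets borel" for i using union by (auto simp: borel_eq_closed)
      then have "(\<Union>i. A i) \<in> sets borel" by auto
      have t: "(\<integral>\<xi>. indicator B \<xi> *\<^sub>R F \<xi> \<partial>arc_length) = set_lebesgue_integral arc_length (B \<inter> sphere 0 1) F" for B
        unfolding set_lebesgue_integral_def
        by (rule Bochner_Integration.integral_cong) (auto split: split_indicator)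
      have ms': "B \<inter> sphere 0 1 \<in> sets arc_length" if "B \<in> sets borel" for B
        using that by (auto simp: sets_arc_length sets_restrict_space)
      have "set_lebesgue_integral arc_length (\<Union>i. A i \<inter> sphere 0 1) F = (\<Sum>i. set_lebesgue_integral arc_length (A i \<inter> sphere 0 1) F)"
      proof (rule lebesgue_integral_countable_add)
        show "A i \<inter> sphere 0 1 \<in> sets arc_length" for i using ms'[OF m] .
        show "(A i \<inter> sphere 0 1) \<inter> (A j \<inter> sphere 0 1) = {}" if "i \<noteq> j" for i j
          using union(1) that by (auto simp: disjoint_family_on_def)
        have "(\<Union>i. A i \<inter> sphere 0 1) \<in> sets arc_length"
          by (rule sets.countable_UN) (use ms'[OF m] in blast)
        from integrable_mult_indicator[OF this F(1)]
        show "set_integrable arc_length (\<Union>i. A i \<inter> sphere 0 1) F" by (simp add: set_integrable_def)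
      qed
      also have "\<dots> = 0" using union(3) by (simp add: t)
      also have "(\<Union>i. A i \<inter> sphere 0 1) = (\<Union>i. A i) \<inter> sphere 0 1" by auto
      finally show ?case by (simp add: t)
    qed
  qed
  show ?thesis
  proof (rule arc_length.density_zero[OF F(1)])
    fix B assume "B \<in> sets arc_length"
    then obtain A where "A \<in> sets borel" "B = A \<inter> sphere 0 1"
      by (auto simp: sets_arc_length sets_restrict_space)
    have "set_lebesgue_integral arc_length B F = (\<integral>\<xi>. indicator A \<xi> *\<^sub>R F \<xi> \<partial>arc_length)"
      unfolding set_lebesgue_integral_def \<open>B = _\<close>
      by (rule Bochner_Integration.integral_cong) (auto split: split_indicator)
    then show "set_lebesgue_integral arc_length B F = 0" using all[OF \<open>A \<in> sets borel\<close>] by simp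
  qed
qed

abbreviation sq_norm :: "(real^2 \<Rightarrow> complex) \<Rightarrow> real" where
  "sq_norm f \<equiv> \<integral>\<xi>. (norm (f \<xi>))\<^sup>2 \<partial>arc_length"

definition fsum :: "int set \<Rightarrow> (real^2 \<Rightarrow> complex) \<Rightarrow> real^2 \<Rightarrow> complex" where
  "fsum A f \<xi> = (\<Sum>n\<in>A. fcoeff n f / (2 * pi) * chr n \<xi>)"

lemma fsum_square_integrable: "square_integrable arc_length (fsum A f)"
  unfolding fsum_def
  by (intro square_integrable_sum square_integrable_bound[OF chr_square_integrable, of _ "norm (fcoeff _ f / (2 * pi))"])
     (auto simp: norm_mult norm_divide)

lemma fcoeff_norm_le:
  assumes "square_integrable arc_length f"
  shows "(norm (fcoeff n f))\<^sup>2 \<le> 2 * pi * sq_norm f"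
proof -
  have i: "integrable arc_length f" by (rule arc_length.square_integrable_integrable[OF assms])
  have "norm (fcoeff n f) \<le> (\<integral>\<xi>. norm (cnj (chr n \<xi>) * f \<xi>) \<partial>arc_length)"
    unfolding fcoeff_def by (rule integral_norm_bound)
  also have "\<dots> = (\<integral>\<xi>. norm (f \<xi>) \<partial>arc_length)"
    by (rule Bochner_Integration.integral_cong) (auto simp: norm_mult)
  finally have "(norm (fcoeff n f))\<^sup>2 \<le> (\<integral>\<xi>. norm (f \<xi>) \<partial>arc_length)\<^sup>2"
    by (intro power_mono) auto
  also have "\<dots> \<le> 2 * pi * sq_norm f" using arc_length.square_integral_norm_le[OF assms] by simp
  finally show ?thesis .
qed

lemma fcoeff_fsum:
  assumes "finite A"
  shows "fcoeff n (fsum A f) = (if n \<in> A then fcoeff n f else 0)"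
proof -
  have i: "integrable arc_length (\<lambda>\<xi>. cnj (chr n \<xi>) * (c * chr m \<xi>))" for c m
    using integrable_chr_mult(1)[OF integrable_mult_right[OF arc_length.square_integrable_integrable[OF chr_square_integrable]]] by blast
  have "fcoeff n (fsum A f) = (\<Sum>m\<in>A. \<integral>\<xi>. cnj (chr n \<xi>) * (fcoeff m f / (2 * pi) * chr m \<xi>) \<partial>arc_length)"
    unfolding fcoeff_def[of n] fsum_def sum_distrib_left
    by (rule Bochner_Integration.integral_sum) (rule i)
  also have "\<dots> = (\<Sum>m\<in>A. fcoeff n (\<lambda>\<xi>. fcoeff m f / (2 * pi) * chr m \<xi>))"
    by (simp add: fcoeff_def)
  also have "\<dots> = (\<Sum>m\<in>A. if n = m then fcoeff n f else 0)"
    unfolding fcoeff_cmult fcoeff_chr by (intro sum.cong refl) auto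
  also have "\<dots> = (if n \<in> A then fcoeff n f else 0)" using assms by (simp add: sum.delta)
  finally show ?thesis .
qed

text \<open>Expand the square and use orthogonality of the characters. The first identity contains Bessel's inequality,
  the second one controls differences of partial sums.\<close>

lemma sq_norm_diff_fsum:
  assumes f: "square_integrable arc_length f" and A: "finite A"
  shows "sq_norm (\<lambda>\<xi>. f \<xi> - fsum A f \<xi>) = sq_norm f - (\<Sum>n\<in>A. (norm (fcoeff n f))\<^sup>2) / (2 * pi)"
    and "sq_norm (fsum A f) = (\<Sum>n\<in>A. (norm (fcoeff n f))\<^sup>2) / (2 * pi)"
proof -
  let ?s = "fsum A f" and ?S = "(\<Sum>n\<in>A. (norm (fcoeff n f))\<^sup>2) / (2 * pi)"
  have cross: "(\<integral>\<xi>. cnj (?s \<xi>) * g \<xi> \<partial>arc_length) = (\<Sum>n\<in>A. cnj (fcoeff n f) * fcoeff n g) / (2 * pi)"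
    if g: "square_integrable arc_length g" for g
  proof -
    have i: "integrable arc_length (\<lambda>\<xi>. cnj (chr n \<xi>) * g \<xi>)" for n
      by (rule integrable_chr_mult(1)[OF arc_length.square_integrable_integrable[OF g]])
    have "(\<integral>\<xi>. cnj (?s \<xi>) * g \<xi> \<partial>arc_length) = (\<integral>\<xi>. (\<Sum>n\<in>A. cnj (fcoeff n f) / (2 * pi) * (cnj (chr n \<xi>) * g \<xi>)) \<partial>arc_length)"
      by (simp add: fsum_def sum_distrib_right mult.assoc)
    also have "\<dots> = (\<Sum>n\<in>A. \<integral>\<xi>. cnj (fcoeff n f) / (2 * pi) * (cnj (chr n \<xi>) * g \<xi>) \<partial>arc_length)"
      by (rule Bochner_Integration.integral_sum) (use i in auto)
    also have "\<dots> = (\<Sum>n\<in>A. cnj (fcoeff n f) * fcoeff n g) / (2 * pi)"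
      by (simp add: fcoeff_def[of _ g] sum_divide_distrib)
    finally show ?thesis .
  qed
  have nn: "cnj z * z = of_real ((norm z)\<^sup>2)" for z by (subst complex_norm_square) simp
  have ss: "square_integrable arc_length ?s" by (rule fsum_square_integrable)
  have c1: "(\<integral>\<xi>. cnj (?s \<xi>) * f \<xi> \<partial>arc_length) = of_real ?S" unfolding cross[OF f] nn by simp
  have "(\<Sum>n\<in>A. cnj (fcoeff n f) * fcoeff n ?s) = (\<Sum>n\<in>A. of_real ((norm (fcoeff n f))\<^sup>2))"
    by (intro sum.cong refl) (simp add: fcoeff_fsum[OF A] nn)
  then have c2: "(\<integral>\<xi>. cnj (?s \<xi>) * ?s \<xi> \<partial>arc_length) = of_real ?S" unfolding cross[OF ss] by simp
  have "(\<integral>\<xi>. cnj (?s \<xi>) * ?s \<xi> \<partial>arc_length) = of_real (sq_norm ?s)"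
    unfolding nn by (rule integral_complex_of_real)
  then show s: "sq_norm ?s = ?S" using c2 of_real_eq_iff by metis
  have sc: "square_integrable arc_length (\<lambda>\<xi>. cnj (?s \<xi>))"
    by (rule square_integrable_bound[OF ss, of _ 1]) (use ss in \<open>auto simp: square_integrable_def\<close>)
  have ic: "integrable arc_length (\<lambda>\<xi>. cnj (?s \<xi>) * f \<xi>)" by (rule square_integrable_mult_integrable[OF sc f])
  have "sq_norm (\<lambda>\<xi>. f \<xi> - ?s \<xi>) = (\<integral>\<xi>. (norm (f \<xi>))\<^sup>2 + (norm (?s \<xi>))\<^sup>2 - 2 * Re (cnj (?s \<xi>) * f \<xi>) \<partial>arc_length)"
  proof (rule Bochner_Integration.integral_cong[OF refl])
    fix \<xi>
    show "(norm (f \<xi> - ?s \<xi>))\<^sup>2 = (norm (f \<xi>))\<^sup>2 + (norm (?s \<xi>))\<^sup>2 - 2 * Re (cnj (?s \<xi>) * f \<xi>)"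
      unfolding cmod_power2 by (simp add: power2_eq_square algebra_simps)
  qed
  also have "\<dots> = sq_norm f + sq_norm ?s - 2 * Re (\<integral>\<xi>. cnj (?s \<xi>) * f \<xi> \<partial>arc_length)"
    using f ss ic by (simp add: square_integrable_def del: times_complex.sel cnj.sel)
  also have "\<dots> = sq_norm f - ?S" unfolding c1 s by simp
  finally show "sq_norm (\<lambda>\<xi>. f \<xi> - ?s \<xi>) = sq_norm f - ?S" .
qed

text \<open>By Bessel's inequality the partial sums of the Fourier series are Cauchy, hence converge in \<open>L\<^sup>2\<close>.
  The limit has the coefficients of \<open>f\<close>, so it is \<open>f\<close> by uniqueness, and the error in Bessel's inequality
  tends to zero.\<close>

theorem parseval:
  assumes f: "square_integrable arc_length f"
  shows "(\<integral>\<^sup>+n. ennreal ((norm (fcoeff n f))\<^sup>2) \<partial>count_space UNIV) = ennreal (2 * pi * sq_norm f)"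
proof -
  define A where "A N = {- int N..int N}" for N
  define s where "s N = fsum (A N) f" for N
  define a where "a N = (\<Sum>n\<in>A N. (norm (fcoeff n f))\<^sup>2) / (2 * pi)" for N
  have fin: "finite (A N)" for N by (simp add: A_def)
  have mono: "A M \<subseteq> A N" if "M \<le> N" for M N using that by (auto simp: A_def)
  have a_le: "a N \<le> sq_norm f" for N
  proof -
    have "0 \<le> sq_norm (\<lambda>\<xi>. f \<xi> - s N \<xi>)" by simp
    then show ?thesis unfolding s_def a_def sq_norm_diff_fsum(1)[OF f fin] by simp
  qed
  have "incseq a"
    unfolding a_def by (intro incseq_SucI divide_right_mono sum_mono2 fin mono) auto
  have "convergent a"
    by (rule incseq_convergent[OF \<open>incseq a\<close>, of "sq_norm f"]) (auto simp: a_le convergent_def)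
  have diff: "sq_norm (\<lambda>\<xi>. s N \<xi> - s M \<xi>) = \<bar>a N - a M\<bar>" for M N
  proof -
    have *: "sq_norm (\<lambda>\<xi>. s N \<xi> - s M \<xi>) = a N - a M" if "M \<le> N" for M N
    proof -
      have "s N \<xi> - s M \<xi> = fsum (A N - A M) f \<xi>" for \<xi>
        by (simp add: s_def fsum_def sum_diff[OF fin mono[OF that]])
      then show ?thesis
        using sq_norm_diff_fsum(2)[OF f, of "A N - A M"] fin
        by (simp add: a_def sum_diff[OF fin mono[OF that]] diff_divide_distrib)
    qed
    show ?thesis
    proof (cases "M \<le> N")
      case True
      then show ?thesis using *[OF True] incseqD[OF \<open>incseq a\<close> True] by simp
    next
      case False
      then have "N \<le> M" by simp
      then show ?thesis using *[OF \<open>N \<le> M\<close>] incseqD[OF \<open>incseq a\<close> \<open>N \<le> M\<close>]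
        by (simp add: norm_minus_commute)
    qed
  qed
  have ss: "square_integrable arc_length (s N)" for N unfolding s_def by (rule fsum_square_integrable)
  have "Cauchy a" using \<open>convergent a\<close> by (rule convergent_Cauchy)
  obtain h r where h: "square_integrable arc_length h" "(\<lambda>N. sq_norm (\<lambda>\<xi>. s N \<xi> - h \<xi>)) \<longlonglongrightarrow> 0"
  proof (rule arc_length.square_integrable_complete[of s])
    show "square_integrable arc_length (s n)" for n by (rule ss)
    fix e :: real assume "e > 0"
    then show "\<exists>N. \<forall>m\<ge>N. \<forall>n\<ge>N. sq_norm (\<lambda>\<xi>. s m \<xi> - s n \<xi>) < e"
      using \<open>Cauchy a\<close> by (simp add: diff Cauchy_def dist_real_def)
  qed
  note fi = arc_length.square_integrable_integrable
  have "fcoeff n (\<lambda>\<xi>. f \<xi> - h \<xi>) = 0" for n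
  proof -
    have "\<forall>\<^sub>F N in sequentially. (norm (fcoeff n f - fcoeff n h))\<^sup>2 \<le> 2 * pi * sq_norm (\<lambda>\<xi>. s N \<xi> - h \<xi>)"
      using eventually_ge_at_top[of "nat \<bar>n\<bar>"]
    proof eventually_elim
      case (elim N)
      then have "n \<in> A N" by (auto simp: A_def)
      then have "fcoeff n f - fcoeff n h = fcoeff n (\<lambda>\<xi>. s N \<xi> - h \<xi>)"
        by (simp add: fcoeff_diff fi ss h(1)) (simp add: s_def fcoeff_fsum fin)
      then show ?case using fcoeff_norm_le[OF square_integrable_diff[OF ss h(1)], of n N] by simp
    qed
    note ev = this
    have "(\<lambda>N. 2 * pi * sq_norm (\<lambda>\<xi>. s N \<xi> - h \<xi>)) \<longlonglongrightarrow> 0"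
      using tendsto_mult_left[OF h(2), of "2 * pi"] by simp
    from tendsto_lowerbound[OF this ev] have "(norm (fcoeff n f - fcoeff n h))\<^sup>2 \<le> 0" by simp
    then show ?thesis by (simp add: fcoeff_diff fi f h(1))
  qed
  then have "AE \<xi> in arc_length. f \<xi> - h \<xi> = 0"
    by (intro fcoeff_zero_imp_AE_zero fi square_integrable_diff f h)
  then have "sq_norm (\<lambda>\<xi>. f \<xi> - s N \<xi>) = sq_norm (\<lambda>\<xi>. s N \<xi> - h \<xi>)" for N
    using f h(1) ss[of N] by (intro integral_cong_AE) (auto simp: square_integrable_def norm_minus_commute)
  then have "(\<lambda>N. sq_norm f - a N) \<longlonglongrightarrow> 0"
    using h(2) sq_norm_diff_fsum(1)[OF f fin] by (simp add: s_def a_def)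
  from tendsto_diff[OF tendsto_const[of "sq_norm f"] this] have lim: "a \<longlonglongrightarrow> sq_norm f" by simp
  define b where "b N n = ennreal ((norm (fcoeff n f))\<^sup>2) * indicator (A N) n" for N n
  have bsup: "(SUP N. b N n) = ennreal ((norm (fcoeff n f))\<^sup>2)" for n
  proof (rule antisym)
    show "(SUP N. b N n) \<le> ennreal ((norm (fcoeff n f))\<^sup>2)"
      by (intro SUP_least) (auto simp: b_def split: split_indicator)
    have "n \<in> A (nat \<bar>n\<bar>)" by (auto simp: A_def)
    then show "ennreal ((norm (fcoeff n f))\<^sup>2) \<le> (SUP N. b N n)"
      by (intro SUP_upper2[of "nat \<bar>n\<bar>"]) (auto simp: b_def)
  qed
  have bint: "(\<integral>\<^sup>+n. b N n \<partial>count_space UNIV) = ennreal (2 * pi * a N)" for N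
    unfolding b_def using fin[of N]
    by (subst nn_integral_count_space_indicator[symmetric])
       (simp_all add: nn_integral_count_space_finite a_def sum_ennreal)
  have "(\<integral>\<^sup>+n. (SUP N. b N n) \<partial>count_space UNIV) = (SUP N. \<integral>\<^sup>+n. b N n \<partial>count_space UNIV)"
  proof (rule nn_integral_monotone_convergence_SUP)
    show "incseq b"
      unfolding incseq_def le_fun_def b_def using mono by (auto split: split_indicator)
  qed simp
  also have "\<dots> = (SUP N. ennreal (2 * pi * a N))" by (simp add: bint)
  also have "\<dots> = ennreal (2 * pi * sq_norm f)"
  proof (rule LIMSEQ_unique)
    show "(\<lambda>N. ennreal (2 * pi * a N)) \<longlonglongrightarrow> (SUP N. ennreal (2 * pi * a N))"
      using \<open>incseq a\<close> by (intro LIMSEQ_SUP) (auto simp: incseq_def intro!: ennreal_leI)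
    show "(\<lambda>N. ennreal (2 * pi * a N)) \<longlonglongrightarrow> ennreal (2 * pi * sq_norm f)"
      using tendsto_mult_left[OF lim, of "2 * pi"] by (intro tendsto_ennrealI) simp
  qed
  finally show ?thesis by (simp add: bsup)
qed

section \<open>The Fourier transform of the weight\<close>

text \<open>A multiple of the error function, normalised to be odd.\<close>

lemma gaussian_antiderivative:
  obtains P :: "real \<Rightarrow> real" where "\<And>x. (P has_real_derivative exp (- x\<^sup>2)) (at x)"
    "(P \<longlongrightarrow> sqrt pi / 2) at_top" "(P \<longlongrightarrow> - sqrt pi / 2) at_bot"
proof -
  obtain Q where Q: "\<And>x. (Q has_vector_derivative exp (- x\<^sup>2)) (at x)"
    using einterval_antiderivative[of "-\<infinity>" \<infinity> "\<lambda>x. exp (- x\<^sup>2)"] by auto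
  define P where "P x = Q x - Q 0" for x
  have d: "(P has_real_derivative exp (- x\<^sup>2)) (at x)" for x
    using Q[of x] unfolding P_def has_real_derivative_iff_has_vector_derivative
    by (auto intro!: derivative_eq_intros)
  note gm = gaussian_moment_0[unfolded has_bochner_integral_iff]
  have g: "(\<integral>x. indicator {0..} x *\<^sub>R exp (- x\<^sup>2) \<partial>lborel) = sqrt pi / 2"
    using gm by (rule conjunct2)
  have "((\<lambda>y. \<integral>x. indicator {..y} x *\<^sub>R (indicator {0..} x *\<^sub>R exp (- x\<^sup>2)) \<partial>lborel) \<longlongrightarrow> sqrt pi / 2) at_top"
    using tendsto_integral_at_top[OF _ conjunct1[OF gm]] unfolding g by simp
  then have lim: "(P \<longlongrightarrow> sqrt pi / 2) at_top"
  proof (rule Lim_transform_eventually)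
    show "\<forall>\<^sub>F y in at_top. (\<integral>x. indicator {..y} x *\<^sub>R (indicator {0..} x *\<^sub>R exp (- x\<^sup>2)) \<partial>lborel) = P y"
      using eventually_ge_at_top[of 0]
    proof eventually_elim
      case (elim y)
      have "(\<integral>x. indicator {..y} x *\<^sub>R (indicator {0..} x *\<^sub>R exp (- x\<^sup>2)) \<partial>lborel) = (\<integral>x. exp (- x\<^sup>2) * indicator {0..y} x \<partial>lborel)"
        by (intro Bochner_Integration.integral_cong) (auto split: split_indicator)
      also have "\<dots> = P y - P 0"
        by (rule integral_FTC_Icc_real) (use elim d in \<open>auto intro!: continuous_intros\<close>)
      finally show ?case by (simp add: P_def)
    qed
  qed
  have odd: "P (- x) = - P x" for x
  proof -
    have "((\<lambda>x. P x + P (- x)) has_real_derivative 0) (at x)" for x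
    proof -
      have "((\<lambda>x. P (- x)) has_real_derivative exp (- (- x)\<^sup>2) * (-1)) (at x)"
        by (rule DERIV_chain2[OF d]) (auto intro!: derivative_eq_intros)
      from DERIV_add[OF d this] show ?thesis by simp
    qed
    then have "P x + P (- x) = P 0 + P (- 0)"
      using DERIV_isconst_all[of "\<lambda>x. P x + P (- x)"] by blast
    then show ?thesis by (simp add: P_def)
  qed
  have "((\<lambda>x. - P x) \<longlongrightarrow> - (sqrt pi / 2)) at_top" by (intro tendsto_minus lim)
  then have "((\<lambda>x. P (- x)) \<longlongrightarrow> - sqrt pi / 2) at_top" by (simp add: odd)
  then have "(P \<longlongrightarrow> - sqrt pi / 2) at_bot" by (simp add: filterlim_at_bot_mirror)
  from that[OF d lim this] show ?thesis .
qed

text \<open>With \<open>P\<close> the antiderivative of \<open>exp(-y\<^sup>2)\<close>, an antiderivative of the integrand is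
  \<open>exp(-s) P(\<surd>t - s/(2\<surd>t)) + exp(s) P(\<surd>t + s/(2\<surd>t))\<close>: both squares differ from
  \<open>t + s\<^sup>2/(4t)\<close> by \<open>\<mp>s\<close>, and the terms with \<open>s/t\<close> in the inner derivatives cancel.\<close>

lemma integral_exp_inverse:
  fixes s :: real
  assumes "s > 0"
  shows "set_integrable lborel {0<..} (\<lambda>t. exp (- t - s\<^sup>2 / (4 * t)) / sqrt t)"
    and "(LINT t:{0<..}|lborel. exp (- t - s\<^sup>2 / (4 * t)) / sqrt t) = sqrt pi * exp (- s)"
proof -
  obtain P :: "real \<Rightarrow> real" where P: "\<And>x. (P has_real_derivative exp (- x\<^sup>2)) (at x)"
    "(P \<longlongrightarrow> sqrt pi / 2) at_top" "(P \<longlongrightarrow> - sqrt pi / 2) at_bot"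
    by (rule gaussian_antiderivative) blast
  define F where "F t = exp (- s) * P (sqrt t - s / (2 * sqrt t)) + exp s * P (sqrt t + s / (2 * sqrt t))" for t
  define f where "f t = exp (- t - s\<^sup>2 / (4 * t)) / sqrt t" for t
  have dF: "(F has_real_derivative f t) (at t)" if "t > 0" for t
  proof -
    have e1: "exp (- s) * exp (- (sqrt t - s / (2 * sqrt t))\<^sup>2) = exp (- t - s\<^sup>2 / (4 * t))"
    proof -
      have "(sqrt t - s / (2 * sqrt t))\<^sup>2 = t - s + s\<^sup>2 / (4 * t)"
        using that by (simp add: power2_diff power_divide power_mult_distrib)
      then show ?thesis by (simp only: mult_exp_exp) (simp add: algebra_simps)
    qed
    have e2: "exp s * exp (- (sqrt t + s / (2 * sqrt t))\<^sup>2) = exp (- t - s\<^sup>2 / (4 * t))"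
    proof -
      have "(sqrt t + s / (2 * sqrt t))\<^sup>2 = t + s + s\<^sup>2 / (4 * t)"
        using that by (simp add: power2_sum power_divide power_mult_distrib)
      then show ?thesis by (simp only: mult_exp_exp) (simp add: algebra_simps)
    qed
    have d1: "((\<lambda>t. sqrt t - s / (2 * sqrt t)) has_real_derivative 1 / (2 * sqrt t) + s / (4 * t * sqrt t)) (at t)"
      using that by (auto intro!: derivative_eq_intros simp: field_simps)
    have d2: "((\<lambda>t. sqrt t + s / (2 * sqrt t)) has_real_derivative 1 / (2 * sqrt t) - s / (4 * t * sqrt t)) (at t)"
      using that by (auto intro!: derivative_eq_intros simp: field_simps)
    have "(F has_real_derivative
        exp (- s) * (exp (- (sqrt t - s / (2 * sqrt t))\<^sup>2) * (1 / (2 * sqrt t) + s / (4 * t * sqrt t)))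
      + exp s * (exp (- (sqrt t + s / (2 * sqrt t))\<^sup>2) * (1 / (2 * sqrt t) - s / (4 * t * sqrt t)))) (at t)"
      unfolding F_def by (intro DERIV_add DERIV_cmult DERIV_chain2[OF P(1)] d1 d2)
    also have "exp (- s) * (exp (- (sqrt t - s / (2 * sqrt t))\<^sup>2) * (1 / (2 * sqrt t) + s / (4 * t * sqrt t)))
      + exp s * (exp (- (sqrt t + s / (2 * sqrt t))\<^sup>2) * (1 / (2 * sqrt t) - s / (4 * t * sqrt t)))
      = exp (- t - s\<^sup>2 / (4 * t)) * (1 / (2 * sqrt t) + s / (4 * t * sqrt t)) + exp (- t - s\<^sup>2 / (4 * t)) * (1 / (2 * sqrt t) - s / (4 * t * sqrt t))"
      unfolding mult.assoc[symmetric] e1 e2 ..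
    also have "\<dots> = f t" using that by (simp add: f_def field_simps)
    finally show ?thesis .
  qed
  have "((\<lambda>t. F t) \<longlongrightarrow> exp (- s) * (- sqrt pi / 2) + exp s * (sqrt pi / 2)) (at_right 0)"
    unfolding F_def
  proof (intro tendsto_add tendsto_mult tendsto_const)
    have "filterlim (\<lambda>t. sqrt t - s / (2 * sqrt t)) at_bot (at_right 0)" using assms by real_asymp
    from filterlim_compose[OF P(3) this]
    show "((\<lambda>t. P (sqrt t - s / (2 * sqrt t))) \<longlongrightarrow> - sqrt pi / 2) (at_right 0)" .
    have "filterlim (\<lambda>t. sqrt t + s / (2 * sqrt t)) at_top (at_right 0)" using assms by real_asymp
    from filterlim_compose[OF P(2) this]
    show "((\<lambda>t. P (sqrt t + s / (2 * sqrt t))) \<longlongrightarrow> sqrt pi / 2) (at_right 0)" .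
  qed
  then have l0: "((F \<circ> real_of_ereal) \<longlongrightarrow> exp (- s) * (- sqrt pi / 2) + exp s * (sqrt pi / 2)) (at_right 0)"
    by (simp add: ereal_tendsto_simps zero_ereal_def)
  have "((\<lambda>t. F t) \<longlongrightarrow> exp (- s) * (sqrt pi / 2) + exp s * (sqrt pi / 2)) at_top"
    unfolding F_def
  proof (intro tendsto_add tendsto_mult tendsto_const)
    have "filterlim (\<lambda>t. sqrt t - s / (2 * sqrt t)) at_top at_top" using assms by real_asymp
    from filterlim_compose[OF P(2) this]
    show "((\<lambda>t. P (sqrt t - s / (2 * sqrt t))) \<longlongrightarrow> sqrt pi / 2) at_top" .
    have "filterlim (\<lambda>t. sqrt t + s / (2 * sqrt t)) at_top at_top" using assms by real_asymp
    from filterlim_compose[OF P(2) this]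
    show "((\<lambda>t. P (sqrt t + s / (2 * sqrt t))) \<longlongrightarrow> sqrt pi / 2) at_top" .
  qed
  then have l1: "((F \<circ> real_of_ereal) \<longlongrightarrow> exp (- s) * (sqrt pi / 2) + exp s * (sqrt pi / 2)) (at_left \<infinity>)"
    by (simp add: ereal_tendsto_simps)
  have cont: "isCont f t" if "t > 0" for t
    unfolding f_def using that by (auto intro!: continuous_intros)
  have ei: "einterval 0 \<infinity> = {0<..}" by (auto simp: einterval_def)
  have A: "set_integrable lborel (einterval 0 \<infinity>) f"
    and B: "(LBINT x=0..\<infinity>. f x) = exp (- s) * (sqrt pi / 2) + exp s * (sqrt pi / 2) - (exp (- s) * (- sqrt pi / 2) + exp s * (sqrt pi / 2))"
    by (rule interval_integral_FTC_nonneg[OF _ dF cont _ l0 l1];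
        auto simp: zero_ereal_def f_def intro!: AE_I2)+
  show "set_integrable lborel {0<..} (\<lambda>t. exp (- t - s\<^sup>2 / (4 * t)) / sqrt t)"
    using A unfolding ei f_def .
  show "(LINT t:{0<..}|lborel. exp (- t - s\<^sup>2 / (4 * t)) / sqrt t) = sqrt pi * exp (- s)"
    using B unfolding interval_lebesgue_integral_def ei f_def by (simp add: algebra_simps)
qed

text \<open>The characteristic function of the standard normal distribution, rescaled.\<close>

lemma gaussian_fourier:
  assumes "t > 0"
  shows "integrable lborel (\<lambda>x. cis (s * x) * exp (- t * x\<^sup>2))"
    and "(\<integral>x. cis (s * x) * exp (- t * x\<^sup>2) \<partial>lborel) = sqrt (pi / t) * exp (- s\<^sup>2 / (4 * t))"
proof -
  define c where "c = 1 / sqrt (2 * t)"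
  have c: "c > 0" "t * c\<^sup>2 = 1 / 2" using assms by (auto simp: c_def power_divide)
  have "integrable lborel (\<lambda>x. std_normal_density x)"
    by (rule integrable_normal_density) simp
  then have i0: "integrable lborel (\<lambda>x. std_normal_density x *\<^sub>R cis (s * c * x))"
    by (rule Bochner_Integration.integrable_bound) (auto simp: normal_density_nonneg cis_conv_exp)
  have e: "cis (s * (0 + c * x)) * exp (- t * (0 + c * x)\<^sup>2) = sqrt (2 * pi) * (std_normal_density x *\<^sub>R cis (s * c * x))" for x
  proof -
    have "t * (c * x)\<^sup>2 = x\<^sup>2 / 2" using c(2) by (simp add: power_mult_distrib mult.assoc[symmetric])
    then show ?thesis by (simp add: normal_density_def scaleR_conv_of_real mult.assoc)
  qed
  have "integrable lborel (\<lambda>x. cis (s * (0 + c * x)) * exp (- t * (0 + c * x)\<^sup>2))"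
    unfolding e by (rule integrable_mult_right[OF i0])
  then show "integrable lborel (\<lambda>x. cis (s * x) * exp (- t * x\<^sup>2))"
    using lborel_integrable_real_affine_iff[of c "\<lambda>x. cis (s * x) * exp (- t * x\<^sup>2)" 0] c by simp
  have "char std_normal_distribution (s * c) = (\<integral>x. std_normal_density x *\<^sub>R cis (s * c * x) \<partial>lborel)"
    unfolding char_def by (subst integral_density) (auto simp: normal_density_nonneg cis_conv_exp)
  then have v: "(\<integral>x. std_normal_density x *\<^sub>R cis (s * c * x) \<partial>lborel) = exp (- (s * c)\<^sup>2 / 2)"
    by (simp add: char_std_normal_distribution)
  have "(\<integral>x. cis (s * x) * exp (- t * x\<^sup>2) \<partial>lborel) = \<bar>c\<bar> *\<^sub>R (\<integral>x. cis (s * (0 + c * x)) * exp (- t * (0 + c * x)\<^sup>2) \<partial>lborel)"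
    using c by (intro lborel_integral_real_affine) simp
  also have "\<dots> = c * (sqrt (2 * pi) * exp (- (s * c)\<^sup>2 / 2))"
    unfolding e using v c by (simp add: scaleR_conv_of_real)
  also have "\<dots> = complex_of_real (c * sqrt (2 * pi)) * exp (- s\<^sup>2 / (4 * t))"
    using assms by (simp add: c_def power_mult_distrib power_divide)
  also have "c * sqrt (2 * pi) = sqrt (pi / t)"
    using assms by (simp add: c_def real_sqrt_divide real_sqrt_mult)
  finally show "(\<integral>x. cis (s * x) * exp (- t * x\<^sup>2) \<partial>lborel) = sqrt (pi / t) * exp (- s\<^sup>2 / (4 * t))"
    by simp
qed

lemma integrable_inverse_square: "integrable lborel (\<lambda>x::real. 1 / (1 + x\<^sup>2))"
proof -
  have "set_integrable lborel (einterval (-\<infinity>) \<infinity>) (\<lambda>x::real. inverse (1 + x\<^sup>2))"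
    using integrable_inverse_1_plus_square .
  then show ?thesis by (simp add: set_integrable_def inverse_eq_divide)
qed

text \<open>Write \<open>1/(1 + x\<^sup>2)\<close> as the integral of \<open>exp(-(1 + x\<^sup>2)t)\<close> over \<open>t > 0\<close>, and exchange the integrals.\<close>

theorem fourier_cauchy_density:
  assumes "s > 0"
  shows "(\<integral>x. cis (s * x) * (1 / (1 + x\<^sup>2)) \<partial>lborel) = pi * exp (- s)"
proof -
  let ?f = "\<lambda>x t. indicator {0<..} t *\<^sub>R (cis (s * x) * exp (- (1 + x\<^sup>2) * t))"
  have ex: "has_bochner_integral lborel (\<lambda>t. indicator {0<..} t *\<^sub>R exp (- (1 + x\<^sup>2) * t)) (1 / (1 + x\<^sup>2))" for x :: real
  proof -
    have p: "1 + x\<^sup>2 > 0" by (smt (verit) zero_le_power2)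
    have "(\<integral>\<^sup>+t. ennreal (exp (- (1 + x\<^sup>2) * t)) * indicator {0..} t \<partial>lborel) = 0 - (- 1 / (1 + x\<^sup>2) * exp (- (1 + x\<^sup>2) * 0))"
    proof (rule nn_integral_FTC_atLeast)
      show "((\<lambda>t. - 1 / (1 + x\<^sup>2) * exp (- (1 + x\<^sup>2) * t)) \<longlongrightarrow> 0) at_top"
        using p by real_asymp
      show "DERIV (\<lambda>t. - 1 / (1 + x\<^sup>2) * exp (- (1 + x\<^sup>2) * t)) t :> exp (- (1 + x\<^sup>2) * t)" for t
        by (rule derivative_eq_intros refl)+ (use p in \<open>simp add: field_simps\<close>)
    qed auto
    also have "(\<integral>\<^sup>+t. ennreal (exp (- (1 + x\<^sup>2) * t)) * indicator {0..} t \<partial>lborel) = (\<integral>\<^sup>+t. ennreal (indicator {0<..} t *\<^sub>R exp (- (1 + x\<^sup>2) * t)) \<partial>lborel)"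
      by (rule nn_integral_cong_AE, use AE_lborel_singleton[of 0] in eventually_elim) (auto split: split_indicator)
    finally show ?thesis
      using p by (intro has_bochner_integral_nn_integral) auto
  qed
  have nf: "norm (?f x t) = indicator {0<..} t *\<^sub>R exp (- (1 + x\<^sup>2) * t)" for x t
    by (simp add: norm_mult split: split_indicator)
  have m: "(\<lambda>(x, t). ?f x t) \<in> borel_measurable (lborel \<Otimes>\<^sub>M lborel)"
    unfolding cis_conv_exp by measurable
  have int: "integrable (lborel \<Otimes>\<^sub>M lborel) (\<lambda>(x, t). ?f x t)"
  proof (rule lborel_pair.Fubini_integrable[OF m])
    have "(\<integral>t. norm (case (x, t) of (x, t) \<Rightarrow> ?f x t) \<partial>lborel) = 1 / (1 + x\<^sup>2)" for x
      unfolding prod.case nf using ex[of x] unfolding has_bochner_integral_iff by (rule conjunct2)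
    then show "integrable lborel (\<lambda>x. \<integral>t. norm (case (x, t) of (x, t) \<Rightarrow> ?f x t) \<partial>lborel)"
      using integrable_inverse_square by simp
    have "integrable lborel (?f x)" for x
    proof (rule Bochner_Integration.integrable_bound)
      show "integrable lborel (\<lambda>t. indicator {0<..} t *\<^sub>R exp (- (1 + x\<^sup>2) * t))" using ex by (simp add: has_bochner_integral_iff)
      show "AE t in lborel. norm (?f x t) \<le> norm (indicator {0<..} t *\<^sub>R exp (- (1 + x\<^sup>2) * t))"
        unfolding nf real_norm_def by (intro AE_I2 abs_ge_self)
    qed (unfold cis_conv_exp, measurable)
    then show "AE x in lborel. integrable lborel (\<lambda>t. case (x, t) of (x, t) \<Rightarrow> ?f x t)" by simp
  qed
  have "(\<integral>t. \<integral>x. ?f x t \<partial>lborel \<partial>lborel) = (\<integral>x. \<integral>t. ?f x t \<partial>lborel \<partial>lborel)"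
    using lborel_pair.Fubini_integral[OF int] .
  moreover have "(\<integral>t. ?f x t \<partial>lborel) = cis (s * x) * (1 / (1 + x\<^sup>2))" for x
  proof -
    have "(\<integral>t. ?f x t \<partial>lborel) = (\<integral>t. cis (s * x) * of_real (indicator {0<..} t *\<^sub>R exp (- (1 + x\<^sup>2) * t)) \<partial>lborel)"
      by (intro Bochner_Integration.integral_cong) (auto split: split_indicator)
    also have "\<dots> = cis (s * x) * of_real (1 / (1 + x\<^sup>2))"
      using ex[of x] by (subst integral_mult_right_zero, subst integral_complex_of_real) (simp add: has_bochner_integral_iff)
    finally show ?thesis by simp
  qed
  moreover have "(\<integral>x. ?f x t \<partial>lborel) = of_real (sqrt pi * (indicator {0<..} t *\<^sub>R (exp (- t - s\<^sup>2 / (4 * t)) / sqrt t)))" for t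
  proof (cases "t > 0")
    case True
    have "(\<integral>x. ?f x t \<partial>lborel) = (\<integral>x. of_real (exp (- t)) * (cis (s * x) * exp (- t * x\<^sup>2)) \<partial>lborel)"
      using True by (intro Bochner_Integration.integral_cong) (auto simp: algebra_simps exp_diff exp_minus divide_simps)
    also have "\<dots> = of_real (exp (- t)) * (sqrt (pi / t) * exp (- s\<^sup>2 / (4 * t)))"
      by (subst integral_mult_right_zero, subst gaussian_fourier(2)[OF True]) simp
    also have "\<dots> = of_real (sqrt pi * (exp (- t - s\<^sup>2 / (4 * t)) / sqrt t))"
    proof -
      have "exp (- t - s\<^sup>2 / (4 * t)) = exp (- t) * exp (- s\<^sup>2 / (4 * t))"
        by (simp add: mult_exp_exp)
      then show ?thesis by (simp only:) (simp add: real_sqrt_divide)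
    qed
    finally show ?thesis using True by simp
  qed simp
  ultimately have "(\<integral>x. cis (s * x) * (1 / (1 + x\<^sup>2)) \<partial>lborel)
    = (\<integral>t. of_real (sqrt pi * (indicator {0<..} t *\<^sub>R (exp (- t - s\<^sup>2 / (4 * t)) / sqrt t))) \<partial>lborel)"
    by simp
  also have "\<dots> = of_real (sqrt pi * (LINT t:{0<..}|lborel. exp (- t - s\<^sup>2 / (4 * t)) / sqrt t))"
    unfolding set_lebesgue_integral_def
    by (subst integral_mult_right_zero[symmetric]) (rule integral_complex_of_real)
  also have "\<dots> = pi * exp (- s)"
    unfolding integral_exp_inverse(2)[OF assms] by (simp add: mult.assoc[symmetric] flip: of_real_mult)
  finally show ?thesis .
qed

text \<open>The antiderivative is \<open>b / (A \<surd>(A + b\<^sup>2))\<close>. For \<open>A = 1 + a\<^sup>2\<close> the integrand is the weight at \<open>(a, b)\<close>.\<close>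

lemma integral_inverse_bracket_slice:
  fixes A :: real
  assumes "A > 0"
  shows "integrable lborel (\<lambda>b. 1 / sqrt (A + b\<^sup>2) ^ 3)" "(\<integral>b. 1 / sqrt (A + b\<^sup>2) ^ 3 \<partial>lborel) = 2 / A"
proof -
  define F where "F b = b / (A * sqrt (A + b\<^sup>2))" for b
  have pos: "A + b\<^sup>2 > 0" for b using assms by (smt (verit) zero_le_power2)
  have d: "(F has_real_derivative 1 / sqrt (A + b\<^sup>2) ^ 3) (at b)" for b
  proof -
    define r where "r = sqrt (A + b\<^sup>2)"
    have r: "r > 0" "r\<^sup>2 = A + b\<^sup>2" using pos[of b] by (auto simp: r_def)
    have "((\<lambda>b. sqrt (A + b\<^sup>2)) has_real_derivative b / r) (at b)"
      unfolding r_def using pos[of b] by (auto intro!: derivative_eq_intros simp: field_simps)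
    from DERIV_divide[OF DERIV_ident DERIV_cmult[OF this, of A]] r assms
    have "(F has_real_derivative (1 * (A * r) - b * (A * (b / r))) / ((A * r) * (A * r))) (at b)"
      unfolding F_def r_def[symmetric] by simp
    also have "(1 * (A * r) - b * (A * (b / r))) / ((A * r) * (A * r)) = (r\<^sup>2 - b\<^sup>2) / (A * r ^ 3)"
      using r(1) assms by (simp add: field_simps power2_eq_square power3_eq_cube)
    also have "\<dots> = 1 / r ^ 3" unfolding r(2) using assms by simp
    finally show ?thesis by (simp add: r_def)
  qed
  have "(F \<longlongrightarrow> - 1 / A) at_bot" "(F \<longlongrightarrow> 1 / A) at_top"
    unfolding F_def using assms by (real_asymp simp: field_simps)+
  then have l: "((F \<circ> real_of_ereal) \<longlongrightarrow> - 1 / A) (at_right (-\<infinity>))" "((F \<circ> real_of_ereal) \<longlongrightarrow> 1 / A) (at_left \<infinity>)"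
    by (simp_all add: ereal_tendsto_simps)
  have c: "isCont (\<lambda>b. 1 / sqrt (A + b\<^sup>2) ^ 3) b" for b
    using pos[of b] by (auto intro!: continuous_intros)
  have "set_integrable lborel (einterval (-\<infinity>) \<infinity>) (\<lambda>b. 1 / sqrt (A + b\<^sup>2) ^ 3)"
    "(LBINT b=-\<infinity>..\<infinity>. 1 / sqrt (A + b\<^sup>2) ^ 3) = 1 / A - (- 1 / A)"
    by (rule interval_integral_FTC_nonneg[OF _ d c _ l]; use pos in \<open>auto intro!: AE_I2 simp: less_imp_le\<close>)+
  then show "integrable lborel (\<lambda>b. 1 / sqrt (A + b\<^sup>2) ^ 3)" "(\<integral>b. 1 / sqrt (A + b\<^sup>2) ^ 3 \<partial>lborel) = 2 / A"
    by (simp_all add: set_integrable_def interval_lebesgue_integral_def set_lebesgue_integral_def)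
qed

lemma Basis_vec2: "(Basis :: (real^2) set) = {axis 1 1, axis 2 1}"
  by (auto simp: Basis_vec_def UNIV_2)

lemma prod_Basis_vec2: "(\<Prod>b\<in>(Basis :: (real^2) set). x \<bullet> b) = x $ 1 * x $ 2"
proof -
  have "axis 1 1 \<noteq> (axis 2 1 :: real^2)" by (simp add: axis_eq_axis)
  then show ?thesis by (simp add: Basis_vec2 inner_axis)
qed

lemma le_Basis_vec2: "(\<forall>b\<in>Basis. l \<bullet> b \<le> u \<bullet> b) \<longleftrightarrow> l $ 1 \<le> u $ 1 \<and> l $ 2 \<le> u $ 2" for l u :: "real^2"
  by (simp add: Basis_vec2 inner_axis)

lemma lborel_vec2: "lborel = distr (lborel \<Otimes>\<^sub>M lborel) borel (\<lambda>(a, b). vector [a, b] :: real^2)"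
proof (rule lborel_eqI)
  have [measurable]: "(\<lambda>(a, b). vector [a, b] :: real^2) \<in> borel_measurable (borel \<Otimes>\<^sub>M borel)"
    unfolding case_prod_beta borel_prod
    by (intro borel_measurable_continuous_onI continuous_intros)
  fix l u :: "real^2" assume "\<And>b. b \<in> Basis \<Longrightarrow> l \<bullet> b \<le> u \<bullet> b"
  then have le: "l $ 1 \<le> u $ 1" "l $ 2 \<le> u $ 2" using le_Basis_vec2[of l u] by auto
  have "emeasure (distr (lborel \<Otimes>\<^sub>M lborel) borel (\<lambda>(a, b). vector [a, b])) (box l u)
      = emeasure (lborel \<Otimes>\<^sub>M lborel) ({l $ 1<..<u $ 1} \<times> {l $ 2<..<u $ 2})"
    by (subst emeasure_distr)
       (auto intro!: arg_cong[where f = "emeasure _"] simp: space_pair_measure mem_box_cart forall_2)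
  also have "\<dots> = ennreal (u $ 1 - l $ 1) * ennreal (u $ 2 - l $ 2)"
    by (subst lborel.emeasure_pair_measure_Times) (use le in auto)
  also have "\<dots> = ennreal ((u - l) $ 1 * (u - l) $ 2)" using le by (simp add: ennreal_mult)
  finally show "emeasure (distr (lborel \<Otimes>\<^sub>M lborel) borel (\<lambda>(a, b). vector [a, b])) (box l u) = (\<Prod>b\<in>Basis. (u - l) \<bullet> b)"
    by (simp only: prod_Basis_vec2)
qed simp

lemma rot_linear: "linear (rot \<eta>)"
  by (rule linearI) (simp_all add: vec2_eq_iff algebra_simps)

lemma rot_conj2_cancel:
  assumes "\<eta> \<in> sphere 0 1"
  shows "rot \<eta> (rot (conj2 \<eta>) x) = x" "rot (conj2 \<eta>) (rot \<eta> x) = x"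
proof -
  have 1: "(\<eta> $ 1)\<^sup>2 + (\<eta> $ 2)\<^sup>2 = 1" using assms by (simp add: norm_vec2)
  have "rot \<eta> (rot (conj2 \<eta>) x) = ((\<eta> $ 1)\<^sup>2 + (\<eta> $ 2)\<^sup>2) *\<^sub>R x"
    "rot (conj2 \<eta>) (rot \<eta> x) = ((\<eta> $ 1)\<^sup>2 + (\<eta> $ 2)\<^sup>2) *\<^sub>R x"
    by (simp_all add: vec2_eq_iff power2_eq_square algebra_simps)
  then show "rot \<eta> (rot (conj2 \<eta>) x) = x" "rot (conj2 \<eta>) (rot \<eta> x) = x" by (simp_all add: 1)
qed

lemma rot_measurable [measurable]: "rot \<eta> \<in> borel_measurable borel"
  by (intro borel_measurable_continuous_onI continuous_intros)

lemma lborel_rot: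
  assumes \<eta>: "\<eta> \<in> sphere 0 1"
  shows "distr lborel borel (rot \<eta>) = lborel"
proof (rule lborel_eqI[symmetric])
  fix l u :: "real^2" assume le: "\<And>b. b \<in> Basis \<Longrightarrow> l \<bullet> b \<le> u \<bullet> b"
  have orth: "orthogonal_transformation (rot (conj2 \<eta>))"
    using \<eta> by (simp add: orthogonal_transformation rot_linear)
  have pre: "rot \<eta> -` box l u = rot (conj2 \<eta>) ` box l u"
  proof safe
    fix x assume "rot \<eta> x \<in> box l u"
    then show "x \<in> rot (conj2 \<eta>) ` box l u"
      by (intro image_eqI[of _ _ "rot \<eta> x"]) (simp_all only: rot_conj2_cancel[OF \<eta>])
  next
    fix x assume "x \<in> box l u"
    then show "rot (conj2 \<eta>) x \<in> rot \<eta> -` box l u"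
      by (simp only: vimage_eq rot_conj2_cancel[OF \<eta>])
  qed
  have lm: "rot (conj2 \<eta>) ` box l u \<in> lmeasurable" "measure lebesgue (rot (conj2 \<eta>) ` box l u) = measure lebesgue (box l u)"
    using measurable_orthogonal_image[OF orth] measure_orthogonal_image[OF orth] by auto
  have "emeasure (distr lborel borel (rot \<eta>)) (box l u) = emeasure lborel (rot \<eta> -` box l u)"
    by (subst emeasure_distr) auto
  also have "\<dots> = emeasure lebesgue (rot \<eta> -` box l u)"
    using measurable_sets[OF rot_measurable, of "box l u" \<eta>] by simp
  also have "\<dots> = ennreal (measure lebesgue (box l u))"
    unfolding pre lm(2)[symmetric] using lm(1) by (rule emeasure_eq_measure2)
  also have "\<dots> = emeasure lborel (box l u)"
    by (subst emeasure_eq_measure2[symmetric]) auto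
  also have "\<dots> = (\<Prod>b\<in>Basis. (u - l) \<bullet> b)" using le by simp
  finally show "emeasure (distr lborel borel (rot \<eta>)) (box l u) = (\<Prod>b\<in>Basis. (u - l) \<bullet> b)" .
qed simp

lemma nn_integral_rot:
  assumes "\<eta> \<in> sphere 0 1" "f \<in> borel_measurable borel"
  shows "(\<integral>\<^sup>+x. f (rot \<eta> x) \<partial>lborel) = (\<integral>\<^sup>+x. f x \<partial>lborel)"
proof -
  have "(\<integral>\<^sup>+x. f x \<partial>lborel) = (\<integral>\<^sup>+x. f x \<partial>distr lborel borel (rot \<eta>))" by (simp only: lborel_rot[OF assms(1)])
  also have "\<dots> = (\<integral>\<^sup>+x. f (rot \<eta> x) \<partial>lborel)" using assms(2) by (intro nn_integral_distr) auto
  finally show ?thesis by simp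
qed

lemma integral_rot:
  fixes f :: "_ \<Rightarrow> complex"
  assumes "\<eta> \<in> sphere 0 1" "f \<in> borel_measurable borel"
  shows "(\<integral>x. f (rot \<eta> x) \<partial>lborel) = (\<integral>x. f x \<partial>lborel)"
proof -
  have "(\<integral>x. f x \<partial>lborel) = (\<integral>x. f x \<partial>distr lborel borel (rot \<eta>))" by (simp only: lborel_rot[OF assms(1)])
  also have "\<dots> = (\<integral>x. f (rot \<eta> x) \<partial>lborel)" using assms(2) by (intro integral_distr) auto
  finally show ?thesis by simp
qed

definition weight :: "real^2 \<Rightarrow> real" where
  "weight x = 1 / bracket x ^ 3"

lemma weight_pos [simp]: "weight x > 0"
  by (simp add: weight_def bracket_def add_pos_nonneg)

lemma weight_nonneg [simp]: "weight x \<ge> 0"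
  using weight_pos[of x] by linarith

lemma weight_rot: "\<eta> \<in> sphere 0 1 \<Longrightarrow> weight (rot \<eta> x) = weight x"
  by (simp add: weight_def bracket_def)

lemma weight_vector: "weight (vector [a, b]) = 1 / sqrt ((1 + a\<^sup>2) + b\<^sup>2) ^ 3"
  by (simp add: weight_def bracket_def norm_vec2 add.assoc)

lemma continuous_weight: "continuous_on UNIV weight"
proof -
  have "1 + (norm x)\<^sup>2 > 0" for x :: "real^2" by (simp add: add_pos_nonneg)
  then have "sqrt (1 + (norm x)\<^sup>2) \<noteq> 0" for x :: "real^2" by (metis less_irrefl real_sqrt_eq_0_iff)
  then show ?thesis unfolding weight_def bracket_def by (intro continuous_intros) auto
qed

lemma weight_measurable [measurable]: "weight \<in> borel_measurable borel"
  by (intro borel_measurable_continuous_onI continuous_weight)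

lemma weight_pair_integrable: "integrable (lborel \<Otimes>\<^sub>M lborel) (\<lambda>(a, b). weight (vector [a, b]))"
proof (rule lborel_pair.Fubini_integrable)
  show "(\<lambda>(a, b). weight (vector [a, b])) \<in> borel_measurable (lborel \<Otimes>\<^sub>M lborel)"
    unfolding weight_vector by measurable
  have p: "1 + a\<^sup>2 > (0::real)" for a by (simp add: add_pos_nonneg)
  have *: "(\<integral>b. norm (case (a, b) of (a, b) \<Rightarrow> weight (vector [a, b])) \<partial>lborel) = 2 * (1 / (1 + a\<^sup>2))" for a
    using integral_inverse_bracket_slice(2)[OF p] by (simp add: weight_vector)
  show "integrable lborel (\<lambda>a. \<integral>b. norm (case (a, b) of (a, b) \<Rightarrow> weight (vector [a, b])) \<partial>lborel)"
  proof -
    have "integrable lborel (\<lambda>a::real. 2 * (1 / (1 + a\<^sup>2)))"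
      by (rule integrable_mult_right) (rule integrable_inverse_square)
    then show ?thesis unfolding * .
  qed
  show "AE a in lborel. integrable lborel (\<lambda>b. case (a, b) of (a, b) \<Rightarrow> weight (vector [a, b]))"
    using integral_inverse_bracket_slice(1)[OF p] by (simp add: weight_vector)
qed

lemma vector_measurable: "(\<lambda>(a, b). vector [a, b] :: real^2) \<in> borel_measurable (lborel \<Otimes>\<^sub>M lborel)"
proof -
  have "(\<lambda>(a, b). vector [a, b] :: real^2) \<in> borel_measurable (borel \<Otimes>\<^sub>M borel)"
    unfolding case_prod_beta borel_prod
    by (intro borel_measurable_continuous_onI continuous_intros)
  then show ?thesis by simp
qed

lemma weight_integrable: "integrable lborel weight"
proof -
  have "integrable (distr (lborel \<Otimes>\<^sub>M lborel) borel (\<lambda>(a, b). vector [a, b])) weight"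
    by (subst integrable_distr_eq[OF vector_measurable]) (use weight_pair_integrable in \<open>auto simp: case_prod_unfold\<close>)
  then show ?thesis by (simp only: lborel_vec2[symmetric])
qed

lemma bounded_weight_integrable:
  fixes f :: "_ \<Rightarrow> 'a::{banach, second_countable_topology}"
  assumes "f \<in> borel_measurable borel" "\<And>x. norm (f x) \<le> B"
  shows "integrable lborel (\<lambda>x. weight x *\<^sub>R f x)"
proof (rule Bochner_Integration.integrable_bound)
  show "integrable lborel (\<lambda>x. B * weight x)" using weight_integrable by simp
  have "norm (weight x *\<^sub>R f x) \<le> norm (B * weight x)" for x
  proof -
    have "norm (f x) * weight x \<le> B * weight x" using assms(2)[of x] by (intro mult_right_mono) auto
    also have "\<dots> \<le> \<bar>B * weight x\<bar>" by simp
    finally show ?thesis by (simp add: mult.commute)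
  qed
  then show "AE x in lborel. norm (weight x *\<^sub>R f x) \<le> norm (B * weight x)" by simp
qed (use assms(1) in measurable)

text \<open>Rotate \<open>z\<close> to the first axis. The integral over the second coordinate then leaves the Fourier
  transform of the Cauchy density at \<open>norm z\<close>.\<close>

theorem fourier_weight_nonzero:
  assumes "z \<noteq> 0"
  shows "(\<integral>x. weight x *\<^sub>R cis (x \<bullet> z) \<partial>lborel) = 2 * pi * exp (- norm z)"
proof -
  define s where "s = norm z"
  have s: "s > 0" using assms by (simp add: s_def)
  define \<zeta> where "\<zeta> = (1 / s) *\<^sub>R z"
  have \<zeta>: "\<zeta> \<in> sphere 0 1" "z = s *\<^sub>R \<zeta>" using s by (auto simp: \<zeta>_def s_def)
  have 1: "(\<zeta> $ 1)\<^sup>2 + (\<zeta> $ 2)\<^sup>2 = 1" using \<zeta>(1) by (simp add: norm_vec2)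
  have r: "rot \<zeta> x \<bullet> z = s * x $ 1" for x
  proof -
    have "rot \<zeta> x \<bullet> z = s * (x $ 1 * ((\<zeta> $ 1)\<^sup>2 + (\<zeta> $ 2)\<^sup>2))"
      by (simp add: inner_vec2 \<zeta>(2) algebra_simps power2_eq_square)
    then show ?thesis by (simp add: 1)
  qed
  have cm: "(\<lambda>x::real^2. cis (f x)) \<in> borel_measurable borel" if "continuous_on UNIV f" for f
    using that by (intro borel_measurable_continuous_onI continuous_intros)
  have m: "(\<lambda>x::real^2. weight x *\<^sub>R cis (x \<bullet> z)) \<in> borel_measurable borel"
    "(\<lambda>x::real^2. weight x *\<^sub>R cis (s * x $ 1)) \<in> borel_measurable borel"
    by (intro borel_measurable_scaleR weight_measurable cm continuous_intros)+
  have ip: "integrable (lborel \<Otimes>\<^sub>M lborel) (\<lambda>(a, b). weight (vector [a, b]) *\<^sub>R cis (s * a))"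
  proof (rule Bochner_Integration.integrable_bound[OF weight_pair_integrable])
    show "(\<lambda>(a, b). weight (vector [a, b]) *\<^sub>R cis (s * a)) \<in> borel_measurable (lborel \<Otimes>\<^sub>M lborel)"
      unfolding weight_vector cis_conv_exp by measurable
  qed auto
  have "(\<integral>x. weight x *\<^sub>R cis (x \<bullet> z) \<partial>lborel) = (\<integral>x. weight (rot \<zeta> x) *\<^sub>R cis (rot \<zeta> x \<bullet> z) \<partial>lborel)"
    by (rule integral_rot[OF \<zeta>(1) m(1), symmetric])
  also have "\<dots> = (\<integral>x. weight x *\<^sub>R cis (s * x $ 1) \<partial>lborel)"
    by (simp only: weight_rot[OF \<zeta>(1)] r)
  also have "\<dots> = (\<integral>p. (case p of (a, b) \<Rightarrow> weight (vector [a, b]) *\<^sub>R cis (s * a)) \<partial>(lborel \<Otimes>\<^sub>M lborel))"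
    by (subst lborel_vec2, subst integral_distr[OF vector_measurable m(2)]) (simp add: case_prod_unfold)
  also have "\<dots> = (\<integral>a. \<integral>b. weight (vector [a, b]) *\<^sub>R cis (s * a) \<partial>lborel \<partial>lborel)"
    by (rule lborel_pair.integral_fst[OF ip, symmetric, simplified])
  also have "\<dots> = (\<integral>a. 2 * (cis (s * a) * (1 / (1 + a\<^sup>2))) \<partial>lborel)"
  proof (rule Bochner_Integration.integral_cong[OF refl])
    fix a :: real
    have p: "1 + a\<^sup>2 > 0" by (simp add: add_pos_nonneg)
    have "(\<integral>b. weight (vector [a, b]) *\<^sub>R cis (s * a) \<partial>lborel) = (\<integral>b. weight (vector [a, b]) \<partial>lborel) *\<^sub>R cis (s * a)"
      by (rule integral_scaleR_left) (use integral_inverse_bracket_slice(1)[OF p] in \<open>simp add: weight_vector\<close>)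
    also have "\<dots> = (2 / (1 + a\<^sup>2)) *\<^sub>R cis (s * a)"
      using integral_inverse_bracket_slice(2)[OF p] by (simp add: weight_vector)
    finally show "(\<integral>b. weight (vector [a, b]) *\<^sub>R cis (s * a) \<partial>lborel) = 2 * (cis (s * a) * (1 / (1 + a\<^sup>2)))"
      by (simp add: scaleR_conv_of_real)
  qed
  also have "\<dots> = 2 * pi * exp (- s)"
    unfolding integral_mult_right_zero fourier_cauchy_density[OF s] by (simp only: mult.assoc of_real_mult of_real_numeral)
  finally show ?thesis by (simp add: s_def)
qed

section \<open>Scalar Herglotz waves\<close>

definition herg :: "real \<Rightarrow> (real^2 \<Rightarrow> complex) \<Rightarrow> real^2 \<Rightarrow> complex" where
  "herg k f x = (\<integral>\<xi>. cis (k * (x \<bullet> \<xi>)) * f \<xi> \<partial>arc_length)"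

lemma cis_inner_measurable [measurable]: "(\<lambda>\<xi>. cis (k * (x \<bullet> \<xi>))) \<in> borel_measurable arc_length"
  by (intro borel_measurable_arc_length_continuous continuous_intros)

lemma herg_integrable:
  assumes "integrable arc_length f"
  shows "integrable arc_length (\<lambda>\<xi>. cis (k * (x \<bullet> \<xi>)) * f \<xi>)"
  by (rule Bochner_Integration.integrable_bound[OF assms]) (use assms in \<open>auto simp: norm_mult\<close>)

lemma herg_add:
  "integrable arc_length f \<Longrightarrow> integrable arc_length g \<Longrightarrow>
    herg k (\<lambda>\<xi>. f \<xi> + g \<xi>) x = herg k f x + herg k g x"
  by (simp add: herg_def distrib_left herg_integrable)

lemma herg_cmult: "herg k (\<lambda>\<xi>. c * f \<xi>) x = c * herg k f x"
  by (simp add: herg_def mult.left_commute)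

lemma herg_norm_le:
  assumes "integrable arc_length f"
  shows "norm (herg k f x) \<le> (\<integral>\<xi>. norm (f \<xi>) \<partial>arc_length)"
proof -
  have "norm (herg k f x) \<le> (\<integral>\<xi>. norm (cis (k * (x \<bullet> \<xi>)) * f \<xi>) \<partial>arc_length)"
    unfolding herg_def by (rule integral_norm_bound)
  then show ?thesis by (simp add: norm_mult)
qed

lemma herg_cong:
  "(\<And>\<xi>. \<xi> \<in> sphere 0 1 \<Longrightarrow> f \<xi> = g \<xi>) \<Longrightarrow> herg k f x = herg k g x"
  unfolding herg_def by (rule Bochner_Integration.integral_cong) auto

lemma integrable_coord_mult:
  fixes f :: "real^2 \<Rightarrow> complex"
  assumes "integrable arc_length f"
  shows "integrable arc_length (\<lambda>\<xi>. of_real (h \<bullet> \<xi>) * f \<xi>)"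
proof (rule Bochner_Integration.integrable_bound)
  show "integrable arc_length (\<lambda>\<xi>. norm h * norm (f \<xi>))" using assms by simp
  have [measurable]: "(\<lambda>\<xi>. of_real (h \<bullet> \<xi>) :: complex) \<in> borel_measurable arc_length"
    by (intro borel_measurable_arc_length_continuous continuous_intros)
  show "(\<lambda>\<xi>. of_real (h \<bullet> \<xi>) * f \<xi>) \<in> borel_measurable arc_length" using assms by measurable
  show "AE \<xi> in arc_length. norm (of_real (h \<bullet> \<xi>) * f \<xi>) \<le> norm (norm h * norm (f \<xi>))"
  proof (intro AE_I2)
    fix \<xi> :: "real^2" assume "\<xi> \<in> space arc_length"
    then have "\<bar>h \<bullet> \<xi>\<bar> \<le> norm h" using Cauchy_Schwarz_ineq2[of h \<xi>] by simp
    then show "norm (of_real (h \<bullet> \<xi>) * f \<xi>) \<le> norm (norm h * norm (f \<xi>))"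
      by (simp add: norm_mult mult_right_mono)
  qed
qed

definition herg_deriv :: "real \<Rightarrow> (real^2 \<Rightarrow> complex) \<Rightarrow> real^2 \<Rightarrow> real^2 \<Rightarrow> complex" where
  "herg_deriv k f x h = herg k (\<lambda>\<xi>. \<i> * of_real k * (of_real (h \<bullet> \<xi>) * f \<xi>)) x"

text \<open>Differentiation under the integral sign, with the remainder \<open>|exp(\<i>b) - 1 - \<i>b| \<le> b\<^sup>2/2\<close>.\<close>

lemma herg_has_derivative:
  assumes f: "integrable arc_length f"
  shows "(herg k f has_derivative herg_deriv k f x) (at x)"
proof -
  let ?I = "\<integral>\<xi>. norm (f \<xi>) \<partial>arc_length"
  have i: "integrable arc_length (\<lambda>\<xi>. \<i> * of_real k * (of_real (h \<bullet> \<xi>) * f \<xi>))" for h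
    using integrable_coord_mult[OF f] by simp
  note j = herg_integrable[OF i]
  have lin: "bounded_linear (herg_deriv k f x)"
  proof (rule linear_conv_bounded_linear[THEN iffD1], rule linearI)
    fix a b :: "real^2"
    show "herg_deriv k f x (a + b) = herg_deriv k f x a + herg_deriv k f x b"
      unfolding herg_deriv_def herg_add[OF i i, symmetric]
      by (intro herg_cong) (simp add: inner_add_left algebra_simps)
  next
    fix r and a :: "real^2"
    show "herg_deriv k f x (r *\<^sub>R a) = r *\<^sub>R herg_deriv k f x a"
    proof -
      have "herg_deriv k f x (r *\<^sub>R a) = herg k (\<lambda>\<xi>. of_real r * (\<i> * of_real k * (of_real (a \<bullet> \<xi>) * f \<xi>))) x"
        unfolding herg_deriv_def by (rule herg_cong) simp
      also have "\<dots> = of_real r * herg_deriv k f x a"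
        unfolding herg_deriv_def by (rule herg_cmult)
      finally show ?thesis by (simp only: scaleR_conv_of_real)
    qed
  qed
  have rem: "norm (cis (a + b) - cis a - \<i> * of_real b * cis a) \<le> b\<^sup>2 / 2" for a b
  proof -
    have "norm (iexp b - (\<Sum>m\<le>1. (\<i> * b) ^ m / fact m)) \<le> \<bar>b\<bar> ^ Suc 1 / fact (Suc 1)"
      by (rule iexp_approx1)
    then have *: "norm (cis b - 1 - \<i> * b) \<le> b\<^sup>2 / 2"
      by (simp add: cis_conv_exp diff_diff_eq power2_eq_square)
    have "cis (a + b) - cis a - \<i> * of_real b * cis a = cis a * (cis b - 1 - \<i> * b)"
      unfolding cis_mult[of a b, symmetric] by (simp add: algebra_simps)
    then show ?thesis using * by (simp add: norm_mult)
  qed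
  have bound: "norm (herg k f y - herg k f x - herg_deriv k f x (y - x)) \<le> k\<^sup>2 * ?I * (norm (y - x))\<^sup>2" for y
  proof -
    have e: "herg k f y - herg k f x - herg_deriv k f x (y - x)
       = (\<integral>\<xi>. cis (k * (y \<bullet> \<xi>)) * f \<xi> - cis (k * (x \<bullet> \<xi>)) * f \<xi>
           - cis (k * (x \<bullet> \<xi>)) * (\<i> * of_real k * (of_real ((y - x) \<bullet> \<xi>) * f \<xi>)) \<partial>arc_length)"
      unfolding herg_deriv_def herg_def
      by (subst Bochner_Integration.integral_diff[OF Bochner_Integration.integrable_diff[OF herg_integrable[OF f] herg_integrable[OF f]] j],
          subst Bochner_Integration.integral_diff[OF herg_integrable[OF f] herg_integrable[OF f]]) (rule refl)
    have "norm (herg k f y - herg k f x - herg_deriv k f x (y - x)) \<le> (\<integral>\<xi>. norm (cis (k * (y \<bullet> \<xi>)) * f \<xi> - cis (k * (x \<bullet> \<xi>)) * f \<xi>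
           - cis (k * (x \<bullet> \<xi>)) * (\<i> * of_real k * (of_real ((y - x) \<bullet> \<xi>) * f \<xi>))) \<partial>arc_length)"
      unfolding e by (rule integral_norm_bound)
    also have "\<dots> \<le> (\<integral>\<xi>. (k\<^sup>2 * (norm (y - x))\<^sup>2) * norm (f \<xi>) \<partial>arc_length)"
    proof (rule integral_mono)
      fix \<xi> :: "real^2" assume "\<xi> \<in> space arc_length"
      then have n: "norm \<xi> = 1" by simp
      define a b where "a = k * (x \<bullet> \<xi>)" and "b = k * ((y - x) \<bullet> \<xi>)"
      have ab: "k * (y \<bullet> \<xi>) = a + b" by (simp add: a_def b_def inner_diff_left right_diff_distrib)
      have "\<bar>(y - x) \<bullet> \<xi>\<bar> \<le> norm (y - x)" using Cauchy_Schwarz_ineq2[of "y - x" \<xi>] n by simp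
      then have "((y - x) \<bullet> \<xi>)\<^sup>2 \<le> (norm (y - x))\<^sup>2" by (subst abs_le_square_iff[symmetric]) simp
      then have "k\<^sup>2 * ((y - x) \<bullet> \<xi>)\<^sup>2 \<le> k\<^sup>2 * (norm (y - x))\<^sup>2" by (intro mult_left_mono) auto
      then have "b\<^sup>2 \<le> k\<^sup>2 * (norm (y - x))\<^sup>2" by (simp only: b_def power_mult_distrib)
      moreover have "0 \<le> b\<^sup>2" by simp
      ultimately have r: "norm (cis (a + b) - cis a - \<i> * of_real b * cis a) \<le> k\<^sup>2 * (norm (y - x))\<^sup>2"
        using rem[of a b] by linarith
      have "cis (k * (y \<bullet> \<xi>)) * f \<xi> - cis (k * (x \<bullet> \<xi>)) * f \<xi>
           - cis (k * (x \<bullet> \<xi>)) * (\<i> * of_real k * (of_real ((y - x) \<bullet> \<xi>) * f \<xi>))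
         = (cis (a + b) - cis a - \<i> * of_real b * cis a) * f \<xi>"
        unfolding ab a_def[symmetric] by (simp only: b_def of_real_mult left_diff_distrib right_diff_distrib mult_ac)
      then have "norm (cis (k * (y \<bullet> \<xi>)) * f \<xi> - cis (k * (x \<bullet> \<xi>)) * f \<xi>
           - cis (k * (x \<bullet> \<xi>)) * (\<i> * of_real k * (of_real ((y - x) \<bullet> \<xi>) * f \<xi>)))
         = norm (cis (a + b) - cis a - \<i> * of_real b * cis a) * norm (f \<xi>)"
        by (simp only: norm_mult)
      then show "norm (cis (k * (y \<bullet> \<xi>)) * f \<xi> - cis (k * (x \<bullet> \<xi>)) * f \<xi>
           - cis (k * (x \<bullet> \<xi>)) * (\<i> * of_real k * (of_real ((y - x) \<bullet> \<xi>) * f \<xi>)))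
         \<le> (k\<^sup>2 * (norm (y - x))\<^sup>2) * norm (f \<xi>)"
        using mult_right_mono[OF r norm_ge_zero[of "f \<xi>"]] by linarith
    next
      show "integrable arc_length (\<lambda>\<xi>. norm (cis (k * (y \<bullet> \<xi>)) * f \<xi> - cis (k * (x \<bullet> \<xi>)) * f \<xi>
           - cis (k * (x \<bullet> \<xi>)) * (\<i> * of_real k * (of_real ((y - x) \<bullet> \<xi>) * f \<xi>))))"
        by (intro integrable_norm Bochner_Integration.integrable_diff herg_integrable[OF f] j)
      show "integrable arc_length (\<lambda>\<xi>. (k\<^sup>2 * (norm (y - x))\<^sup>2) * norm (f \<xi>))"
        by (intro integrable_mult_right integrable_norm f)
    qed
    finally show ?thesis unfolding integral_mult_right_zero by (simp only: mult_ac)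
  qed
  show ?thesis
  proof (rule has_derivativeI_sandwich[of 1 _ _ _ _ "\<lambda>y. k\<^sup>2 * ?I * norm (y - x)"])
    fix y assume "y \<noteq> x"
    then have "norm (y - x) > 0" by simp
    then show "norm (herg k f y - herg k f x - herg_deriv k f x (y - x)) / norm (y - x) \<le> k\<^sup>2 * ?I * norm (y - x)"
      using bound[of y] by (simp add: divide_le_eq power2_eq_square mult.assoc)
  next
    show "((\<lambda>y. k\<^sup>2 * ?I * norm (y - x)) \<longlongrightarrow> 0) (at x)"
      by (rule tendsto_eq_intros refl)+ simp
  qed (use lin in auto)
qed

lemma herg_differentiable: "integrable arc_length f \<Longrightarrow> herg k f differentiable at x"
  by (rule differentiableI[OF herg_has_derivative])

lemma herg_continuous: "integrable arc_length f \<Longrightarrow> continuous_on UNIV (herg k f)"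
  by (intro continuous_at_imp_continuous_on ballI has_derivative_continuous[OF herg_has_derivative])

lemma frechet_herg: "integrable arc_length f \<Longrightarrow> frechet_derivative (herg k f) (at x) h = herg_deriv k f x h"
  by (simp add: frechet_derivative_at[OF herg_has_derivative, symmetric])

lemma partial_herg:
  assumes "integrable arc_length f"
  shows "partial j (herg k f) = herg k (\<lambda>\<xi>. \<i> * of_real k * (of_real (\<xi> $ j) * f \<xi>))"
  by (simp add: fun_eq_iff partial_def frechet_herg[OF assms] herg_deriv_def inner_axis' )

lemma integrable_partial_density:
  "integrable arc_length f \<Longrightarrow> integrable arc_length (\<lambda>\<xi>. \<i> * of_real k * (of_real (\<xi> $ j) * f \<xi>))"
  using integrable_coord_mult[of f "axis j 1"] by (simp add: inner_axis')

lemma Ck_herg: "integrable arc_length f \<Longrightarrow> Ck m (herg k f)"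
proof (induction m arbitrary: f)
  case 0
  then show ?case by (simp add: herg_continuous)
next
  case (Suc m)
  then show ?case by (simp add: herg_differentiable partial_herg integrable_partial_density)
qed

section \<open>Angular derivatives and angular Fourier coefficients\<close>

text \<open>The derivative in the direction of the rotation field, that is \<open>\<partial>/\<partial>\<phi>\<close> in polar coordinates, but
  also meaningful at the origin.\<close>

definition ang_deriv :: "(real^2 \<Rightarrow> 'a::real_normed_vector) \<Rightarrow> real^2 \<Rightarrow> 'a" where
  "ang_deriv v x = frechet_derivative v (at x) (vector [- x $ 2, x $ 1])"

lemma ang_deriv_eq_partials:
  assumes "v differentiable at x"
  shows "ang_deriv v x = x $ 1 *\<^sub>R partial 2 v x - x $ 2 *\<^sub>R partial 1 v x"
proof -
  have d: "linear (frechet_derivative v (at x))"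
    by (rule linear_frechet_derivative[OF assms])
  have "vector [- x $ 2, x $ 1] = x $ 1 *\<^sub>R axis 2 1 - x $ 2 *\<^sub>R (axis 1 1 :: real^2)"
    by (simp add: vec2_eq_iff axis_def)
  then show ?thesis unfolding ang_deriv_def partial_def by (simp only: linear_diff[OF d] linear_scale[OF d])
qed

lemma ang_deriv_continuous:
  assumes "Ck (Suc 0) v"
  shows "continuous_on UNIV (ang_deriv v)"
proof -
  have d: "v differentiable at x" and c: "continuous_on UNIV (partial j v)" for x j
    using assms by auto
  have "ang_deriv v = (\<lambda>x. x $ 1 *\<^sub>R partial 2 v x - x $ 2 *\<^sub>R partial 1 v x)"
    by (intro ext ang_deriv_eq_partials d)
  then show ?thesis by (simp only:) (intro continuous_intros c)
qed

lemma vector_derivative_rot_polar: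
  assumes "\<And>y. v differentiable at y"
  shows "((\<lambda>\<theta>. v (rot (polar 1 \<theta>) x)) has_vector_derivative ang_deriv v (rot (polar 1 \<theta>) x)) (at \<theta> within S)"
proof -
  let ?g = "\<lambda>\<theta>. rot (polar 1 \<theta>) x"
  have eq: "?g = (\<lambda>\<theta>. (cos \<theta> * x $ 1 - sin \<theta> * x $ 2) *\<^sub>R axis 1 1 + (sin \<theta> * x $ 1 + cos \<theta> * x $ 2) *\<^sub>R axis 2 1)"
    by (simp add: fun_eq_iff vec2_eq_iff axis_def)
  have "((\<lambda>\<theta>. cos \<theta> * x $ 1 - sin \<theta> * x $ 2) has_real_derivative - sin \<theta> * x $ 1 - cos \<theta> * x $ 2) (at \<theta> within S)"
    by (auto intro!: derivative_eq_intros)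
  from has_vector_derivative_scaleR[OF this has_vector_derivative_const[of "axis 1 1 :: real^2"]]
  have d1: "((\<lambda>\<theta>. (cos \<theta> * x $ 1 - sin \<theta> * x $ 2) *\<^sub>R axis 1 1 :: real^2) has_vector_derivative
      (- sin \<theta> * x $ 1 - cos \<theta> * x $ 2) *\<^sub>R axis 1 1) (at \<theta> within S)" by simp
  have "((\<lambda>\<theta>. sin \<theta> * x $ 1 + cos \<theta> * x $ 2) has_real_derivative cos \<theta> * x $ 1 + - sin \<theta> * x $ 2) (at \<theta> within S)"
    by (auto intro!: derivative_eq_intros)
  from has_vector_derivative_scaleR[OF this has_vector_derivative_const[of "axis 2 1 :: real^2"]]
  have d2: "((\<lambda>\<theta>. (sin \<theta> * x $ 1 + cos \<theta> * x $ 2) *\<^sub>R axis 2 1 :: real^2) has_vector_derivative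
      (cos \<theta> * x $ 1 + - sin \<theta> * x $ 2) *\<^sub>R axis 2 1) (at \<theta> within S)" by simp
  have "(?g has_vector_derivative
      (- sin \<theta> * x $ 1 - cos \<theta> * x $ 2) *\<^sub>R axis 1 1 + (cos \<theta> * x $ 1 + - sin \<theta> * x $ 2) *\<^sub>R axis 2 1) (at \<theta> within S)"
    unfolding eq by (rule has_vector_derivative_add[OF d1 d2])
  also have "(- sin \<theta> * x $ 1 - cos \<theta> * x $ 2) *\<^sub>R axis 1 1 + (cos \<theta> * x $ 1 + - sin \<theta> * x $ 2) *\<^sub>R (axis 2 1 :: real^2)
      = vector [- ?g \<theta> $ 2, ?g \<theta> $ 1]"
    by (simp add: vec2_eq_iff axis_def)
  finally have g: "(?g has_vector_derivative vector [- ?g \<theta> $ 2, ?g \<theta> $ 1]) (at \<theta> within S)" .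
  have "(v has_derivative frechet_derivative v (at (?g \<theta>))) (at (?g \<theta>) within range ?g)"
    by (rule has_derivative_at_withinI[OF frechet_derivative_works[THEN iffD1, OF assms]])
  from vector_derivative_diff_chain_within[OF g has_derivative_subset[OF this]]
  show ?thesis by (auto simp: ang_deriv_def o_def)
qed

text \<open>The \<open>n\<close>-th Fourier coefficient of \<open>h\<close> along the circle through \<open>x\<close> around the origin.\<close>

definition angular_coeff :: "int \<Rightarrow> (real^2 \<Rightarrow> complex) \<Rightarrow> real^2 \<Rightarrow> complex" where
  "angular_coeff n h x = fcoeff n (\<lambda>\<eta>. h (rot \<eta> x))"

text \<open>Integration by parts on the circle.\<close>

lemma angular_coeff_ang_deriv:
  assumes v: "Ck (Suc 0) v"
  shows "angular_coeff n (ang_deriv v) x = \<i> * of_int n * angular_coeff n v x"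
proof -
  let ?F = "\<lambda>\<theta>. v (rot (polar 1 \<theta>) x)" and ?G = "\<lambda>\<theta>. ang_deriv v (rot (polar 1 \<theta>) x)"
  have d: "\<And>y. v differentiable at y" using v by simp
  then have cv: "continuous_on UNIV v"
    by (simp add: continuous_at_imp_continuous_on differentiable_imp_continuous_within)
  have ca: "continuous_on UNIV (ang_deriv v)" by (rule ang_deriv_continuous[OF v])
  have c1: "continuous_on S (\<lambda>\<eta>. v (rot \<eta> x))" "continuous_on S (\<lambda>\<eta>. ang_deriv v (rot \<eta> x))" for S
    by (intro continuous_on_compose2[OF cv] continuous_on_compose2[OF ca] continuous_intros; simp)+
  define m where "m = real_of_int (- n)"
  have "((\<lambda>\<theta>. cis (m * \<theta>) * ?G \<theta> + \<i> * m * cis (m * \<theta>) * ?F \<theta>) has_integral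
     cis (m * (2 * pi)) * ?F (2 * pi) - cis (m * 0) * ?F 0) {0..2*pi}"
  proof (rule fundamental_theorem_of_calculus)
    fix \<theta> :: real
    from has_vector_derivative_mult[OF has_vector_derivative_cis vector_derivative_rot_polar[OF d]]
    show "((\<lambda>\<theta>. cis (m * \<theta>) * ?F \<theta>) has_vector_derivative cis (m * \<theta>) * ?G \<theta> + \<i> * m * cis (m * \<theta>) * ?F \<theta>)
        (at \<theta> within {0..2*pi})" .
  qed simp
  moreover have "cis (m * (2 * pi)) * ?F (2 * pi) = cis (m * 0) * ?F 0"
    using cis_multiple_2pi[of m] polar_periodic[of 1 0] by (simp add: mult_ac m_def)
  ultimately have "integral {0..2*pi} (\<lambda>\<theta>. cis (m * \<theta>) * ?G \<theta> + \<i> * m * (cis (m * \<theta>) * ?F \<theta>)) = 0"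
    by (auto simp: mult.assoc dest!: integral_unique)
  moreover have "(\<lambda>\<theta>. cis (m * \<theta>) * ?G \<theta>) integrable_on {0..2*pi}" "(\<lambda>\<theta>. \<i> * m * (cis (m * \<theta>) * ?F \<theta>)) integrable_on {0..2*pi}"
    by (intro integrable_continuous_interval continuous_intros continuous_on_compose2[OF cv] continuous_on_compose2[OF ca]; simp)+
  ultimately have "integral {0..2*pi} (\<lambda>\<theta>. cis (m * \<theta>) * ?G \<theta>) + \<i> * m * integral {0..2*pi} (\<lambda>\<theta>. cis (m * \<theta>) * ?F \<theta>) = 0"
    by (simp add: Henstock_Kurzweil_Integration.integral_add)
  then show ?thesis
    unfolding angular_coeff_def fcoeff_def
    by (simp add: integral_arc_length_continuous c1 continuous_intros chr_polar cis_cnj m_def)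
qed

lemma rot_inner: "rot \<eta> x \<bullet> \<xi> = x \<bullet> rot \<xi> (conj2 \<eta>)"
  by (simp add: inner_vec2 algebra_simps)

lemma arc_length_measurable_ident: "(\<lambda>x. x) \<in> measurable arc_length borel"
  by (subst measurable_cong_sets[OF sets_arc_length refl]) (intro measurable_restrict_space1 measurable_ident_sets refl)

interpretation sigma_sigma: pair_sigma_finite arc_length arc_length ..
interpretation lborel_sigma: pair_sigma_finite lborel arc_length ..

lemma measurable_pair_arc_length:
  fixes h :: "(real^2) \<times> (real^2) \<Rightarrow> 'a::topological_space"
  assumes h: "continuous_on UNIV h"
  shows "h \<in> borel_measurable (arc_length \<Otimes>\<^sub>M arc_length)" "h \<in> borel_measurable (lborel \<Otimes>\<^sub>M arc_length)"
proof -
  have b: "h \<in> measurable (borel \<Otimes>\<^sub>M borel) borel"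
    unfolding borel_prod by (rule borel_measurable_continuous_onI[OF h])
  note [measurable] = arc_length_measurable_ident
  have "(\<lambda>p. h (fst p, snd p)) \<in> borel_measurable (arc_length \<Otimes>\<^sub>M arc_length)"
    by (rule measurable_compose[OF _ b]) measurable
  then show "h \<in> borel_measurable (arc_length \<Otimes>\<^sub>M arc_length)" by simp
  have "(\<lambda>p. h (fst p, snd p)) \<in> borel_measurable (lborel \<Otimes>\<^sub>M arc_length)"
    by (rule measurable_compose[OF _ b]) measurable
  then show "h \<in> borel_measurable (lborel \<Otimes>\<^sub>M arc_length)" by simp
qed

text \<open>Since \<open>rot \<eta> x \<bullet> \<xi> = x \<bullet> rot \<xi> (conj2 \<eta>)\<close>, reflecting the circle separates the two
  integrals.\<close>

lemma angular_coeff_herg: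
  assumes f: "integrable arc_length f"
  shows "angular_coeff n (herg k f) x = fcoeff n f * herg k (chr n) x"
proof -
  have [measurable]: "f \<in> borel_measurable arc_length" using f by simp
  have [measurable]: "(\<lambda>p. cis (k * (rot (fst p) x \<bullet> snd p))) \<in> borel_measurable (arc_length \<Otimes>\<^sub>M arc_length)"
    by (intro measurable_pair_arc_length continuous_intros)
  have fi: "integrable (arc_length \<Otimes>\<^sub>M arc_length) (\<lambda>(\<eta>, \<xi>). cnj (chr n \<eta>) * (cis (k * (rot \<eta> x \<bullet> \<xi>)) * f \<xi>))"
  proof (rule sigma_sigma.Fubini_integrable)
    show "(\<lambda>(\<eta>, \<xi>). cnj (chr n \<eta>) * (cis (k * (rot \<eta> x \<bullet> \<xi>)) * f \<xi>)) \<in> borel_measurable (arc_length \<Otimes>\<^sub>M arc_length)"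
      unfolding case_prod_beta by measurable
    have "integrable arc_length (\<lambda>\<eta>. \<integral>\<xi>. norm (case (\<eta>, \<xi>) of (\<eta>, \<xi>) \<Rightarrow> cnj (chr n \<eta>) * (cis (k * (rot \<eta> x \<bullet> \<xi>)) * f \<xi>)) \<partial>arc_length)
      \<longleftrightarrow> integrable arc_length (\<lambda>\<eta>. \<integral>\<xi>. norm (f \<xi>) \<partial>arc_length)"
      by (rule Bochner_Integration.integrable_cong) (auto simp: norm_mult)
    then show "integrable arc_length (\<lambda>\<eta>. \<integral>\<xi>. norm (case (\<eta>, \<xi>) of (\<eta>, \<xi>) \<Rightarrow> cnj (chr n \<eta>) * (cis (k * (rot \<eta> x \<bullet> \<xi>)) * f \<xi>)) \<partial>arc_length)"
      by simp
    show "AE \<eta> in arc_length. integrable arc_length (\<lambda>\<xi>. case (\<eta>, \<xi>) of (\<eta>, \<xi>) \<Rightarrow> cnj (chr n \<eta>) * (cis (k * (rot \<eta> x \<bullet> \<xi>)) * f \<xi>))"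
      using herg_integrable[OF f] by (intro AE_I2) auto
  qed
  have inner: "(\<integral>\<eta>. cnj (chr n \<eta>) * cis (k * (rot \<eta> x \<bullet> \<xi>)) \<partial>arc_length) = cnj (chr n \<xi>) * herg k (chr n) x"
    if \<xi>: "\<xi> \<in> sphere 0 1" for \<xi>
  proof -
    have "herg k (chr n) x = (\<integral>\<eta>. cis (k * (x \<bullet> rot \<xi> (conj2 \<eta>))) * chr n (rot \<xi> (conj2 \<eta>)) \<partial>arc_length)"
      unfolding herg_def
      by (rule integral_arc_length_reflect[symmetric, OF _ \<xi>]) (intro continuous_intros)
    also have "\<dots> = (\<integral>\<eta>. chr n \<xi> * (cnj (chr n \<eta>) * cis (k * (rot \<eta> x \<bullet> \<xi>))) \<partial>arc_length)"
      by (rule Bochner_Integration.integral_cong) (use \<xi> in \<open>auto simp: chr_rot_conj2 rot_inner\<close>)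
    also have "\<dots> = chr n \<xi> * (\<integral>\<eta>. cnj (chr n \<eta>) * cis (k * (rot \<eta> x \<bullet> \<xi>)) \<partial>arc_length)" by simp
    finally show ?thesis
      using \<xi> complex_norm_square[of "chr n \<xi>"] by (simp add: mult.assoc[symmetric] mult.commute[of "cnj _"])
  qed
  have "angular_coeff n (herg k f) x = (\<integral>\<eta>. \<integral>\<xi>. cnj (chr n \<eta>) * (cis (k * (rot \<eta> x \<bullet> \<xi>)) * f \<xi>) \<partial>arc_length \<partial>arc_length)"
    by (simp add: angular_coeff_def fcoeff_def herg_def)
  also have "\<dots> = (\<integral>\<xi>. \<integral>\<eta>. cnj (chr n \<eta>) * (cis (k * (rot \<eta> x \<bullet> \<xi>)) * f \<xi>) \<partial>arc_length \<partial>arc_length)"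
    by (rule sigma_sigma.Fubini_integral[OF fi, symmetric])
  also have "\<dots> = (\<integral>\<xi>. (\<integral>\<eta>. cnj (chr n \<eta>) * cis (k * (rot \<eta> x \<bullet> \<xi>)) \<partial>arc_length) * f \<xi> \<partial>arc_length)"
    by (simp add: mult.assoc[symmetric])
  also have "\<dots> = (\<integral>\<xi>. herg k (chr n) x * (cnj (chr n \<xi>) * f \<xi>) \<partial>arc_length)"
    by (rule Bochner_Integration.integral_cong) (auto simp: inner)
  also have "\<dots> = fcoeff n f * herg k (chr n) x" by (simp add: fcoeff_def)
  finally show ?thesis .
qed

text \<open>Parseval on every circle, integrated over \<open>x\<close>. Averaging over the rotation \<open>\<eta>\<close> costs nothing because
  the weight and Lebesgue measure are rotation invariant; this replaces polar coordinates.\<close>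

theorem weighted_parseval:
  assumes h: "continuous_on UNIV h"
  shows "(\<integral>\<^sup>+n. \<integral>\<^sup>+x. ennreal (weight x * (norm (angular_coeff n h x))\<^sup>2) \<partial>lborel \<partial>count_space UNIV)
      = ennreal (4 * pi\<^sup>2) * (\<integral>\<^sup>+x. ennreal (weight x * (norm (h x))\<^sup>2) \<partial>lborel)"
proof -
  have hb[measurable]: "h \<in> borel_measurable borel" by (rule borel_measurable_continuous_onI[OF h])
  have hr: "(\<lambda>p. h (rot (snd p) (fst p))) \<in> borel_measurable (lborel \<Otimes>\<^sub>M arc_length)"
    by (intro measurable_pair_arc_length continuous_on_compose2[OF h] continuous_intros) auto
  have hx: "square_integrable arc_length (\<lambda>\<eta>. h (rot \<eta> x))" for x
  proof -
    have c: "continuous_on (sphere 0 1) (\<lambda>\<eta>. h (rot \<eta> x))"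
      by (intro continuous_on_compose2[OF h] continuous_intros) auto
    then have "bounded ((\<lambda>\<eta>. h (rot \<eta> x)) ` sphere 0 1)"
      by (intro compact_imp_bounded compact_continuous_image) auto
    then obtain B where "\<forall>y \<in> (\<lambda>\<eta>. h (rot \<eta> x)) ` sphere 0 1. norm y \<le> B" unfolding bounded_iff by blast
    then show ?thesis
      by (intro arc_length.square_integrable_bounded borel_measurable_arc_length_continuous c) auto
  qed
  have pm: "angular_coeff n h \<in> borel_measurable borel" for n
  proof -
    have "(\<lambda>x. \<integral>\<eta>. cnj (chr n \<eta>) * h (rot \<eta> x) \<partial>arc_length) \<in> borel_measurable lborel"
      using hr by (intro arc_length.borel_measurable_lebesgue_integral) (simp add: case_prod_beta)
    then show ?thesis by (simp add: angular_coeff_def[abs_def] fcoeff_def)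
  qed
  have "(\<integral>\<^sup>+n. \<integral>\<^sup>+x. ennreal (weight x * (norm (angular_coeff n h x))\<^sup>2) \<partial>lborel \<partial>count_space UNIV)
      = (\<integral>\<^sup>+x. \<integral>\<^sup>+n. ennreal (weight x * (norm (angular_coeff n h x))\<^sup>2) \<partial>count_space UNIV \<partial>lborel)"
    using pm by (intro nn_integral_count_space_nn_integral[symmetric]) auto
  also have "\<dots> = (\<integral>\<^sup>+x. ennreal (2 * pi) * (\<integral>\<^sup>+\<eta>. ennreal (weight x * (norm (h (rot \<eta> x)))\<^sup>2) \<partial>arc_length) \<partial>lborel)"
  proof (rule nn_integral_cong)
    fix x :: "real^2"
    have "(\<integral>\<^sup>+n. ennreal (weight x * (norm (angular_coeff n h x))\<^sup>2) \<partial>count_space UNIV)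
        = ennreal (weight x) * ennreal (2 * pi * sq_norm (\<lambda>\<eta>. h (rot \<eta> x)))"
      unfolding angular_coeff_def parseval[OF hx, symmetric] by (simp add: ennreal_mult nn_integral_cmult)
    also have "\<dots> = ennreal (2 * pi) * ennreal (\<integral>\<eta>. weight x * (norm (h (rot \<eta> x)))\<^sup>2 \<partial>arc_length)"
      by (simp add: ennreal_mult'[symmetric] mult_ac)
    also have "ennreal (\<integral>\<eta>. weight x * (norm (h (rot \<eta> x)))\<^sup>2 \<partial>arc_length) = (\<integral>\<^sup>+\<eta>. ennreal (weight x * (norm (h (rot \<eta> x)))\<^sup>2) \<partial>arc_length)"
      using hx[of x] by (intro nn_integral_eq_integral[symmetric]) (auto simp: square_integrable_def)
    finally show "(\<integral>\<^sup>+n. ennreal (weight x * (norm (angular_coeff n h x))\<^sup>2) \<partial>count_space UNIV)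
        = ennreal (2 * pi) * (\<integral>\<^sup>+\<eta>. ennreal (weight x * (norm (h (rot \<eta> x)))\<^sup>2) \<partial>arc_length)" .
  qed
  also have "\<dots> = ennreal (2 * pi) * (\<integral>\<^sup>+x. \<integral>\<^sup>+\<eta>. ennreal (weight x * (norm (h (rot \<eta> x)))\<^sup>2) \<partial>arc_length \<partial>lborel)"
    using hr by (intro nn_integral_cmult arc_length.borel_measurable_nn_integral) (simp add: case_prod_beta)
  also have "(\<integral>\<^sup>+x. \<integral>\<^sup>+\<eta>. ennreal (weight x * (norm (h (rot \<eta> x)))\<^sup>2) \<partial>arc_length \<partial>lborel)
      = (\<integral>\<^sup>+\<eta>. \<integral>\<^sup>+x. ennreal (weight x * (norm (h (rot \<eta> x)))\<^sup>2) \<partial>lborel \<partial>arc_length)"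
    using hr by (intro lborel_sigma.Fubini'[symmetric]) (simp add: case_prod_beta)
  also have "\<dots> = (\<integral>\<^sup>+\<eta>. (\<integral>\<^sup>+x. ennreal (weight x * (norm (h x))\<^sup>2) \<partial>lborel) \<partial>arc_length)"
  proof (rule nn_integral_cong)
    fix \<eta> :: "real^2" assume "\<eta> \<in> space arc_length"
    then have \<eta>: "\<eta> \<in> sphere 0 1" by simp
    have "(\<integral>\<^sup>+x. ennreal (weight x * (norm (h (rot \<eta> x)))\<^sup>2) \<partial>lborel) = (\<integral>\<^sup>+x. ennreal (weight (rot \<eta> x) * (norm (h (rot \<eta> x)))\<^sup>2) \<partial>lborel)"
      by (simp only: weight_rot[OF \<eta>])
    also have "\<dots> = (\<integral>\<^sup>+x. ennreal (weight x * (norm (h x))\<^sup>2) \<partial>lborel)"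
      by (rule nn_integral_rot[OF \<eta>]) measurable
    finally show "(\<integral>\<^sup>+x. ennreal (weight x * (norm (h (rot \<eta> x)))\<^sup>2) \<partial>lborel) = (\<integral>\<^sup>+x. ennreal (weight x * (norm (h x))\<^sup>2) \<partial>lborel)" .
  qed
  also have "\<dots> = (\<integral>\<^sup>+x. ennreal (weight x * (norm (h x))\<^sup>2) \<partial>lborel) * ennreal (2 * pi)"
    by (simp add: emeasure_arc_length)
  finally show ?thesis
    by (simp add: ennreal_mult[symmetric] mult_ac power2_eq_square) (simp add: ennreal_mult mult_ac)
qed

lemma partial_add:
  assumes "f differentiable at x" "g differentiable at x"
  shows "partial j (\<lambda>x. f x + g x) x = partial j f x + partial j g x"
proof -
  have "((\<lambda>x. f x + g x) has_derivative (\<lambda>h. frechet_derivative f (at x) h + frechet_derivative g (at x) h)) (at x)"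
    by (intro has_derivative_add frechet_derivative_works[THEN iffD1] assms)
  from frechet_derivative_at[OF this] show ?thesis by (simp add: partial_def fun_eq_iff)
qed

lemma Ck_add: "Ck m f \<Longrightarrow> Ck m g \<Longrightarrow> Ck m (\<lambda>x. f x + g x)"
proof (induction m arbitrary: f g)
  case 0
  then show ?case by (auto intro: continuous_on_add)
next
  case (Suc m)
  have d: "f differentiable at x" "g differentiable at x" for x using Suc.prems by auto
  have "partial j (\<lambda>x. f x + g x) = (\<lambda>x. partial j f x + partial j g x)" for j
    by (intro ext partial_add d)
  then show ?case using Suc d by (auto intro: differentiable_add)
qed

section \<open>Injectivity of the Herglotz representation\<close>

lemma herg_pair_zero_partial:
  assumes f: "integrable arc_length f1" "integrable arc_length f2"
    and z: "\<And>x. herg k1 f1 x + herg k2 f2 x = 0"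
  shows "herg k1 (\<lambda>\<xi>. of_real k1 * of_real (\<xi> $ j) * f1 \<xi>) x + herg k2 (\<lambda>\<xi>. of_real k2 * of_real (\<xi> $ j) * f2 \<xi>) x = 0"
proof -
  have "partial j (\<lambda>x. herg k1 f1 x + herg k2 f2 x) x = partial j (herg k1 f1) x + partial j (herg k2 f2) x"
    by (intro partial_add herg_differentiable f)
  moreover have "(\<lambda>x. herg k1 f1 x + herg k2 f2 x) = (\<lambda>x. 0)" using z by auto
  ultimately have "partial j (herg k1 f1) x + partial j (herg k2 f2) x = 0"
    by (simp add: partial_def)
  then have "\<i> * (herg k1 (\<lambda>\<xi>. of_real k1 * of_real (\<xi> $ j) * f1 \<xi>) x + herg k2 (\<lambda>\<xi>. of_real k2 * of_real (\<xi> $ j) * f2 \<xi>) x) = 0"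
    by (simp add: partial_herg f herg_cmult[symmetric] distrib_left mult.assoc)
  then show ?thesis by simp
qed

lemma integrable_wavenumber_nth_mult:
  "integrable arc_length f \<Longrightarrow> integrable arc_length (\<lambda>\<xi>. of_real k * of_real (\<xi> $ j) * f \<xi> :: complex)"
  using integrable_coord_mult[of f "axis j 1"] by (simp add: inner_axis' mult.assoc)

text \<open>The Laplacian multiplies the two waves by different factors \<open>-k\<^sub>1\<^sup>2 \<noteq> -k\<^sub>2\<^sup>2\<close>.\<close>

lemma herg_pair_zero_separate:
  assumes f: "integrable arc_length f1" "integrable arc_length f2"
    and z: "\<And>x. herg k1 f1 x + herg k2 f2 x = 0" and k: "k1 > 0" "k2 > 0" "k1 \<noteq> k2"
  shows "herg k1 f1 x = 0" "herg k2 f2 x = 0"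
proof -
  have 2: "herg k1 (\<lambda>\<xi>. of_real k1 * of_real (\<xi> $ j) * (of_real k1 * of_real (\<xi> $ j) * f1 \<xi>)) x
         + herg k2 (\<lambda>\<xi>. of_real k2 * of_real (\<xi> $ j) * (of_real k2 * of_real (\<xi> $ j) * f2 \<xi>)) x = 0" for j
    by (intro herg_pair_zero_partial integrable_wavenumber_nth_mult f z)
  have L: "herg k (\<lambda>\<xi>. of_real k * of_real (\<xi> $ 1) * (of_real k * of_real (\<xi> $ 1) * f \<xi>)) x
        + herg k (\<lambda>\<xi>. of_real k * of_real (\<xi> $ 2) * (of_real k * of_real (\<xi> $ 2) * f \<xi>)) x = of_real (k\<^sup>2) * herg k f x"
    if f: "integrable arc_length f" for k f
  proof -
    have "herg k (\<lambda>\<xi>. of_real k * of_real (\<xi> $ 1) * (of_real k * of_real (\<xi> $ 1) * f \<xi>)) x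
        + herg k (\<lambda>\<xi>. of_real k * of_real (\<xi> $ 2) * (of_real k * of_real (\<xi> $ 2) * f \<xi>)) x
        = herg k (\<lambda>\<xi>. of_real k * of_real (\<xi> $ 1) * (of_real k * of_real (\<xi> $ 1) * f \<xi>)
           + of_real k * of_real (\<xi> $ 2) * (of_real k * of_real (\<xi> $ 2) * f \<xi>)) x"
      by (intro herg_add[symmetric] integrable_wavenumber_nth_mult f)
    also have "\<dots> = herg k (\<lambda>\<xi>. of_real (k\<^sup>2) * f \<xi>) x"
    proof (rule herg_cong)
      fix \<xi> :: "real^2" assume "\<xi> \<in> sphere 0 1"
      then have s: "(\<xi> $ 1)\<^sup>2 + (\<xi> $ 2)\<^sup>2 = 1" by (simp add: norm_vec2)
      have "of_real k * of_real (\<xi> $ 1) * (of_real k * of_real (\<xi> $ 1) * f \<xi>) + of_real k * of_real (\<xi> $ 2) * (of_real k * of_real (\<xi> $ 2) * f \<xi>)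
         = of_real (k\<^sup>2 * ((\<xi> $ 1)\<^sup>2 + (\<xi> $ 2)\<^sup>2)) * f \<xi>"
        by (simp add: algebra_simps power2_eq_square)
      then show "of_real k * of_real (\<xi> $ 1) * (of_real k * of_real (\<xi> $ 1) * f \<xi>) + of_real k * of_real (\<xi> $ 2) * (of_real k * of_real (\<xi> $ 2) * f \<xi>)
         = of_real (k\<^sup>2) * f \<xi>" by (simp add: s)
    qed
    finally show ?thesis by (simp only: herg_cmult)
  qed
  have "of_real (k1\<^sup>2) * herg k1 f1 x + of_real (k2\<^sup>2) * herg k2 f2 x = 0"
    using 2[of 1] 2[of 2] unfolding L[OF f(1), symmetric] L[OF f(2), symmetric] by (simp add: algebra_simps add_eq_0_iff)
  moreover have e: "herg k2 f2 x = - herg k1 f1 x" using z[of x] by (simp add: add_eq_0_iff)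
  ultimately have "of_real (k1\<^sup>2 - k2\<^sup>2) * herg k1 f1 x = 0" by (simp add: algebra_simps)
  moreover have "k1\<^sup>2 \<noteq> k2\<^sup>2" using k by (simp add: power2_eq_iff)
  ultimately show "herg k1 f1 x = 0" by (simp del: of_real_diff)
  then show "herg k2 f2 x = 0" using e by simp
qed

text \<open>If the wave of \<open>f\<close> vanishes then so does the wave of \<open>\<xi>\<^sub>1 \<plusminus> \<i>\<xi>\<^sub>2\<close> times \<open>f\<close>, by
  differentiation. By induction the wave of \<open>chr m\<close> times \<open>f\<close> vanishes for every \<open>m\<close>; evaluate it at the origin.\<close>

lemma herg_zero_imp_fcoeff_zero:
  assumes f: "integrable arc_length f" and z: "\<And>x. herg k f x = 0" and k: "k > 0"
  shows "fcoeff n f = 0"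
proof -
  have step: "\<forall>x. herg k (\<lambda>\<xi>. chr s \<xi> * g \<xi>) x = 0" if g: "integrable arc_length g" "\<forall>x. herg k g x = 0" and s: "s = 1 \<or> s = -1" for g s
  proof
    fix x
    have c: "herg k (\<lambda>\<xi>. of_real (\<xi> $ j) * g \<xi>) x = 0" for j
    proof -
      have i0: "integrable arc_length (\<lambda>\<xi>. 0 :: complex)" by simp
      have "herg k (\<lambda>\<xi>. of_real k * of_real (\<xi> $ j) * g \<xi>) x + herg k (\<lambda>\<xi>. of_real k * of_real (\<xi> $ j) * 0) x = 0"
        using herg_pair_zero_partial[OF g(1) i0, of k k j x] g(2) by (simp add: herg_def[of _ "\<lambda>_. 0"])
      then have "of_real k * herg k (\<lambda>\<xi>. of_real (\<xi> $ j) * g \<xi>) x = 0"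
        by (simp add: herg_cmult[symmetric] mult.assoc) (simp add: herg_def[of _ "\<lambda>_. 0"])
      then show ?thesis using k by simp
    qed
    have i: "integrable arc_length (\<lambda>\<xi>. of_real (\<xi> $ j) * g \<xi>)" for j
      using integrable_coord_mult[OF g(1), of "axis j 1"] by (simp add: inner_axis')
    have e: "chr s \<xi> * g \<xi> = of_real (\<xi> $ 1) * g \<xi> + (of_int s * \<i>) * (of_real (\<xi> $ 2) * g \<xi>)" if "\<xi> \<in> sphere 0 1" for \<xi>
    proof -
      have 1: "chr 1 \<xi> = of_real (\<xi> $ 1) + \<i> * of_real (\<xi> $ 2)" by (simp add: chr_def Complex_eq)
      have "chr (-1) \<xi> = cnj (chr 1 \<xi>)" using cnj_chr[OF that, of 1] by simp
      then have m1: "chr (-1) \<xi> = of_real (\<xi> $ 1) - \<i> * of_real (\<xi> $ 2)" unfolding 1 by simp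
      from s show ?thesis
        by (elim disjE) (simp_all only: 1 m1, simp_all add: algebra_simps)
    qed
    have "herg k (\<lambda>\<xi>. chr s \<xi> * g \<xi>) x = herg k (\<lambda>\<xi>. of_real (\<xi> $ 1) * g \<xi> + (of_int s * \<i>) * (of_real (\<xi> $ 2) * g \<xi>)) x"
      by (rule herg_cong) (rule e)
    also have "\<dots> = 0"
      by (subst herg_add[OF i integrable_mult_right[OF i]], subst herg_cmult) (simp add: c)
    finally show "herg k (\<lambda>\<xi>. chr s \<xi> * g \<xi>) x = 0" .
  qed
  have up: "\<forall>x. herg k (\<lambda>\<xi>. chr (m + s) \<xi> * f \<xi>) x = 0" if "\<forall>x. herg k (\<lambda>\<xi>. chr m \<xi> * f \<xi>) x = 0" "s = 1 \<or> s = -1" for m s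
  proof
    fix x
    have "herg k (\<lambda>\<xi>. chr (m + s) \<xi> * f \<xi>) x = herg k (\<lambda>\<xi>. chr s \<xi> * (chr m \<xi> * f \<xi>)) x"
      by (rule herg_cong) (simp add: chr_add)
    also have "\<dots> = 0"
      using step[OF integrable_chr_mult(2)[OF f] that] by blast
    finally show "herg k (\<lambda>\<xi>. chr (m + s) \<xi> * f \<xi>) x = 0" .
  qed
  have all: "\<forall>x. herg k (\<lambda>\<xi>. chr m \<xi> * f \<xi>) x = 0" for m
  proof (induction m rule: int_induct[where k = 0])
    case base then show ?case using z by simp
  next
    case (step1 i) then show ?case using up[of i 1] by blast
  next
    case (step2 i) then show ?case using up[of i "-1"] by simp
  qed
  have "fcoeff n f = herg k (\<lambda>\<xi>. chr (- n) \<xi> * f \<xi>) 0"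
    unfolding fcoeff_def herg_def by (rule Bochner_Integration.integral_cong) (auto simp: cnj_chr)
  then show ?thesis using all by simp
qed

section \<open>Gram matrices of the angular modes\<close>

abbreviation mode :: "real \<Rightarrow> int \<Rightarrow> real^2 \<Rightarrow> complex" where
  "mode k n \<equiv> herg k (chr n)"

lemma integrable_chr: "integrable arc_length (chr n)"
  by (rule arc_length.square_integrable_integrable[OF chr_square_integrable])

lemma mode_bounded: "norm (mode k n x) \<le> 2 * pi"
proof -
  have "norm (mode k n x) \<le> (\<integral>\<xi>. norm (chr n \<xi>) \<partial>arc_length)" by (rule herg_norm_le[OF integrable_chr])
  also have "\<dots> = (\<integral>\<xi>. 1 \<partial>arc_length)" by (rule Bochner_Integration.integral_cong) auto
  finally show ?thesis by simp
qed

lemma mode_continuous: "continuous_on UNIV (mode k n)"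
  by (rule herg_continuous[OF integrable_chr])

lemma mode_measurable [measurable]: "mode k n \<in> borel_measurable borel"
  by (rule borel_measurable_continuous_onI[OF mode_continuous])

text \<open>The point \<open>z = 0\<close> is reached by continuity of both sides.\<close>

lemma fourier_weight:
  "(\<integral>x. weight x *\<^sub>R cis (x \<bullet> z) \<partial>lborel) = 2 * pi * exp (- norm z)"
proof (cases "z = 0")
  case True
  define w where "w m = (1 / real (Suc m)) *\<^sub>R (axis 1 1 :: real^2)" for m
  have w: "w \<longlonglongrightarrow> 0 *\<^sub>R axis 1 1"
    unfolding w_def by (intro tendsto_scaleR tendsto_const LIMSEQ_Suc[OF lim_1_over_n])
  have ic: "isCont cis t" for t
    by (rule continuous_on_eq_continuous_at[OF open_UNIV, THEN iffD1, rule_format, OF continuous_on_cis[OF continuous_on_id] UNIV_I])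
  have wn: "w m \<noteq> 0" for m by (simp add: w_def axis_eq_0_iff)
  have cm: "(\<lambda>x. cis (x \<bullet> y)) \<in> borel_measurable borel" for y :: "real^2"
    by (intro borel_measurable_continuous_onI continuous_intros)
  have "(\<lambda>m. \<integral>x. weight x *\<^sub>R cis (x \<bullet> w m) \<partial>lborel) \<longlonglongrightarrow> (\<integral>x. weight x *\<^sub>R cis (x \<bullet> z) \<partial>lborel)"
  proof (rule integral_dominated_convergence[where w = weight])
    show "AE x in lborel. (\<lambda>m. weight x *\<^sub>R cis (x \<bullet> w m)) \<longlonglongrightarrow> weight x *\<^sub>R cis (x \<bullet> z)"
      unfolding True using w
      by (intro AE_I2 tendsto_scaleR tendsto_const isCont_tendsto_compose[OF ic] tendsto_inner) simp
  qed (use cm weight_integrable in auto)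
  moreover have "(\<lambda>m. complex_of_real (2 * pi * exp (- norm (w m)))) \<longlonglongrightarrow> complex_of_real (2 * pi * exp (- norm (0 *\<^sub>R axis 1 1 :: real^2)))"
    by (intro tendsto_intros w)
  moreover have "(\<lambda>m. \<integral>x. weight x *\<^sub>R cis (x \<bullet> w m) \<partial>lborel) = (\<lambda>m. complex_of_real (2 * pi * exp (- norm (w m))))"
    by (simp only: fourier_weight_nonzero[OF wn])
  ultimately have "(\<integral>x. weight x *\<^sub>R cis (x \<bullet> z) \<partial>lborel) = complex_of_real (2 * pi * exp (- norm (0 *\<^sub>R axis 1 1 :: real^2)))"
    by (intro LIMSEQ_unique[of "\<lambda>m. \<integral>x. weight x *\<^sub>R cis (x \<bullet> w m) \<partial>lborel"]) simp_all
  then show ?thesis using True by simp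
qed (rule fourier_weight_nonzero)

text \<open>Up to the factor \<open>2\<pi>\<close>, the Fourier transform of the weight at \<open>k\<eta> - l e\<^sub>1\<close>.\<close>

definition kern :: "real \<Rightarrow> real \<Rightarrow> real^2 \<Rightarrow> complex" where
  "kern k l \<eta> = of_real (exp (- norm (k *\<^sub>R \<eta> - l *\<^sub>R axis 1 1)))"

lemma continuous_kern: "continuous_on S (kern k l)"
  unfolding kern_def by (intro continuous_intros)

definition gram :: "int \<Rightarrow> real \<Rightarrow> real \<Rightarrow> complex" where
  "gram n k l = (\<integral>x. weight x *\<^sub>R (mode k n x * cnj (mode l n x)) \<partial>lborel)"

lemma gram_integrable: "integrable lborel (\<lambda>x. weight x *\<^sub>R (mode k n x * cnj (mode l n x)))"
proof (rule bounded_weight_integrable)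
  show "norm (mode k n x * cnj (mode l n x)) \<le> (2 * pi) * (2 * pi)" for x
    unfolding norm_mult complex_mod_cnj by (intro mult_mono mode_bounded) auto
qed measurable

text \<open>Substitute \<open>\<xi> = \<zeta>\<eta>\<^sup>-\<^sup>1\<close>: the distance \<open>|k\<xi> - l\<zeta>|\<close> becomes \<open>|k\<eta> - l e\<^sub>1|\<close>, and the characters combine to
  \<open>\<eta>\<^sup>-\<^sup>n\<close>.\<close>

lemma gram_inner:
  assumes \<zeta>: "\<zeta> \<in> sphere 0 1"
  shows "(\<integral>\<xi>. chr n \<xi> * cnj (chr n \<zeta>) * of_real (exp (- norm (k *\<^sub>R \<xi> - l *\<^sub>R \<zeta>))) \<partial>arc_length) = fcoeff n (kern k l)"
proof -
  have "(\<integral>\<xi>. chr n \<xi> * cnj (chr n \<zeta>) * of_real (exp (- norm (k *\<^sub>R \<xi> - l *\<^sub>R \<zeta>))) \<partial>arc_length)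
      = (\<integral>\<eta>. chr n (rot \<zeta> (conj2 \<eta>)) * cnj (chr n \<zeta>) * of_real (exp (- norm (k *\<^sub>R rot \<zeta> (conj2 \<eta>) - l *\<^sub>R \<zeta>))) \<partial>arc_length)"
    by (rule integral_arc_length_reflect[OF _ \<zeta>, symmetric]) (intro continuous_intros)
  also have "\<dots> = fcoeff n (kern k l)"
    unfolding fcoeff_def
  proof (rule Bochner_Integration.integral_cong[OF refl])
    fix \<eta> assume "\<eta> \<in> space arc_length"
    then have \<eta>: "\<eta> \<in> sphere 0 1" by simp
    have "k *\<^sub>R rot \<zeta> (conj2 \<eta>) - l *\<^sub>R \<zeta> = rot \<zeta> (conj2 (k *\<^sub>R \<eta> - l *\<^sub>R axis 1 1))"
      by (simp add: vec2_eq_iff axis_def algebra_simps)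
    then have "norm (k *\<^sub>R rot \<zeta> (conj2 \<eta>) - l *\<^sub>R \<zeta>) = norm (k *\<^sub>R \<eta> - l *\<^sub>R axis 1 1)"
      using \<zeta> by simp
    moreover have "chr n (rot \<zeta> (conj2 \<eta>)) * cnj (chr n \<zeta>) = cnj (chr n \<eta>)"
      using complex_norm_square[of "chr n \<zeta>"] \<zeta> by (simp add: chr_rot_conj2[OF \<zeta> \<eta>] mult_ac)
    ultimately show "chr n (rot \<zeta> (conj2 \<eta>)) * cnj (chr n \<zeta>) * of_real (exp (- norm (k *\<^sub>R rot \<zeta> (conj2 \<eta>) - l *\<^sub>R \<zeta>)))
       = cnj (chr n \<eta>) * kern k l \<eta>"
      by (simp add: kern_def)
  qed
  finally show ?thesis .
qed

text \<open>Exchanging integrals, the integral over \<open>x\<close> becomes \<open>2\<pi> exp(-|k\<xi> - l\<zeta>|)\<close>. It depends only on the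
  angle between \<open>\<xi>\<close> and \<open>\<zeta>\<close>, so the double integral over the circle collapses to a Fourier coefficient.\<close>

theorem gram_eq_fcoeff: "gram n k l = 4 * pi\<^sup>2 * fcoeff n (kern k l)"
proof -
  define F where "F x p = weight x *\<^sub>R (cis (x \<bullet> (k *\<^sub>R fst p - l *\<^sub>R snd p)) * (chr n (fst p) * cnj (chr n (snd p))))" for x and p :: "(real^2) \<times> (real^2)"
  interpret P: finite_measure "arc_length \<Otimes>\<^sub>M arc_length"
    by (rule finite_measure_pair_measure; unfold_locales)
  interpret LP: pair_sigma_finite lborel "arc_length \<Otimes>\<^sub>M arc_length" ..
  have cm: "(\<lambda>q. cis (fst q \<bullet> (k *\<^sub>R fst (snd q) - l *\<^sub>R snd (snd q)))) \<in> borel_measurable (lborel \<Otimes>\<^sub>M (arc_length \<Otimes>\<^sub>M arc_length))"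
  proof -
    have b: "(\<lambda>q :: (real^2) \<times> (real^2) \<times> (real^2). cis (fst q \<bullet> (k *\<^sub>R fst (snd q) - l *\<^sub>R snd (snd q)))) \<in> measurable (borel \<Otimes>\<^sub>M (borel \<Otimes>\<^sub>M borel)) borel"
      unfolding borel_prod by (intro borel_measurable_continuous_onI continuous_intros)
    note [measurable] = arc_length_measurable_ident
    have "(\<lambda>q. (fst q, fst (snd q), snd (snd q))) \<in> measurable (lborel \<Otimes>\<^sub>M (arc_length \<Otimes>\<^sub>M arc_length)) (borel \<Otimes>\<^sub>M (borel \<Otimes>\<^sub>M borel))"
      by measurable
    from measurable_compose[OF this b] show ?thesis by simp
  qed
  have Fm: "(\<lambda>q. F (fst q) (snd q)) \<in> borel_measurable (lborel \<Otimes>\<^sub>M (arc_length \<Otimes>\<^sub>M arc_length))"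
    unfolding F_def using cm by measurable
  have Fi: "integrable (lborel \<Otimes>\<^sub>M (arc_length \<Otimes>\<^sub>M arc_length)) (\<lambda>(x, p). F x p)"
  proof (rule LP.Fubini_integrable)
    show "(\<lambda>(x, p). F x p) \<in> borel_measurable (lborel \<Otimes>\<^sub>M (arc_length \<Otimes>\<^sub>M arc_length))"
      using Fm by (simp add: case_prod_unfold)
    have N: "norm (F x p) = weight x" if "p \<in> space (arc_length \<Otimes>\<^sub>M arc_length)" for x p
      using that by (auto simp: F_def norm_mult space_pair_measure)
    have "(\<integral>p. norm (case (x, p) of (x, p) \<Rightarrow> F x p) \<partial>(arc_length \<Otimes>\<^sub>M arc_length)) = measure (arc_length \<Otimes>\<^sub>M arc_length) (space (arc_length \<Otimes>\<^sub>M arc_length)) * weight x" for x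
    proof -
      have "(\<integral>p. norm (F x p) \<partial>(arc_length \<Otimes>\<^sub>M arc_length)) = (\<integral>p. weight x \<partial>(arc_length \<Otimes>\<^sub>M arc_length))"
        by (rule Bochner_Integration.integral_cong[OF refl N])
      then show ?thesis by simp
    qed
    then show "integrable lborel (\<lambda>x. \<integral>p. norm (case (x, p) of (x, p) \<Rightarrow> F x p) \<partial>(arc_length \<Otimes>\<^sub>M arc_length))"
      using weight_integrable by simp
    have "integrable (arc_length \<Otimes>\<^sub>M arc_length) (F x)" for x
    proof (rule P.integrable_const_bound)
      show "AE p in arc_length \<Otimes>\<^sub>M arc_length. norm (F x p) \<le> weight x" by (intro AE_I2) (simp add: N)
      show "F x \<in> borel_measurable (arc_length \<Otimes>\<^sub>M arc_length)"
        using measurable_compose[OF measurable_Pair1' Fm, of x] by simp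
    qed
    then show "AE x in lborel. integrable (arc_length \<Otimes>\<^sub>M arc_length) (\<lambda>p. case (x, p) of (x, p) \<Rightarrow> F x p)" by simp
  qed
  have prod: "(\<integral>p. F x p \<partial>(arc_length \<Otimes>\<^sub>M arc_length)) = weight x *\<^sub>R (mode k n x * cnj (mode l n x))" for x
  proof -
    have i: "integrable (arc_length \<Otimes>\<^sub>M arc_length) (\<lambda>(\<xi>, \<zeta>). (cis (k * (x \<bullet> \<xi>)) * chr n \<xi>) * cnj (cis (l * (x \<bullet> \<zeta>)) * chr n \<zeta>))"
    proof (rule P.integrable_const_bound[where B = 1])
      show "(\<lambda>(\<xi>, \<zeta>). (cis (k * (x \<bullet> \<xi>)) * chr n \<xi>) * cnj (cis (l * (x \<bullet> \<zeta>)) * chr n \<zeta>)) \<in> borel_measurable (arc_length \<Otimes>\<^sub>M arc_length)"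
        unfolding case_prod_beta by measurable
    qed (auto intro!: AE_I2 simp: norm_mult space_pair_measure)
    have ii: "integrable arc_length (\<lambda>\<zeta>. cis (l * (x \<bullet> \<zeta>)) * chr n \<zeta>)" by (rule herg_integrable[OF integrable_chr])
    have sp: "cis (x \<bullet> (k *\<^sub>R a - l *\<^sub>R b)) = cis (k * (x \<bullet> a)) * cnj (cis (l * (x \<bullet> b)))" for a b
      by (simp add: inner_diff_right cis_cnj cis_mult)
    have "(\<integral>p. F x p \<partial>(arc_length \<Otimes>\<^sub>M arc_length))
        = (\<integral>p. weight x *\<^sub>R (case p of (\<xi>, \<zeta>) \<Rightarrow> (cis (k * (x \<bullet> \<xi>)) * chr n \<xi>) * cnj (cis (l * (x \<bullet> \<zeta>)) * chr n \<zeta>)) \<partial>(arc_length \<Otimes>\<^sub>M arc_length))"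
      by (rule Bochner_Integration.integral_cong)
         (simp_all add: F_def sp case_prod_unfold mult_ac)
    also have "\<dots> = weight x *\<^sub>R (\<integral>\<xi>. \<integral>\<zeta>. (cis (k * (x \<bullet> \<xi>)) * chr n \<xi>) * cnj (cis (l * (x \<bullet> \<zeta>)) * chr n \<zeta>) \<partial>arc_length \<partial>arc_length)"
      by (simp only: integral_scaleR_right sigma_sigma.integral_fst'[OF i, symmetric] prod.case)
    also have "\<dots> = weight x *\<^sub>R (mode k n x * cnj (mode l n x))"
      by (simp only: integral_mult_right_zero integral_mult_left_zero Bochner_Integration.integral_cnj herg_def)
    finally show ?thesis .
  qed
  have inner: "(\<integral>x. F x p \<partial>lborel) = 2 * pi * (chr n (fst p) * cnj (chr n (snd p)) * of_real (exp (- norm (k *\<^sub>R fst p - l *\<^sub>R snd p))))" for p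
  proof -
    have "(\<integral>x. F x p \<partial>lborel) = (\<integral>x. (weight x *\<^sub>R cis (x \<bullet> (k *\<^sub>R fst p - l *\<^sub>R snd p))) * (chr n (fst p) * cnj (chr n (snd p))) \<partial>lborel)"
      by (simp add: F_def)
    also have "\<dots> = (2 * pi * exp (- norm (k *\<^sub>R fst p - l *\<^sub>R snd p))) * (chr n (fst p) * cnj (chr n (snd p)))"
      by (simp only: integral_mult_left_zero fourier_weight)
    finally show ?thesis by (simp add: mult_ac)
  qed
  have gi: "integrable (arc_length \<Otimes>\<^sub>M arc_length) (\<lambda>(\<xi>, \<zeta>). chr n \<xi> * cnj (chr n \<zeta>) * of_real (exp (- norm (k *\<^sub>R \<xi> - l *\<^sub>R \<zeta>))) :: complex)"
  proof (rule P.integrable_const_bound[where B = 1])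
    have [measurable]: "(\<lambda>p. of_real (exp (- norm (k *\<^sub>R fst p - l *\<^sub>R snd p))) :: complex) \<in> borel_measurable (arc_length \<Otimes>\<^sub>M arc_length)"
      by (intro measurable_pair_arc_length continuous_intros)
    show "(\<lambda>(\<xi>, \<zeta>). chr n \<xi> * cnj (chr n \<zeta>) * of_real (exp (- norm (k *\<^sub>R \<xi> - l *\<^sub>R \<zeta>))) :: complex) \<in> borel_measurable (arc_length \<Otimes>\<^sub>M arc_length)"
      unfolding case_prod_beta by measurable
  qed (auto intro!: AE_I2 simp: norm_mult space_pair_measure)
  have "gram n k l = (\<integral>x. \<integral>p. F x p \<partial>(arc_length \<Otimes>\<^sub>M arc_length) \<partial>lborel)"
    by (simp only: prod gram_def)
  also have "\<dots> = (\<integral>p. \<integral>x. F x p \<partial>lborel \<partial>(arc_length \<Otimes>\<^sub>M arc_length))"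
    by (rule LP.Fubini_integral[OF Fi, symmetric])
  also have "\<dots> = 2 * pi * (\<integral>(\<xi>, \<zeta>). chr n \<xi> * cnj (chr n \<zeta>) * of_real (exp (- norm (k *\<^sub>R \<xi> - l *\<^sub>R \<zeta>))) \<partial>(arc_length \<Otimes>\<^sub>M arc_length))"
    by (simp only: inner integral_mult_right_zero case_prod_unfold)
  also have "\<dots> = 2 * pi * (\<integral>\<zeta>. \<integral>\<xi>. chr n \<xi> * cnj (chr n \<zeta>) * of_real (exp (- norm (k *\<^sub>R \<xi> - l *\<^sub>R \<zeta>))) \<partial>arc_length \<partial>arc_length)"
    by (simp only: sigma_sigma.integral_snd[OF gi])
  also have "(\<integral>\<zeta>. \<integral>\<xi>. chr n \<xi> * cnj (chr n \<zeta>) * of_real (exp (- norm (k *\<^sub>R \<xi> - l *\<^sub>R \<zeta>))) \<partial>arc_length \<partial>arc_length) = (\<integral>\<zeta>. fcoeff n (kern k l) \<partial>arc_length)"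
    by (rule Bochner_Integration.integral_cong) (auto intro!: gram_inner)
  finally show ?thesis by (simp add: scaleR_conv_of_real power2_eq_square)
qed

section \<open>Asymptotics of the Gram matrices\<close>

text \<open>A quantitative Riemann--Lebesgue lemma, from Bessel's inequality.\<close>

lemma finite_large_fcoeff:
  assumes f: "square_integrable arc_length f" and e: "e > 0"
  shows "finite {n. e \<le> norm (fcoeff n f)}"
proof (rule finite_if_finite_subsets_card_bdd[THEN conjunct1])
  fix A assume A: "A \<subseteq> {n. e \<le> norm (fcoeff n f)}" "finite A"
  have "e\<^sup>2 * real (card A) = (\<Sum>n\<in>A. e\<^sup>2)" by simp
  also have "\<dots> \<le> (\<Sum>n\<in>A. (norm (fcoeff n f))\<^sup>2)"
    using A(1) e by (intro sum_mono power_mono) auto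
  also have "\<dots> \<le> 2 * pi * sq_norm f"
  proof -
    have "0 \<le> sq_norm (\<lambda>\<xi>. f \<xi> - fsum A f \<xi>)" by simp
    then show ?thesis unfolding sq_norm_diff_fsum(1)[OF f A(2)] by (simp add: field_simps)
  qed
  finally have "real (card A) \<le> 2 * pi * sq_norm f / e\<^sup>2" using e by (simp add: field_simps)
  then show "card A \<le> nat \<lfloor>2 * pi * sq_norm f / e\<^sup>2\<rfloor>" by (simp add: le_nat_floor)
qed

lemma square_integrable_continuous:
  fixes H :: "real^2 \<Rightarrow> complex"
  assumes "continuous_on (sphere 0 1) H"
  shows "square_integrable arc_length H"
  unfolding square_integrable_def
  by (intro conjI borel_measurable_arc_length_continuous integrable_arc_length_continuous continuous_intros assms)

text \<open>Two integrations by parts on \<open>[0, 2\<pi>]\<close>. The boundary term is the jump of the derivative at angle 0.\<close>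

lemma fcoeff_second_derivative:
  assumes G: "continuous_on (sphere 0 1) G" and H: "continuous_on (sphere 0 1) H"
    and d1: "\<And>\<theta>. \<theta> \<in> {0..2*pi} \<Longrightarrow> ((\<lambda>\<theta>. G (polar 1 \<theta>)) has_vector_derivative g1 \<theta>) (at \<theta> within {0..2*pi})"
    and d2: "\<And>\<theta>. \<theta> \<in> {0..2*pi} \<Longrightarrow> (g1 has_vector_derivative H (polar 1 \<theta>)) (at \<theta> within {0..2*pi})"
  shows "of_int n ^ 2 * fcoeff n G = g1 (2 * pi) - g1 0 - fcoeff n H"
proof -
  define m where "m = real_of_int (- n)"
  let ?G = "\<lambda>\<theta>. G (polar 1 \<theta>)" and ?H = "\<lambda>\<theta>. H (polar 1 \<theta>)"
  \<comment> \<open>both integrations by parts at once\<close>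
  let ?P = "\<lambda>\<theta>. cis (m * \<theta>) * (g1 \<theta> - \<i> * m * ?G \<theta>)"
  have "((\<lambda>\<theta>. cis (m * \<theta>) * ?H \<theta> + of_real (m\<^sup>2) * (cis (m * \<theta>) * ?G \<theta>)) has_integral ?P (2 * pi) - ?P 0) {0..2*pi}"
  proof (rule fundamental_theorem_of_calculus)
    fix \<theta> assume \<theta>: "\<theta> \<in> {0..2*pi}"
    have "((\<lambda>\<theta>. g1 \<theta> - \<i> * m * ?G \<theta>) has_vector_derivative ?H \<theta> - \<i> * m * g1 \<theta>) (at \<theta> within {0..2*pi})"
      by (intro has_vector_derivative_diff has_vector_derivative_mult_right d1 d2 \<theta>)
    from has_vector_derivative_mult[OF has_vector_derivative_cis this, of m]
    show "(?P has_vector_derivative cis (m * \<theta>) * ?H \<theta> + of_real (m\<^sup>2) * (cis (m * \<theta>) * ?G \<theta>)) (at \<theta> within {0..2*pi})"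
      by (rule has_vector_derivative_eq_rhs) (simp add: algebra_simps power2_eq_square)
  qed simp
  moreover have "cis (m * (2 * pi)) = 1" using cis_multiple_2pi[of m] by (simp add: mult_ac m_def)
  moreover have "polar 1 (2 * pi) = polar 1 0" using polar_periodic[of 1 0] by simp
  ultimately have "integral {0..2*pi} (\<lambda>\<theta>. cis (m * \<theta>) * ?H \<theta> + of_real (m\<^sup>2) * (cis (m * \<theta>) * ?G \<theta>)) = g1 (2 * pi) - g1 0"
    by (auto dest!: integral_unique)
  moreover have "(\<lambda>\<theta>. cis (m * \<theta>) * ?H \<theta>) integrable_on {0..2*pi}" "(\<lambda>\<theta>. of_real (m\<^sup>2) * (cis (m * \<theta>) * ?G \<theta>)) integrable_on {0..2*pi}"
    by (intro integrable_continuous_interval continuous_intros continuous_on_compose2[OF G] continuous_on_compose2[OF H]; auto)+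
  ultimately have "integral {0..2*pi} (\<lambda>\<theta>. cis (m * \<theta>) * ?H \<theta>) + of_real (m\<^sup>2) * integral {0..2*pi} (\<lambda>\<theta>. cis (m * \<theta>) * ?G \<theta>) = g1 (2 * pi) - g1 0"
    by (simp add: Henstock_Kurzweil_Integration.integral_add del: of_real_power)
  moreover have "fcoeff n G = integral {0..2*pi} (\<lambda>\<theta>. cis (m * \<theta>) * ?G \<theta>)" "fcoeff n H = integral {0..2*pi} (\<lambda>\<theta>. cis (m * \<theta>) * ?H \<theta>)"
    unfolding fcoeff_def using G H
    by (simp_all add: integral_arc_length_continuous continuous_intros chr_polar cis_cnj m_def)
  ultimately show ?thesis by (simp add: m_def algebra_simps)
qed

text \<open>In the angle the kernel is \<open>exp(-2k sin(\<theta>/2))\<close>. Its derivative jumps by \<open>2k\<close> at angle 0, while its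
  second derivative closes up to a continuous function \<open>H\<close> on the circle.\<close>

lemma fcoeff_kern_diagonal:
  assumes k: "k > 0"
  shows "\<exists>H. continuous_on (sphere 0 1) H \<and> (\<forall>n. of_int n ^ 2 * fcoeff n (kern k k) = of_real (2 * k) - fcoeff n H)"
proof -
  define N where "N \<eta> = norm (k *\<^sub>R \<eta> - k *\<^sub>R axis 1 1)" for \<eta> :: "real^2"
  define H :: "real^2 \<Rightarrow> complex" where "H \<eta> = of_real ((N \<eta> / 4 + k\<^sup>2 * (1 + \<eta> $ 1) / 2) * exp (- N \<eta>))" for \<eta>
  define g1 :: "real \<Rightarrow> complex" where "g1 \<theta> = of_real (- (k * cos (\<theta> / 2)) * exp (- (2 * k * sin (\<theta> / 2))))" for \<theta>
  have N: "N (polar 1 \<theta>) = 2 * k * sin (\<theta> / 2)" if "\<theta> \<in> {0..2*pi}" for \<theta>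
  proof -
    have h: "cos \<theta> = 1 - 2 * (sin (\<theta> / 2))\<^sup>2" using cos_double_sin[of "\<theta> / 2"] by simp
    have sc: "(sin \<theta>)\<^sup>2 + (cos \<theta>)\<^sup>2 = 1" by simp
    have "(k * cos \<theta> - k)\<^sup>2 + (k * sin \<theta>)\<^sup>2 = k\<^sup>2 * ((sin \<theta>)\<^sup>2 + (cos \<theta>)\<^sup>2) + k\<^sup>2 - 2 * k\<^sup>2 * cos \<theta>"
      by algebra
    also have "\<dots> = (2 * k * sin (\<theta> / 2))\<^sup>2" unfolding sc unfolding h by (simp add: algebra_simps power2_eq_square)
    finally have "N (polar 1 \<theta>) = \<bar>2 * k * sin (\<theta> / 2)\<bar>"
      unfolding N_def norm_vec2 by (simp add: axis_def)
    moreover have "sin (\<theta> / 2) \<ge> 0" using that by (intro sin_ge_zero) auto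
    ultimately show ?thesis using k by simp
  qed
  have Hc: "continuous_on (sphere 0 1) H" unfolding H_def N_def by (intro continuous_intros) auto
  have gc: "continuous_on (sphere 0 1) (kern k k)" by (rule continuous_kern)
  have "of_int n ^ 2 * fcoeff n (kern k k) = g1 (2 * pi) - g1 0 - fcoeff n H" for n
  proof (rule fcoeff_second_derivative[OF gc Hc])
    fix \<theta> assume \<theta>: "\<theta> \<in> {0..2*pi}"
    have "((\<lambda>\<theta>. exp (- (2 * k * sin (\<theta> / 2)))) has_real_derivative - (k * cos (\<theta> / 2)) * exp (- (2 * k * sin (\<theta> / 2)))) (at \<theta> within {0..2*pi})"
      by (auto intro!: derivative_eq_intros)
    then have "((\<lambda>\<theta>. complex_of_real (exp (- (2 * k * sin (\<theta> / 2))))) has_vector_derivative g1 \<theta>) (at \<theta> within {0..2*pi})"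
      unfolding g1_def by (intro has_vector_derivative_of_real) (simp add: has_real_derivative_iff_has_vector_derivative)
    then show "((\<lambda>\<theta>. kern k k (polar 1 \<theta>)) has_vector_derivative g1 \<theta>) (at \<theta> within {0..2*pi})"
      by (rule has_vector_derivative_transform[rotated 2]) (use \<theta> N in \<open>auto simp: kern_def N_def\<close>)
    have c2: "(cos (\<theta> / 2))\<^sup>2 = (1 + cos \<theta>) / 2" using cos_double_cos[of "\<theta> / 2"] by simp
    have "((\<lambda>\<theta>. - (k * cos (\<theta> / 2)) * exp (- (2 * k * sin (\<theta> / 2)))) has_real_derivative
        (k * sin (\<theta> / 2) / 2) * exp (- (2 * k * sin (\<theta> / 2))) + - (k * cos (\<theta> / 2)) * (- (k * cos (\<theta> / 2)) * exp (- (2 * k * sin (\<theta> / 2))))) (at \<theta> within {0..2*pi})"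
      by (auto intro!: derivative_eq_intros)
    moreover have "(k * sin (\<theta> / 2) / 2) * exp (- (2 * k * sin (\<theta> / 2))) + - (k * cos (\<theta> / 2)) * (- (k * cos (\<theta> / 2)) * exp (- (2 * k * sin (\<theta> / 2))))
        = (k * sin (\<theta> / 2) / 2 + k\<^sup>2 * (cos (\<theta> / 2))\<^sup>2) * exp (- (2 * k * sin (\<theta> / 2)))"
      by (simp add: algebra_simps power2_eq_square)
    ultimately have "((\<lambda>\<theta>. - (k * cos (\<theta> / 2)) * exp (- (2 * k * sin (\<theta> / 2)))) has_real_derivative
        (k * sin (\<theta> / 2) / 2 + k\<^sup>2 * (cos (\<theta> / 2))\<^sup>2) * exp (- (2 * k * sin (\<theta> / 2)))) (at \<theta> within {0..2*pi})"
      by simp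
    then have "(g1 has_vector_derivative of_real ((k * sin (\<theta> / 2) / 2 + k\<^sup>2 * (cos (\<theta> / 2))\<^sup>2) * exp (- (2 * k * sin (\<theta> / 2))))) (at \<theta> within {0..2*pi})"
      unfolding g1_def[abs_def] by (intro has_vector_derivative_of_real) (simp add: has_real_derivative_iff_has_vector_derivative)
    moreover have "H (polar 1 \<theta>) = of_real ((k * sin (\<theta> / 2) / 2 + k\<^sup>2 * (cos (\<theta> / 2))\<^sup>2) * exp (- (2 * k * sin (\<theta> / 2))))"
      unfolding H_def N[OF \<theta>] c2 by simp
    ultimately show "(g1 has_vector_derivative H (polar 1 \<theta>)) (at \<theta> within {0..2*pi})" by simp
  qed
  moreover have "g1 (2 * pi) - g1 0 = of_real (2 * k)" by (simp add: g1_def)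
  ultimately show ?thesis using Hc by (intro exI[of _ H]) simp
qed

text \<open>The distance \<open>s\<close> from \<open>k\<eta>\<close> to \<open>l e\<^sub>1\<close> never vanishes, so the kernel is smooth on the circle and
  there is no jump. From \<open>s s' = k l sin \<theta>\<close> one reads off the derivatives.\<close>

lemma fcoeff_kern_off_diagonal:
  assumes k: "k > 0" "l > 0" "k \<noteq> l"
  shows "\<exists>H. continuous_on (sphere 0 1) H \<and> (\<forall>n. of_int n ^ 2 * fcoeff n (kern k l) = - fcoeff n H)"
proof -
  define N where "N \<eta> = norm (k *\<^sub>R \<eta> - l *\<^sub>R axis 1 1)" for \<eta> :: "real^2"
  define s where "s \<theta> = N (polar 1 \<theta>)" for \<theta>
  define H :: "real^2 \<Rightarrow> complex" where "H \<eta> = of_real (((k * l * \<eta> $ 2 / N \<eta>)\<^sup>2 - (k * l * \<eta> $ 1 - (k * l * \<eta> $ 2 / N \<eta>)\<^sup>2) / N \<eta>) * exp (- N \<eta>))" for \<eta>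
  define r where "r \<theta> = k * l * sin \<theta> / s \<theta>" for \<theta>
  define g1 :: "real \<Rightarrow> complex" where "g1 \<theta> = of_real (- r \<theta> * exp (- s \<theta>))" for \<theta>
  have Npos: "N \<eta> > 0" if "\<eta> \<in> sphere 0 1" for \<eta>
  proof -
    have "norm (k *\<^sub>R \<eta>) \<noteq> norm (l *\<^sub>R axis 1 1 :: real^2)" using that k by (simp add: norm_axis_1)
    then have "k *\<^sub>R \<eta> \<noteq> l *\<^sub>R axis 1 1" by metis
    then show ?thesis by (simp add: N_def)
  qed
  have spos: "s \<theta> > 0" for \<theta> using Npos[of "polar 1 \<theta>"] by (simp add: s_def)
  have s2: "s \<theta> = sqrt (k\<^sup>2 + l\<^sup>2 - 2 * k * l * cos \<theta>)" for \<theta>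
  proof -
    have sc: "(sin \<theta>)\<^sup>2 + (cos \<theta>)\<^sup>2 = 1" by simp
    have "(k * cos \<theta> - l)\<^sup>2 + (k * sin \<theta>)\<^sup>2 = k\<^sup>2 * ((sin \<theta>)\<^sup>2 + (cos \<theta>)\<^sup>2) + l\<^sup>2 - 2 * k * l * cos \<theta>"
      by algebra
    then show ?thesis unfolding sc s_def N_def norm_vec2 by (simp add: axis_def)
  qed
  have ds: "(s has_real_derivative r \<theta>) (at \<theta>)" for \<theta>
  proof -
    have "k\<^sup>2 + l\<^sup>2 - 2 * k * l * cos \<theta> > 0" using spos[of \<theta>] unfolding s2 by simp
    then have "((\<lambda>\<theta>. sqrt (k\<^sup>2 + l\<^sup>2 - 2 * k * l * cos \<theta>)) has_real_derivative k * l * sin \<theta> / sqrt (k\<^sup>2 + l\<^sup>2 - 2 * k * l * cos \<theta>)) (at \<theta>)"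
      by (auto intro!: derivative_eq_intros simp: field_simps)
    then show ?thesis by (simp add: s2[abs_def] r_def)
  qed
  have dr: "(r has_real_derivative (k * l * cos \<theta> - (r \<theta>)\<^sup>2) / s \<theta>) (at \<theta>)" for \<theta>
  proof -
    have "(r has_real_derivative (k * l * cos \<theta> * s \<theta> - k * l * sin \<theta> * r \<theta>) / (s \<theta> * s \<theta>)) (at \<theta>)"
      unfolding r_def[abs_def]
      by (rule DERIV_divide[OF _ ds[unfolded r_def]]) (use spos[of \<theta>] in \<open>auto intro!: derivative_eq_intros\<close>)
    moreover have "k * l * sin \<theta> = r \<theta> * s \<theta>" using spos[of \<theta>] by (simp add: r_def)
    then have "(k * l * cos \<theta> * s \<theta> - k * l * sin \<theta> * r \<theta>) / (s \<theta> * s \<theta>) = (k * l * cos \<theta> - (r \<theta>)\<^sup>2) / s \<theta>"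
      using spos[of \<theta>] by (simp only:) (simp add: field_simps power2_eq_square)
    ultimately show ?thesis by (simp only:)
  qed
  have de: "((\<lambda>\<theta>. exp (- s \<theta>)) has_real_derivative - r \<theta> * exp (- s \<theta>)) (at \<theta>)" for \<theta>
    by (auto intro!: derivative_eq_intros ds)
  have Hc: "continuous_on (sphere 0 1) H"
    unfolding H_def N_def using Npos by (intro continuous_intros) (auto simp: N_def)
  have gc: "continuous_on (sphere 0 1) (kern k l)" by (rule continuous_kern)
  have "of_int n ^ 2 * fcoeff n (kern k l) = g1 (2 * pi) - g1 0 - fcoeff n H" for n
  proof (rule fcoeff_second_derivative[OF gc Hc])
    fix \<theta>
    have "((\<lambda>\<theta>. complex_of_real (exp (- s \<theta>))) has_vector_derivative g1 \<theta>) (at \<theta> within {0..2*pi})"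
      unfolding g1_def using has_field_derivative_at_within[OF de]
      by (intro has_vector_derivative_of_real) (simp add: has_real_derivative_iff_has_vector_derivative)
    then show "((\<lambda>\<theta>. kern k l (polar 1 \<theta>)) has_vector_derivative g1 \<theta>) (at \<theta> within {0..2*pi})"
      by (simp add: kern_def s_def N_def)
    have "((\<lambda>\<theta>. - r \<theta> * exp (- s \<theta>)) has_real_derivative
       - ((k * l * cos \<theta> - (r \<theta>)\<^sup>2) / s \<theta>) * exp (- s \<theta>) + (- r \<theta> * exp (- s \<theta>)) * - r \<theta>) (at \<theta>)"
      by (rule DERIV_mult'[THEN DERIV_cong, OF DERIV_minus[OF dr] de]) (simp add: algebra_simps)
    moreover have "- ((k * l * cos \<theta> - (r \<theta>)\<^sup>2) / s \<theta>) * exp (- s \<theta>) + (- r \<theta> * exp (- s \<theta>)) * - r \<theta>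
        = ((r \<theta>)\<^sup>2 - (k * l * cos \<theta> - (r \<theta>)\<^sup>2) / s \<theta>) * exp (- s \<theta>)"
      by (simp add: algebra_simps power2_eq_square)
    ultimately have "((\<lambda>\<theta>. - r \<theta> * exp (- s \<theta>)) has_real_derivative
       ((r \<theta>)\<^sup>2 - (k * l * cos \<theta> - (r \<theta>)\<^sup>2) / s \<theta>) * exp (- s \<theta>)) (at \<theta> within {0..2*pi})"
      by (simp only: has_field_derivative_at_within)
    then have "(g1 has_vector_derivative of_real (((r \<theta>)\<^sup>2 - (k * l * cos \<theta> - (r \<theta>)\<^sup>2) / s \<theta>) * exp (- s \<theta>))) (at \<theta> within {0..2*pi})"
      unfolding g1_def[abs_def] by (intro has_vector_derivative_of_real) (simp add: has_real_derivative_iff_has_vector_derivative)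
    moreover have "H (polar 1 \<theta>) = of_real (((r \<theta>)\<^sup>2 - (k * l * cos \<theta> - (r \<theta>)\<^sup>2) / s \<theta>) * exp (- s \<theta>))"
      by (simp add: H_def r_def s_def)
    ultimately show "(g1 has_vector_derivative H (polar 1 \<theta>)) (at \<theta> within {0..2*pi})" by simp
  qed
  moreover have "g1 (2 * pi) - g1 0 = 0" by (simp add: g1_def r_def)
  ultimately show ?thesis using Hc by (intro exI[of _ H]) simp
qed

lemma gram_diagonal_asymp:
  assumes k: "k > 0" and e: "e > 0"
  shows "finite {n. e \<le> norm (of_int n ^ 2 * gram n k k - of_real (8 * pi\<^sup>2 * k))}"
proof -
  obtain H where H: "continuous_on (sphere 0 1) H" "\<And>n. of_int n ^ 2 * fcoeff n (kern k k) = of_real (2 * k) - fcoeff n H"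
    using fcoeff_kern_diagonal[OF k] by auto
  have eq: "norm (of_int n ^ 2 * gram n k k - of_real (8 * pi\<^sup>2 * k)) = (4 * pi\<^sup>2) * norm (fcoeff n H)" for n
  proof -
    have "of_int n ^ 2 * gram n k k = 4 * pi\<^sup>2 * (of_int n ^ 2 * fcoeff n (kern k k))"
      unfolding gram_eq_fcoeff by (rule mult.left_commute)
    then have "of_int n ^ 2 * gram n k k - of_real (8 * pi\<^sup>2 * k) = - (4 * pi\<^sup>2) * fcoeff n H"
      unfolding H(2) by (simp add: right_diff_distrib)
    then show ?thesis by (simp only:) (simp add: norm_mult norm_power)
  qed
  have "finite {n. e / (4 * pi\<^sup>2) \<le> norm (fcoeff n H)}"
    by (rule finite_large_fcoeff[OF square_integrable_continuous[OF H(1)]]) (use e in simp)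
  also have "{n. e / (4 * pi\<^sup>2) \<le> norm (fcoeff n H)} = {n. e \<le> (4 * pi\<^sup>2) * norm (fcoeff n H)}"
    by (intro Collect_cong) (subst pos_divide_le_eq; simp add: mult_ac)
  finally show ?thesis unfolding eq .
qed

lemma gram_off_diagonal_asymp:
  assumes k: "k > 0" "l > 0" "k \<noteq> l" and e: "e > 0"
  shows "finite {n. e \<le> norm (of_int n ^ 2 * gram n k l)}"
proof -
  obtain H where H: "continuous_on (sphere 0 1) H" "\<And>n. of_int n ^ 2 * fcoeff n (kern k l) = - fcoeff n H"
    using fcoeff_kern_off_diagonal[OF k] by auto
  have eq: "norm (of_int n ^ 2 * gram n k l) = (4 * pi\<^sup>2) * norm (fcoeff n H)" for n
  proof -
    have "of_int n ^ 2 * gram n k l = 4 * pi\<^sup>2 * (of_int n ^ 2 * fcoeff n (kern k l))"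
      unfolding gram_eq_fcoeff by (rule mult.left_commute)
    then have "of_int n ^ 2 * gram n k l = - (4 * pi\<^sup>2) * fcoeff n H"
      unfolding H(2) by simp
    then show ?thesis by (simp only:) (simp add: norm_mult norm_power)
  qed
  have "finite {n. e / (4 * pi\<^sup>2) \<le> norm (fcoeff n H)}"
    by (rule finite_large_fcoeff[OF square_integrable_continuous[OF H(1)]]) (use e in simp)
  also have "{n. e / (4 * pi\<^sup>2) \<le> norm (fcoeff n H)} = {n. e \<le> (4 * pi\<^sup>2) * norm (fcoeff n H)}"
    by (intro Collect_cong) (subst pos_divide_le_eq; simp add: mult_ac)
  finally show ?thesis unfolding eq .
qed

section \<open>Energy estimates for scalar waves\<close>

text \<open>The squared norm of the ambient space, for waves with values in any space. It is extended
  real-valued, so that it can be computed before it is known to be finite.\<close>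

definition energy :: "(real^2 \<Rightarrow> 'a::{banach, second_countable_topology}) \<Rightarrow> ennreal" where
  "energy v = (\<integral>\<^sup>+x. ennreal (weight x * ((norm (v x))\<^sup>2 + (norm (ang_deriv v x))\<^sup>2)) \<partial>lborel)"

definition qform :: "real \<Rightarrow> real \<Rightarrow> int \<Rightarrow> complex \<Rightarrow> complex \<Rightarrow> real" where
  "qform k l n a b = (norm a)\<^sup>2 * Re (gram n k k) + (norm b)\<^sup>2 * Re (gram n l l) + 2 * Re (a * cnj b * gram n k l)"

lemma qform_eq_integral:
  "integrable lborel (\<lambda>x. weight x * (norm (a * mode k n x + b * mode l n x))\<^sup>2)"
  "qform k l n a b = (\<integral>x. weight x * (norm (a * mode k n x + b * mode l n x))\<^sup>2 \<partial>lborel)"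
proof -
  define F where "F i j x = weight x *\<^sub>R (mode i n x * cnj (mode j n x))" for i j x
  have i: "integrable lborel (\<lambda>x. Re (c * F i j x))" for i j c
    unfolding F_def by (intro integrable_Re integrable_mult_right gram_integrable)
  have g: "(\<integral>x. Re (c * F i j x) \<partial>lborel) = Re (c * gram n i j)" for i j c
  proof -
    have "(\<integral>x. Re (c * F i j x) \<partial>lborel) = Re (\<integral>x. c * F i j x \<partial>lborel)"
      unfolding F_def by (intro integral_Re integrable_mult_right gram_integrable)
    then show ?thesis by (simp only: integral_mult_right_zero) (simp only: F_def gram_def)
  qed
  have e: "weight x * (norm (a * mode k n x + b * mode l n x))\<^sup>2
      = Re (of_real ((norm a)\<^sup>2) * F k k x) + Re (of_real ((norm b)\<^sup>2) * F l l x) + Re (2 * (a * cnj b) * F k l x)" for x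
  proof -
    define p q where "p = mode k n x" and "q = mode l n x"
    have n: "(norm z)\<^sup>2 = Re (z * cnj z)" for z by (simp add: complex_norm_square[symmetric])
    have "(norm (a * p + b * q))\<^sup>2 = Re ((a * cnj a) * (p * cnj p)) + Re ((b * cnj b) * (q * cnj q)) + Re (2 * (a * cnj b) * (p * cnj q))"
      unfolding n by (simp add: algebra_simps)
    also have "\<dots> = Re (of_real ((norm a)\<^sup>2) * (p * cnj p)) + Re (of_real ((norm b)\<^sup>2) * (q * cnj q)) + Re (2 * (a * cnj b) * (p * cnj q))"
      by (simp only: complex_norm_square)
    finally have "weight x * (norm (a * p + b * q))\<^sup>2 = weight x * (Re (of_real ((norm a)\<^sup>2) * (p * cnj p)) + Re (of_real ((norm b)\<^sup>2) * (q * cnj q)) + Re (2 * (a * cnj b) * (p * cnj q)))"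
      by (simp only:)
    then show ?thesis
      by (simp only: F_def p_def[symmetric] q_def[symmetric] mult_scaleR_right scaleR_complex.sel distrib_left)
  qed
  show "integrable lborel (\<lambda>x. weight x * (norm (a * mode k n x + b * mode l n x))\<^sup>2)"
    unfolding e by (intro Bochner_Integration.integrable_add i)
  have "(\<integral>x. weight x * (norm (a * mode k n x + b * mode l n x))\<^sup>2 \<partial>lborel)
      = Re (of_real ((norm a)\<^sup>2) * gram n k k) + Re (of_real ((norm b)\<^sup>2) * gram n l l) + Re (2 * (a * cnj b) * gram n k l)"
    unfolding e by (simp only: Bochner_Integration.integral_add Bochner_Integration.integrable_add i g)
  also have "\<dots> = qform k l n a b"
  proof -
    have r: "Re (of_real t * z) = t * Re z" for t z by simp
    have "Re (2 * (a * cnj b) * gram n k l) = 2 * Re (a * cnj b * gram n k l)"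
      using r[of 2 "a * cnj b * gram n k l"] by (simp only: of_real_numeral mult.assoc)
    then show ?thesis by (simp only: qform_def r)
  qed
  finally show "qform k l n a b = (\<integral>x. weight x * (norm (a * mode k n x + b * mode l n x))\<^sup>2 \<partial>lborel)" by simp
qed

lemma qform_nonneg: "0 \<le> qform k l n a b"
  unfolding qform_eq_integral(2) by (intro Bochner_Integration.integral_nonneg) simp

lemma AE_zero_continuous:
  fixes h :: "'a::euclidean_space \<Rightarrow> 'b::real_normed_vector"
  assumes h: "continuous_on UNIV h" and ae: "AE x in lborel. h x = 0"
  shows "h x = 0"
proof (rule ccontr)
  assume "h x \<noteq> 0"
  have "open {x. h x \<noteq> 0}"
    using open_Collect_neq[OF h continuous_on_const[of UNIV 0]] .
  moreover have "{x. h x \<noteq> 0} \<noteq> {}" using \<open>h x \<noteq> 0\<close> by auto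
  ultimately have "\<not> negligible {x. h x \<noteq> 0}" by (rule open_not_negligible)
  moreover have "{x. h x \<noteq> 0} \<in> null_sets lborel"
    using ae \<open>open _\<close> by (subst AE_iff_null_sets) auto
  ultimately show False
    using null_sets_completionI negligible_iff_null_sets by blast
qed

text \<open>A combination of the two modes with vanishing norm vanishes identically; separate the wave numbers,
  then use injectivity.\<close>

lemma qform_zero:
  assumes k: "k > 0" "l > 0" "k \<noteq> l" and z: "qform k l n a b = 0"
  shows "a = 0" "b = 0"
proof -
  let ?h = "\<lambda>x. a * mode k n x + b * mode l n x"
  have hc: "continuous_on UNIV ?h" by (intro continuous_intros mode_continuous)
  have "AE x in lborel. weight x * (norm (?h x))\<^sup>2 = 0"
    using integral_nonneg_eq_0_iff_AE[OF qform_eq_integral(1)[of a k n b l]] z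
    unfolding qform_eq_integral(2) by simp
  then have "AE x in lborel. ?h x = 0"
  proof eventually_elim
    case (elim x)
    then show ?case using weight_pos[of x] by simp
  qed
  then have hz: "?h x = 0" for x by (rule AE_zero_continuous[OF hc])
  have ia: "integrable arc_length (\<lambda>\<xi>. c * chr n \<xi>)" for c by (intro integrable_mult_right integrable_chr)
  have "herg k (\<lambda>\<xi>. a * chr n \<xi>) x + herg l (\<lambda>\<xi>. b * chr n \<xi>) x = 0" for x
    using hz[of x] by (simp only: herg_cmult)
  note s = herg_pair_zero_separate[OF ia ia this k]
  have "fcoeff n (\<lambda>\<xi>. a * chr n \<xi>) = 0" by (rule herg_zero_imp_fcoeff_zero[OF ia s(1) k(1)])
  then show "a = 0" by (simp add: fcoeff_cmult fcoeff_chr)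
  have "fcoeff n (\<lambda>\<xi>. b * chr n \<xi>) = 0" by (rule herg_zero_imp_fcoeff_zero[OF ia s(2) k(2)])
  then show "b = 0" by (simp add: fcoeff_cmult fcoeff_chr)
qed

lemma qform_scale: "qform k l n (of_real r * a) (of_real r * b) = r\<^sup>2 * qform k l n a b"
  unfolding qform_def
  by (simp add: norm_mult power_mult_distrib power2_eq_square algebra_simps)

text \<open>A positive definite form attains a positive minimum on the unit sphere.\<close>

lemma qform_coercive:
  assumes k: "k > 0" "l > 0" "k \<noteq> l"
  shows "\<exists>c>0. \<forall>a b. c * ((norm a)\<^sup>2 + (norm b)\<^sup>2) \<le> qform k l n a b"
proof -
  let ?q = "\<lambda>p. qform k l n (fst p) (snd p)"
  have cq: "continuous_on (sphere 0 1) ?q"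
    unfolding qform_def by (intro continuous_intros)
  have "compact (sphere (0 :: complex \<times> complex) 1)" "sphere (0 :: complex \<times> complex) 1 \<noteq> {}" by simp_all
  from continuous_attains_inf[OF this cq] obtain p where
    p: "p \<in> sphere 0 1" "\<And>y. y \<in> sphere 0 1 \<Longrightarrow> ?q p \<le> ?q y" by blast
  have "?q p \<noteq> 0"
  proof
    assume "?q p = 0"
    from qform_zero[OF k this] have "p = 0" by (simp add: prod_eq_iff)
    then show False using p(1) by simp
  qed
  then have c: "?q p > 0" using qform_nonneg[of k l n "fst p" "snd p"] by linarith
  have "?q p * ((norm a)\<^sup>2 + (norm b)\<^sup>2) \<le> qform k l n a b" for a b
  proof (cases "(a, b) = 0")
    case True
    then show ?thesis by (simp add: zero_prod_def qform_nonneg)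
  next
    case False
    define r where "r = norm (a, b)"
    have r: "r > 0" "r\<^sup>2 = (norm a)\<^sup>2 + (norm b)\<^sup>2" using False by (simp add: r_def) (simp add: r_def norm_prod_def)
    have "norm ((1 / r) *\<^sub>R (a, b)) = 1" using r(1) unfolding norm_scaleR by (simp add: r_def[symmetric])
    then have "?q p \<le> qform k l n (of_real (1 / r) * a) (of_real (1 / r) * b)"
      using p(2)[of "(1 / r) *\<^sub>R (a, b)"] by (simp add: scaleR_conv_of_real)
    also have "\<dots> = (1 / r)\<^sup>2 * qform k l n a b" by (rule qform_scale)
    finally have "?q p * r\<^sup>2 \<le> qform k l n a b" using r(1) by (simp add: power_divide field_simps)
    then show ?thesis unfolding r(2) .
  qed
  then show ?thesis using c by blast
qed

lemma Re_of_int_square_mult: "Re (of_int n ^ 2 * z) = (of_int n)\<^sup>2 * Re z"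
proof -
  have "Re (of_real ((of_int n)\<^sup>2) * z) = (of_int n)\<^sup>2 * Re z" by simp
  then show ?thesis by (simp only: of_real_power of_real_of_int_eq)
qed

text \<open>For all but finitely many \<open>n\<close> the diagonal entries of \<open>n\<^sup>2 q\<^sub>n\<close> exceed half of their limits
  \<open>8\<pi>\<^sup>2k\<close> and \<open>8\<pi>\<^sup>2l\<close> and dominate the off-diagonal entry, which tends to zero. The finitely many
  exceptions are covered by coercivity of the single forms.\<close>

lemma qform_lower:
  assumes k: "k > 0" "l > 0" "k \<noteq> l"
  shows "\<exists>c>0. \<forall>n a b. c * ((norm a)\<^sup>2 + (norm b)\<^sup>2) \<le> (1 + (of_int n)\<^sup>2) * qform k l n a b"
proof -
  \<comment> \<open>a quarter of the smaller one of the limits \<open>8\<pi>\<^sup>2k\<close> and \<open>8\<pi>\<^sup>2l\<close> of the diagonal entries\<close>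
  define m where "m = 2 * pi\<^sup>2 * min k l"
  have m: "m > 0" "2 * m \<le> 4 * pi\<^sup>2 * k" "2 * m \<le> 4 * pi\<^sup>2 * l" using k by (auto simp: m_def)
  define B where "B = {n. 4 * pi\<^sup>2 * k \<le> norm (of_int n ^ 2 * gram n k k - of_real (8 * pi\<^sup>2 * k))}
     \<union> {n. 4 * pi\<^sup>2 * l \<le> norm (of_int n ^ 2 * gram n l l - of_real (8 * pi\<^sup>2 * l))}
     \<union> {n. m / 2 \<le> norm (of_int n ^ 2 * gram n k l)} \<union> {0}"
  have fB: "finite B"
    unfolding B_def using gram_diagonal_asymp[OF k(1), of "4 * pi\<^sup>2 * k"] gram_diagonal_asymp[OF k(2), of "4 * pi\<^sup>2 * l"]
      gram_off_diagonal_asymp[OF k, of "m / 2"] k m by simp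
  have big: "m * ((norm a)\<^sup>2 + (norm b)\<^sup>2) \<le> (1 + (of_int n)\<^sup>2) * qform k l n a b" if n: "n \<notin> B" for n a b
  proof -
    let ?N = "(of_int n)\<^sup>2 :: real"
    have d: "?N * Re (gram n j j) \<ge> 4 * pi\<^sup>2 * j"
      if "norm (of_int n ^ 2 * gram n j j - of_real (8 * pi\<^sup>2 * j)) < 4 * pi\<^sup>2 * j" for j
    proof -
      have "Re (of_int n ^ 2 * gram n j j) = ?N * Re (gram n j j)"
        by (rule Re_of_int_square_mult)
      moreover have "\<bar>Re (of_int n ^ 2 * gram n j j - of_real (8 * pi\<^sup>2 * j))\<bar> < 4 * pi\<^sup>2 * j"
        using abs_Re_le_cmod that le_less_trans by blast
      ultimately show ?thesis by (simp only: minus_complex.sel Re_complex_of_real)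
    qed
    have dk: "?N * Re (gram n k k) \<ge> 2 * m" and dl: "?N * Re (gram n l l) \<ge> 2 * m"
    proof -
      have "norm (of_int n ^ 2 * gram n k k - of_real (8 * pi\<^sup>2 * k)) < 4 * pi\<^sup>2 * k"
        "norm (of_int n ^ 2 * gram n l l - of_real (8 * pi\<^sup>2 * l)) < 4 * pi\<^sup>2 * l"
        using n unfolding B_def by (simp_all only: Un_iff mem_Collect_eq de_Morgan_disj not_le)
      from d[OF this(1)] d[OF this(2)] m
      show "?N * Re (gram n k k) \<ge> 2 * m" "?N * Re (gram n l l) \<ge> 2 * m" by linarith+
    qed
    have off: "?N * norm (gram n k l) \<le> m / 2"
      using n by (simp add: B_def not_le norm_mult norm_power less_imp_le)
    have "?N * (2 * Re (a * cnj b * gram n k l)) \<ge> - (m / 2) * ((norm a)\<^sup>2 + (norm b)\<^sup>2)"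
    proof -
      have "- Re (a * cnj b * gram n k l) \<le> norm a * norm b * norm (gram n k l)"
        using abs_Re_le_cmod[of "a * cnj b * gram n k l"] by (simp only: norm_mult complex_mod_cnj)
      then have "?N * (- (2 * Re (a * cnj b * gram n k l))) \<le> ?N * (2 * (norm a * norm b * norm (gram n k l)))"
        by (intro mult_left_mono) auto
      also have "\<dots> = (2 * norm a * norm b) * (?N * norm (gram n k l))" by simp
      also have "\<dots> \<le> ((norm a)\<^sup>2 + (norm b)\<^sup>2) * (m / 2)"
        by (intro mult_mono sum_squares_bound off) auto
      finally show ?thesis by (simp add: algebra_simps)
    qed
    moreover have "?N * ((norm a)\<^sup>2 * Re (gram n k k)) \<ge> (norm a)\<^sup>2 * (2 * m)"
      using mult_left_mono[OF dk, of "(norm a)\<^sup>2"] by (simp add: mult_ac)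
    moreover have "?N * ((norm b)\<^sup>2 * Re (gram n l l)) \<ge> (norm b)\<^sup>2 * (2 * m)"
      using mult_left_mono[OF dl, of "(norm b)\<^sup>2"] by (simp add: mult_ac)
    moreover have "?N * qform k l n a b = ?N * ((norm a)\<^sup>2 * Re (gram n k k)) + ?N * ((norm b)\<^sup>2 * Re (gram n l l)) + ?N * (2 * Re (a * cnj b * gram n k l))"
      unfolding qform_def distrib_left ..
    ultimately have "(norm a)\<^sup>2 * (2 * m) + (norm b)\<^sup>2 * (2 * m) - (m / 2) * ((norm a)\<^sup>2 + (norm b)\<^sup>2) \<le> ?N * qform k l n a b"
      by linarith
    moreover have "(norm a)\<^sup>2 * (2 * m) + (norm b)\<^sup>2 * (2 * m) - (m / 2) * ((norm a)\<^sup>2 + (norm b)\<^sup>2) = m * ((norm a)\<^sup>2 + (norm b)\<^sup>2) + (m / 2) * ((norm a)\<^sup>2 + (norm b)\<^sup>2)"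
      by (simp add: field_simps)
    moreover have "0 \<le> (m / 2) * ((norm a)\<^sup>2 + (norm b)\<^sup>2)" using m by simp
    moreover have "0 \<le> qform k l n a b" by (rule qform_nonneg)
    ultimately show ?thesis by (simp only: distrib_right mult_1)
  qed
  obtain c where c: "\<And>n. c n > 0" "\<And>n a b. c n * ((norm a)\<^sup>2 + (norm b)\<^sup>2) \<le> qform k l n a b"
    using qform_coercive[OF k] by metis
  define c0 where "c0 = Min (insert m (c ` B))"
  have c0: "c0 > 0" "c0 \<le> m" "\<And>n. n \<in> B \<Longrightarrow> c0 \<le> c n"
    unfolding c0_def using fB m(1) c(1) by auto
  have "c0 * ((norm a)\<^sup>2 + (norm b)\<^sup>2) \<le> (1 + (of_int n)\<^sup>2) * qform k l n a b" for n a b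
  proof (cases "n \<in> B")
    case True
    have "c0 * ((norm a)\<^sup>2 + (norm b)\<^sup>2) \<le> c n * ((norm a)\<^sup>2 + (norm b)\<^sup>2)"
      by (intro mult_right_mono c0(3) True) simp
    also have "\<dots> \<le> qform k l n a b" by (rule c(2))
    also have "\<dots> \<le> (1 + (of_int n)\<^sup>2) * qform k l n a b"
      using qform_nonneg[of k l n a b] by (simp add: distrib_right)
    finally show ?thesis .
  next
    case False
    have "c0 * ((norm a)\<^sup>2 + (norm b)\<^sup>2) \<le> m * ((norm a)\<^sup>2 + (norm b)\<^sup>2)"
      by (intro mult_right_mono c0(2)) simp
    also note big[OF False]
    finally show ?thesis .
  qed
  then show ?thesis using c0(1) by blast
qed

text \<open>The entries converge as \<open>|n|\<close> grows, so they are bounded.\<close>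

lemma gram_diagonal_upper:
  assumes k: "k > 0"
  shows "\<exists>C\<ge>0. \<forall>n. (1 + (of_int n)\<^sup>2) * Re (gram n k k) \<le> C"
proof -
  define B where "B = {n. 1 \<le> norm (of_int n ^ 2 * gram n k k - of_real (8 * pi\<^sup>2 * k))} \<union> {0}"
  have fB: "finite B" unfolding B_def using gram_diagonal_asymp[OF k, of 1] by simp
  have g0: "Re (gram n k k) \<ge> 0" for n
    using qform_nonneg[of k k n 1 0] by (simp add: qform_def)
  define C where "C = Max (insert (2 * (1 + 8 * pi\<^sup>2 * k)) ((\<lambda>n. (1 + (of_int n)\<^sup>2) * Re (gram n k k)) ` B))"
  have C1: "2 * (1 + 8 * pi\<^sup>2 * k) \<le> C" unfolding C_def using fB by (intro Max_ge) auto
  have C2: "(1 + (of_int n)\<^sup>2) * Re (gram n k k) \<le> C" if "n \<in> B" for n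
    unfolding C_def using fB that by (intro Max_ge) auto
  have "(1 + (of_int n)\<^sup>2) * Re (gram n k k) \<le> C" if n: "n \<notin> B" for n
  proof -
    let ?N = "(of_int n)\<^sup>2 :: real"
    have "Re (of_int n ^ 2 * gram n k k) = ?N * Re (gram n k k)"
      by (rule Re_of_int_square_mult)
    moreover have "\<bar>Re (of_int n ^ 2 * gram n k k - of_real (8 * pi\<^sup>2 * k))\<bar> < 1"
      using n abs_Re_le_cmod le_less_trans by (fastforce simp: B_def not_le)
    ultimately have a: "?N * Re (gram n k k) \<le> 1 + 8 * pi\<^sup>2 * k"
      by (simp only: minus_complex.sel Re_complex_of_real)
    have "n \<noteq> 0" using n by (simp add: B_def)
    then have "1 \<le> \<bar>n\<bar>" by simp
    then have "1 \<le> \<bar>of_int n :: real\<bar>" by linarith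
    then have "1 \<le> ?N" using one_le_power[of "\<bar>of_int n :: real\<bar>" 2] by simp
    then have "Re (gram n k k) \<le> ?N * Re (gram n k k)" using mult_right_mono[OF _ g0, of 1 ?N] by simp
    moreover have "2 * (?N * Re (gram n k k)) \<le> C" using mult_left_mono[OF a, of 2] C1 by (rule_tac order_trans) auto
    ultimately show ?thesis by (simp only: distrib_right mult_1)
  qed
  then have "\<forall>n. (1 + (of_int n)\<^sup>2) * Re (gram n k k) \<le> C" using C2 by blast
  moreover have "0 \<le> C" using C1 k by (smt (verit) mult_nonneg_nonneg zero_le_power2)
  ultimately show ?thesis by blast
qed

text \<open>The weighted Parseval identity for the wave and for its angular derivative, whose coefficients differ
  by the factor \<open>\<i>n\<close>.\<close>

lemma energy_eq_qform:
  assumes f: "integrable arc_length f" "integrable arc_length g"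
  shows "ennreal (4 * pi\<^sup>2) * energy (\<lambda>x. herg k f x + herg l g x)
    = (\<integral>\<^sup>+n. ennreal ((1 + (of_int n)\<^sup>2) * qform k l n (fcoeff n f) (fcoeff n g)) \<partial>count_space UNIV)"
proof -
  define h where "h = (\<lambda>x. herg k f x + herg l g x)"
  have C: "Ck m h" for m unfolding h_def by (intro Ck_add Ck_herg f)
  have hc: "continuous_on UNIV h" using C[of 0] by simp
  have ac: "continuous_on UNIV (ang_deriv h)" by (rule ang_deriv_continuous[OF C])
  have [measurable]: "h \<in> borel_measurable borel" "ang_deriv h \<in> borel_measurable borel"
    by (intro borel_measurable_continuous_onI hc ac)+
  have p: "angular_coeff n h x = fcoeff n f * mode k n x + fcoeff n g * mode l n x" for n x
  proof -
    have i: "integrable arc_length (\<lambda>\<eta>. herg k f (rot \<eta> x))" if "integrable arc_length f" for k f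
      by (intro integrable_arc_length_continuous continuous_on_compose2[OF herg_continuous[OF that]] continuous_intros) auto
    have "angular_coeff n h x = angular_coeff n (herg k f) x + angular_coeff n (herg l g) x"
      unfolding angular_coeff_def h_def by (intro fcoeff_add i f)
    then show ?thesis by (simp only: angular_coeff_herg[OF f(1)] angular_coeff_herg[OF f(2)])
  qed
  have q: "(\<integral>\<^sup>+x. ennreal (weight x * (norm (angular_coeff n h x))\<^sup>2) \<partial>lborel) = ennreal (qform k l n (fcoeff n f) (fcoeff n g))" for n
    unfolding p qform_eq_integral(2) by (intro nn_integral_eq_integral qform_eq_integral(1)) simp
  have q2: "(\<integral>\<^sup>+x. ennreal (weight x * (norm (angular_coeff n (ang_deriv h) x))\<^sup>2) \<partial>lborel) = ennreal ((of_int n)\<^sup>2 * qform k l n (fcoeff n f) (fcoeff n g))" for n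
  proof -
    have "weight x * (norm (angular_coeff n (ang_deriv h) x))\<^sup>2 = (of_int n)\<^sup>2 * (weight x * (norm (angular_coeff n h x))\<^sup>2)" for x
      unfolding angular_coeff_ang_deriv[OF C] by (simp add: norm_mult power_mult_distrib)
    then have "(\<integral>\<^sup>+x. ennreal (weight x * (norm (angular_coeff n (ang_deriv h) x))\<^sup>2) \<partial>lborel)
       = (\<integral>\<^sup>+x. ennreal ((of_int n)\<^sup>2) * ennreal (weight x * (norm (angular_coeff n h x))\<^sup>2) \<partial>lborel)"
      by (simp only: ennreal_mult'[OF zero_le_power2])
    also have "\<dots> = ennreal ((of_int n)\<^sup>2) * ennreal (qform k l n (fcoeff n f) (fcoeff n g))"
      unfolding q[symmetric] p by (rule nn_integral_cmult) measurable
    finally show ?thesis by (simp only: ennreal_mult'[OF zero_le_power2])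
  qed
  have "energy h = (\<integral>\<^sup>+x. ennreal (weight x * (norm (h x))\<^sup>2) + ennreal (weight x * (norm (ang_deriv h x))\<^sup>2) \<partial>lborel)"
    unfolding energy_def distrib_left by (intro nn_integral_cong ennreal_plus) auto
  also have "\<dots> = (\<integral>\<^sup>+x. ennreal (weight x * (norm (h x))\<^sup>2) \<partial>lborel) + (\<integral>\<^sup>+x. ennreal (weight x * (norm (ang_deriv h x))\<^sup>2) \<partial>lborel)"
    by (rule nn_integral_add) measurable
  finally have "ennreal (4 * pi\<^sup>2) * energy h
     = (\<integral>\<^sup>+n. ennreal (qform k l n (fcoeff n f) (fcoeff n g)) \<partial>count_space UNIV)
     + (\<integral>\<^sup>+n. ennreal ((of_int n)\<^sup>2 * qform k l n (fcoeff n f) (fcoeff n g)) \<partial>count_space UNIV)"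
    by (simp only: distrib_left weighted_parseval[OF hc, symmetric] weighted_parseval[OF ac, symmetric] q q2)
  also have "\<dots> = (\<integral>\<^sup>+n. ennreal (qform k l n (fcoeff n f) (fcoeff n g)) + ennreal ((of_int n)\<^sup>2 * qform k l n (fcoeff n f) (fcoeff n g)) \<partial>count_space UNIV)"
    by (rule nn_integral_add[symmetric]) auto
  also have "\<dots> = (\<integral>\<^sup>+n. ennreal ((1 + (of_int n)\<^sup>2) * qform k l n (fcoeff n f) (fcoeff n g)) \<partial>count_space UNIV)"
    by (intro nn_integral_cong) (simp add: distrib_right qform_nonneg ennreal_plus)
  finally show ?thesis unfolding h_def .
qed

text \<open>Sum the coefficientwise lower bound over \<open>n\<close> and apply Parseval to both densities.\<close>

theorem herg_pair_energy_lower: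
  assumes k: "k > 0" "l > 0" "k \<noteq> l"
  shows "\<exists>c>0. \<forall>f g. square_integrable arc_length f \<longrightarrow> square_integrable arc_length g \<longrightarrow>
    ennreal (c * (sq_norm f + sq_norm g)) \<le> energy (\<lambda>x. herg k f x + herg l g x)"
proof -
  obtain c where c: "c > 0" "\<And>n a b. c * ((norm a)\<^sup>2 + (norm b)\<^sup>2) \<le> (1 + (of_int n)\<^sup>2) * qform k l n a b"
    using qform_lower[OF k] by blast
  \<comment> \<open>\<open>2\<pi>\<close> is from Parseval, \<open>4\<pi>\<^sup>2\<close> from the diagonalised energy\<close>
  define d where "d = c * (2 * pi) / (4 * pi\<^sup>2)"
  have "ennreal (d * (sq_norm f + sq_norm g)) \<le> energy (\<lambda>x. herg k f x + herg l g x)"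
    if f: "square_integrable arc_length f" and g: "square_integrable arc_length g" for f g
  proof -
    have "ennreal (4 * pi\<^sup>2) * ennreal (d * (sq_norm f + sq_norm g)) = ennreal c * (ennreal (2 * pi * sq_norm f) + ennreal (2 * pi * sq_norm g))"
    proof -
      have "4 * pi\<^sup>2 * (d * (sq_norm f + sq_norm g)) = c * (2 * pi * sq_norm f + 2 * pi * sq_norm g)"
        by (simp add: d_def field_simps)
      then show ?thesis using c(1)
        by (simp add: ennreal_plus[symmetric] ennreal_mult'[symmetric] del: ennreal_plus)
    qed
    also have "\<dots> = ennreal c * (\<integral>\<^sup>+n. ennreal ((norm (fcoeff n f))\<^sup>2) + ennreal ((norm (fcoeff n g))\<^sup>2) \<partial>count_space UNIV)"
      unfolding parseval[OF f, symmetric] parseval[OF g, symmetric] by (subst nn_integral_add) auto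
    also have "\<dots> = (\<integral>\<^sup>+n. ennreal c * (ennreal ((norm (fcoeff n f))\<^sup>2) + ennreal ((norm (fcoeff n g))\<^sup>2)) \<partial>count_space UNIV)"
      by (rule nn_integral_cmult[symmetric]) simp
    also have "\<dots> \<le> (\<integral>\<^sup>+n. ennreal ((1 + (of_int n)\<^sup>2) * qform k l n (fcoeff n f) (fcoeff n g)) \<partial>count_space UNIV)"
    proof (rule nn_integral_mono)
      fix n
      have "ennreal c * (ennreal ((norm (fcoeff n f))\<^sup>2) + ennreal ((norm (fcoeff n g))\<^sup>2)) = ennreal (c * ((norm (fcoeff n f))\<^sup>2 + (norm (fcoeff n g))\<^sup>2))"
        using c(1) by (simp add: ennreal_plus[symmetric] ennreal_mult'[symmetric] del: ennreal_plus)
      also have "\<dots> \<le> ennreal ((1 + (of_int n)\<^sup>2) * qform k l n (fcoeff n f) (fcoeff n g))"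
        by (rule ennreal_leI[OF c(2)])
      finally show "ennreal c * (ennreal ((norm (fcoeff n f))\<^sup>2) + ennreal ((norm (fcoeff n g))\<^sup>2)) \<le> ennreal ((1 + (of_int n)\<^sup>2) * qform k l n (fcoeff n f) (fcoeff n g))" .
    qed
    also have "\<dots> = ennreal (4 * pi\<^sup>2) * energy (\<lambda>x. herg k f x + herg l g x)"
      by (rule energy_eq_qform[symmetric]; rule arc_length.square_integrable_integrable; fact)
    finally show ?thesis
      by (subst (asm) ennreal_mult_le_mult_iff) simp_all
  qed
  moreover have "d > 0" using c(1) by (simp add: d_def)
  ultimately show ?thesis by blast
qed

theorem herg_energy_upper:
  assumes k: "k > 0"
  shows "\<exists>C\<ge>0. \<forall>f. square_integrable arc_length f \<longrightarrow> energy (herg k f) \<le> ennreal (C * sq_norm f)"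
proof -
  obtain C where C: "C \<ge> 0" "\<And>n. (1 + (of_int n)\<^sup>2) * Re (gram n k k) \<le> C"
    using gram_diagonal_upper[OF k] by blast
  define D where "D = C * (2 * pi) / (4 * pi\<^sup>2)"
  have "energy (herg k f) \<le> ennreal (D * sq_norm f)" if f: "square_integrable arc_length f" for f
  proof -
    have fi: "integrable arc_length f" by (rule arc_length.square_integrable_integrable[OF f])
    have "(\<lambda>x. herg k f x + herg k (\<lambda>\<xi>. 0) x) = herg k f" by (simp add: herg_def fun_eq_iff)
    then have "ennreal (4 * pi\<^sup>2) * energy (herg k f) = (\<integral>\<^sup>+n. ennreal ((1 + (of_int n)\<^sup>2) * qform k k n (fcoeff n f) (fcoeff n (\<lambda>\<xi>. 0))) \<partial>count_space UNIV)"
      using energy_eq_qform[OF fi, of "\<lambda>\<xi>. 0" k k] by simp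
    also have "\<dots> \<le> (\<integral>\<^sup>+n. ennreal C * ennreal ((norm (fcoeff n f))\<^sup>2) \<partial>count_space UNIV)"
    proof (rule nn_integral_mono)
      fix n
      have "(1 + (of_int n)\<^sup>2) * qform k k n (fcoeff n f) (fcoeff n (\<lambda>\<xi>. 0)) = (1 + (of_int n)\<^sup>2) * Re (gram n k k) * (norm (fcoeff n f))\<^sup>2"
        by (simp add: qform_def fcoeff_def)
      also have "\<dots> \<le> C * (norm (fcoeff n f))\<^sup>2" by (intro mult_right_mono C(2)) simp
      finally show "ennreal ((1 + (of_int n)\<^sup>2) * qform k k n (fcoeff n f) (fcoeff n (\<lambda>\<xi>. 0))) \<le> ennreal C * ennreal ((norm (fcoeff n f))\<^sup>2)"
        using C(1) by (simp add: ennreal_mult'[symmetric] ennreal_leI)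
    qed
    also have "\<dots> = ennreal C * ennreal (2 * pi * sq_norm f)"
      unfolding parseval[OF f, symmetric] by (rule nn_integral_cmult) simp
    also have "\<dots> = ennreal (4 * pi\<^sup>2) * ennreal (D * sq_norm f)"
      using C(1) by (simp add: ennreal_mult'[symmetric]) (simp add: D_def power2_eq_square)
    finally show ?thesis
      by (subst (asm) ennreal_mult_le_mult_iff) simp_all
  qed
  moreover have "D \<ge> 0" using C(1) by (simp add: D_def)
  ultimately show ?thesis by blast
qed

section \<open>Riesz representation and reproducing kernels\<close>

lemma quadratic_nonneg_imp:
  fixes a b c :: real
  assumes "\<And>t. 0 \<le> a * t\<^sup>2 + 2 * b * t + c" "a > 0"
  shows "b\<^sup>2 \<le> a * c"
proof -
  have "0 \<le> a * (a * (- b / a)\<^sup>2 + 2 * b * (- b / a) + c)"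
    using assms(1)[of "- b / a"] assms(2) by (intro mult_nonneg_nonneg) auto
  also have "\<dots> = a * c - b\<^sup>2" using assms(2) by (simp add: field_simps power2_eq_square)
  finally show ?thesis by simp
qed

text \<open>The functional \<open>J v = \<parallel>v\<parallel>\<^sup>2 - 2 Re (l v)\<close> is bounded below. By the parallelogram identity its
  minimising sequences are Cauchy, and the derivative of \<open>J\<close> at the limit \<open>w\<close> vanishes, which says
  \<open>Re (l u) = Re (ip w u)\<close>. Replacing \<open>u\<close> by \<open>\<i>u\<close> gives the imaginary part.\<close>

theorem riesz_representation:
  fixes H :: "('x \<Rightarrow> complex^'d) set"
  assumes hs: "hilbert_function_space H ip"
    and l_add: "\<And>u v. u \<in> H \<Longrightarrow> v \<in> H \<Longrightarrow> l (\<lambda>x. u x + v x) = l u + l v"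
    and l_scale: "\<And>c u. u \<in> H \<Longrightarrow> l (\<lambda>x. c *s u x) = c * (l u :: complex)"
    and l_bound: "\<And>u. u \<in> H \<Longrightarrow> norm (l u) \<le> C * sqrt (Re (ip u u))"
  shows "\<exists>w\<in>H. \<forall>u\<in>H. l u = ip u w"
proof -
  define N where "N u = Re (ip u u)" for u
  have H0: "(\<lambda>x. 0) \<in> H" and H_add: "\<And>u v. u \<in> H \<Longrightarrow> v \<in> H \<Longrightarrow> (\<lambda>x. u x + v x) \<in> H"
    and H_scale: "\<And>c u. u \<in> H \<Longrightarrow> (\<lambda>x. c *s u x) \<in> H"
    and ip_add: "\<And>u v w. u \<in> H \<Longrightarrow> v \<in> H \<Longrightarrow> w \<in> H \<Longrightarrow> ip (\<lambda>x. u x + v x) w = ip u w + ip v w"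
    and ip_scale: "\<And>c u v. u \<in> H \<Longrightarrow> v \<in> H \<Longrightarrow> ip (\<lambda>x. c *s u x) v = c * ip u v"
    and ip_cnj: "\<And>u v. u \<in> H \<Longrightarrow> v \<in> H \<Longrightarrow> ip v u = cnj (ip u v)"
    and ip_nonneg: "\<And>u. u \<in> H \<Longrightarrow> 0 \<le> N u"
    and ip_zero: "\<And>u. u \<in> H \<Longrightarrow> ip u u = 0 \<Longrightarrow> u = (\<lambda>x. 0)"
    using hs unfolding hilbert_function_space_def N_def by blast+
  have complete: "\<exists>u\<in>H. (\<lambda>n. sqrt (N (\<lambda>x. s n x - u x))) \<longlonglongrightarrow> 0"
    if "\<And>n. s n \<in> H" "\<And>e. e > 0 \<Longrightarrow> \<exists>M. \<forall>m\<ge>M. \<forall>n\<ge>M. sqrt (N (\<lambda>x. s m x - s n x)) < e" for s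
    using hs that unfolding hilbert_function_space_def N_def by blast
  have ip_add2: "ip w (\<lambda>x. u x + v x) = ip w u + ip w v" if "u \<in> H" "v \<in> H" "w \<in> H" for u v w
    using ip_cnj[of "\<lambda>x. u x + v x" w] ip_cnj[of u w] ip_cnj[of v w] ip_add[OF that] H_add that by simp
  have ip_scale2: "ip w (\<lambda>x. c *s u x) = cnj c * ip w u" if "u \<in> H" "w \<in> H" for c u w
    using ip_cnj[of "\<lambda>x. c *s u x" w] ip_cnj[of u w] ip_scale[OF that] H_scale that by simp
  have N_comb: "N (\<lambda>x. u x + of_real t *s v x) = N u + 2 * t * Re (ip u v) + t\<^sup>2 * N v" if "u \<in> H" "v \<in> H" for u v t
  proof -
    have "ip (\<lambda>x. u x + of_real t *s v x) (\<lambda>x. u x + of_real t *s v x)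
        = ip u u + of_real t * ip u v + of_real t * ip v u + of_real (t\<^sup>2) * ip v v"
      using that H_scale[of v "of_real t"] H_add[of u "\<lambda>x. of_real t *s v x"]
      by (simp add: ip_add ip_add2 ip_scale ip_scale2 algebra_simps power2_eq_square)
    then show ?thesis using ip_cnj[OF that] by (simp add: N_def algebra_simps)
  qed
  have N_scale: "N (\<lambda>x. of_real t *s u x) = t\<^sup>2 * N u" if "u \<in> H" for u t
    using that by (simp add: N_def ip_scale ip_scale2 H_scale power2_eq_square mult.assoc[symmetric])
  have diff: "(\<lambda>x. u x - v x) = (\<lambda>x. u x + of_real (-1) *s v x)" for u v :: "'x \<Rightarrow> complex^'d"
    by (simp add: fun_eq_iff vec_eq_iff)
  have H_diff: "(\<lambda>x. u x - v x) \<in> H" if "u \<in> H" "v \<in> H" for u v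
    unfolding diff using that by (intro H_add H_scale)
  have CS: "(Re (ip u v))\<^sup>2 \<le> N v * N u" if uv: "u \<in> H" "v \<in> H" for u v
  proof (cases "N v = 0")
    case True
    moreover have "Im (ip v v) = 0" using ip_cnj[OF uv(2) uv(2)] by (metis complex_cnj cnj.sel(2) equal_neg_zero)
    ultimately have "v = (\<lambda>x. 0)" using ip_zero[OF uv(2)] by (simp add: N_def complex_eq_iff)
    then have "v = (\<lambda>x. 0 *s v x)" by simp
    then have "ip u v = 0" using ip_scale2[OF uv(2,1), of 0] by simp
    then show ?thesis using True by simp
  next
    case False
    then have "N v > 0" using ip_nonneg[OF uv(2)] by simp
    then show ?thesis
    proof (rule quadratic_nonneg_imp[rotated])
      fix t
      have "0 \<le> N (\<lambda>x. u x + of_real t *s v x)" using uv by (intro ip_nonneg H_add H_scale)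
      then show "0 \<le> N v * t\<^sup>2 + 2 * Re (ip u v) * t + N u" unfolding N_comb[OF uv] by (simp add: algebra_simps)
    qed
  qed
  define J where "J v = N v - 2 * Re (l v)" for v
  have J_comb: "J (\<lambda>x. u x + of_real t *s v x) = J u + 2 * t * (Re (ip u v) - Re (l v)) + t\<^sup>2 * N v" if "u \<in> H" "v \<in> H" for u v t
    using that by (simp add: J_def N_comb l_add l_scale H_scale algebra_simps)
  have J_lower: "- C\<^sup>2 \<le> J v" if "v \<in> H" for v
  proof -
    have "Re (l v) \<le> C * sqrt (N v)" using l_bound[OF that] complex_Re_le_cmod[of "l v"] by (simp add: N_def)
    moreover have "2 * C * sqrt (N v) \<le> C\<^sup>2 + (sqrt (N v))\<^sup>2" by (rule sum_squares_bound)
    ultimately show ?thesis using ip_nonneg[OF that] by (simp add: J_def)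
  qed
  define I where "I = Inf (J ` H)"
  have bb: "bdd_below (J ` H)" using J_lower by (intro bdd_belowI2)
  have I_le: "I \<le> J v" if "v \<in> H" for v unfolding I_def using bb that by (intro cInf_lower) auto
  have "\<exists>v\<in>H. J v < I + inverse (real (Suc n))" for n
  proof -
    have "Inf (J ` H) < I + inverse (real (Suc n))" by (simp add: I_def)
    then show ?thesis using cInf_less_iff[of "J ` H"] bb H0 by auto
  qed
  then obtain s where s: "\<And>n. s n \<in> H" "\<And>n. J (s n) < I + inverse (real (Suc n))" by metis
  have par: "N (\<lambda>x. s m x - s n x) \<le> 2 * inverse (real (Suc m)) + 2 * inverse (real (Suc n))" for m n
  proof -
    have d: "N (\<lambda>x. s m x - s n x) = N (s m) - 2 * Re (ip (s m) (s n)) + N (s n)"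
      unfolding diff N_comb[OF s(1) s(1)] by simp
    have "(\<lambda>x. of_real (1/2) *s (s m x + s n x)) \<in> H" by (intro H_scale H_add s)
    then have "I \<le> J (\<lambda>x. of_real (1/2) *s (s m x + s n x))" by (rule I_le)
    also have "J (\<lambda>x. of_real (1/2) *s (s m x + s n x)) = (N (s m) + 2 * Re (ip (s m) (s n)) + N (s n)) / 4 - Re (l (s m)) - Re (l (s n))"
    proof -
      have "N (\<lambda>x. of_real (1/2) *s (s m x + s n x)) = N (\<lambda>x. s m x + s n x) / 4"
        unfolding N_scale[OF H_add[OF s(1) s(1)]] by (simp add: power2_eq_square)
      moreover have "N (\<lambda>x. s m x + s n x) = N (s m) + 2 * Re (ip (s m) (s n)) + N (s n)"
        using N_comb[OF s(1)[of m] s(1)[of n], of 1] by simp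
      moreover have "Re (l (\<lambda>x. of_real (1/2) *s (s m x + s n x))) = (Re (l (s m)) + Re (l (s n))) / 2"
        unfolding l_scale[OF H_add[OF s(1) s(1)]] l_add[OF s(1) s(1)] by simp
      ultimately show ?thesis unfolding J_def by (simp only:) (simp add: field_simps)
    qed
    finally have "4 * I \<le> N (s m) + 2 * Re (ip (s m) (s n)) + N (s n) - 4 * Re (l (s m)) - 4 * Re (l (s n))"
      by (simp add: field_simps)
    moreover have "N (s m) - 2 * Re (l (s m)) < I + inverse (real (Suc m))" "N (s n) - 2 * Re (l (s n)) < I + inverse (real (Suc n))"
      using s(2)[of m] s(2)[of n] by (simp_all add: J_def)
    ultimately show ?thesis unfolding d by linarith
  qed
  obtain w where w: "w \<in> H" "(\<lambda>n. sqrt (N (\<lambda>x. s n x - w x))) \<longlonglongrightarrow> 0"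
  proof -
    have "\<exists>M. \<forall>m\<ge>M. \<forall>n\<ge>M. sqrt (N (\<lambda>x. s m x - s n x)) < e" if "e > 0" for e
    proof -
      obtain M where M: "inverse (real (Suc M)) < e\<^sup>2 / 4" using reals_Archimedean[of "e\<^sup>2 / 4"] \<open>e > 0\<close> by auto
      show ?thesis
      proof (intro exI allI impI)
        fix m n assume "m \<ge> M" "n \<ge> M"
        then have "inverse (real (Suc m)) \<le> inverse (real (Suc M))" "inverse (real (Suc n)) \<le> inverse (real (Suc M))"
          by (auto intro!: le_imp_inverse_le)
        then have "N (\<lambda>x. s m x - s n x) < e\<^sup>2" using par[of m n] M by linarith
        then show "sqrt (N (\<lambda>x. s m x - s n x)) < e" using \<open>e > 0\<close> real_less_rsqrt real_sqrt_less_iff by (metis abs_of_pos real_sqrt_abs)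
      qed
    qed
    from complete[OF s(1) this] show ?thesis using that by blast
  qed
  have lim: "Re (l u) = Re (ip w u)" if u: "u \<in> H" for u
  proof -
    \<comment> \<open>half the derivative of \<open>J\<close> at \<open>s n\<close> in direction \<open>u\<close>, small because \<open>s n\<close> nearly minimises \<open>J\<close>\<close>
    define D where "D n = Re (ip (s n) u) - Re (l u)" for n
    have D: "(D n)\<^sup>2 \<le> (N u + 1) * inverse (real (Suc n))" for n
    proof (rule quadratic_nonneg_imp)
      show "0 < N u + 1" using ip_nonneg[OF u] by simp
      fix t
      have "I \<le> J (\<lambda>x. s n x + of_real t *s u x)" by (intro I_le H_add H_scale s u)
      also have "\<dots> = J (s n) + 2 * t * D n + t\<^sup>2 * N u" unfolding J_comb[OF s(1) u] D_def ..
      finally have "0 \<le> t\<^sup>2 * N u + 2 * t * D n + inverse (real (Suc n))" using s(2)[of n] by linarith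
      moreover have "(N u + 1) * t\<^sup>2 + 2 * D n * t + inverse (real (Suc n)) = (t\<^sup>2 * N u + 2 * t * D n + inverse (real (Suc n))) + t\<^sup>2"
        by (simp add: algebra_simps)
      ultimately show "0 \<le> (N u + 1) * t\<^sup>2 + 2 * D n * t + inverse (real (Suc n))"
        using zero_le_power2[of t] by linarith
    qed
    have D0: "(\<lambda>n. (D n)\<^sup>2) \<longlonglongrightarrow> 0"
    proof (rule tendsto_sandwich[OF _ _ tendsto_const])
      show "\<forall>\<^sub>F n in sequentially. (D n)\<^sup>2 \<le> (N u + 1) * inverse (real (Suc n))" using D by simp
      show "(\<lambda>n. (N u + 1) * inverse (real (Suc n))) \<longlonglongrightarrow> 0"
        by (rule tendsto_mult_right_zero[OF LIMSEQ_inverse_real_of_nat])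
    qed simp
    have E: "(Re (ip (s n) u) - Re (ip w u))\<^sup>2 \<le> N u * N (\<lambda>x. s n x - w x)" for n
    proof -
      have "ip (\<lambda>x. s n x - w x) u = ip (s n) u - ip w u"
        unfolding diff using s(1) w(1) u H_scale[OF w(1), of "of_real (-1)"] by (simp only: ip_add ip_scale) simp
      then show ?thesis using CS[OF H_diff[OF s(1) w(1)] u, of n] by simp
    qed
    have E0: "(\<lambda>n. (Re (ip (s n) u) - Re (ip w u))\<^sup>2) \<longlonglongrightarrow> 0"
    proof (rule tendsto_sandwich[OF _ _ tendsto_const])
      show "\<forall>\<^sub>F n in sequentially. (Re (ip (s n) u) - Re (ip w u))\<^sup>2 \<le> N u * N (\<lambda>x. s n x - w x)" using E by simp
      have "(\<lambda>n. (sqrt (N (\<lambda>x. s n x - w x)))\<^sup>2) \<longlonglongrightarrow> 0\<^sup>2" by (intro tendsto_power w(2))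
      moreover have "(sqrt (N (\<lambda>x. s n x - w x)))\<^sup>2 = N (\<lambda>x. s n x - w x)" for n
        using ip_nonneg[OF H_diff[OF s(1) w(1)]] by simp
      ultimately show "(\<lambda>n. N u * N (\<lambda>x. s n x - w x)) \<longlonglongrightarrow> 0"
        by (intro tendsto_mult_right_zero) simp
    qed simp
    have "D \<longlonglongrightarrow> 0" "(\<lambda>n. Re (ip (s n) u) - Re (ip w u)) \<longlonglongrightarrow> 0"
      using tendsto_real_sqrt[OF D0] tendsto_real_sqrt[OF E0] by (simp_all add: tendsto_rabs_zero_iff)
    from tendsto_diff[OF this] show ?thesis by (simp add: D_def LIMSEQ_const_iff)
  qed
  have "l u = ip u w" if u: "u \<in> H" for u
  proof -
    have "Re (l u) = Re (ip w u)" by (rule lim[OF u])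
    moreover have "Re (l (\<lambda>x. \<i> *s u x)) = Re (ip w (\<lambda>x. \<i> *s u x))" by (rule lim[OF H_scale[OF u]])
    then have "Im (l u) = - Im (ip w u)" by (simp add: l_scale[OF u] ip_scale2[OF u w(1)])
    ultimately show ?thesis using ip_cnj[OF w(1) u] by (simp add: complex_eq_iff)
  qed
  then show ?thesis using w(1) by blast
qed

text \<open>The columns of \<open>\<Gamma> x\<close> are the Riesz representers of the coordinates of the evaluation at \<open>x\<close>.\<close>

theorem bounded_evaluation_imp_reproducing_kernel:
  fixes H :: "('x \<Rightarrow> complex^'d) set"
  assumes hs: "hilbert_function_space H ip"
    and ev: "\<And>x. \<exists>C. \<forall>u\<in>H. norm (u x) \<le> C * sqrt (Re (ip u u))"
  shows "reproducing_kernel_hilbert_space H ip"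
proof -
  have H0: "(\<lambda>x. 0) \<in> H" and H_add: "\<And>u v. u \<in> H \<Longrightarrow> v \<in> H \<Longrightarrow> (\<lambda>x. u x + v x) \<in> H"
    and H_scale: "\<And>c u. u \<in> H \<Longrightarrow> (\<lambda>x. c *s u x) \<in> H"
    and ip_add: "\<And>u v w. u \<in> H \<Longrightarrow> v \<in> H \<Longrightarrow> w \<in> H \<Longrightarrow> ip (\<lambda>x. u x + v x) w = ip u w + ip v w"
    and ip_scale: "\<And>c u v. u \<in> H \<Longrightarrow> v \<in> H \<Longrightarrow> ip (\<lambda>x. c *s u x) v = c * ip u v"
    and ip_cnj: "\<And>u v. u \<in> H \<Longrightarrow> v \<in> H \<Longrightarrow> ip v u = cnj (ip u v)"
    using hs unfolding hilbert_function_space_def by blast+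
  have "\<exists>w\<in>H. \<forall>u\<in>H. u x $ j = ip u w" for x j
  proof -
    obtain C where C: "\<And>u. u \<in> H \<Longrightarrow> norm (u x) \<le> C * sqrt (Re (ip u u))" using ev[of x] by blast
    show ?thesis
    proof (rule riesz_representation[OF hs, where C = C])
      show "norm (u x $ j) \<le> C * sqrt (Re (ip u u))" if "u \<in> H" for u
        by (rule order_trans[OF Finite_Cartesian_Product.norm_nth_le C[OF that]])
    qed simp_all
  qed
  then obtain R where R: "\<And>x j. R x j \<in> H" "\<And>x j u. u \<in> H \<Longrightarrow> u x $ j = ip u (R x j)" by metis
  define \<Gamma> where "\<Gamma> x y = (\<chi> i j. R x j y $ i)" for x y
  have mv: "(\<lambda>y. \<Gamma> x y *v z) = (\<lambda>y. \<Sum>j\<in>UNIV. (z $ j) *s R x j y)" for x z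
    by (auto simp: fun_eq_iff vec_eq_iff matrix_vector_mult_def \<Gamma>_def mult.commute)
  have sum: "(\<lambda>y. \<Sum>j\<in>A. (z $ j) *s R x j y) \<in> H \<and>
      (\<forall>u\<in>H. ip u (\<lambda>y. \<Sum>j\<in>A. (z $ j) *s R x j y) = (\<Sum>j\<in>A. u x $ j * cnj (z $ j)))" if "finite A" for A x z
    using that
  proof (induction A)
    case empty
    have "ip u (\<lambda>y. 0) = 0" if "u \<in> H" for u
      using ip_cnj[OF H0 that] ip_scale[OF H0 that, of 0] by simp
    then show ?case using H0 by simp
  next
    case (insert j A)
    let ?S = "\<lambda>y. \<Sum>j\<in>A. (z $ j) *s R x j y"
    have S: "?S \<in> H" and Su: "\<And>u. u \<in> H \<Longrightarrow> ip u ?S = (\<Sum>j\<in>A. u x $ j * cnj (z $ j))" using insert.IH by auto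
    have z: "(\<lambda>y. (z $ j) *s R x j y) \<in> H" by (intro H_scale R)
    have zS: "(\<lambda>y. (z $ j) *s R x j y + ?S y) \<in> H" by (intro H_add z S)
    have "ip u (\<lambda>y. (z $ j) *s R x j y + ?S y) = u x $ j * cnj (z $ j) + (\<Sum>j\<in>A. u x $ j * cnj (z $ j))" if u: "u \<in> H" for u
    proof -
      have "ip u (\<lambda>y. (z $ j) *s R x j y + ?S y) = cnj (z $ j * ip (R x j) u + ip ?S u)"
        by (simp only: ip_cnj[OF zS u] ip_add[OF z S u] ip_scale[OF R(1) u])
      also have "\<dots> = ip u (R x j) * cnj (z $ j) + ip u ?S"
        using ip_cnj[OF R(1) u] ip_cnj[OF S u] by (simp add: mult.commute)
      finally show ?thesis by (simp add: R(2)[OF u] Su[OF u])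
    qed
    then show ?case using insert.hyps zS by simp
  qed
  have "(\<lambda>y. \<Gamma> x y *v z) \<in> H" "\<forall>u\<in>H. cdot (u x) (vcnj z) = ip u (\<lambda>y. \<Gamma> x y *v z)" for x z
    unfolding mv using sum[of UNIV z x] by (simp_all add: cdot_def vcnj_def)
  then show ?thesis unfolding reproducing_kernel_hilbert_space_def using hs by blast
qed

section \<open>Smooth radial cutoffs\<close>

lemma Ck_imp_continuous: "Ck m f \<Longrightarrow> continuous_on UNIV f"
  by (cases m) (auto intro!: continuous_at_imp_continuous_on differentiable_imp_continuous_within)

lemma Ck_Suc_imp_Ck: "Ck (Suc m) f \<Longrightarrow> Ck m f"
proof (induction m arbitrary: f)
  case 0
  then show ?case using Ck_imp_continuous[of "Suc 0" f] by simp
next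
  case (Suc m)
  then have "\<forall>x. f differentiable at x" "\<forall>j. Ck (Suc m) (partial j f)" by simp_all
  then show ?case using Suc.IH by simp
qed

lemma partial_eqI: "(f has_derivative D) (at x) \<Longrightarrow> partial j f x = D (axis j 1)"
  using frechet_derivative_at[of f D x] by (simp add: partial_def)

lemma Ck_const: "Ck m (\<lambda>x. c)"
proof (induction m arbitrary: c)
  case (Suc m)
  have "partial j (\<lambda>x. c) = (\<lambda>x. 0)" for j by (intro ext partial_eqI[where D = "\<lambda>_. 0"]) simp
  then show ?case using Suc by simp
qed simp

lemma Ck_bounded_linear:
  assumes L: "bounded_linear L"
  shows "Ck m f \<Longrightarrow> Ck m (\<lambda>x. L (f x))"
proof (induction m arbitrary: f)
  case 0
  then show ?case by (simp add: bounded_linear.continuous_on[OF L])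
next
  case (Suc m)
  have d: "f differentiable at x" for x using Suc.prems by simp
  have hd: "((\<lambda>x. L (f x)) has_derivative (\<lambda>h. L (frechet_derivative f (at x) h))) (at x)" for x
    by (rule bounded_linear.has_derivative[OF L frechet_derivative_works[THEN iffD1, OF d]])
  have "partial j (\<lambda>x. L (f x)) = (\<lambda>x. L (partial j f x))" for j
    by (intro ext) (simp add: partial_eqI[OF hd] partial_def)
  then show ?case using Suc differentiableI[OF hd] by simp
qed

lemma Ck_linear:
  assumes L: "bounded_linear L"
  shows "Ck m L"
proof (cases m)
  case 0
  then show ?thesis by (simp add: linear_continuous_on[OF L])
next
  case (Suc k)
  have hd: "(L has_derivative L) (at x)" for x by (rule bounded_linear_imp_has_derivative[OF L])
  have "partial j L = (\<lambda>x. L (axis j 1))" for j by (intro ext partial_eqI[OF hd])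
  then show ?thesis using Suc differentiableI[OF hd] by (simp add: Ck_const)
qed

lemma Ck_scaleR: "Ck m \<phi> \<Longrightarrow> Ck m v \<Longrightarrow> Ck m (\<lambda>x. \<phi> x *\<^sub>R v x)"
proof (induction m arbitrary: \<phi> v)
  case 0
  then show ?case by (auto intro: continuous_on_scaleR)
next
  case (Suc m)
  have d: "\<phi> differentiable at x" "v differentiable at x" for x using Suc.prems by simp_all
  have hd: "((\<lambda>x. \<phi> x *\<^sub>R v x) has_derivative (\<lambda>h. \<phi> x *\<^sub>R frechet_derivative v (at x) h + frechet_derivative \<phi> (at x) h *\<^sub>R v x)) (at x)" for x
    by (intro has_derivative_scaleR frechet_derivative_works[THEN iffD1] d)
  have "partial j (\<lambda>x. \<phi> x *\<^sub>R v x) = (\<lambda>x. \<phi> x *\<^sub>R partial j v x + partial j \<phi> x *\<^sub>R v x)" for j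
    by (intro ext) (simp add: partial_eqI[OF hd] partial_def)
  moreover have "Ck m (\<lambda>x. \<phi> x *\<^sub>R partial j v x + partial j \<phi> x *\<^sub>R v x)" for j
    using Suc.prems Ck_Suc_imp_Ck[OF Suc.prems(1)] Ck_Suc_imp_Ck[OF Suc.prems(2)]
    by (intro Ck_add Suc.IH) simp_all
  ultimately show ?case using differentiableI[OF hd] by simp
qed

text \<open>A family containing \<open>exp(-1/t)\<close>, extended by zero, whose linear span is closed under differentiation.\<close>

definition expinv :: "nat \<Rightarrow> real \<Rightarrow> real" where
  "expinv m t = (if t > 0 then (1 / t) ^ m * exp (- (1 / t)) else 0)"

lemma expinv_deriv: "(expinv m has_real_derivative - real m * expinv (Suc m) t + expinv (m + 2) t) (at t)"
proof (cases t "0::real" rule: linorder_cases)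
  case greater
  define y where "y = 1 / t"
  have d: "((\<lambda>t. 1 / t) has_real_derivative - y\<^sup>2) (at t)"
    using greater by (auto intro!: derivative_eq_intros simp: y_def power2_eq_square)
  have e: "((\<lambda>t. exp (- (1 / t))) has_real_derivative exp (- y) * y\<^sup>2) (at t)"
    using DERIV_chain2[OF DERIV_exp DERIV_minus[OF d]] by (simp add: y_def)
  have "((\<lambda>t. (1 / t) ^ m * exp (- (1 / t))) has_real_derivative
      real m * (- y\<^sup>2 * y ^ (m - Suc 0)) * exp (- y) + exp (- y) * y\<^sup>2 * y ^ m) (at t)"
    using DERIV_mult[OF DERIV_power[OF d, of m] e] by (simp add: y_def)
  also have "real m * (- y\<^sup>2 * y ^ (m - Suc 0)) * exp (- y) + exp (- y) * y\<^sup>2 * y ^ m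
     = - real m * expinv (Suc m) t + expinv (m + 2) t"
    using greater by (cases m) (simp_all add: expinv_def y_def[symmetric] power2_eq_square algebra_simps)
  finally show ?thesis
    by (rule DERIV_cong_ev[THEN iffD1, rotated 3])
       (use greater eventually_nhds_in_open[of "{0<..}" t] in \<open>auto elim!: eventually_mono simp: expinv_def\<close>)
next
  case less
  have "((\<lambda>t. 0) has_real_derivative 0) (at t)" by simp
  then have "(expinv m has_real_derivative 0) (at t)"
    by (rule DERIV_cong_ev[THEN iffD1, rotated 3])
       (use less eventually_nhds_in_open[of "{..<0}" t] in \<open>auto elim!: eventually_mono simp: expinv_def\<close>)
  then show ?thesis using less by (simp add: expinv_def)
next
  case equal
  have r: "((\<lambda>h. expinv m h / h) \<longlongrightarrow> 0) (at_right 0)"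
  proof -
    have "((\<lambda>h::real. (inverse h) ^ Suc m / exp (inverse h)) \<longlongrightarrow> 0) (at_right 0)"
      by (rule filterlim_compose[OF tendsto_power_div_exp_0 filterlim_inverse_at_top_right])
    moreover have "\<forall>\<^sub>F h::real in at_right 0. (inverse h) ^ Suc m / exp (inverse h) = expinv m h / h"
      using eventually_at_right_less[of 0]
      by eventually_elim (simp add: expinv_def exp_minus inverse_eq_divide field_simps)
    ultimately show ?thesis by (rule Lim_transform_eventually)
  qed
  have l: "((\<lambda>h. expinv m h / h) \<longlongrightarrow> 0) (at_left 0)"
  proof (rule tendsto_eventually)
    show "\<forall>\<^sub>F h::real in at_left 0. expinv m h / h = 0"
      using eventually_at_left_field[of _ "0::real"] by (auto simp: eventually_at_left_field expinv_def intro: exI[of _ "-1"])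
  qed
  have "((\<lambda>h. (expinv m (0 + h) - expinv m 0) / h) \<longlongrightarrow> 0) (at 0)"
    using filterlim_split_at[OF l r] by (simp add: expinv_def[of _ 0])
  then have "(expinv m has_real_derivative 0) (at 0)" by (simp only: DERIV_def)
  then show ?thesis using equal by (simp add: expinv_def)
qed

text \<open>Normalised to be 1 at the origin, so that it tends to 1 pointwise as \<open>R\<close> grows. The support is the ball of
  radius \<open>Suc R\<close>, which is positive also for \<open>R = 0\<close>.\<close>

definition cutoff :: "nat \<Rightarrow> real^2 \<Rightarrow> real" where
  "cutoff R x = exp 1 * expinv 0 (1 - (norm x)\<^sup>2 / (real (Suc R))\<^sup>2)"

text \<open>Induction on the order for the whole family at once: each partial derivative is a linear function times a
  combination of two members of the family.\<close>

lemma Ck_expinv_radial: "Ck k (\<lambda>x::real^2. expinv m (1 - c * (x \<bullet> x)))"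
proof (induction k arbitrary: m)
  case 0
  have "continuous_on UNIV (expinv m)"
    using DERIV_isCont[OF expinv_deriv] continuous_at_imp_continuous_on by blast
  then show ?case by (auto intro!: continuous_on_compose2[of UNIV "expinv m"] continuous_intros)
next
  case (Suc k)
  let ?f = "\<lambda>x::real^2. expinv m (1 - c * (x \<bullet> x))" and ?q = "\<lambda>x::real^2. 1 - c * (x \<bullet> x)"
  let ?e = "\<lambda>x. - real m * expinv (Suc m) (?q x) + expinv (m + 2) (?q x)"
  have hq: "(?q has_derivative (\<lambda>h. - 2 * c * (x \<bullet> h))) (at x)" for x
    by (auto intro!: derivative_eq_intros simp: inner_commute algebra_simps)
  have hd: "(?f has_derivative (\<lambda>h. (- 2 * c * (x \<bullet> h)) * ?e x)) (at x)" for x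
    using has_derivative_compose[OF hq expinv_deriv[of m "?q x", unfolded has_field_derivative_def]]
    by (simp add: mult.commute)
  have "partial j ?f = (\<lambda>x. (- 2 * c * x $ j) *\<^sub>R ?e x)" for j
    by (intro ext) (simp add: partial_eqI[OF hd] inner_axis)
  moreover have "Ck k (\<lambda>x. (- 2 * c * x $ j) *\<^sub>R ?e x)" for j
  proof (intro Ck_scaleR Ck_add)
    show "Ck k (\<lambda>x. - 2 * c * x $ j)"
      by (rule Ck_linear) (intro bounded_linear_mult_right[THEN bounded_linear_compose] bounded_linear_vec_nth)
    show "Ck k (\<lambda>x::real^2. - real m * expinv (Suc m) (?q x))"
      by (rule Ck_bounded_linear[OF bounded_linear_mult_right]) (rule Suc.IH)
    show "Ck k (\<lambda>x::real^2. expinv (m + 2) (?q x))" by (rule Suc.IH)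
  qed
  ultimately show ?case using differentiableI[OF hd] by simp
qed

lemma Ck_cutoff: "Ck k (cutoff R)"
proof -
  have "Ck k (\<lambda>x::real^2. exp 1 * expinv 0 (1 - 1 / (real (Suc R))\<^sup>2 * (x \<bullet> x)))"
    by (rule Ck_bounded_linear[OF bounded_linear_mult_right Ck_expinv_radial])
  then show ?thesis by (simp add: cutoff_def[abs_def] power2_norm_eq_inner)
qed

lemma cutoff_range: "0 \<le> cutoff R x" "cutoff R x \<le> 1"
proof -
  have e: "expinv 0 t \<le> exp (- 1)" if "t \<le> 1" for t
    using that by (auto simp: expinv_def field_simps)
  have "exp 1 * expinv 0 (1 - (norm x)\<^sup>2 / (real (Suc R))\<^sup>2) \<le> exp 1 * exp (- 1)"
    by (intro mult_left_mono e) auto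
  then show "cutoff R x \<le> 1" by (simp add: cutoff_def exp_minus)
  show "0 \<le> cutoff R x" by (simp add: cutoff_def expinv_def)
qed

lemma cutoff_support: "x \<notin> cball 0 (real (Suc R)) \<Longrightarrow> cutoff R x = 0"
proof -
  assume "x \<notin> cball 0 (real (Suc R))"
  then have "real (Suc R) < norm x" by simp
  then have "(real (Suc R))\<^sup>2 < (norm x)\<^sup>2" by (intro power_strict_mono) auto
  then have "1 < (norm x)\<^sup>2 / (real (Suc R))\<^sup>2" by (simp add: less_divide_eq)
  then show ?thesis by (simp add: cutoff_def expinv_def)
qed

lemma cutoff_tendsto: "(\<lambda>R. cutoff R x) \<longlonglongrightarrow> 1"
proof -
  have "(\<lambda>R. 1 - (norm x)\<^sup>2 * (inverse (real (Suc R)))\<^sup>2) \<longlonglongrightarrow> 1 - (norm x)\<^sup>2 * 0\<^sup>2"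
    by (intro tendsto_intros LIMSEQ_inverse_real_of_nat)
  then have t: "(\<lambda>R. 1 - (norm x)\<^sup>2 / (real (Suc R))\<^sup>2) \<longlonglongrightarrow> 1"
    by (simp add: power_inverse divide_inverse)
  have "isCont (expinv 0) 1" by (rule DERIV_isCont[OF expinv_deriv])
  from isCont_tendsto_compose[OF this t]
  have "(\<lambda>R. exp 1 * expinv 0 (1 - (norm x)\<^sup>2 / (real (Suc R))\<^sup>2)) \<longlonglongrightarrow> exp 1 * expinv 0 1"
    by (intro tendsto_mult tendsto_const)
  then show ?thesis by (simp add: cutoff_def expinv_def exp_minus)
qed

lemma cutoff_rot: "\<eta> \<in> sphere 0 1 \<Longrightarrow> cutoff R (rot \<eta> x) = cutoff R x"
  by (simp add: cutoff_def)

section \<open>The angular gradient in Cartesian components\<close>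

lemma polar_eq_rot: "polar r \<theta> = rot (polar 1 \<theta>) (r *\<^sub>R axis 1 1)"
  by (simp add: vec2_eq_iff axis_def)

lemma ang_deriv_eqI:
  assumes "\<And>y. v differentiable at y"
    and "((\<lambda>\<theta>. v (rot (polar 1 \<theta>) x)) has_vector_derivative D) (at 0)"
  shows "ang_deriv v x = D"
proof -
  have "rot (polar 1 0) x = x" by (simp add: vec2_eq_iff)
  then show ?thesis
    using vector_derivative_unique_at[OF vector_derivative_rot_polar[OF assms(1), of x 0 UNIV] assms(2)] by simp
qed

text \<open>Radial functions are constants for the angular derivative.\<close>

lemma ang_deriv_cutoff:
  assumes v: "\<And>y. v differentiable at y"
  shows "ang_deriv (\<lambda>x. cutoff R x *\<^sub>R v x) x = cutoff R x *\<^sub>R ang_deriv v x"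
proof (rule ang_deriv_eqI)
  have c: "cutoff R differentiable at y" for y using Ck_cutoff[of 1 R] by simp
  show "(\<lambda>x. cutoff R x *\<^sub>R v x) differentiable at y" for y by (intro differentiable_scaleR c v)
  have e: "(\<lambda>\<theta>. cutoff R (rot (polar 1 \<theta>) x) *\<^sub>R v (rot (polar 1 \<theta>) x)) = (\<lambda>\<theta>. cutoff R x *\<^sub>R v (rot (polar 1 \<theta>) x))"
    by (simp add: cutoff_rot)
  have "rot (polar 1 0) x = x" by (simp add: vec2_eq_iff)
  then have "((\<lambda>\<theta>. v (rot (polar 1 \<theta>) x)) has_vector_derivative ang_deriv v x) (at 0)"
    using vector_derivative_rot_polar[OF v, of x 0 UNIV] by simp
  then show "((\<lambda>\<theta>. cutoff R (rot (polar 1 \<theta>) x) *\<^sub>R v (rot (polar 1 \<theta>) x)) has_vector_derivative cutoff R x *\<^sub>R ang_deriv v x) (at 0)"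
    unfolding e by (rule bounded_linear.has_vector_derivative[OF bounded_linear_scaleR_right])
qed

definition angle_dir :: "real^2 \<Rightarrow> complex^2" where
  "angle_dir x = cvec (phi_hat (Arg (Complex (x $ 1) (x $ 2))))"

lemma polar_norm_Arg: "polar (norm x) (Arg (Complex (x $ 1) (x $ 2))) = x"
proof -
  have "Complex (x $ 1) (x $ 2) = rcis (norm x) (Arg (Complex (x $ 1) (x $ 2)))"
    using rcis_cmod_Arg[of "Complex (x $ 1) (x $ 2)"] by (simp add: cmod_def norm_vec2)
  then have "x $ 1 = norm x * cos (Arg (Complex (x $ 1) (x $ 2)))" "x $ 2 = norm x * sin (Arg (Complex (x $ 1) (x $ 2)))"
    by (metis Re_rcis complex.sel(1), metis Im_rcis complex.sel(2))
  then show ?thesis by (simp add: vec2_eq_iff)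
qed

text \<open>The terms \<open>-u\<^sup>\<phi>\<close> and \<open>u\<^sup>r\<close> in the definition cancel the derivatives of the moving frame. What
  remains are the components of \<open>ang_deriv u\<close> in that frame.\<close>

theorem angular_gradient_eq:
  assumes u: "\<And>y. u differentiable at y"
  shows "angular_gradient u x = tensor (angle_dir x) (ang_deriv u x)"
proof -
  define \<phi> where "\<phi> = Arg (Complex (x $ 1) (x $ 2))"
  define r where "r = norm x"
  have x: "polar r \<phi> = x" unfolding r_def \<phi>_def by (rule polar_norm_Arg)
  have U: "((\<lambda>\<theta>. u (polar r \<theta>)) has_vector_derivative ang_deriv u x) (at \<phi>)"
    using vector_derivative_rot_polar[OF u, of "r *\<^sub>R axis 1 1" \<phi> UNIV] unfolding polar_eq_rot[symmetric] x by simp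
  have Uj: "((\<lambda>\<theta>. u (polar r \<theta>) $ j) has_vector_derivative ang_deriv u x $ j) (at \<phi>)" for j
    by (rule bounded_linear.has_vector_derivative[OF bounded_linear_vec_nth U])
  have dc: "((\<lambda>\<theta>. complex_of_real (cos \<theta>)) has_vector_derivative of_real (- sin \<phi>)) (at \<phi>)"
    "((\<lambda>\<theta>. complex_of_real (sin \<theta>)) has_vector_derivative of_real (cos \<phi>)) (at \<phi>)"
    by (intro has_vector_derivative_of_real; auto simp: has_real_derivative_iff_has_vector_derivative[symmetric] intro!: derivative_eq_intros)+
  define a b where "a = ang_deriv u x $ 1" and "b = ang_deriv u x $ 2"
  have r1: "r_hat \<phi> $ 1 = cos \<phi>" "r_hat \<phi> $ 2 = sin \<phi>" "phi_hat \<phi> $ 1 = - sin \<phi>" "phi_hat \<phi> $ 2 = cos \<phi>" for \<phi>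
    by (simp_all add: r_hat_def phi_hat_def)
  have ur: "u_r u r = (\<lambda>\<theta>. u (polar r \<theta>) $ 1 * of_real (cos \<theta>) + u (polar r \<theta>) $ 2 * of_real (sin \<theta>))"
    by (simp add: fun_eq_iff u_r_def cdot_def cvec_def sum_2 r1)
  have up: "u_phi u r = (\<lambda>\<theta>. u (polar r \<theta>) $ 2 * of_real (cos \<theta>) - u (polar r \<theta>) $ 1 * of_real (sin \<theta>))"
    by (simp add: fun_eq_iff u_phi_def cdot_def cvec_def sum_2 r1)
  have "(u_r u r has_vector_derivative (u (polar r \<phi>) $ 1 * of_real (- sin \<phi>) + a * of_real (cos \<phi>)) + (u (polar r \<phi>) $ 2 * of_real (cos \<phi>) + b * of_real (sin \<phi>))) (at \<phi>)"
    unfolding ur a_def b_def by (intro has_vector_derivative_add has_vector_derivative_mult Uj dc)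
  then have R: "vector_derivative (u_r u r) (at \<phi>) - u_phi u r \<phi> = a * of_real (cos \<phi>) + b * of_real (sin \<phi>)"
    by (simp add: vector_derivative_at up algebra_simps)
  have "(u_phi u r has_vector_derivative (u (polar r \<phi>) $ 2 * of_real (- sin \<phi>) + b * of_real (cos \<phi>)) - (u (polar r \<phi>) $ 1 * of_real (cos \<phi>) + a * of_real (sin \<phi>))) (at \<phi>)"
    unfolding up a_def b_def by (intro has_vector_derivative_diff has_vector_derivative_mult Uj dc)
  then have P: "vector_derivative (u_phi u r) (at \<phi>) + u_r u r \<phi> = b * of_real (cos \<phi>) - a * of_real (sin \<phi>)"
    by (simp add: vector_derivative_at ur algebra_simps)
  have sc: "(complex_of_real (sin \<phi>))\<^sup>2 + (complex_of_real (cos \<phi>))\<^sup>2 = 1"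
    by (simp flip: of_real_power of_real_add)
  have 1: "(a * of_real (cos \<phi>) + b * of_real (sin \<phi>)) * of_real (cos \<phi>) + (b * of_real (cos \<phi>) - a * of_real (sin \<phi>)) * of_real (- sin \<phi>) = a"
  proof -
    have "(a * of_real (cos \<phi>) + b * of_real (sin \<phi>)) * of_real (cos \<phi>) + (b * of_real (cos \<phi>) - a * of_real (sin \<phi>)) * of_real (- sin \<phi>)
      = a * ((complex_of_real (sin \<phi>))\<^sup>2 + (complex_of_real (cos \<phi>))\<^sup>2)"
      unfolding of_real_minus by algebra
    then show ?thesis unfolding sc by simp
  qed
  have 2: "(a * of_real (cos \<phi>) + b * of_real (sin \<phi>)) * of_real (sin \<phi>) + (b * of_real (cos \<phi>) - a * of_real (sin \<phi>)) * of_real (cos \<phi>) = b"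
  proof -
    have "(a * of_real (cos \<phi>) + b * of_real (sin \<phi>)) * of_real (sin \<phi>) + (b * of_real (cos \<phi>) - a * of_real (sin \<phi>)) * of_real (cos \<phi>)
      = b * ((complex_of_real (sin \<phi>))\<^sup>2 + (complex_of_real (cos \<phi>))\<^sup>2)"
      by algebra
    then show ?thesis unfolding sc by simp
  qed
  have "angular_gradient u x $ i $ j = cvec (phi_hat \<phi>) $ i * ((a * of_real (cos \<phi>) + b * of_real (sin \<phi>)) * cvec (r_hat \<phi>) $ j
      + (b * of_real (cos \<phi>) - a * of_real (sin \<phi>)) * cvec (phi_hat \<phi>) $ j)" for i j
    unfolding angular_gradient_def angular_gradient_polar_def r_def[symmetric] \<phi>_def[symmetric]
    by (simp only: vec_lambda_beta R P tensor_def) (simp only: algebra_simps)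
  then have "angular_gradient u x $ i $ j = cvec (phi_hat \<phi>) $ i * ang_deriv u x $ j" for i j
    using exhaust_2[of j] 1 2 by (auto simp only: cvec_def vec_lambda_beta r1 a_def[symmetric] b_def[symmetric])
  then show ?thesis
    by (simp add: vec_eq_iff tensor_def angle_dir_def \<phi>_def)
qed

section \<open>Vector fields of finite energy\<close>

lemma bounded_linear_axis: "bounded_linear (axis j :: 'a::euclidean_space \<Rightarrow> 'a^'n)"
  by (rule linear_conv_bounded_linear[THEN iffD1], rule linearI) (simp_all add: vec_eq_iff axis_def)

lemma vec2_eq_axis_sum: "v = axis 1 (v $ 1) + axis 2 (v $ 2)" for v :: "'a::ab_group_add^2"
  by (simp add: vec2_eq_iff axis_def)

lemma measurable_vec_nth: "f \<in> borel_measurable M \<Longrightarrow> (\<lambda>x. f x $ j :: 'a::real_normed_vector) \<in> borel_measurable M"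
  by (rule measurable_compose[OF _ borel_measurable_continuous_onI]) (auto intro!: continuous_intros)

lemma norm_vec2_square: "(norm v)\<^sup>2 = (norm (v $ 1))\<^sup>2 + (norm (v $ 2))\<^sup>2" for v :: "'a::real_normed_vector^2"
  by (simp add: norm_vec2)

lemma integrable_vec2:
  fixes f :: "'b \<Rightarrow> complex^2"
  assumes "\<And>j. integrable M (\<lambda>x. f x $ j)"
  shows "integrable M f" "(\<integral>x. f x \<partial>M) $ j = (\<integral>x. f x $ j \<partial>M)"
proof -
  have "integrable M (\<lambda>x. axis 1 (f x $ 1) + axis 2 (f x $ 2) :: complex^2)"
    by (intro Bochner_Integration.integrable_add integrable_bounded_linear[OF bounded_linear_axis] assms)
  then show i: "integrable M f" by (simp only: vec2_eq_axis_sum[symmetric])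
  show "(\<integral>x. f x \<partial>M) $ j = (\<integral>x. f x $ j \<partial>M)"
    by (rule integral_bounded_linear[OF bounded_linear_vec_nth i, symmetric])
qed

lemma partial_nth:
  fixes u :: "real^2 \<Rightarrow> complex^2"
  assumes "u differentiable at x"
  shows "partial k (\<lambda>x. u x $ j) x = partial k u x $ j"
proof -
  have "((\<lambda>x. u x $ j) has_derivative (\<lambda>h. frechet_derivative u (at x) h $ j)) (at x)"
    by (rule bounded_linear.has_derivative[OF bounded_linear_vec_nth frechet_derivative_works[THEN iffD1, OF assms]])
  from partial_eqI[OF this] show ?thesis by (simp add: partial_def)
qed

lemma ang_deriv_nth:
  fixes u :: "real^2 \<Rightarrow> complex^2"
  assumes "u differentiable at x"
  shows "ang_deriv (\<lambda>x. u x $ j) x = ang_deriv u x $ j"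
proof -
  have "((\<lambda>x. u x $ j) has_derivative (\<lambda>h. frechet_derivative u (at x) h $ j)) (at x)"
    by (rule bounded_linear.has_derivative[OF bounded_linear_vec_nth frechet_derivative_works[THEN iffD1, OF assms]])
  from frechet_derivative_at[OF this] show ?thesis by (simp add: ang_deriv_def fun_eq_iff)
qed

lemma ang_deriv_add:
  assumes "u differentiable at x" "v differentiable at x"
  shows "ang_deriv (\<lambda>x. u x + v x) x = ang_deriv u x + ang_deriv v x"
proof -
  have "((\<lambda>x. u x + v x) has_derivative (\<lambda>h. frechet_derivative u (at x) h + frechet_derivative v (at x) h)) (at x)"
    by (intro has_derivative_add frechet_derivative_works[THEN iffD1] assms)
  from frechet_derivative_at[OF this] show ?thesis by (simp add: ang_deriv_def fun_eq_iff)
qed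

lemma bounded_linear_cscale: "bounded_linear (\<lambda>v::complex^2. c *s v)"
  by (rule linear_conv_bounded_linear[THEN iffD1], rule linearI) (simp_all add: vec_eq_iff algebra_simps)

lemma ang_deriv_cscale:
  fixes u :: "real^2 \<Rightarrow> complex^2"
  assumes "u differentiable at x"
  shows "ang_deriv (\<lambda>x. c *s u x) x = c *s ang_deriv u x"
proof -
  have "((\<lambda>x. c *s u x) has_derivative (\<lambda>h. c *s frechet_derivative u (at x) h)) (at x)"
    by (rule bounded_linear.has_derivative[OF bounded_linear_cscale frechet_derivative_works[THEN iffD1, OF assms]])
  from frechet_derivative_at[OF this] show ?thesis by (simp add: ang_deriv_def fun_eq_iff)
qed

text \<open>Fields on which the inner product is given by an absolutely convergent integral.\<close>

definition finite_energy :: "(real^2 \<Rightarrow> complex^2) set" where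
  "finite_energy = {u. Ck (Suc 0) u \<and> energy u < \<infinity>}"

definition sq_energy :: "(real^2 \<Rightarrow> complex^2) \<Rightarrow> real" where
  "sq_energy u = (\<integral>x. weight x * ((norm (u x))\<^sup>2 + (norm (ang_deriv u x))\<^sup>2) \<partial>lborel)"

lemma finite_energyD:
  assumes "u \<in> finite_energy"
  shows "\<And>x. u differentiable at x" "continuous_on UNIV u" "continuous_on UNIV (ang_deriv u)"
    "u \<in> borel_measurable borel" "ang_deriv u \<in> borel_measurable borel"
    "integrable lborel (\<lambda>x. weight x * ((norm (u x))\<^sup>2 + (norm (ang_deriv u x))\<^sup>2))"
    "ennreal (sq_energy u) = energy u"
proof -
  have C: "Ck (Suc 0) u" and E: "energy u < \<infinity>" using assms by (auto simp: finite_energy_def)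
  show "\<And>x. u differentiable at x" using C by simp
  show c: "continuous_on UNIV u" "continuous_on UNIV (ang_deriv u)"
    by (rule Ck_imp_continuous[OF C], rule ang_deriv_continuous[OF C])
  show [measurable]: "u \<in> borel_measurable borel" "ang_deriv u \<in> borel_measurable borel"
    by (intro borel_measurable_continuous_onI c)+
  show i: "integrable lborel (\<lambda>x. weight x * ((norm (u x))\<^sup>2 + (norm (ang_deriv u x))\<^sup>2))"
  proof (rule integrableI_bounded)
    have "(\<integral>\<^sup>+x. ennreal (norm (weight x * ((norm (u x))\<^sup>2 + (norm (ang_deriv u x))\<^sup>2))) \<partial>lborel) = energy u"
      unfolding energy_def by (intro nn_integral_cong) simp
    then show "(\<integral>\<^sup>+x. ennreal (norm (weight x * ((norm (u x))\<^sup>2 + (norm (ang_deriv u x))\<^sup>2))) \<partial>lborel) < \<infinity>"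
      using E by simp
  qed measurable
  show "ennreal (sq_energy u) = energy u"
    unfolding sq_energy_def energy_def by (rule nn_integral_eq_integral[OF i, symmetric]) simp
qed

lemma sq_energy_nonneg: "0 \<le> sq_energy u"
  unfolding sq_energy_def by (rule Bochner_Integration.integral_nonneg) simp

lemma energy_mono_pair:
  fixes u v w :: "real^2 \<Rightarrow> 'a::{banach, second_countable_topology}"
  assumes m: "u \<in> borel_measurable borel" "ang_deriv u \<in> borel_measurable borel" "v \<in> borel_measurable borel" "ang_deriv v \<in> borel_measurable borel"
    and b: "\<And>x. (norm (w x))\<^sup>2 + (norm (ang_deriv w x))\<^sup>2 \<le> c * ((norm (u x))\<^sup>2 + (norm (ang_deriv u x))\<^sup>2) + d * ((norm (v x))\<^sup>2 + (norm (ang_deriv v x))\<^sup>2)"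
    and cd: "c \<ge> 0" "d \<ge> 0"
  shows "energy w \<le> ennreal c * energy u + ennreal d * energy v"
proof -
  note [measurable] = m
  have "energy w \<le> (\<integral>\<^sup>+x. ennreal c * ennreal (weight x * ((norm (u x))\<^sup>2 + (norm (ang_deriv u x))\<^sup>2))
      + ennreal d * ennreal (weight x * ((norm (v x))\<^sup>2 + (norm (ang_deriv v x))\<^sup>2)) \<partial>lborel)"
    unfolding energy_def
  proof (rule nn_integral_mono)
    fix x
    have "weight x * ((norm (w x))\<^sup>2 + (norm (ang_deriv w x))\<^sup>2) \<le> weight x * (c * ((norm (u x))\<^sup>2 + (norm (ang_deriv u x))\<^sup>2) + d * ((norm (v x))\<^sup>2 + (norm (ang_deriv v x))\<^sup>2))"
      by (intro mult_left_mono b) simp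
    also have "\<dots> = c * (weight x * ((norm (u x))\<^sup>2 + (norm (ang_deriv u x))\<^sup>2)) + d * (weight x * ((norm (v x))\<^sup>2 + (norm (ang_deriv v x))\<^sup>2))"
      by (simp only: distrib_left mult_ac)
    finally have "ennreal (weight x * ((norm (w x))\<^sup>2 + (norm (ang_deriv w x))\<^sup>2))
       \<le> ennreal (c * (weight x * ((norm (u x))\<^sup>2 + (norm (ang_deriv u x))\<^sup>2)) + d * (weight x * ((norm (v x))\<^sup>2 + (norm (ang_deriv v x))\<^sup>2)))"
      by (rule ennreal_leI)
    also have "\<dots> = ennreal c * ennreal (weight x * ((norm (u x))\<^sup>2 + (norm (ang_deriv u x))\<^sup>2))
      + ennreal d * ennreal (weight x * ((norm (v x))\<^sup>2 + (norm (ang_deriv v x))\<^sup>2))"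
      using cd by (subst ennreal_plus) (auto simp: ennreal_mult)
    finally show "ennreal (weight x * ((norm (w x))\<^sup>2 + (norm (ang_deriv w x))\<^sup>2)) \<le> ennreal c * ennreal (weight x * ((norm (u x))\<^sup>2 + (norm (ang_deriv u x))\<^sup>2))
      + ennreal d * ennreal (weight x * ((norm (v x))\<^sup>2 + (norm (ang_deriv v x))\<^sup>2))" .
  qed
  also have "\<dots> = (\<integral>\<^sup>+x. ennreal c * ennreal (weight x * ((norm (u x))\<^sup>2 + (norm (ang_deriv u x))\<^sup>2)) \<partial>lborel)
      + (\<integral>\<^sup>+x. ennreal d * ennreal (weight x * ((norm (v x))\<^sup>2 + (norm (ang_deriv v x))\<^sup>2)) \<partial>lborel)"
    by (rule nn_integral_add) measurable
  also have "\<dots> = ennreal c * energy u + ennreal d * energy v"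
    unfolding energy_def by (subst (1 2) nn_integral_cmult) measurable
  finally show ?thesis .
qed

lemma energy_add_le:
  fixes u v :: "real^2 \<Rightarrow> 'a::{banach, second_countable_topology}"
  assumes "Ck (Suc 0) u" "Ck (Suc 0) v"
  shows "energy (\<lambda>x. u x + v x) \<le> 2 * energy u + 2 * energy v"
proof -
  have "energy (\<lambda>x. u x + v x) \<le> ennreal 2 * energy u + ennreal 2 * energy v"
  proof (rule energy_mono_pair)
    show "u \<in> borel_measurable borel" "ang_deriv u \<in> borel_measurable borel" "v \<in> borel_measurable borel" "ang_deriv v \<in> borel_measurable borel"
      by (intro borel_measurable_continuous_onI Ck_imp_continuous[OF assms(1)] Ck_imp_continuous[OF assms(2)] ang_deriv_continuous assms)+
    fix x
    have d: "u differentiable at x" "v differentiable at x" using assms by simp_all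
    show "(norm (u x + v x))\<^sup>2 + (norm (ang_deriv (\<lambda>x. u x + v x) x))\<^sup>2 \<le> 2 * ((norm (u x))\<^sup>2 + (norm (ang_deriv u x))\<^sup>2) + 2 * ((norm (v x))\<^sup>2 + (norm (ang_deriv v x))\<^sup>2)"
      unfolding ang_deriv_add[OF d] using norm_add_square_le[of "u x" "v x"] norm_add_square_le[of "ang_deriv u x" "ang_deriv v x"] by simp
  qed simp_all
  then show ?thesis by simp
qed

lemma finite_energy_add:
  assumes "u \<in> finite_energy" "v \<in> finite_energy"
  shows "(\<lambda>x. u x + v x) \<in> finite_energy"
proof -
  have C: "Ck (Suc 0) u" "Ck (Suc 0) v" and E: "energy u < \<infinity>" "energy v < \<infinity>" using assms by (auto simp: finite_energy_def)
  have "2 * energy u + 2 * energy v < \<infinity>" using E by (simp add: ennreal_mult_less_top)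
  then have "energy (\<lambda>x. u x + v x) < \<infinity>" using energy_add_le[OF C] by (rule le_less_trans[rotated])
  then show ?thesis using Ck_add[OF C] by (simp add: finite_energy_def del: Ck.simps)
qed

lemma norm_cscale: "norm (c *s v) = norm c * norm v" for v :: "complex^2"
proof -
  have "(norm (c * v $ 1))\<^sup>2 + (norm (c * v $ 2))\<^sup>2 = (norm c)\<^sup>2 * ((norm (v $ 1))\<^sup>2 + (norm (v $ 2))\<^sup>2)"
    by (simp add: norm_mult power_mult_distrib distrib_left)
  then show ?thesis by (simp add: norm_vec2 real_sqrt_mult)
qed

lemma norm_cdot_vcnj_le: "norm (cdot a (vcnj b)) \<le> (norm a)\<^sup>2 + (norm b)\<^sup>2" for a b :: "complex^2"
proof -
  have 1: "norm x * norm y \<le> (norm x)\<^sup>2 + (norm y)\<^sup>2" for x y :: complex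
  proof -
    have "norm x * norm y \<le> 2 * norm x * norm y" by simp
    also have "\<dots> \<le> (norm x)\<^sup>2 + (norm y)\<^sup>2" by (rule sum_squares_bound)
    finally show ?thesis .
  qed
  have "norm (cdot a (vcnj b)) \<le> norm (a $ 1) * norm (b $ 1) + norm (a $ 2) * norm (b $ 2)"
    unfolding cdot_def vcnj_def sum_2 by (rule order_trans[OF norm_triangle_ineq]) (simp add: norm_mult)
  also have "\<dots> \<le> (norm a)\<^sup>2 + (norm b)\<^sup>2"
    using 1[of "a $ 1" "b $ 1"] 1[of "a $ 2" "b $ 2"] by (simp add: norm_vec2_square)
  finally show ?thesis .
qed

lemma cdot_vcnj_self: "cdot a (vcnj a) = of_real ((norm a)\<^sup>2)" for a :: "complex^2"
  unfolding norm_vec2_square of_real_add complex_norm_square by (simp add: cdot_def vcnj_def sum_2)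

lemma cdot_simps:
  "cdot (a + b) d = cdot a d + cdot b d" "cdot (c *s a) d = c * cdot a d"
  "cnj (cdot a (vcnj b)) = cdot b (vcnj a)" for a b d :: "complex^2"
  by (simp_all add: cdot_def vcnj_def sum_2 algebra_simps)

lemma norm_angle_dir: "cdot (angle_dir x) (vcnj (angle_dir x)) = 1" "norm (angle_dir x) = 1"
proof -
  have "norm (angle_dir x) = 1"
    by (simp add: angle_dir_def norm_vec2 cvec_def phi_hat_def)
  then show "cdot (angle_dir x) (vcnj (angle_dir x)) = 1" "norm (angle_dir x) = 1" by (simp_all add: cdot_vcnj_self)
qed

lemma ddot_tensor: "ddot (tensor a b) (mcnj (tensor a c)) = cdot a (vcnj a) * cdot b (vcnj c)" for a b c :: "complex^2"
  by (simp add: ddot_def tensor_def mcnj_def cdot_def vcnj_def sum_2 algebra_simps)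

lemma norm_tensor: "norm (tensor a b) = norm a * norm b" for a b :: "complex^2"
proof -
  have "norm (tensor a b $ i) = norm (a $ i) * norm b" for i
  proof -
    have "tensor a b $ i = a $ i *s b" by (simp add: tensor_def vec_eq_iff)
    then show ?thesis by (simp add: norm_cscale)
  qed
  then have "norm (tensor a b) = sqrt (((norm (a $ 1))\<^sup>2 + (norm (a $ 2))\<^sup>2) * (norm b)\<^sup>2)"
    by (simp add: norm_vec2[of "tensor a b"] power_mult_distrib distrib_right)
  then show ?thesis by (simp add: norm_vec2[of a] real_sqrt_mult)
qed

lemma H_inner_eq:
  assumes "u \<in> finite_energy" "v \<in> finite_energy"
  shows "H_inner u v = (\<integral>x. weight x *\<^sub>R (cdot (u x) (vcnj (v x)) + cdot (ang_deriv u x) (vcnj (ang_deriv v x))) \<partial>lborel)"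
    "integrable lborel (\<lambda>x. weight x *\<^sub>R (cdot (u x) (vcnj (v x)) + cdot (ang_deriv u x) (vcnj (ang_deriv v x))))"
proof -
  note u = finite_energyD[OF assms(1)] and v = finite_energyD[OF assms(2)]
  show "H_inner u v = (\<integral>x. weight x *\<^sub>R (cdot (u x) (vcnj (v x)) + cdot (ang_deriv u x) (vcnj (ang_deriv v x))) \<partial>lborel)"
    unfolding H_inner_def angular_gradient_eq[OF u(1)] angular_gradient_eq[OF v(1)] ddot_tensor norm_angle_dir
    by (rule Bochner_Integration.integral_cong) (simp_all add: weight_def scaleR_conv_of_real)
  show "integrable lborel (\<lambda>x. weight x *\<^sub>R (cdot (u x) (vcnj (v x)) + cdot (ang_deriv u x) (vcnj (ang_deriv v x))))"
  proof (rule Bochner_Integration.integrable_bound[OF Bochner_Integration.integrable_add[OF u(6) v(6)]])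
    note [measurable] = u(4,5) v(4,5) measurable_vec_nth
    show "(\<lambda>x. weight x *\<^sub>R (cdot (u x) (vcnj (v x)) + cdot (ang_deriv u x) (vcnj (ang_deriv v x)))) \<in> borel_measurable lborel"
      unfolding cdot_def vcnj_def sum_2 vec_lambda_beta by measurable
    have "norm (weight x *\<^sub>R (cdot (u x) (vcnj (v x)) + cdot (ang_deriv u x) (vcnj (ang_deriv v x))))
        \<le> weight x * ((norm (u x))\<^sup>2 + (norm (ang_deriv u x))\<^sup>2) + weight x * ((norm (v x))\<^sup>2 + (norm (ang_deriv v x))\<^sup>2)" for x
    proof -
      have "norm (cdot (u x) (vcnj (v x)) + cdot (ang_deriv u x) (vcnj (ang_deriv v x))) \<le> ((norm (u x))\<^sup>2 + (norm (ang_deriv u x))\<^sup>2) + ((norm (v x))\<^sup>2 + (norm (ang_deriv v x))\<^sup>2)"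
        using norm_triangle_ineq[of "cdot (u x) (vcnj (v x))" "cdot (ang_deriv u x) (vcnj (ang_deriv v x))"]
          norm_cdot_vcnj_le[of "u x" "v x"] norm_cdot_vcnj_le[of "ang_deriv u x" "ang_deriv v x"] by linarith
      from mult_left_mono[OF this weight_nonneg[of x]] show ?thesis by (simp add: distrib_left)
    qed
    note bound = this
    show "AE x in lborel. norm (weight x *\<^sub>R (cdot (u x) (vcnj (v x)) + cdot (ang_deriv u x) (vcnj (ang_deriv v x))))
        \<le> norm (weight x * ((norm (u x))\<^sup>2 + (norm (ang_deriv u x))\<^sup>2) + weight x * ((norm (v x))\<^sup>2 + (norm (ang_deriv v x))\<^sup>2))"
      unfolding real_norm_def by (intro AE_I2) (rule order_trans[OF bound abs_ge_self])
  qed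
qed

lemma H_inner_self:
  assumes "u \<in> finite_energy"
  shows "H_inner u u = of_real (sq_energy u)"
proof -
  have "H_inner u u = (\<integral>x. of_real (weight x * ((norm (u x))\<^sup>2 + (norm (ang_deriv u x))\<^sup>2)) \<partial>lborel)"
    unfolding H_inner_eq(1)[OF assms assms] cdot_vcnj_self
    by (intro Bochner_Integration.integral_cong refl) (simp add: scaleR_conv_of_real)
  then show ?thesis unfolding sq_energy_def by (simp only: integral_complex_of_real)
qed

lemma finite_energy_cscale:
  assumes "u \<in> finite_energy"
  shows "(\<lambda>x. c *s u x) \<in> finite_energy"
proof -
  note u = finite_energyD[OF assms]
  have C: "Ck (Suc 0) u" and E: "energy u < \<infinity>" using assms by (auto simp: finite_energy_def)
  have "energy (\<lambda>x. c *s u x) \<le> ennreal ((norm c)\<^sup>2) * energy u + ennreal 0 * energy u"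
    by (rule energy_mono_pair) (use u in \<open>auto simp: ang_deriv_cscale norm_cscale power_mult_distrib distrib_left\<close>)
  also have "\<dots> < \<infinity>" using E by (simp add: ennreal_mult_less_top)
  finally show ?thesis
    using Ck_bounded_linear[OF bounded_linear_cscale C] by (simp add: finite_energy_def del: Ck.simps)
qed

lemma H_inner_add:
  assumes "u \<in> finite_energy" "v \<in> finite_energy" "w \<in> finite_energy"
  shows "H_inner (\<lambda>x. u x + v x) w = H_inner u w + H_inner v w"
proof -
  note d = finite_energyD(1)
  have "H_inner (\<lambda>x. u x + v x) w = (\<integral>x. weight x *\<^sub>R (cdot (u x) (vcnj (w x)) + cdot (ang_deriv u x) (vcnj (ang_deriv w x)))
      + weight x *\<^sub>R (cdot (v x) (vcnj (w x)) + cdot (ang_deriv v x) (vcnj (ang_deriv w x))) \<partial>lborel)"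
    unfolding H_inner_eq(1)[OF finite_energy_add[OF assms(1,2)] assms(3)] ang_deriv_add[OF d[OF assms(1)] d[OF assms(2)]]
    by (intro Bochner_Integration.integral_cong refl) (simp add: cdot_simps(1) scaleR_add_right)
  then show ?thesis using assms by (simp add: H_inner_eq)
qed

lemma H_inner_cscale:
  assumes "u \<in> finite_energy" "v \<in> finite_energy"
  shows "H_inner (\<lambda>x. c *s u x) v = c * H_inner u v"
proof -
  have "H_inner (\<lambda>x. c *s u x) v = (\<integral>x. c * (weight x *\<^sub>R (cdot (u x) (vcnj (v x)) + cdot (ang_deriv u x) (vcnj (ang_deriv v x)))) \<partial>lborel)"
    unfolding H_inner_eq(1)[OF finite_energy_cscale[OF assms(1)] assms(2)] ang_deriv_cscale[OF finite_energyD(1)[OF assms(1)]]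
    by (intro Bochner_Integration.integral_cong refl) (simp add: cdot_simps(2) distrib_left)
  then show ?thesis by (simp only: integral_mult_right_zero H_inner_eq(1)[OF assms])
qed

lemma H_inner_cnj:
  assumes "u \<in> finite_energy" "v \<in> finite_energy"
  shows "H_inner v u = cnj (H_inner u v)"
proof -
  have "cnj (H_inner u v) = (\<integral>x. cnj (weight x *\<^sub>R (cdot (u x) (vcnj (v x)) + cdot (ang_deriv u x) (vcnj (ang_deriv v x)))) \<partial>lborel)"
    unfolding H_inner_eq(1)[OF assms] by (rule Bochner_Integration.integral_cnj[symmetric])
  also have "\<dots> = H_inner v u"
    unfolding H_inner_eq(1)[OF assms(2,1)]
    by (intro Bochner_Integration.integral_cong refl) (simp add: cdot_simps(3) scaleR_conv_of_real)
  finally show ?thesis by simp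
qed

lemma sq_energy_zero:
  assumes u: "u \<in> finite_energy" and z: "sq_energy u = 0"
  shows "u = (\<lambda>x. 0)"
proof -
  note f = finite_energyD[OF u]
  have "AE x in lborel. weight x * ((norm (u x))\<^sup>2 + (norm (ang_deriv u x))\<^sup>2) = 0"
    by (rule integral_nonneg_eq_0_iff_AE[THEN iffD1, OF f(6)]) (use z in \<open>auto simp: sq_energy_def\<close>)
  then have "AE x in lborel. u x = 0"
  proof eventually_elim
    case (elim x)
    then have "(norm (u x))\<^sup>2 + (norm (ang_deriv u x))\<^sup>2 = 0" using weight_pos[of x] by (metis mult_eq_0_iff less_irrefl)
    then show ?case by (simp only: sum_power2_eq_zero_iff norm_eq_zero)
  qed
  from AE_zero_continuous[OF f(2) this] show ?thesis by (rule ext)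
qed

section \<open>Approximation by test functions\<close>

lemma continuous_on_tensor: "continuous_on UNIV (\<lambda>p. tensor (fst p) (snd p) :: complex^2^2)"
  unfolding tensor_def by (intro continuous_intros)

text \<open>Away from the origin the direction is \<open>(-x\<^sub>2, x\<^sub>1)/|x|\<close>.\<close>

lemma angle_dir_measurable: "angle_dir \<in> borel_measurable borel"
proof -
  have c: "(\<lambda>p. cvec (vector [fst p, snd p]) :: complex^2) \<in> borel_measurable (borel \<Otimes>\<^sub>M borel)"
    unfolding borel_prod cvec_def by (intro borel_measurable_continuous_onI continuous_intros)
  have eq: "angle_dir x = (if x = 0 then cvec (vector [0, 1]) else cvec (vector [fst p, snd p]))"
    if p: "p = (- x $ 2 / norm x, x $ 1 / norm x)" for x p
  proof (cases "x = 0")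
    case True
    then have "Complex (x $ 1) (x $ 2) = 0" by (simp add: complex_eq_iff)
    then show ?thesis using True by (simp add: angle_dir_def phi_hat_def Arg_zero)
  next
    case False
    define \<phi> where "\<phi> = Arg (Complex (x $ 1) (x $ 2))"
    have "x $ 1 = norm x * cos \<phi>" "x $ 2 = norm x * sin \<phi>"
      using polar_norm_Arg[of x] unfolding \<phi>_def by (metis polar_nth)+
    then have "x $ 1 / norm x = cos \<phi>" "- x $ 2 / norm x = - sin \<phi>" using False
      by (metis nonzero_mult_div_cancel_left norm_eq_zero, metis minus_divide_left nonzero_mult_div_cancel_left norm_eq_zero)
    then show ?thesis using False by (simp add: angle_dir_def phi_hat_def \<phi>_def[symmetric] p)
  qed
  have [measurable]: "(\<lambda>x::real^2. x $ j) \<in> borel_measurable borel" for j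
    by (intro borel_measurable_continuous_onI continuous_intros)
  have "(\<lambda>x::real^2. (- x $ 2 / norm x, x $ 1 / norm x)) \<in> measurable borel (borel \<Otimes>\<^sub>M borel)" by measurable
  from measurable_compose[OF this c]
  have "(\<lambda>x::real^2. if x = 0 then cvec (vector [0, 1]) else cvec (vector [- x $ 2 / norm x, x $ 1 / norm x]) :: complex^2) \<in> borel_measurable borel"
    by (intro measurable_If) auto
  moreover have "angle_dir = (\<lambda>x::real^2. if x = 0 then cvec (vector [0, 1]) else cvec (vector [- x $ 2 / norm x, x $ 1 / norm x]))"
    using eq[OF refl] by (intro ext) (simp only: fst_conv snd_conv)
  ultimately show ?thesis by (simp only:)
qed

lemma angular_gradient_measurable:
  assumes "u \<in> finite_energy"
  shows "angular_gradient u \<in> borel_measurable borel"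
proof -
  note u = finite_energyD[OF assms]
  have "(\<lambda>x. (angle_dir x, ang_deriv u x)) \<in> measurable borel (borel \<Otimes>\<^sub>M borel)"
    using angle_dir_measurable u(5) by measurable
  moreover have "(\<lambda>p. tensor (fst p) (snd p) :: complex^2^2) \<in> borel_measurable (borel \<Otimes>\<^sub>M borel)"
    unfolding borel_prod by (rule borel_measurable_continuous_onI[OF continuous_on_tensor])
  ultimately have "(\<lambda>x. tensor (fst (angle_dir x, ang_deriv u x)) (snd (angle_dir x, ang_deriv u x))) \<in> borel_measurable borel"
    by (rule measurable_compose)
  moreover have "angular_gradient u = (\<lambda>x. tensor (angle_dir x) (ang_deriv u x))" by (intro ext angular_gradient_eq u(1))
  ultimately show ?thesis by simp
qed

text \<open>With a cutoff factor \<open>\<chi>\<close> the error is \<open>(1 - \<chi>)\<^sup>2\<close> times the energy density, also in the angular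
  gradient, and dominated convergence applies.\<close>

theorem finite_energy_smooth_in_H_ambient:
  assumes u: "u \<in> finite_energy" and smooth: "\<And>k. Ck k u"
  shows "(u, angular_gradient u) \<in> H_ambient"
proof -
  note f = finite_energyD[OF u]
  note [measurable] = f(4,5) angular_gradient_measurable[OF u]
  have [measurable]: "cutoff n \<in> borel_measurable borel" for n
    by (intro borel_measurable_continuous_onI Ck_imp_continuous[OF Ck_cutoff])
  define F where "F n x = cutoff n x *\<^sub>R u x" for n x
  define e where "e x = weight x * ((norm (u x))\<^sup>2 + (norm (ang_deriv u x))\<^sup>2)" for x
  have ag: "norm (angular_gradient u x) = norm (ang_deriv u x)" for x
    by (simp add: angular_gradient_eq[OF f(1)] norm_tensor norm_angle_dir)
  have test: "F n \<in> test_functions" for n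
  proof -
    have "Ck k (F n)" for k unfolding F_def by (intro Ck_scaleR Ck_cutoff smooth)
    moreover have "\<forall>x. x \<notin> cball 0 (real (Suc n)) \<longrightarrow> F n x = 0" using cutoff_support by (auto simp: F_def simp del: mem_cball)
    ultimately show ?thesis unfolding test_functions_def using compact_cball by blast
  qed
  have Fd: "F n differentiable at x" for n x using test[of n] by (auto simp: test_functions_def dest: spec[of _ "Suc 0"])
  have agF: "angular_gradient (F n) x = cutoff n x *\<^sub>R angular_gradient u x" for n x
  proof -
    have "angular_gradient (F n) x = tensor (angle_dir x) (cutoff n x *\<^sub>R ang_deriv u x)"
      unfolding angular_gradient_eq[OF Fd] by (simp add: F_def[abs_def] ang_deriv_cutoff[OF f(1)])
    then show ?thesis by (simp add: angular_gradient_eq[OF f(1)] tensor_def vec_eq_iff)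
  qed
  have d: "(norm (u x - F n x))\<^sup>2 + (norm (angular_gradient u x - angular_gradient (F n) x))\<^sup>2 = (1 - cutoff n x)\<^sup>2 * ((norm (u x))\<^sup>2 + (norm (ang_deriv u x))\<^sup>2)" for n x
  proof -
    have "u x - F n x = (1 - cutoff n x) *\<^sub>R u x" "angular_gradient u x - angular_gradient (F n) x = (1 - cutoff n x) *\<^sub>R angular_gradient u x"
      unfolding agF by (simp_all add: F_def scaleR_diff_left)
    then show ?thesis by (simp add: ag power_mult_distrib distrib_left)
  qed
  have "(\<lambda>n. \<integral>\<^sup>+x. ennreal ((1 - cutoff n x)\<^sup>2 * e x) \<partial>lborel) \<longlonglongrightarrow> (\<integral>\<^sup>+x. 0 \<partial>(lborel :: (real^2) measure))"
  proof (rule nn_integral_dominated_convergence[where u = "\<lambda>n x. ennreal ((1 - cutoff n x)\<^sup>2 * e x)" and u' = "\<lambda>_. 0" and w = "\<lambda>x. ennreal (e x)"])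
    show "(\<lambda>x. ennreal ((1 - cutoff n x)\<^sup>2 * e x)) \<in> borel_measurable lborel" for n unfolding e_def by measurable
    show "(\<lambda>x. ennreal (e x)) \<in> borel_measurable lborel" unfolding e_def by measurable
    show "AE x in lborel. ennreal ((1 - cutoff n x)\<^sup>2 * e x) \<le> ennreal (e x)" for n
    proof (intro AE_I2 ennreal_leI)
      fix x
      have "(1 - cutoff n x)\<^sup>2 \<le> 1" using cutoff_range[of n x] by (intro power_le_one) auto
      then show "(1 - cutoff n x)\<^sup>2 * e x \<le> e x" using mult_right_mono[of "(1 - cutoff n x)\<^sup>2" 1 "e x"] by (simp add: e_def)
    qed
    show "(\<integral>\<^sup>+x. ennreal (e x) \<partial>lborel) < \<infinity>" using u by (simp add: finite_energy_def energy_def e_def)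
    show "AE x in lborel. (\<lambda>n. ennreal ((1 - cutoff n x)\<^sup>2 * e x)) \<longlonglongrightarrow> 0"
    proof (intro AE_I2)
      fix x
      have "(\<lambda>n. (1 - cutoff n x)\<^sup>2 * e x) \<longlonglongrightarrow> (1 - 1)\<^sup>2 * e x" by (intro tendsto_intros cutoff_tendsto)
      then have "(\<lambda>n. ennreal ((1 - cutoff n x)\<^sup>2 * e x)) \<longlonglongrightarrow> ennreal ((1 - 1)\<^sup>2 * e x)" by (rule tendsto_ennrealI)
      then show "(\<lambda>n. ennreal ((1 - cutoff n x)\<^sup>2 * e x)) \<longlonglongrightarrow> 0" by simp
    qed
  qed simp
  moreover have "ennreal (((norm (u x - F n x))\<^sup>2 + (norm (angular_gradient u x - angular_gradient (F n) x))\<^sup>2) / bracket x ^ 3) = ennreal ((1 - cutoff n x)\<^sup>2 * e x)" for n x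
    unfolding d by (simp add: e_def weight_def)
  ultimately have "(\<lambda>n. \<integral>\<^sup>+x. ennreal (((norm (u x - F n x))\<^sup>2 + (norm (angular_gradient u x - angular_gradient (F n) x))\<^sup>2) / bracket x ^ 3) \<partial>lborel) \<longlonglongrightarrow> 0"
    by simp
  moreover have "integrable lborel (\<lambda>x. ((norm (u x))\<^sup>2 + (norm (angular_gradient u x))\<^sup>2) / bracket x ^ 3)"
    using f(6) by (simp add: ag weight_def)
  ultimately show ?thesis unfolding H_ambient_def using test by (auto intro!: exI[of _ F])
qed

section \<open>Elastic Herglotz waves and their densities\<close>

abbreviation vec_sq_norm :: "(real^2 \<Rightarrow> complex^2) \<Rightarrow> real" where
  "vec_sq_norm g \<equiv> \<integral>\<xi>. (norm (g \<xi>))\<^sup>2 \<partial>arc_length"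

lemma L2_circle_iff: "g \<in> L2_circle \<longleftrightarrow> square_integrable arc_length g"
  by (simp add: L2_circle_def square_integrable_def)

lemma square_integrable_nth:
  fixes g :: "'a \<Rightarrow> complex^2"
  assumes "square_integrable M g"
  shows "square_integrable M (\<lambda>x. g x $ j)"
  by (rule square_integrable_bound[OF assms, of _ 1])
     (use assms in \<open>auto simp: square_integrable_def Finite_Cartesian_Product.norm_nth_le intro!: measurable_vec_nth\<close>)

lemma integrable_nth:
  "square_integrable arc_length g \<Longrightarrow> integrable arc_length (\<lambda>\<xi>. g \<xi> $ j)" for g :: "real^2 \<Rightarrow> complex^2"
  by (intro arc_length.square_integrable_integrable square_integrable_nth)

lemma vec_sq_norm_eq:
  assumes "square_integrable arc_length g"
  shows "vec_sq_norm g = sq_norm (\<lambda>\<xi>. g \<xi> $ 1) + sq_norm (\<lambda>\<xi>. g \<xi> $ 2)"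
proof -
  have i: "integrable arc_length (\<lambda>\<xi>. (norm (g \<xi> $ j))\<^sup>2)" for j
    using square_integrable_nth[OF assms] by (simp add: square_integrable_def)
  show ?thesis unfolding norm_vec2_square by (rule Bochner_Integration.integral_add[OF i i])
qed

definition elastic_wave :: "real \<Rightarrow> real \<Rightarrow> (real^2 \<Rightarrow> complex^2) \<Rightarrow> (real^2 \<Rightarrow> complex^2) \<Rightarrow> real^2 \<Rightarrow> complex^2" where
  "elastic_wave k l g1 g2 x = (\<chi> j. herg k (\<lambda>\<xi>. g1 \<xi> $ j) x + herg l (\<lambda>\<xi>. g2 \<xi> $ j) x)"

definition elastic_densities :: "((real^2 \<Rightarrow> complex^2) \<times> (real^2 \<Rightarrow> complex^2)) set" where
  "elastic_densities = {(g1, g2). square_integrable arc_length g1 \<and> square_integrable arc_length g2 \<and>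
     (AE \<xi> in arc_length. \<exists>c. g1 \<xi> = c *s cvec \<xi>) \<and> (AE \<xi> in arc_length. cdot (g2 \<xi>) (cvec \<xi>) = 0)}"

lemma elastic_wave_eq_integral:
  assumes g: "square_integrable arc_length g1" "square_integrable arc_length g2"
  shows "elastic_wave k l g1 g2 x = (LINT \<xi>|arc_length. exp (\<i> * complex_of_real (k * (x \<bullet> \<xi>))) *s g1 \<xi>
                        + exp (\<i> * complex_of_real (l * (x \<bullet> \<xi>))) *s g2 \<xi>)"
    (is "_ = (LINT \<xi>|arc_length. ?F \<xi>)")
proof -
  have F: "?F \<xi> $ j = cis (k * (x \<bullet> \<xi>)) * (g1 \<xi> $ j) + cis (l * (x \<bullet> \<xi>)) * (g2 \<xi> $ j)" for \<xi> j
    by (simp add: cis_conv_exp)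
  have i: "integrable arc_length (\<lambda>\<xi>. ?F \<xi> $ j)" for j
    unfolding F by (intro Bochner_Integration.integrable_add herg_integrable integrable_nth g)
  have "(LINT \<xi>|arc_length. ?F \<xi>) $ j = elastic_wave k l g1 g2 x $ j" for j
    unfolding integrable_vec2(2)[OF i] unfolding F elastic_wave_def vec_lambda_beta herg_def
    by (intro Bochner_Integration.integral_add herg_integrable integrable_nth g)
  then show ?thesis by (simp only: vec_eq_iff) simp
qed

lemma elastic_wave_nth: "(\<lambda>x. elastic_wave k l g1 g2 x $ j) = (\<lambda>x. herg k (\<lambda>\<xi>. g1 \<xi> $ j) x + herg l (\<lambda>\<xi>. g2 \<xi> $ j) x)"
  by (simp add: elastic_wave_def)

lemma Ck_elastic_wave:
  assumes g: "square_integrable arc_length g1" "square_integrable arc_length g2"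
  shows "Ck m (elastic_wave k l g1 g2)"
proof -
  have "elastic_wave k l g1 g2 = (\<lambda>x. axis 1 (herg k (\<lambda>\<xi>. g1 \<xi> $ 1) x + herg l (\<lambda>\<xi>. g2 \<xi> $ 1) x)
      + axis 2 (herg k (\<lambda>\<xi>. g1 \<xi> $ 2) x + herg l (\<lambda>\<xi>. g2 \<xi> $ 2) x))"
    by (simp add: fun_eq_iff vec2_eq_iff elastic_wave_def axis_def)
  moreover have "Ck m (\<lambda>x. axis 1 (herg k (\<lambda>\<xi>. g1 \<xi> $ 1) x + herg l (\<lambda>\<xi>. g2 \<xi> $ 1) x)
      + axis 2 (herg k (\<lambda>\<xi>. g1 \<xi> $ 2) x + herg l (\<lambda>\<xi>. g2 \<xi> $ 2) x) :: complex^2)"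
    by (intro Ck_add Ck_bounded_linear[OF bounded_linear_axis] Ck_herg integrable_nth g)
  ultimately show ?thesis by simp
qed

lemma elastic_wave_add:
  assumes "square_integrable arc_length g1" "square_integrable arc_length g2"
    "square_integrable arc_length h1" "square_integrable arc_length h2"
  shows "elastic_wave k l (\<lambda>\<xi>. g1 \<xi> + h1 \<xi>) (\<lambda>\<xi>. g2 \<xi> + h2 \<xi>) x = elastic_wave k l g1 g2 x + elastic_wave k l h1 h2 x"
  using assms by (simp add: elastic_wave_def vec_eq_iff herg_add integrable_nth)

lemma elastic_wave_cscale: "elastic_wave k l (\<lambda>\<xi>. c *s g1 \<xi>) (\<lambda>\<xi>. c *s g2 \<xi>) x = c *s elastic_wave k l g1 g2 x"
  by (simp add: elastic_wave_def vec_eq_iff herg_cmult distrib_left)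

lemma square_integrable_cscale:
  fixes g :: "'a \<Rightarrow> complex^2"
  assumes "square_integrable M g"
  shows "square_integrable M (\<lambda>x. c *s g x)"
proof (rule square_integrable_bound[OF assms, of _ "norm c"])
  show "(\<lambda>x. c *s g x) \<in> borel_measurable M"
    using assms unfolding square_integrable_def
    by (intro measurable_compose[OF _ borel_measurable_continuous_onI[OF linear_continuous_on[OF bounded_linear_cscale]]]) simp
qed (simp add: norm_cscale)

lemma elastic_densities_add:
  assumes "(g1, g2) \<in> elastic_densities" "(h1, h2) \<in> elastic_densities"
  shows "(\<lambda>\<xi>. g1 \<xi> + h1 \<xi>, \<lambda>\<xi>. g2 \<xi> + h2 \<xi>) \<in> elastic_densities"
proof -
  have "AE \<xi> in arc_length. \<exists>c. g1 \<xi> + h1 \<xi> = c *s cvec \<xi>"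
  proof -
    have "AE \<xi> in arc_length. \<exists>c. g1 \<xi> = c *s cvec \<xi>" "AE \<xi> in arc_length. \<exists>c. h1 \<xi> = c *s cvec \<xi>"
      using assms by (auto simp: elastic_densities_def)
    then show ?thesis
    proof eventually_elim
      case (elim \<xi>)
      then obtain c d where "g1 \<xi> = c *s cvec \<xi>" "h1 \<xi> = d *s cvec \<xi>" by blast
      then have "g1 \<xi> + h1 \<xi> = (c + d) *s cvec \<xi>" by (simp add: vec_eq_iff distrib_right)
      then show ?case by blast
    qed
  qed
  moreover have "AE \<xi> in arc_length. cdot (g2 \<xi> + h2 \<xi>) (cvec \<xi>) = 0"
  proof -
    have "AE \<xi> in arc_length. cdot (g2 \<xi>) (cvec \<xi>) = 0" "AE \<xi> in arc_length. cdot (h2 \<xi>) (cvec \<xi>) = 0"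
      using assms by (auto simp: elastic_densities_def)
    then show ?thesis by eventually_elim (simp add: cdot_simps(1))
  qed
  ultimately show ?thesis using assms by (auto simp: elastic_densities_def intro: square_integrable_add)
qed

lemma elastic_densities_cscale:
  assumes "(g1, g2) \<in> elastic_densities"
  shows "(\<lambda>\<xi>. c *s g1 \<xi>, \<lambda>\<xi>. c *s g2 \<xi>) \<in> elastic_densities"
proof -
  have "AE \<xi> in arc_length. \<exists>d. g1 \<xi> = d *s cvec \<xi>" using assms by (auto simp: elastic_densities_def)
  then have "AE \<xi> in arc_length. \<exists>d. c *s g1 \<xi> = d *s cvec \<xi>"
  proof eventually_elim
    case (elim \<xi>)
    then obtain d where "g1 \<xi> = d *s cvec \<xi>" by blast
    then have "c *s g1 \<xi> = (c * d) *s cvec \<xi>" by (simp add: vec_eq_iff)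
    then show ?case by blast
  qed
  moreover have "AE \<xi> in arc_length. cdot (c *s g2 \<xi>) (cvec \<xi>) = 0"
  proof -
    have "AE \<xi> in arc_length. cdot (g2 \<xi>) (cvec \<xi>) = 0" using assms by (auto simp: elastic_densities_def)
    then show ?thesis by eventually_elim (simp add: cdot_simps(2))
  qed
  ultimately show ?thesis using assms by (auto simp: elastic_densities_def intro: square_integrable_cscale)
qed

lemma herg_cong_AE:
  assumes "integrable arc_length f" "integrable arc_length g" "AE \<xi> in arc_length. f \<xi> = g \<xi>"
  shows "herg k f x = herg k g x"
  unfolding herg_def using assms(3)
  by (intro integral_cong_AE borel_measurable_integrable herg_integrable assms(1,2)) auto

lemma partial_partial_herg:
  assumes f: "integrable arc_length f"
  shows "partial i (partial j (herg k f)) x = - of_real (k\<^sup>2) * herg k (\<lambda>\<xi>. of_real (\<xi> $ i) * (of_real (\<xi> $ j) * f \<xi>)) x"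
proof -
  have "partial i (partial j (herg k f)) x = herg k (\<lambda>\<xi>. \<i> * of_real k * (of_real (\<xi> $ i) * (\<i> * of_real k * (of_real (\<xi> $ j) * f \<xi>)))) x"
    unfolding partial_herg[OF f] partial_herg[OF integrable_partial_density[OF f]] ..
  also have "\<dots> = herg k (\<lambda>\<xi>. - of_real (k\<^sup>2) * (of_real (\<xi> $ i) * (of_real (\<xi> $ j) * f \<xi>))) x"
    by (rule herg_cong) (simp add: power2_eq_square algebra_simps)
  finally show ?thesis by (simp only: herg_cmult)
qed

lemma integrable_nth_times:
  "integrable arc_length f \<Longrightarrow> integrable arc_length (\<lambda>\<xi>. of_real (\<xi> $ j) * f \<xi> :: complex)"
  using integrable_coord_mult[of f "axis j 1"] by (simp add: inner_axis')

lemma laplacian_herg: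
  assumes f: "integrable arc_length f"
  shows "partial 1 (partial 1 (herg k f)) x + partial 2 (partial 2 (herg k f)) x = - of_real (k\<^sup>2) * herg k f x"
proof -
  have "partial 1 (partial 1 (herg k f)) x + partial 2 (partial 2 (herg k f)) x
      = - of_real (k\<^sup>2) * (herg k (\<lambda>\<xi>. of_real (\<xi> $ 1) * (of_real (\<xi> $ 1) * f \<xi>)) x + herg k (\<lambda>\<xi>. of_real (\<xi> $ 2) * (of_real (\<xi> $ 2) * f \<xi>)) x)"
    by (simp only: partial_partial_herg[OF f] distrib_left)
  also have "herg k (\<lambda>\<xi>. of_real (\<xi> $ 1) * (of_real (\<xi> $ 1) * f \<xi>)) x + herg k (\<lambda>\<xi>. of_real (\<xi> $ 2) * (of_real (\<xi> $ 2) * f \<xi>)) x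
      = herg k (\<lambda>\<xi>. of_real (\<xi> $ 1) * (of_real (\<xi> $ 1) * f \<xi>) + of_real (\<xi> $ 2) * (of_real (\<xi> $ 2) * f \<xi>)) x"
    by (intro herg_add[symmetric] integrable_nth_times f)
  also have "\<dots> = herg k f x"
  proof (rule herg_cong)
    fix \<xi> :: "real^2" assume "\<xi> \<in> sphere 0 1"
    then have s: "(\<xi> $ 1)\<^sup>2 + (\<xi> $ 2)\<^sup>2 = 1" by (simp add: norm_vec2)
    have "of_real (\<xi> $ 1) * (of_real (\<xi> $ 1) * f \<xi>) + of_real (\<xi> $ 2) * (of_real (\<xi> $ 2) * f \<xi>) = of_real ((\<xi> $ 1)\<^sup>2 + (\<xi> $ 2)\<^sup>2) * f \<xi>"
      by (simp add: algebra_simps power2_eq_square)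
    then show "of_real (\<xi> $ 1) * (of_real (\<xi> $ 1) * f \<xi>) + of_real (\<xi> $ 2) * (of_real (\<xi> $ 2) * f \<xi>) = f \<xi>" by (simp add: s)
  qed
  finally show ?thesis .
qed

text \<open>The Laplacian multiplies the two parts by \<open>-kp\<^sup>2\<close> and \<open>-ks\<^sup>2\<close>. On the level of densities, the gradient of
  the divergence is \<open>-k\<^sup>2\<close> times the orthogonal projection to \<open>\<xi>\<close>, which keeps the first density and kills
  the second. The relations for \<open>kp\<close> and \<open>ks\<close> make the sum vanish.\<close>

theorem elastic_wave_navier:
  assumes g: "(g1, g2) \<in> elastic_densities"
    and \<mu>: "\<mu> > 0" "2 * \<mu> + lam > 0"
    and k: "kp\<^sup>2 = \<omega>\<^sup>2 * \<rho> / (2 * \<mu> + lam)" "ks\<^sup>2 = \<omega>\<^sup>2 * \<rho> / \<mu>"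
  shows "entire_navier_solution lam \<mu> \<rho> \<omega> (elastic_wave kp ks g1 g2)"
proof -
  define u where "u = elastic_wave kp ks g1 g2"
  define a b where "a j \<xi> = g1 \<xi> $ j" and "b j \<xi> = g2 \<xi> $ j" for j \<xi>
  have sq: "square_integrable arc_length g1" "square_integrable arc_length g2" using g by (auto simp: elastic_densities_def)
  have i: "integrable arc_length (a j)" "integrable arc_length (b j)" for j
    unfolding a_def b_def by (intro integrable_nth sq)+
  have C: "Ck m u" for m unfolding u_def by (rule Ck_elastic_wave[OF sq])
  have d: "u differentiable at x" for x using C[of "Suc 0"] by simp
  have dd: "partial j u differentiable at x" for j x using C[of "Suc (Suc 0)"] by simp
  have uj: "(\<lambda>x. u x $ j) = (\<lambda>x. herg kp (a j) x + herg ks (b j) x)" for j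
    unfolding u_def elastic_wave_nth a_def b_def ..
  have p1: "(\<lambda>x. partial i u x $ j) = (\<lambda>x. partial i (herg kp (a j)) x + partial i (herg ks (b j)) x)" for i j
  proof
    fix x
    have "partial i u x $ j = partial i (\<lambda>x. u x $ j) x" by (rule partial_nth[OF d, symmetric])
    also have "\<dots> = partial i (herg kp (a j)) x + partial i (herg ks (b j)) x"
      unfolding uj by (intro partial_add herg_differentiable i)
    finally show "partial i u x $ j = partial i (herg kp (a j)) x + partial i (herg ks (b j)) x" .
  qed
  have hd: "partial i (herg k f) differentiable at x" if "integrable arc_length f" for i k f x
    using Ck_herg[OF that, of "Suc (Suc 0)" k] by simp
  have lap: "laplacian u x $ j = - of_real (kp\<^sup>2) * herg kp (a j) x - of_real (ks\<^sup>2) * herg ks (b j) x" for x j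
  proof -
    have "partial i (partial i u) x $ j = partial i (partial i (herg kp (a j))) x + partial i (partial i (herg ks (b j))) x" for i
    proof -
      have "partial i (partial i u) x $ j = partial i (\<lambda>x. partial i u x $ j) x" by (rule partial_nth[OF dd, symmetric])
      also have "\<dots> = partial i (partial i (herg kp (a j))) x + partial i (partial i (herg ks (b j))) x"
        unfolding p1 by (intro partial_add hd i)
      finally show ?thesis .
    qed
    then have "laplacian u x $ j = (partial 1 (partial 1 (herg kp (a j))) x + partial 2 (partial 2 (herg kp (a j))) x)
       + (partial 1 (partial 1 (herg ks (b j))) x + partial 2 (partial 2 (herg ks (b j))) x)"
      by (simp add: laplacian_def sum_2)
    then show ?thesis unfolding laplacian_herg[OF i(1)] laplacian_herg[OF i(2)] by simp
  qed
  have div: "divergence u = (\<lambda>x. (partial 1 (herg kp (a 1)) x + partial 1 (herg ks (b 1)) x) + (partial 2 (herg kp (a 2)) x + partial 2 (herg ks (b 2)) x))"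
  proof
    fix x
    show "divergence u x = (partial 1 (herg kp (a 1)) x + partial 1 (herg ks (b 1)) x) + (partial 2 (herg kp (a 2)) x + partial 2 (herg ks (b 2)) x)"
      unfolding divergence_def sum_2 using p1[of 1 1, THEN fun_cong, of x] p1[of 2 2, THEN fun_cong, of x] by simp
  qed
  have grad: "grad (divergence u) x $ j = - of_real (kp\<^sup>2) * herg kp (a j) x" for x j
  proof -
    have "grad (divergence u) x $ j = (partial j (partial 1 (herg kp (a 1))) x + partial j (partial 1 (herg ks (b 1))) x) + (partial j (partial 2 (herg kp (a 2))) x + partial j (partial 2 (herg ks (b 2))) x)"
      unfolding grad_def vec_lambda_beta div
      by (subst partial_add; (intro differentiable_add hd i)?) (subst (1 2) partial_add; (intro hd i refl)?)
    also have "\<dots> = - of_real (kp\<^sup>2) * (herg kp (\<lambda>\<xi>. of_real (\<xi> $ j) * (of_real (\<xi> $ 1) * a 1 \<xi>)) x + herg kp (\<lambda>\<xi>. of_real (\<xi> $ j) * (of_real (\<xi> $ 2) * a 2 \<xi>)) x)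
       - of_real (ks\<^sup>2) * (herg ks (\<lambda>\<xi>. of_real (\<xi> $ j) * (of_real (\<xi> $ 1) * b 1 \<xi>)) x + herg ks (\<lambda>\<xi>. of_real (\<xi> $ j) * (of_real (\<xi> $ 2) * b 2 \<xi>)) x)"
      unfolding partial_partial_herg[OF i(1)] partial_partial_herg[OF i(2)] by (simp add: algebra_simps)
    also have "herg kp (\<lambda>\<xi>. of_real (\<xi> $ j) * (of_real (\<xi> $ 1) * a 1 \<xi>)) x + herg kp (\<lambda>\<xi>. of_real (\<xi> $ j) * (of_real (\<xi> $ 2) * a 2 \<xi>)) x = herg kp (a j) x"
    proof -
      have "herg kp (\<lambda>\<xi>. of_real (\<xi> $ j) * (of_real (\<xi> $ 1) * a 1 \<xi>)) x + herg kp (\<lambda>\<xi>. of_real (\<xi> $ j) * (of_real (\<xi> $ 2) * a 2 \<xi>)) x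
         = herg kp (\<lambda>\<xi>. of_real (\<xi> $ j) * (of_real (\<xi> $ 1) * a 1 \<xi>) + of_real (\<xi> $ j) * (of_real (\<xi> $ 2) * a 2 \<xi>)) x"
        by (intro herg_add[symmetric] integrable_nth_times i)
      also have "\<dots> = herg kp (a j) x"
      proof (rule herg_cong_AE)
        have "AE \<xi> in arc_length. \<exists>c. g1 \<xi> = c *s cvec \<xi>" using g by (auto simp: elastic_densities_def)
        then show "AE \<xi> in arc_length. of_real (\<xi> $ j) * (of_real (\<xi> $ 1) * a 1 \<xi>) + of_real (\<xi> $ j) * (of_real (\<xi> $ 2) * a 2 \<xi>) = a j \<xi>"
          using AE_space
        proof eventually_elim
          case (elim \<xi>)
          then obtain c where c: "g1 \<xi> = c *s cvec \<xi>" by blast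
          have s: "(\<xi> $ 1)\<^sup>2 + (\<xi> $ 2)\<^sup>2 = 1" using elim(2) by (simp add: norm_vec2)
          have "of_real (\<xi> $ j) * (of_real (\<xi> $ 1) * a 1 \<xi>) + of_real (\<xi> $ j) * (of_real (\<xi> $ 2) * a 2 \<xi>)
             = c * of_real (\<xi> $ j) * of_real ((\<xi> $ 1)\<^sup>2 + (\<xi> $ 2)\<^sup>2)"
            by (simp add: a_def c cvec_def power2_eq_square algebra_simps)
          then show ?case by (simp add: s a_def c cvec_def)
        qed
      qed (intro Bochner_Integration.integrable_add integrable_nth_times i)+
      finally show ?thesis .
    qed
    also have "herg ks (\<lambda>\<xi>. of_real (\<xi> $ j) * (of_real (\<xi> $ 1) * b 1 \<xi>)) x + herg ks (\<lambda>\<xi>. of_real (\<xi> $ j) * (of_real (\<xi> $ 2) * b 2 \<xi>)) x = 0"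
    proof -
      have "herg ks (\<lambda>\<xi>. of_real (\<xi> $ j) * (of_real (\<xi> $ 1) * b 1 \<xi>)) x + herg ks (\<lambda>\<xi>. of_real (\<xi> $ j) * (of_real (\<xi> $ 2) * b 2 \<xi>)) x
         = herg ks (\<lambda>\<xi>. of_real (\<xi> $ j) * (of_real (\<xi> $ 1) * b 1 \<xi>) + of_real (\<xi> $ j) * (of_real (\<xi> $ 2) * b 2 \<xi>)) x"
        by (intro herg_add[symmetric] integrable_nth_times i)
      also have "\<dots> = herg ks (\<lambda>\<xi>. 0) x"
      proof (rule herg_cong_AE)
        have "AE \<xi> in arc_length. cdot (g2 \<xi>) (cvec \<xi>) = 0" using g by (auto simp: elastic_densities_def)
        then show "AE \<xi> in arc_length. of_real (\<xi> $ j) * (of_real (\<xi> $ 1) * b 1 \<xi>) + of_real (\<xi> $ j) * (of_real (\<xi> $ 2) * b 2 \<xi>) = 0"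
        proof eventually_elim
          case (elim \<xi>)
          have "of_real (\<xi> $ j) * (of_real (\<xi> $ 1) * b 1 \<xi>) + of_real (\<xi> $ j) * (of_real (\<xi> $ 2) * b 2 \<xi>) = of_real (\<xi> $ j) * cdot (g2 \<xi>) (cvec \<xi>)"
            by (simp add: b_def cdot_def cvec_def sum_2 algebra_simps)
          then show ?case by (simp add: elim)
        qed
      qed (intro Bochner_Integration.integrable_add integrable_nth_times i Bochner_Integration.integrable_zero)+
      finally show ?thesis by (simp add: herg_def)
    qed
    finally show ?thesis by simp
  qed
  have navier: "\<mu> *\<^sub>R laplacian u x + (lam + \<mu>) *\<^sub>R grad (divergence u) x + (\<rho> * \<omega>\<^sup>2) *\<^sub>R u x = 0" for x
  proof -
    have k': "\<mu> * kp\<^sup>2 + (lam + \<mu>) * kp\<^sup>2 = \<rho> * \<omega>\<^sup>2" "\<mu> * ks\<^sup>2 = \<rho> * \<omega>\<^sup>2"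
    proof -
      have "(2 * \<mu> + lam) * kp\<^sup>2 = \<rho> * \<omega>\<^sup>2" unfolding k(1) using \<mu>(2) by simp
      then show "\<mu> * kp\<^sup>2 + (lam + \<mu>) * kp\<^sup>2 = \<rho> * \<omega>\<^sup>2" by (simp add: algebra_simps)
      show "\<mu> * ks\<^sup>2 = \<rho> * \<omega>\<^sup>2" unfolding k(2) using \<mu>(1) by simp
    qed
    have "(\<mu> *\<^sub>R laplacian u x + (lam + \<mu>) *\<^sub>R grad (divergence u) x + (\<rho> * \<omega>\<^sup>2) *\<^sub>R u x) $ j = 0" for j
    proof -
      define A B where "A = herg kp (a j) x" and "B = herg ks (b j) x"
      have "(\<mu> *\<^sub>R laplacian u x + (lam + \<mu>) *\<^sub>R grad (divergence u) x + (\<rho> * \<omega>\<^sup>2) *\<^sub>R u x) $ j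
         = of_real \<mu> * (- of_real (kp\<^sup>2) * A - of_real (ks\<^sup>2) * B) + of_real (lam + \<mu>) * (- of_real (kp\<^sup>2) * A) + of_real (\<rho> * \<omega>\<^sup>2) * (A + B)"
        using uj[of j, THEN fun_cong, of x]
        by (simp only: vector_add_component vector_scaleR_component lap grad A_def B_def scaleR_conv_of_real[where 'a = complex])
      also have "\<dots> = of_real (\<rho> * \<omega>\<^sup>2 - (\<mu> * kp\<^sup>2 + (lam + \<mu>) * kp\<^sup>2)) * A + of_real (\<rho> * \<omega>\<^sup>2 - \<mu> * ks\<^sup>2) * B"
        by (simp add: algebra_simps)
      also have "\<dots> = 0" unfolding k' by simp
      finally show ?thesis .
    qed
    then show ?thesis by (simp only: vec_eq_iff) simp
  qed
  have "Ck 2 u" using C .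
  then show ?thesis unfolding entire_navier_solution_def u_def[symmetric] using navier by blast
qed

text \<open>The Navier equation holds for every admissible pair of densities, so the space of waves is a linear image
  of the space of densities.\<close>

theorem elastic_herglotz_eq_elastic_waves:
  assumes "\<mu> > 0" "2 * \<mu> + lam > 0" "kp\<^sup>2 = \<omega>\<^sup>2 * \<rho> / (2 * \<mu> + lam)" "ks\<^sup>2 = \<omega>\<^sup>2 * \<rho> / \<mu>"
  shows "elastic_herglotz lam \<mu> \<rho> \<omega> kp ks = (\<lambda>(g1, g2). elastic_wave kp ks g1 g2) ` elastic_densities"
proof (intro equalityI subsetI)
  fix u assume "u \<in> elastic_herglotz lam \<mu> \<rho> \<omega> kp ks"
  then obtain g1 g2 where g: "g1 \<in> L2_circle" "g2 \<in> L2_circle"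
    "AE \<xi> in arc_length. \<exists>c. g1 \<xi> = c *s cvec \<xi>" "AE \<xi> in arc_length. cdot (g2 \<xi>) (cvec \<xi>) = 0"
    "\<And>x. u x = (LINT \<xi>|arc_length. exp (\<i> * complex_of_real (kp * (x \<bullet> \<xi>))) *s g1 \<xi>
                        + exp (\<i> * complex_of_real (ks * (x \<bullet> \<xi>))) *s g2 \<xi>)"
    unfolding elastic_herglotz_def by blast
  have "u = elastic_wave kp ks g1 g2"
    unfolding fun_eq_iff g(5) using g(1,2) by (simp only: L2_circle_iff elastic_wave_eq_integral) simp
  then show "u \<in> (\<lambda>(g1, g2). elastic_wave kp ks g1 g2) ` elastic_densities"
    using g by (intro image_eqI[of _ _ "(g1, g2)"]) (simp_all add: elastic_densities_def L2_circle_iff)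
next
  fix u assume "u \<in> (\<lambda>(g1, g2). elastic_wave kp ks g1 g2) ` elastic_densities"
  then obtain g1 g2 where g: "(g1, g2) \<in> elastic_densities" "u = elastic_wave kp ks g1 g2" by auto
  then have s: "square_integrable arc_length g1" "square_integrable arc_length g2" by (auto simp: elastic_densities_def)
  have "\<forall>x. u x = (LINT \<xi>|arc_length. exp (\<i> * complex_of_real (kp * (x \<bullet> \<xi>))) *s g1 \<xi>
                        + exp (\<i> * complex_of_real (ks * (x \<bullet> \<xi>))) *s g2 \<xi>)"
    unfolding g(2) using elastic_wave_eq_integral[OF s] by blast
  moreover have "entire_navier_solution lam \<mu> \<rho> \<omega> u" unfolding g(2) by (rule elastic_wave_navier[OF g(1) assms])
  moreover have "g1 \<in> L2_circle" "g2 \<in> L2_circle" using s by (simp_all add: L2_circle_iff)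
  moreover have "AE \<xi> in arc_length. \<exists>c. g1 \<xi> = c *s cvec \<xi>" "AE \<xi> in arc_length. cdot (g2 \<xi>) (cvec \<xi>) = 0"
    using g(1) by (auto simp: elastic_densities_def)
  ultimately show "u \<in> elastic_herglotz lam \<mu> \<rho> \<omega> kp ks" unfolding elastic_herglotz_def by blast
qed

section \<open>Equivalence of the energy and the norm of the densities\<close>

lemma energy_elastic_wave:
  assumes g: "square_integrable arc_length g1" "square_integrable arc_length g2"
  shows "energy (elastic_wave k l g1 g2) = energy (\<lambda>x. herg k (\<lambda>\<xi>. g1 \<xi> $ 1) x + herg l (\<lambda>\<xi>. g2 \<xi> $ 1) x)
    + energy (\<lambda>x. herg k (\<lambda>\<xi>. g1 \<xi> $ 2) x + herg l (\<lambda>\<xi>. g2 \<xi> $ 2) x)"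
proof -
  let ?u = "elastic_wave k l g1 g2"
  have C: "Ck (Suc 0) ?u" by (rule Ck_elastic_wave[OF g])
  have d: "?u differentiable at x" for x using C by simp
  define U where "U j x = ?u x $ j" for j x
  have CU: "Ck (Suc 0) (U j)" for j unfolding U_def by (rule Ck_bounded_linear[OF bounded_linear_vec_nth C])
  have [measurable]: "U j \<in> borel_measurable borel" "ang_deriv (U j) \<in> borel_measurable borel" for j
    by (intro borel_measurable_continuous_onI Ck_imp_continuous[OF CU] ang_deriv_continuous[OF CU])+
  have "energy ?u = (\<integral>\<^sup>+x. ennreal (weight x * ((norm (U 1 x))\<^sup>2 + (norm (ang_deriv (U 1) x))\<^sup>2)) + ennreal (weight x * ((norm (U 2 x))\<^sup>2 + (norm (ang_deriv (U 2) x))\<^sup>2)) \<partial>lborel)"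
    unfolding energy_def
  proof (rule nn_integral_cong)
    fix x
    have "weight x * ((norm (?u x))\<^sup>2 + (norm (ang_deriv ?u x))\<^sup>2) = weight x * ((norm (U 1 x))\<^sup>2 + (norm (ang_deriv (U 1) x))\<^sup>2) + weight x * ((norm (U 2 x))\<^sup>2 + (norm (ang_deriv (U 2) x))\<^sup>2)"
      unfolding norm_vec2_square U_def ang_deriv_nth[OF d] by (simp add: algebra_simps)
    then show "ennreal (weight x * ((norm (?u x))\<^sup>2 + (norm (ang_deriv ?u x))\<^sup>2)) = ennreal (weight x * ((norm (U 1 x))\<^sup>2 + (norm (ang_deriv (U 1) x))\<^sup>2)) + ennreal (weight x * ((norm (U 2 x))\<^sup>2 + (norm (ang_deriv (U 2) x))\<^sup>2))"
      by (simp only:) (rule ennreal_plus; simp)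
  qed
  also have "\<dots> = energy (U 1) + energy (U 2)"
    unfolding energy_def by (rule nn_integral_add) measurable
  finally show ?thesis unfolding U_def elastic_wave_nth .
qed

lemma elastic_wave_energy_upper:
  assumes k: "k > 0" "l > 0"
  shows "\<exists>C\<ge>0. \<forall>g1 g2. square_integrable arc_length g1 \<longrightarrow> square_integrable arc_length g2 \<longrightarrow>
    energy (elastic_wave k l g1 g2) \<le> ennreal (C * (vec_sq_norm g1 + vec_sq_norm g2))"
proof -
  obtain C1 where C1: "C1 \<ge> 0" "\<And>f. square_integrable arc_length f \<Longrightarrow> energy (herg k f) \<le> ennreal (C1 * sq_norm f)"
    using herg_energy_upper[OF k(1)] by blast
  obtain C2 where C2: "C2 \<ge> 0" "\<And>f. square_integrable arc_length f \<Longrightarrow> energy (herg l f) \<le> ennreal (C2 * sq_norm f)"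
    using herg_energy_upper[OF k(2)] by blast
  define C where "C = 2 * max C1 C2"
  have C: "C \<ge> 0" "2 * C1 \<le> C" "2 * C2 \<le> C" using C1(1) by (auto simp: C_def)
  have pair: "energy (\<lambda>x. herg k f x + herg l g x) \<le> ennreal (C * (sq_norm f + sq_norm g))"
    if f: "square_integrable arc_length f" and g: "square_integrable arc_length g" for f g
  proof -
    have "energy (\<lambda>x. herg k f x + herg l g x) \<le> 2 * energy (herg k f) + 2 * energy (herg l g)"
      by (intro energy_add_le Ck_herg arc_length.square_integrable_integrable f g)
    also have "\<dots> \<le> 2 * ennreal (C1 * sq_norm f) + 2 * ennreal (C2 * sq_norm g)"
      by (intro add_mono mult_left_mono C1(2) C2(2) f g) auto
    also have "\<dots> = ennreal (2 * C1 * sq_norm f + 2 * C2 * sq_norm g)"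
    proof -
      have "ennreal (2 * C1 * sq_norm f + 2 * C2 * sq_norm g) = ennreal (2 * C1 * sq_norm f) + ennreal (2 * C2 * sq_norm g)"
        using C1(1) C2(1) by (intro ennreal_plus) auto
      then show ?thesis using C1(1) C2(1) by (simp add: ennreal_mult mult.assoc)
    qed
    also have "\<dots> \<le> ennreal (C * (sq_norm f + sq_norm g))"
      unfolding distrib_left by (intro ennreal_leI add_mono mult_right_mono C) auto
    finally show ?thesis .
  qed
  have "energy (elastic_wave k l g1 g2) \<le> ennreal (C * (vec_sq_norm g1 + vec_sq_norm g2))"
    if g: "square_integrable arc_length g1" "square_integrable arc_length g2" for g1 g2
  proof -
    have "energy (elastic_wave k l g1 g2) \<le> ennreal (C * (sq_norm (\<lambda>\<xi>. g1 \<xi> $ 1) + sq_norm (\<lambda>\<xi>. g2 \<xi> $ 1))) + ennreal (C * (sq_norm (\<lambda>\<xi>. g1 \<xi> $ 2) + sq_norm (\<lambda>\<xi>. g2 \<xi> $ 2)))"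
      unfolding energy_elastic_wave[OF g] by (intro add_mono pair square_integrable_nth g)
    also have "\<dots> = ennreal (C * (sq_norm (\<lambda>\<xi>. g1 \<xi> $ 1) + sq_norm (\<lambda>\<xi>. g2 \<xi> $ 1)) + C * (sq_norm (\<lambda>\<xi>. g1 \<xi> $ 2) + sq_norm (\<lambda>\<xi>. g2 \<xi> $ 2)))"
      using C(1) by (intro ennreal_plus[symmetric]) auto
    also have "C * (sq_norm (\<lambda>\<xi>. g1 \<xi> $ 1) + sq_norm (\<lambda>\<xi>. g2 \<xi> $ 1)) + C * (sq_norm (\<lambda>\<xi>. g1 \<xi> $ 2) + sq_norm (\<lambda>\<xi>. g2 \<xi> $ 2)) = C * (vec_sq_norm g1 + vec_sq_norm g2)"
      unfolding vec_sq_norm_eq[OF g(1)] vec_sq_norm_eq[OF g(2)] by (simp add: algebra_simps)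
    finally show ?thesis .
  qed
  then show ?thesis using C(1) by blast
qed

lemma elastic_wave_energy_lower_distinct:
  assumes k: "k > 0" "l > 0" "k \<noteq> l"
  shows "\<exists>c>0. \<forall>g1 g2. square_integrable arc_length g1 \<longrightarrow> square_integrable arc_length g2 \<longrightarrow>
    ennreal (c * (vec_sq_norm g1 + vec_sq_norm g2)) \<le> energy (elastic_wave k l g1 g2)"
proof -
  obtain c where c: "c > 0" "\<And>f g. square_integrable arc_length f \<Longrightarrow> square_integrable arc_length g \<Longrightarrow>
    ennreal (c * (sq_norm f + sq_norm g)) \<le> energy (\<lambda>x. herg k f x + herg l g x)"
    using herg_pair_energy_lower[OF k] by blast
  have "ennreal (c * (vec_sq_norm g1 + vec_sq_norm g2)) \<le> energy (elastic_wave k l g1 g2)"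
    if g: "square_integrable arc_length g1" "square_integrable arc_length g2" for g1 g2
  proof -
    have "c * (vec_sq_norm g1 + vec_sq_norm g2) = c * (sq_norm (\<lambda>\<xi>. g1 \<xi> $ 1) + sq_norm (\<lambda>\<xi>. g2 \<xi> $ 1)) + c * (sq_norm (\<lambda>\<xi>. g1 \<xi> $ 2) + sq_norm (\<lambda>\<xi>. g2 \<xi> $ 2))"
      unfolding vec_sq_norm_eq[OF g(1)] vec_sq_norm_eq[OF g(2)] by (simp add: algebra_simps)
    then have "ennreal (c * (vec_sq_norm g1 + vec_sq_norm g2)) = ennreal (c * (sq_norm (\<lambda>\<xi>. g1 \<xi> $ 1) + sq_norm (\<lambda>\<xi>. g2 \<xi> $ 1))) + ennreal (c * (sq_norm (\<lambda>\<xi>. g1 \<xi> $ 2) + sq_norm (\<lambda>\<xi>. g2 \<xi> $ 2)))"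
      using c(1) by (simp only:) (rule ennreal_plus; simp)
    also have "\<dots> \<le> energy (elastic_wave k l g1 g2)"
      unfolding energy_elastic_wave[OF g] by (intro add_mono c(2) square_integrable_nth g)
    finally show ?thesis .
  qed
  then show ?thesis using c(1) by blast
qed

text \<open>The densities are orthogonal at almost every point of the circle, since \<open>\<xi>\<close> is real.\<close>

lemma elastic_densities_pythagoras:
  assumes g: "(g1, g2) \<in> elastic_densities"
  shows "vec_sq_norm (\<lambda>\<xi>. g1 \<xi> + g2 \<xi>) = vec_sq_norm g1 + vec_sq_norm g2"
proof -
  have sq: "square_integrable arc_length g1" "square_integrable arc_length g2" using g by (auto simp: elastic_densities_def)
  have ae: "AE \<xi> in arc_length. \<exists>c. g1 \<xi> = c *s cvec \<xi>" "AE \<xi> in arc_length. cdot (g2 \<xi>) (cvec \<xi>) = 0"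
    using g by (auto simp: elastic_densities_def)
  have i: "integrable arc_length (\<lambda>\<xi>. (norm (g1 \<xi>))\<^sup>2)" "integrable arc_length (\<lambda>\<xi>. (norm (g2 \<xi>))\<^sup>2)"
    using sq by (auto simp: square_integrable_def)
  have "vec_sq_norm (\<lambda>\<xi>. g1 \<xi> + g2 \<xi>) = (\<integral>\<xi>. (norm (g1 \<xi>))\<^sup>2 + (norm (g2 \<xi>))\<^sup>2 \<partial>arc_length)"
  proof (rule integral_cong_AE)
    show "AE \<xi> in arc_length. (norm (g1 \<xi> + g2 \<xi>))\<^sup>2 = (norm (g1 \<xi>))\<^sup>2 + (norm (g2 \<xi>))\<^sup>2"
      using ae
    proof eventually_elim
      case (elim \<xi>)
      then obtain c where c: "g1 \<xi> = c *s cvec \<xi>" by blast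
      have "cdot (g2 \<xi>) (vcnj (g1 \<xi>)) = cnj c * cdot (g2 \<xi>) (cvec \<xi>)"
        by (simp add: c cdot_def vcnj_def cvec_def sum_2 algebra_simps)
      then have z: "cdot (g2 \<xi>) (vcnj (g1 \<xi>)) = 0" using elim by simp
      have e: "(norm (p + q))\<^sup>2 = (norm p)\<^sup>2 + (norm q)\<^sup>2 + 2 * Re (cdot q (vcnj p))" for p q :: "complex^2"
        unfolding norm_vec2_square by (simp add: cmod_power2 power2_sum cdot_def vcnj_def sum_2 algebra_simps)
      show ?case unfolding e z by simp
    qed
  qed (use sq in \<open>auto simp: square_integrable_def\<close>)
  then show ?thesis using i by simp
qed

text \<open>For equal wave numbers the wave is a single Herglotz wave of \<open>g1 + g2\<close>. It is regarded as a pair with the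
  distinct wave numbers \<open>k\<close> and \<open>k + 1\<close> and second density zero, and Pythagoras splits the norm.\<close>

theorem elastic_energy_lower:
  assumes k: "k > 0" "l > 0"
  shows "\<exists>c>0. \<forall>g1 g2. (g1, g2) \<in> elastic_densities \<longrightarrow>
    ennreal (c * (vec_sq_norm g1 + vec_sq_norm g2)) \<le> energy (elastic_wave k l g1 g2)"
proof (cases "k = l")
  case False
  then show ?thesis using elastic_wave_energy_lower_distinct[OF k False] unfolding elastic_densities_def by blast
next
  case True
  obtain c where c: "c > 0" "\<And>g1 g2. square_integrable arc_length g1 \<Longrightarrow> square_integrable arc_length g2 \<Longrightarrow>
    ennreal (c * (vec_sq_norm g1 + vec_sq_norm g2)) \<le> energy (elastic_wave k (k + 1) g1 g2)"
    using elastic_wave_energy_lower_distinct[of k "k + 1"] k by auto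
  have "ennreal (c * (vec_sq_norm g1 + vec_sq_norm g2)) \<le> energy (elastic_wave k l g1 g2)" if g: "(g1, g2) \<in> elastic_densities" for g1 g2
  proof -
    have sq: "square_integrable arc_length g1" "square_integrable arc_length g2" using g by (auto simp: elastic_densities_def)
    have s0: "square_integrable arc_length (\<lambda>\<xi>. 0 :: complex^2)" by (rule arc_length.square_integrable_const)
    have "elastic_wave k l g1 g2 = elastic_wave k (k + 1) (\<lambda>\<xi>. g1 \<xi> + g2 \<xi>) (\<lambda>\<xi>. 0)"
    proof
      fix x
      have "herg (k + 1) (\<lambda>\<xi>. 0) x = 0" by (simp add: herg_def)
      then show "elastic_wave k l g1 g2 x = elastic_wave k (k + 1) (\<lambda>\<xi>. g1 \<xi> + g2 \<xi>) (\<lambda>\<xi>. 0) x"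
        by (simp add: elastic_wave_def vec_eq_iff True[symmetric] herg_add integrable_nth sq)
    qed
    then show ?thesis
      using c(2)[OF square_integrable_add[OF sq] s0] by (simp add: elastic_densities_pythagoras[OF g])
  qed
  then show ?thesis using c(1) by blast
qed

section \<open>The reproducing kernel Hilbert space\<close>

text \<open>Being parallel to \<open>\<xi>\<close> is expressed by the vanishing of a continuous function, the determinant.\<close>

lemma elastic_densities_limit:
  fixes p q :: "nat \<Rightarrow> real^2 \<Rightarrow> complex^2"
  assumes s: "\<And>n. (p n, q n) \<in> elastic_densities"
    and f: "square_integrable arc_length f" and g: "square_integrable arc_length g"
    and lim: "AE \<xi> in arc_length. (\<lambda>n. p (r n) \<xi>) \<longlonglongrightarrow> f \<xi>" "AE \<xi> in arc_length. (\<lambda>n. q (r' n) \<xi>) \<longlonglongrightarrow> g \<xi>"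
  shows "(f, g) \<in> elastic_densities"
proof -
  have par: "(\<exists>c. v = c *s cvec \<xi>) \<longleftrightarrow> v $ 1 * of_real (\<xi> $ 2) - v $ 2 * of_real (\<xi> $ 1) = 0"
    if "\<xi> \<in> sphere 0 1" for v and \<xi> :: "real^2"
  proof
    assume "\<exists>c. v = c *s cvec \<xi>"
    then show "v $ 1 * of_real (\<xi> $ 2) - v $ 2 * of_real (\<xi> $ 1) = 0" by (auto simp: cvec_def)
  next
    assume z: "v $ 1 * of_real (\<xi> $ 2) - v $ 2 * of_real (\<xi> $ 1) = 0"
    have s: "(\<xi> $ 1)\<^sup>2 + (\<xi> $ 2)\<^sup>2 = 1" using that by (simp add: norm_vec2)
    define c where "c = v $ 1 * of_real (\<xi> $ 1) + v $ 2 * of_real (\<xi> $ 2)"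
    have "c * of_real (\<xi> $ 1) = v $ 1 * of_real ((\<xi> $ 1)\<^sup>2 + (\<xi> $ 2)\<^sup>2) - of_real (\<xi> $ 2) * (v $ 1 * of_real (\<xi> $ 2) - v $ 2 * of_real (\<xi> $ 1))"
      "c * of_real (\<xi> $ 2) = v $ 2 * of_real ((\<xi> $ 1)\<^sup>2 + (\<xi> $ 2)\<^sup>2) + of_real (\<xi> $ 1) * (v $ 1 * of_real (\<xi> $ 2) - v $ 2 * of_real (\<xi> $ 1))"
      by (simp_all add: c_def power2_eq_square algebra_simps)
    then have "v = c *s cvec \<xi>" unfolding s z by (simp add: vec2_eq_iff cvec_def)
    then show "\<exists>c. v = c *s cvec \<xi>" by blast
  qed
  have "\<forall>n. AE \<xi> in arc_length. \<exists>c. p n \<xi> = c *s cvec \<xi>"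
    using s by (auto simp: elastic_densities_def)
  then have "AE \<xi> in arc_length. \<forall>n. \<exists>c. p n \<xi> = c *s cvec \<xi>" by (rule AE_all_countable[THEN iffD2])
  then have "AE \<xi> in arc_length. \<exists>c. f \<xi> = c *s cvec \<xi>"
    using lim(1) AE_space
  proof eventually_elim
    case (elim \<xi>)
    then have \<xi>: "\<xi> \<in> sphere 0 1" by simp
    have "(\<lambda>n. p (r n) \<xi> $ 1 * of_real (\<xi> $ 2) - p (r n) \<xi> $ 2 * of_real (\<xi> $ 1)) \<longlonglongrightarrow> f \<xi> $ 1 * of_real (\<xi> $ 2) - f \<xi> $ 2 * of_real (\<xi> $ 1)"
      by (intro tendsto_intros elim(2))
    moreover have "p (r n) \<xi> $ 1 * of_real (\<xi> $ 2) - p (r n) \<xi> $ 2 * of_real (\<xi> $ 1) = 0" for n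
      using elim(1) par[OF \<xi>, of "p (r n) \<xi>"] by blast
    ultimately show ?case unfolding par[OF \<xi>] by (simp add: LIMSEQ_const_iff)
  qed
  moreover have "AE \<xi> in arc_length. cdot (g \<xi>) (cvec \<xi>) = 0"
  proof -
    have "\<forall>n. AE \<xi> in arc_length. cdot (q n \<xi>) (cvec \<xi>) = 0"
      using s by (auto simp: elastic_densities_def)
    then have "AE \<xi> in arc_length. \<forall>n. cdot (q n \<xi>) (cvec \<xi>) = 0" by (rule AE_all_countable[THEN iffD2])
    then show "AE \<xi> in arc_length. cdot (g \<xi>) (cvec \<xi>) = 0"
      using lim(2)
    proof eventually_elim
      case (elim \<xi>)
      have "(\<lambda>n. cdot (q (r' n) \<xi>) (cvec \<xi>)) \<longlonglongrightarrow> cdot (g \<xi>) (cvec \<xi>)"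
        unfolding cdot_def sum_2 by (intro tendsto_intros elim(2))
      then show ?case using elim(1) by (simp add: LIMSEQ_const_iff)
    qed
  qed
  ultimately show ?thesis using f g by (simp add: elastic_densities_def)
qed

lemma elastic_densities_zero: "(\<lambda>\<xi>. 0, \<lambda>\<xi>. 0) \<in> elastic_densities"
proof -
  have "0 = 0 *s cvec \<xi>" for \<xi> :: "real^2" by simp
  then have "\<exists>c. 0 = c *s cvec \<xi>" for \<xi> :: "real^2" by blast
  then show ?thesis by (simp add: elastic_densities_def arc_length.square_integrable_const cdot_def)
qed

lemma elastic_densities_diff:
  assumes "(g1, g2) \<in> elastic_densities" "(h1, h2) \<in> elastic_densities"
  shows "(\<lambda>\<xi>. g1 \<xi> - h1 \<xi>, \<lambda>\<xi>. g2 \<xi> - h2 \<xi>) \<in> elastic_densities"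
  using elastic_densities_add[OF assms(1) elastic_densities_cscale[OF assms(2), of "-1"]]
  by (simp add: vector_sneg_minus1[symmetric])

lemma herg_diff:
  "integrable arc_length f \<Longrightarrow> integrable arc_length g \<Longrightarrow>
    herg k (\<lambda>\<xi>. f \<xi> - g \<xi>) x = herg k f x - herg k g x"
  by (simp add: herg_def right_diff_distrib herg_integrable)

lemma elastic_wave_diff:
  assumes "square_integrable arc_length g1" "square_integrable arc_length g2"
    "square_integrable arc_length h1" "square_integrable arc_length h2"
  shows "elastic_wave k l (\<lambda>\<xi>. g1 \<xi> - h1 \<xi>) (\<lambda>\<xi>. g2 \<xi> - h2 \<xi>) x = elastic_wave k l g1 g2 x - elastic_wave k l h1 h2 x"
  using assms by (simp add: elastic_wave_def vec_eq_iff herg_diff integrable_nth)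

text \<open>A plane wave has modulus 1, so the wave is bounded by the \<open>L\<^sup>1\<close> norms of the components of its densities.\<close>

lemma elastic_wave_norm_le:
  assumes g: "square_integrable arc_length g1" "square_integrable arc_length g2"
  shows "norm (elastic_wave k l g1 g2 x) \<le> 4 * sqrt (2 * pi * (vec_sq_norm g1 + vec_sq_norm g2))"
proof -
  let ?S = "sqrt (2 * pi * (vec_sq_norm g1 + vec_sq_norm g2))"
  have h: "norm (herg k' (\<lambda>\<xi>. f \<xi> $ j) x) \<le> ?S"
    if f: "square_integrable arc_length f" "vec_sq_norm f \<le> vec_sq_norm g1 + vec_sq_norm g2" for k' f j
  proof (rule real_le_rsqrt)
    have fj: "square_integrable arc_length (\<lambda>\<xi>. f \<xi> $ j)" by (rule square_integrable_nth[OF f(1)])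
    have "(norm (herg k' (\<lambda>\<xi>. f \<xi> $ j) x))\<^sup>2 \<le> (\<integral>\<xi>. norm (f \<xi> $ j) \<partial>arc_length)\<^sup>2"
      by (intro power_mono herg_norm_le integrable_nth f) auto
    also have "\<dots> \<le> 2 * pi * sq_norm (\<lambda>\<xi>. f \<xi> $ j)"
      using arc_length.square_integral_norm_le[OF fj] by simp
    also have "\<dots> \<le> 2 * pi * vec_sq_norm f"
      using f(1) fj by (intro mult_left_mono integral_mono)
        (auto simp: square_integrable_def intro!: power_mono Finite_Cartesian_Product.norm_nth_le)
    also have "\<dots> \<le> 2 * pi * (vec_sq_norm g1 + vec_sq_norm g2)"
      by (intro mult_left_mono f(2)) auto
    finally show "(norm (herg k' (\<lambda>\<xi>. f \<xi> $ j) x))\<^sup>2 \<le> 2 * pi * (vec_sq_norm g1 + vec_sq_norm g2)" .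
  qed
  have "norm (elastic_wave k l g1 g2 x $ j) \<le> 2 * ?S" for j
  proof -
    have "norm (elastic_wave k l g1 g2 x $ j) \<le> norm (herg k (\<lambda>\<xi>. g1 \<xi> $ j) x) + norm (herg l (\<lambda>\<xi>. g2 \<xi> $ j) x)"
      unfolding elastic_wave_def vec_lambda_beta by (rule norm_triangle_ineq)
    also have "\<dots> \<le> ?S + ?S" by (intro add_mono h g) simp_all
    finally show ?thesis by simp
  qed
  note nth = this
  have "norm (elastic_wave k l g1 g2 x) \<le> norm (elastic_wave k l g1 g2 x $ 1) + norm (elastic_wave k l g1 g2 x $ 2)"
    unfolding norm_vec2[of "elastic_wave k l g1 g2 x"] by (rule sqrt_sum_squares_le_sum) auto
  then show ?thesis using nth[of 1] nth[of 2] by linarith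
qed

theorem theorem1p4:
  fixes \<rho> \<omega> lam \<mu> kp ks :: real
  assumes "\<rho> > 0" and "\<omega> > 0" and "\<mu> > 0" and "2 * \<mu> + lam > 0"
    and "kp > 0" and "kp\<^sup>2 = \<omega>\<^sup>2 * \<rho> / (2 * \<mu> + lam)"
    and "ks > 0" and "ks\<^sup>2 = \<omega>\<^sup>2 * \<rho> / \<mu>"
  shows "(\<forall>u\<in>elastic_herglotz lam \<mu> \<rho> \<omega> kp ks. (u, angular_gradient u) \<in> H_ambient) \<and>
         reproducing_kernel_hilbert_space (elastic_herglotz lam \<mu> \<rho> \<omega> kp ks) H_inner"
proof -
  define W where "W = (\<lambda>(g1, g2). elastic_wave kp ks g1 g2) ` elastic_densities"
  have W: "elastic_herglotz lam \<mu> \<rho> \<omega> kp ks = W"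
    unfolding W_def by (rule elastic_herglotz_eq_elastic_waves[OF assms(3,4,6,8)])
  have Wi: "elastic_wave kp ks g1 g2 \<in> W" if "(g1, g2) \<in> elastic_densities" for g1 g2
    unfolding W_def using that by (intro image_eqI[of _ _ "(g1, g2)"]) auto
  have We: "\<exists>g1 g2. (g1, g2) \<in> elastic_densities \<and> u = elastic_wave kp ks g1 g2" if "u \<in> W" for u
    using that unfolding W_def by auto
  have sq: "square_integrable arc_length g1" "square_integrable arc_length g2" if "(g1, g2) \<in> elastic_densities" for g1 g2
    using that by (auto simp: elastic_densities_def)
  obtain C where C: "C \<ge> 0" "\<And>g1 g2. square_integrable arc_length g1 \<Longrightarrow> square_integrable arc_length g2 \<Longrightarrow>
    energy (elastic_wave kp ks g1 g2) \<le> ennreal (C * (vec_sq_norm g1 + vec_sq_norm g2))"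
    using elastic_wave_energy_upper[OF assms(5,7)] by blast
  obtain c where c: "c > 0" "\<And>g1 g2. (g1, g2) \<in> elastic_densities \<Longrightarrow>
    ennreal (c * (vec_sq_norm g1 + vec_sq_norm g2)) \<le> energy (elastic_wave kp ks g1 g2)"
    using elastic_energy_lower[OF assms(5,7)] by blast
  have fin: "elastic_wave kp ks g1 g2 \<in> finite_energy" if "(g1, g2) \<in> elastic_densities" for g1 g2
    using le_less_trans[OF C(2)[OF sq[OF that]] ennreal_less_top] Ck_elastic_wave[OF sq[OF that]]
    by (simp add: finite_energy_def del: Ck.simps)
  have finW: "u \<in> finite_energy" if "u \<in> W" for u using We[OF that] fin by blast
  have upper: "sq_energy (elastic_wave kp ks g1 g2) \<le> C * (vec_sq_norm g1 + vec_sq_norm g2)" if g: "(g1, g2) \<in> elastic_densities" for g1 g2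
    using C(2)[OF sq[OF g]] C(1) unfolding finite_energyD(7)[OF fin[OF g], symmetric] by (subst (asm) ennreal_le_iff) auto
  have lower: "c * (vec_sq_norm g1 + vec_sq_norm g2) \<le> sq_energy (elastic_wave kp ks g1 g2)" if g: "(g1, g2) \<in> elastic_densities" for g1 g2
    using c(2)[OF g] sq_energy_nonneg unfolding finite_energyD(7)[OF fin[OF g], symmetric] by (subst (asm) ennreal_le_iff) auto
  have W0: "(\<lambda>x. 0) \<in> W"
  proof -
    have "elastic_wave kp ks (\<lambda>\<xi>. 0) (\<lambda>\<xi>. 0) = (\<lambda>x. 0)" by (simp add: fun_eq_iff elastic_wave_def herg_def vec_eq_iff)
    then show ?thesis using Wi[OF elastic_densities_zero] by simp
  qed
  have Wadd: "(\<lambda>x. u x + v x) \<in> W" if uv: "u \<in> W" "v \<in> W" for u v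
  proof -
    obtain g1 g2 h1 h2 where g: "(g1, g2) \<in> elastic_densities" "u = elastic_wave kp ks g1 g2"
      and h: "(h1, h2) \<in> elastic_densities" "v = elastic_wave kp ks h1 h2" using We[OF uv(1)] We[OF uv(2)] by blast
    have "(\<lambda>x. u x + v x) = elastic_wave kp ks (\<lambda>\<xi>. g1 \<xi> + h1 \<xi>) (\<lambda>\<xi>. g2 \<xi> + h2 \<xi>)"
      unfolding g(2) h(2) by (intro ext elastic_wave_add[symmetric] sq[OF g(1)] sq[OF h(1)])
    then show ?thesis using Wi[OF elastic_densities_add[OF g(1) h(1)]] by simp
  qed
  have Wscale: "(\<lambda>x. a *s u x) \<in> W" if u: "u \<in> W" for a u
  proof -
    obtain g1 g2 where g: "(g1, g2) \<in> elastic_densities" "u = elastic_wave kp ks g1 g2" using We[OF u] by blast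
    have "(\<lambda>x. a *s u x) = elastic_wave kp ks (\<lambda>\<xi>. a *s g1 \<xi>) (\<lambda>\<xi>. a *s g2 \<xi>)"
      unfolding g(2) by (intro ext elastic_wave_cscale[symmetric])
    then show ?thesis using Wi[OF elastic_densities_cscale[OF g(1)]] by simp
  qed
  have complete: "\<exists>u\<in>W. (\<lambda>n. sqrt (Re (H_inner (\<lambda>x. s n x - u x) (\<lambda>x. s n x - u x)))) \<longlonglongrightarrow> 0"
    if s: "\<And>n. s n \<in> W" and cauchy: "\<And>e. e > 0 \<Longrightarrow> \<exists>N. \<forall>m\<ge>N. \<forall>n\<ge>N. sqrt (Re (H_inner (\<lambda>x. s m x - s n x) (\<lambda>x. s m x - s n x))) < e" for s
  proof -
    obtain p q where pq: "\<And>n. (p n, q n) \<in> elastic_densities" "\<And>n. s n = elastic_wave kp ks (p n) (q n)"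
      using We[OF s] by metis
    have d: "(\<lambda>x. s n x - elastic_wave kp ks g1 g2 x) = elastic_wave kp ks (\<lambda>\<xi>. p n \<xi> - g1 \<xi>) (\<lambda>\<xi>. q n \<xi> - g2 \<xi>)"
      if g: "(g1, g2) \<in> elastic_densities" for n g1 g2
      unfolding pq(2) by (intro ext elastic_wave_diff[symmetric] sq[OF pq(1)] sq[OF g])
    have e: "Re (H_inner (\<lambda>x. s n x - elastic_wave kp ks g1 g2 x) (\<lambda>x. s n x - elastic_wave kp ks g1 g2 x))
       = sq_energy (elastic_wave kp ks (\<lambda>\<xi>. p n \<xi> - g1 \<xi>) (\<lambda>\<xi>. q n \<xi> - g2 \<xi>))"
      if g: "(g1, g2) \<in> elastic_densities" for n g1 g2
      unfolding d[OF g] by (simp add: H_inner_self fin elastic_densities_diff pq(1) g)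
    have small: "\<exists>N. \<forall>m\<ge>N. \<forall>n\<ge>N. vec_sq_norm (\<lambda>\<xi>. p m \<xi> - p n \<xi>) < \<epsilon> \<and> vec_sq_norm (\<lambda>\<xi>. q m \<xi> - q n \<xi>) < \<epsilon>" if "\<epsilon> > 0" for \<epsilon>
    proof -
      obtain N where N: "\<forall>m\<ge>N. \<forall>n\<ge>N. sqrt (Re (H_inner (\<lambda>x. s m x - s n x) (\<lambda>x. s m x - s n x))) < sqrt (c * \<epsilon>)"
        using cauchy[of "sqrt (c * \<epsilon>)"] c(1) \<open>\<epsilon> > 0\<close> by auto
      show ?thesis
      proof (intro exI allI impI)
        fix m n assume mn: "m \<ge> N" "n \<ge> N"
        have "Re (H_inner (\<lambda>x. s m x - s n x) (\<lambda>x. s m x - s n x)) < c * \<epsilon>"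
          using N mn real_sqrt_less_iff by blast
        then have "sq_energy (elastic_wave kp ks (\<lambda>\<xi>. p m \<xi> - p n \<xi>) (\<lambda>\<xi>. q m \<xi> - q n \<xi>)) < c * \<epsilon>"
          using e[OF pq(1), of m n] pq(2)[of n] by simp
        then have "c * (vec_sq_norm (\<lambda>\<xi>. p m \<xi> - p n \<xi>) + vec_sq_norm (\<lambda>\<xi>. q m \<xi> - q n \<xi>)) < c * \<epsilon>"
          using lower[OF elastic_densities_diff[OF pq(1) pq(1)], of m n] by linarith
        then have "vec_sq_norm (\<lambda>\<xi>. p m \<xi> - p n \<xi>) + vec_sq_norm (\<lambda>\<xi>. q m \<xi> - q n \<xi>) < \<epsilon>"
          using c(1) by (simp add: mult_less_cancel_left_pos)
        moreover have "0 \<le> vec_sq_norm (\<lambda>\<xi>. p m \<xi> - p n \<xi>)" "0 \<le> vec_sq_norm (\<lambda>\<xi>. q m \<xi> - q n \<xi>)" by simp_all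
        ultimately show "vec_sq_norm (\<lambda>\<xi>. p m \<xi> - p n \<xi>) < \<epsilon> \<and> vec_sq_norm (\<lambda>\<xi>. q m \<xi> - q n \<xi>) < \<epsilon>" by linarith
      qed
    qed
    obtain f r where f: "square_integrable arc_length f" "AE \<xi> in arc_length. (\<lambda>n. p (r n) \<xi>) \<longlonglongrightarrow> f \<xi>"
      "(\<lambda>n. vec_sq_norm (\<lambda>\<xi>. p n \<xi> - f \<xi>)) \<longlonglongrightarrow> 0"
    proof (rule arc_length.square_integrable_complete[of p])
      show "square_integrable arc_length (p n)" for n by (rule sq[OF pq(1)])
      fix \<epsilon> :: real assume "\<epsilon> > 0"
      from small[OF this] show "\<exists>N. \<forall>m\<ge>N. \<forall>n\<ge>N. vec_sq_norm (\<lambda>\<xi>. p m \<xi> - p n \<xi>) < \<epsilon>" by blast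
    qed
    obtain g r' where g: "square_integrable arc_length g" "AE \<xi> in arc_length. (\<lambda>n. q (r' n) \<xi>) \<longlonglongrightarrow> g \<xi>"
      "(\<lambda>n. vec_sq_norm (\<lambda>\<xi>. q n \<xi> - g \<xi>)) \<longlonglongrightarrow> 0"
    proof (rule arc_length.square_integrable_complete[of q])
      show "square_integrable arc_length (q n)" for n by (rule sq[OF pq(1)])
      fix \<epsilon> :: real assume "\<epsilon> > 0"
      from small[OF this] show "\<exists>N. \<forall>m\<ge>N. \<forall>n\<ge>N. vec_sq_norm (\<lambda>\<xi>. q m \<xi> - q n \<xi>) < \<epsilon>" by blast
    qed
    have fg: "(f, g) \<in> elastic_densities"
      by (rule elastic_densities_limit[OF pq(1) f(1) g(1) f(2) g(2)])
    define E where "E n = sq_energy (elastic_wave kp ks (\<lambda>\<xi>. p n \<xi> - f \<xi>) (\<lambda>\<xi>. q n \<xi> - g \<xi>))" for n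
    have "E \<longlonglongrightarrow> 0"
    proof (rule tendsto_sandwich[OF _ _ tendsto_const])
      show "\<forall>\<^sub>F n in sequentially. 0 \<le> E n" by (simp add: E_def sq_energy_nonneg)
      show "\<forall>\<^sub>F n in sequentially. E n \<le> C * (vec_sq_norm (\<lambda>\<xi>. p n \<xi> - f \<xi>) + vec_sq_norm (\<lambda>\<xi>. q n \<xi> - g \<xi>))"
        unfolding E_def by (intro always_eventually allI upper elastic_densities_diff pq(1) fg)
      have "(\<lambda>n. C * (vec_sq_norm (\<lambda>\<xi>. p n \<xi> - f \<xi>) + vec_sq_norm (\<lambda>\<xi>. q n \<xi> - g \<xi>))) \<longlonglongrightarrow> C * (0 + 0)"
        by (intro tendsto_mult tendsto_add tendsto_const f(3) g(3))
      then show "(\<lambda>n. C * (vec_sq_norm (\<lambda>\<xi>. p n \<xi> - f \<xi>) + vec_sq_norm (\<lambda>\<xi>. q n \<xi> - g \<xi>))) \<longlonglongrightarrow> 0" by simp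
    qed
    from tendsto_real_sqrt[OF this] have "(\<lambda>n. sqrt (E n)) \<longlonglongrightarrow> 0" by simp
    then show ?thesis using Wi[OF fg] unfolding E_def e[OF fg, symmetric] by blast
  qed
  have hilbert: "hilbert_function_space W H_inner"
    unfolding hilbert_function_space_def
  proof (intro conjI ballI allI impI)
    fix s :: "nat \<Rightarrow> real^2 \<Rightarrow> complex^2"
    assume "(\<forall>n. s n \<in> W) \<and> (\<forall>e>0. \<exists>N. \<forall>m\<ge>N. \<forall>n\<ge>N. sqrt (Re (H_inner (\<lambda>x. s m x - s n x) (\<lambda>x. s m x - s n x))) < e)"
    then show "\<exists>u\<in>W. (\<lambda>n. sqrt (Re (H_inner (\<lambda>x. s n x - u x) (\<lambda>x. s n x - u x)))) \<longlonglongrightarrow> 0"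
      using complete[of s] by blast
  next
    fix u assume "u \<in> W" "H_inner u u = 0"
    then show "u = (\<lambda>x. 0)" using sq_energy_zero[OF finW] H_inner_self[OF finW] by simp
  qed (use W0 Wadd Wscale finW in \<open>simp_all add: H_inner_add H_inner_cscale H_inner_self sq_energy_nonneg flip: H_inner_cnj\<close>)
  have "\<exists>K. \<forall>u\<in>W. norm (u x) \<le> K * sqrt (Re (H_inner u u))" for x
  proof (intro exI ballI)
    fix u assume u: "u \<in> W"
    obtain g1 g2 where g: "(g1, g2) \<in> elastic_densities" "u = elastic_wave kp ks g1 g2" using We[OF u] by blast
    have "norm (u x) \<le> 4 * sqrt (2 * pi * (vec_sq_norm g1 + vec_sq_norm g2))"
      unfolding g(2) by (rule elastic_wave_norm_le[OF sq[OF g(1)]])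
    also have "\<dots> \<le> 4 * sqrt (2 * pi / c * sq_energy u)"
    proof -
      have "vec_sq_norm g1 + vec_sq_norm g2 \<le> sq_energy u / c"
        using lower[OF g(1)] c(1) unfolding g(2)[symmetric] by (simp add: pos_le_divide_eq mult.commute)
      then have "2 * pi * (vec_sq_norm g1 + vec_sq_norm g2) \<le> 2 * pi * (sq_energy u / c)" by (intro mult_left_mono) auto
      then show ?thesis by simp
    qed
    also have "\<dots> = (4 * sqrt (2 * pi / c)) * sqrt (Re (H_inner u u))"
      by (simp only: real_sqrt_mult H_inner_self[OF finW[OF u]] Re_complex_of_real mult.assoc)
    finally show "norm (u x) \<le> (4 * sqrt (2 * pi / c)) * sqrt (Re (H_inner u u))" .
  qed
  then have "reproducing_kernel_hilbert_space W H_inner"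
    by (rule bounded_evaluation_imp_reproducing_kernel[OF hilbert])
  moreover have "(u, angular_gradient u) \<in> H_ambient" if "u \<in> W" for u
  proof -
    obtain g1 g2 where g: "(g1, g2) \<in> elastic_densities" "u = elastic_wave kp ks g1 g2" using We[OF \<open>u \<in> W\<close>] by blast
    show ?thesis
      by (rule finite_energy_smooth_in_H_ambient[OF finW[OF that]]) (unfold g(2), rule Ck_elastic_wave[OF sq[OF g(1)]])
  qed
  ultimately show ?thesis unfolding W by blast
qed

end
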